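(* Let $k$ and $p$ be positive integers with $k\ge 2p+1$, and write $k=s(p+1)+r$ with integers $s\ge 1$ and $0\le r<p+1$. Suppose $r\neq 0$, let $m\ge 0$ and $1\le t\le s$ be the unique integers satisfying $r=ms+t$, and suppose $t\neq s$. Then for all sufficiently large $n$, $$\mathrm{SPEX}(n,C_k^p)=\{K_{t-1}\vee T_{n-t+1,\,p+m+1}\}$$ (up to isomorphism).
   Context: All graphs are finite, simple and undirected. $C_k$ is the cycle on $k$ vertices, and $C_k^p$ (its $p$-th power) is the graph on the same vertices in which two distinct vertices are adjacent iff their distance in $C_k$ is at most $p$. A graph is $F$-free if it contains no subgraph (not necessarily induced) isomorphic to $F$. $\lambda(G)$ is the spectral radius of the adjacency matrix of $G$. $\mathrm{spex}(n,F)$ is the maximum of $\lambda(G)$ over $n$-vertex $F$-free graphs $G$, and $\mathrm{SPEX}(n,F)$ is the set of $n$-vertex $F$-free graphs $G$ with $\lambda(G)=\mathrm{spex}(n,F)$. $K_a$ is the complete graph on $a$ vertices ($K_0$ is the empty graph). $T_{n,q}$ is the $q$-partite Turán graph: the complete $q$-partite graph on $n$ vertices with part sizes pairwise differing by at most $1$. $G\vee H$ (join) is obtained from the disjoint union of $G$ and $H$ by adding all edges between $V(G)$ and $V(H)$. *)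

theory Defs
  imports "Graph_Theory.Graph_Theory" "Jordan_Normal_Form.Spectral_Radius"
begin

text \<open>
  A finite simple undirected graph is a \<^locale>\<open>pair_graph\<close>: a finite, loop-free digraph
  without parallel arcs whose arc relation is symmetric, so an edge \<open>uv\<close> is stored as the two
  arcs \<open>(u,v)\<close> and \<open>(v,u)\<close>.
  Isomorphism and (not necessarily induced) subgraphs are the library's
  \<^const>\<open>digraph_iso\<close> and \<^const>\<open>subgraph\<close>.
\<close>

subsection \<open>Particular graphs and graph operations\<close>

text \<open>The side condition \<open>u \<noteq> v\<close> only matters for \<open>k = 1\<close>; for \<open>k \<ge> 3\<close> this is the cycle \<open>C\<^sub>k\<close>.\<close>

definition cycle_graph :: "nat \<Rightarrow> nat pair_pre_digraph" where
  "cycle_graph k = \<lparr> pverts = {..<k},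
     parcs = {(u, v). u < k \<and> v < k \<and> u \<noteq> v \<and> (v = Suc u mod k \<or> u = Suc v mod k)} \<rparr>"

text \<open>\<^const>\<open>wf_digraph.\<mu>\<close> with unit weights is the graph distance (\<open>\<infinity>\<close> if there is no walk).\<close>

definition graph_power :: "'a pair_pre_digraph \<Rightarrow> nat \<Rightarrow> 'a pair_pre_digraph" where
  "graph_power G p = \<lparr> pverts = pverts G,
     parcs = {(u, v). u \<in> pverts G \<and> v \<in> pverts G \<and> u \<noteq> v \<and>
                      wf_digraph.\<mu> (with_proj G) (\<lambda>_. 1) u v \<le> ereal (real p)} \<rparr>"

definition complete_graph :: "nat \<Rightarrow> nat pair_pre_digraph" where
  "complete_graph a = \<lparr> pverts = {..<a}, parcs = {(u, v). u < a \<and> v < a \<and> u \<noteq> v} \<rparr>"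

text \<open>
  For \<open>q \<ge> 1\<close>, the parts of the Turan graph are the residue classes modulo \<open>q\<close> in \<open>{..<n}\<close>;
  see \<open>turan_parts_balanced\<close> below for their sizes.
\<close>

definition turan_graph :: "nat \<Rightarrow> nat \<Rightarrow> nat pair_pre_digraph" where
  "turan_graph n q = \<lparr> pverts = {..<n}, parcs = {(u, v). u < n \<and> v < n \<and> u mod q \<noteq> v mod q} \<rparr>"

definition graph_join :: "'a pair_pre_digraph \<Rightarrow> 'b pair_pre_digraph \<Rightarrow> ('a + 'b) pair_pre_digraph" where
  "graph_join G H = \<lparr> pverts = pverts G <+> pverts H,
     parcs = map_prod Inl Inl ` parcs G \<union> map_prod Inr Inr ` parcs H \<union>
             (Inl ` pverts G) \<times> (Inr ` pverts H) \<union> (Inr ` pverts H) \<times> (Inl ` pverts G) \<rparr>"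

subsection \<open>Spectral extremal graphs\<close>

definition graph_free :: "'b pair_pre_digraph \<Rightarrow> 'a pair_pre_digraph \<Rightarrow> bool" where
  "graph_free F G \<longleftrightarrow> \<not> (\<exists>H. subgraph H (with_proj G) \<and> digraph_iso (with_proj F) H)"

text \<open>
  Every \<open>n\<close>-vertex graph is isomorphic to one with vertex set \<open>{..<n}\<close>, so the \<open>n\<close>-vertex graphs
  are represented by the graphs on \<open>{..<n}\<close>.
\<close>

definition graphs_on :: "nat \<Rightarrow> nat pair_pre_digraph set" where
  "graphs_on n = {G. pair_graph G \<and> pverts G = {..<n}}"

text \<open>Meaningful for graphs whose vertex set is an initial segment \<open>{..<n}\<close> of the naturals.\<close>

definition adjacency_matrix :: "nat pair_pre_digraph \<Rightarrow> complex mat" where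
  "adjacency_matrix G =
     (let n = card (pverts G) in mat n n (\<lambda>(i, j). if (i, j) \<in> parcs G then 1 else 0))"

definition graph_spectral_radius :: "nat pair_pre_digraph \<Rightarrow> real" where
  "graph_spectral_radius G = spectral_radius (adjacency_matrix G)"

definition spex :: "nat \<Rightarrow> 'b pair_pre_digraph \<Rightarrow> real" where
  "spex n F = Max (graph_spectral_radius ` {G \<in> graphs_on n. graph_free F G})"

definition SPEX :: "nat \<Rightarrow> 'b pair_pre_digraph \<Rightarrow> nat pair_pre_digraph set" where
  "SPEX n F = {G \<in> graphs_on n. graph_free F G \<and> graph_spectral_radius G = spex n F}"

subsection \<open>Basic sanity facts\<close>

lemma pair_graphI:
  assumes "finite (pverts G)" "parcs G \<subseteq> pverts G \<times> pverts G"
    and "\<And>u v. (u, v) \<in> parcs G \<Longrightarrow> (v, u) \<in> parcs G" "\<And>u. (u, u) \<notin> parcs G"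
  shows "pair_graph G"
proof -
  have "finite (parcs G)" using assms(1,2) by (meson finite_SigmaI rev_finite_subset)
  moreover have "sym (parcs G)" using assms(3) by (auto intro: symI)
  ultimately show ?thesis
    using assms by unfold_locales (auto simp: symmetric_def)
qed

lemma pair_graph_cycle_graph: "pair_graph (cycle_graph k)"
  by (rule pair_graphI) (auto simp: cycle_graph_def)

lemma pair_graph_complete_graph: "pair_graph (complete_graph a)"
  by (rule pair_graphI) (auto simp: complete_graph_def)

lemma pair_graph_turan_graph: "pair_graph (turan_graph n q)"
  by (rule pair_graphI) (auto simp: turan_graph_def)

lemma pair_graph_graph_join:
  assumes "pair_graph G" "pair_graph H"
  shows "pair_graph (graph_join G H)"
proof -
  interpret G: pair_graph G by fact
  interpret H: pair_graph H by fact
  have "sym (parcs G)" "sym (parcs H)"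
    using G.pair_sym_arcs H.pair_sym_arcs by (auto simp: symmetric_def)
  then show ?thesis
    by (intro pair_graphI)
       (auto simp: graph_join_def G.in_arcsD1 G.in_arcsD2 H.in_arcsD1 H.in_arcsD2
             dest: symD G.pair_no_loops H.pair_no_loops intro: rev_image_eqI)
qed

lemma finite_graphs_on: "finite (graphs_on n)"
proof -
  have "graphs_on n \<subseteq> (\<lambda>A. \<lparr> pverts = {..<n}, parcs = A \<rparr>) ` Pow ({..<n} \<times> {..<n})"
  proof
    fix G assume G: "G \<in> graphs_on n"
    then interpret pair_graph G by (simp add: graphs_on_def)
    have "parcs G \<subseteq> {..<n} \<times> {..<n}"
      using G by (auto simp: graphs_on_def dest: in_arcsD1 in_arcsD2)
    moreover have "G = \<lparr> pverts = {..<n}, parcs = parcs G \<rparr>"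
      using G by (simp add: graphs_on_def)
    ultimately show "G \<in> (\<lambda>A. \<lparr> pverts = {..<n}, parcs = A \<rparr>) ` Pow ({..<n} \<times> {..<n})"
      by (metis PowI image_eqI)
  qed
  then show ?thesis by (rule finite_subset) auto
qed

lemma turan_parts_balanced:
  assumes "i < q"
  shows "card {u. u < n \<and> u mod q = i} = n div q + (if i < n mod q then 1 else 0)"
proof -
  let ?N = "n div q + (if i < n mod q then 1 else 0)"
  have q: "q > 0" using assms by simp
  have "{u. u < n \<and> u mod q = i} = (\<lambda>a. a * q + i) ` {..<?N}"
  proof (rule Set.set_eqI)
    fix u
    have less: "a * q + i < n \<longleftrightarrow> a < ?N" for a
    proof -
      have n: "n = n div q * q + n mod q" by simp
      have r: "n mod q < q" using q by simp
      consider "a < n div q" | "a = n div q" | "a \<ge> Suc (n div q)" by linarith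
      then show ?thesis
      proof cases
        case 1
        then have "Suc a * q \<le> n div q * q" by (intro mult_right_mono) auto
        then have "q + a * q \<le> n div q * q" by simp
        then have "a * q + i < n" using assms n by linarith
        then show ?thesis using 1 by simp
      next
        case 2
        then have "a * q = n div q * q" by simp
        then have "a * q + i < n \<longleftrightarrow> i < n mod q" using n by linarith
        then show ?thesis using 2 by simp
      next
        case 3
        then have "Suc (n div q) * q \<le> a * q" by (intro mult_right_mono) auto
        then have "q + n div q * q \<le> a * q" by simp
        then have "\<not> a * q + i < n" using n r by linarith
        then show ?thesis using 3 by simp
      qed
    qed
    show "u \<in> {u. u < n \<and> u mod q = i} \<longleftrightarrow> u \<in> (\<lambda>a. a * q + i) ` {..<?N}"
    proof
      assume "u \<in> {u. u < n \<and> u mod q = i}"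
      then have u: "u = u div q * q + i" and "u < n" by auto
      then have "u div q * q + i < n" by simp
      then have "u div q \<in> {..<?N}" unfolding less by (simp only: lessThan_iff)
      with u show "u \<in> (\<lambda>a. a * q + i) ` {..<?N}" by (rule image_eqI)
    next
      assume "u \<in> (\<lambda>a. a * q + i) ` {..<?N}"
      then obtain a where a: "u = a * q + i" "a < ?N" by blast
      then have "u < n" unfolding a(1) less by blast
      moreover have "u mod q = i" using a(1) assms by simp
      ultimately show "u \<in> {u. u < n \<and> u mod q = i}" by blast
    qed
  qed
  moreover have "inj_on (\<lambda>a. a * q + i) {..<?N}" using q by (auto simp: inj_on_def)
  ultimately show ?thesis by (simp add: card_image)
qed

end

theory Submission
  imports Defs "HOL-Analysis.Function_Topology" "HOL-Analysis.Convex"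
begin

text \<open>
  Let \<open>F = C\<^sub>k\<^sup>p\<close> and \<open>q = p + m + 1\<close>, so that \<open>k = s q + t\<close>. As \<open>F\<close> has independence number \<open>s\<close>, it cannot be made
  \<open>q\<close>-colourable by deleting \<open>t - 1\<close> vertices; on the other hand, cutting the cycle into \<open>t\<close> blocks of length \<open>q + 1\<close>
  and \<open>s - t\<close> blocks of length \<open>q\<close> embeds \<open>F\<close> into a large complete \<open>q\<close>-partite graph with \<open>c\<close> added universal
  vertices and \<open>t - c\<close> disjoint edges added inside one class, for every \<open>c \<le> t\<close>. Only these two properties are used.

  Deleting vertices of small eigenvector entry gives a subgraph of an extremal graph \<open>G\<close> on almost all vertices with
  minimum degree close to \<open>(1 - 1/q) n\<close>, and such a graph is \<open>q\<close>-partite up to boundedly many vertices. Hence the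
  leading eigenvector is almost constant on the bulk of \<open>G\<close>; re-attaching a vertex to \<open>q - 1\<close> of the classes
  keeps \<open>G\<close> free of \<open>F\<close>, so by extremality \<open>G\<close> itself has large minimum degree and only a bounded exceptional set \<open>W\<close>.
  Let \<open>d\<^sub>w\<close> be the eigenvector weight of the neighbourhood of \<open>w \<in> W\<close>, as a fraction of the total. Comparing \<open>G\<close> with
  \<open>K\<^sub>t\<^sub>-\<^sub>1\<close> joined to a complete \<open>q\<close>-partite graph bounds \<open>\<Sum> d\<^sub>w\<^sup>2\<close> from below, freeness of \<open>F\<close> bounds \<open>\<Sum> d\<^sub>w\<close>
  from above, and together they force \<open>t - 1\<close> vertices with \<open>d\<^sub>w \<approx> 1\<close>. The remaining vertices then span a
  \<open>q\<close>-partite graph, which is complete and balanced by extremality.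
\<close>

subsection \<open>Spectral radius of a finite graph as a maximum of the quadratic form\<close>

text \<open>An independent set of \<open>F\<close> has at most \<open>s\<close> vertices, so
  \<open>q\<close> colours cover at most \<open>s q = k - t\<close> vertices, one fewer than remain
  after deleting \<open>t - 1\<close>; this is where \<open>q\<close> and \<open>t\<close> come
  from. Nothing is known about an extremal graph except its spectral radius: it might be
  disconnected, and its eigenvector might have zeros. Hence \<lambda> is treated as the maximum of a
  quadratic form, and facts about the extremal graph come from competitors that are still free of
  \<open>F\<close>. The size of the exceptional set is bounded before the error \<delta> is chosen;
  so the vertices of a class fall into boundedly many types by their adjacency to \<open>W\<close>,
  and errors can be made small even against \<open>2^|W|\<close>. The two bounds on the
  \<open>d\<^sub>w\<close> work by convexity: up to small errors each \<open>d\<^sub>w\<close> lies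
  between \<open>1 - 1/q\<close> and \<open>1\<close>, so a bound on the sum limits the sum of
  squares, and the value that the comparison demands is reached only when \<open>t - 1\<close> of
  the \<open>d\<^sub>w\<close> are at the top and the others at the bottom.\<close>

definition simple_graph :: "'a set \<Rightarrow> ('a \<Rightarrow> 'a \<Rightarrow> bool) \<Rightarrow> bool" where
  "simple_graph V E \<longleftrightarrow> finite V \<and> (\<forall>u v. E u v \<longrightarrow> u \<in> V \<and> v \<in> V \<and> u \<noteq> v \<and> E v u)"

text \<open>No vertex set appears as an argument, because the relation of a
  \<open>simple_graph\<close> is itself confined to \<open>V\<close>.\<close>

definition nbrs :: "('a \<Rightarrow> 'a \<Rightarrow> bool) \<Rightarrow> 'a \<Rightarrow> 'a set" where
  "nbrs E u = {v. E u v}"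

definition adj_sum :: "('a \<Rightarrow> 'a \<Rightarrow> bool) \<Rightarrow> ('a \<Rightarrow> real) \<Rightarrow> 'a \<Rightarrow> real" where
  "adj_sum E x u = sum x (nbrs E u)"

definition bform :: "'a set \<Rightarrow> ('a \<Rightarrow> 'a \<Rightarrow> bool) \<Rightarrow> ('a \<Rightarrow> real) \<Rightarrow> ('a \<Rightarrow> real) \<Rightarrow> real" where
  "bform V E x y = (\<Sum>u\<in>V. x u * adj_sum E y u)"

abbreviation qform :: "'a set \<Rightarrow> ('a \<Rightarrow> 'a \<Rightarrow> bool) \<Rightarrow> ('a \<Rightarrow> real) \<Rightarrow> real" where
  "qform V E x \<equiv> bform V E x x"

definition sqn :: "'a set \<Rightarrow> ('a \<Rightarrow> real) \<Rightarrow> real" where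
  "sqn V x = (\<Sum>u\<in>V. (x u)\<^sup>2)"

text \<open>The Rayleigh form of the largest adjacency eigenvalue. All of the extremal argument uses
  this form; its agreement with the spectral radius of the matrix is
  \<open>graph_spectral_radius_eq_lam\<close>.\<close>

definition lam :: "'a set \<Rightarrow> ('a \<Rightarrow> 'a \<Rightarrow> bool) \<Rightarrow> real" where
  "lam V E = Sup {qform V E x |x. sqn V x = 1}"

lemma simple_graphD:
  assumes "simple_graph V E"
  shows "finite V" and "E u v \<Longrightarrow> u \<in> V" and "E u v \<Longrightarrow> v \<in> V" and "\<not> E u u"
    and "E u v \<Longrightarrow> E v u" and "nbrs E u \<subseteq> V" and "finite (nbrs E u)"
proof -
  show f: "finite V" and "E u v \<Longrightarrow> u \<in> V" and "E u v \<Longrightarrow> v \<in> V" and "\<not> E u u"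
    and "E u v \<Longrightarrow> E v u" using assms by (auto simp: simple_graph_def)
  show s: "nbrs E u \<subseteq> V" using assms by (auto simp: simple_graph_def nbrs_def)
  show "finite (nbrs E u)" using f s by (rule rev_finite_subset)
qed

lemma adj_sum_if:
  assumes "simple_graph V E"
  shows "adj_sum E x u = (\<Sum>v\<in>V. if E u v then x v else 0)"
proof -
  have "nbrs E u = {v \<in> V. E u v}" using simple_graphD[OF assms] by (auto simp: nbrs_def)
  then show ?thesis using simple_graphD(1)[OF assms] by (simp add: adj_sum_def sum.inter_filter)
qed

lemma bform_sym:
  assumes "simple_graph V E"
  shows "bform V E x y = bform V E y x"
proof -
  have "bform V E x y = (\<Sum>u\<in>V. \<Sum>v\<in>V. if E u v then x u * y v else 0)"
    unfolding bform_def adj_sum_if[OF assms] sum_distrib_left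
    by (intro sum.cong) (auto simp: if_distrib cong: if_cong)
  also have "\<dots> = (\<Sum>v\<in>V. \<Sum>u\<in>V. if E u v then x u * y v else 0)" by (rule sum.swap)
  also have "\<dots> = (\<Sum>v\<in>V. \<Sum>u\<in>V. y v * (if E v u then x u else 0))"
    using simple_graphD(5)[OF assms] by (intro sum.cong) auto
  also have "\<dots> = bform V E y x"
    unfolding bform_def adj_sum_if[OF assms] sum_distrib_left ..
  finally show ?thesis .
qed

lemma adj_sum_add: "adj_sum E (\<lambda>v. x v + y v) u = adj_sum E x u + adj_sum E y u"
  by (simp add: adj_sum_def sum.distrib)

lemma adj_sum_scale: "adj_sum E (\<lambda>v. c * x v) u = c * adj_sum E x u"
  by (simp add: adj_sum_def sum_distrib_left)

lemma bform_add_left: "bform V E (\<lambda>v. x v + y v) z = bform V E x z + bform V E y z"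
  by (simp add: bform_def algebra_simps sum.distrib)

lemma bform_add_right: "bform V E z (\<lambda>v. x v + y v) = bform V E z x + bform V E z y"
  by (simp add: bform_def adj_sum_add algebra_simps sum.distrib)

lemma qform_scale: "qform V E (\<lambda>v. c * x v) = c\<^sup>2 * qform V E x"
  by (simp add: bform_def adj_sum_scale sum_distrib_left power2_eq_square mult_ac)

lemma sqn_scale: "sqn V (\<lambda>v. c * x v) = c\<^sup>2 * sqn V x"
  by (simp add: sqn_def sum_distrib_left power_mult_distrib)

text \<open>There is no loop at \<open>w\<close>, so the form is affine in the single coordinate
  \<open>x w\<close>.\<close>

lemma qform_update:
  assumes G: "simple_graph V E" and w: "w \<in> V"
  shows "qform V E (x(w := c)) = qform V E x + 2 * (c - x w) * adj_sum E x w"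
proof -
  define e where "e = (\<lambda>v. if v = w then c - x w else 0)"
  have x: "x(w := c) = (\<lambda>v. x v + e v)" by (auto simp: e_def)
  have be: "bform V E e z = (c - x w) * adj_sum E z w" for z
  proof -
    have "bform V E e z = (\<Sum>u\<in>V. if u = w then (c - x w) * adj_sum E z w else 0)"
      unfolding bform_def by (intro sum.cong) (auto simp: e_def)
    then show ?thesis using w simple_graphD(1)[OF G] by simp
  qed
  have z: "adj_sum E e w = 0"
    unfolding adj_sum_def e_def using simple_graphD(4)[OF G] by (intro sum.neutral) (auto simp: nbrs_def)
  show ?thesis
    unfolding x by (simp add: bform_add_left bform_add_right be z bform_sym[OF G, of x e] algebra_simps)
qed

lemma sqn_update:
  assumes "finite V" and "w \<in> V"
  shows "sqn V (x(w := c)) = sqn V x - (x w)\<^sup>2 + c\<^sup>2"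
proof -
  have "sqn V x = (x w)\<^sup>2 + sqn (V - {w}) x" for x :: "'a \<Rightarrow> real"
    using assms by (simp add: sqn_def sum.remove)
  from this[of x] this[of "x(w := c)"] show ?thesis
    by (simp add: sqn_def)
qed

text \<open>The form minus \<open>l\<close> times the squared norm is nowhere positive and vanishes
  at \<open>x\<close>, so its derivative in the coordinate \<open>w\<close> vanishes. Here
  \<open>l\<close> is any upper bound that \<open>x\<close> attains; this allows an application in a
  competitor graph with the \<lambda> of the original one.\<close>

lemma eigen_of_maximiser:
  assumes G: "simple_graph V E" and le: "\<And>y. qform V E y \<le> l * sqn V y"
    and eq: "qform V E x = l * sqn V x" and w: "w \<in> V"
  shows "adj_sum E x w = l * x w"
proof (rule ccontr)
  assume ne: "adj_sum E x w \<noteq> l * x w"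
  define d where "d = adj_sum E x w - l * x w"
  \<comment> \<open>A step short enough that the linear gain \<open>2 * c * d\<close> beats the
    quadratic term \<open>l * c^2\<close> for either sign of \<open>l\<close>.\<close>
  define c where "c = d / (\<bar>l\<bar> + 1)"
  have d: "d\<^sup>2 > 0" using ne by (simp add: d_def)
  have "qform V E (x(w := x w + c)) \<le> l * sqn V (x(w := x w + c))" by (rule le)
  then have "2 * c * adj_sum E x w \<le> l * (2 * c * x w + c\<^sup>2)"
    using simple_graphD(1)[OF G] w eq
    by (simp add: qform_update[OF G] sqn_update power2_eq_square algebra_simps)
  then have "2 * c * d \<le> l * c\<^sup>2" by (simp add: d_def algebra_simps)
  also have "\<dots> \<le> (\<bar>l\<bar> + 1) * c\<^sup>2" by (intro mult_right_mono) auto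
  also have "\<dots> = c * (c * (\<bar>l\<bar> + 1))" by (simp add: power2_eq_square mult_ac)
  also have "c * (\<bar>l\<bar> + 1) = d" by (simp add: c_def add_nonneg_eq_0_iff)
  finally have "c * d \<le> 0" by simp
  moreover have "c * d = d\<^sup>2 / (\<bar>l\<bar> + 1)" by (simp add: c_def power2_eq_square)
  then have "c * d > 0" using d by simp
  ultimately show False by simp
qed

lemma ex_maximiser:
  assumes G: "simple_graph V E" and V: "V \<noteq> {}"
  shows "\<exists>x. sqn V x = 1 \<and> (\<forall>y. sqn V y = 1 \<longrightarrow> qform V E y \<le> qform V E x)"
proof -
  note f = simple_graphD(1)[OF G]
  \<comment> \<open>Vectors are functions on the whole type, so the coordinates outside
    \<open>V\<close> are pinned to zero; the box is then compact by Tychonoff.\<close>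
  define B :: "('a \<Rightarrow> real) set" where "B = PiE UNIV (\<lambda>v. if v \<in> V then {-1..1} else {0})"
  define K where "K = B \<inter> {x. sqn V x = 1}"
  have cB: "compact B"
  proof -
    have "compactin (product_topology (\<lambda>i::'a. euclidean :: real topology) UNIV) B"
      unfolding B_def compactin_PiE by auto
    then show ?thesis unfolding euclidean_product_topology by simp
  qed
  have c1: "continuous_on UNIV (\<lambda>x. sqn V x)"
    unfolding sqn_def by (intro continuous_intros continuous_on_product_coordinates)
  have "closed {x. sqn V x = 1}" by (rule closed_Collect_eq[OF c1 continuous_on_const])
  then have cK: "compact K" unfolding K_def using cB by (rule compact_Int_closed[rotated])
  obtain v0 where v0: "v0 \<in> V" using V by blast
  have "(\<lambda>v. if v = v0 then 1 else 0) \<in> K"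
  proof -
    have "sqn V (\<lambda>v. if v = v0 then 1 else 0) = 1"
    proof -
      have "sqn V (\<lambda>v. if v = v0 then 1 else 0) = (\<Sum>v\<in>V. if v = v0 then 1 else 0)"
        unfolding sqn_def by (intro sum.cong) auto
      then show ?thesis using f v0 by simp
    qed
    then show ?thesis using v0 by (auto simp: K_def B_def)
  qed
  then have ne: "K \<noteq> {}" by blast
  have c2: "continuous_on K (\<lambda>x. qform V E x)"
    unfolding bform_def adj_sum_def
    by (intro continuous_intros continuous_on_subset[OF continuous_on_product_coordinates] subset_UNIV)
  obtain x where x: "x \<in> K" and mx: "\<And>y. y \<in> K \<Longrightarrow> qform V E y \<le> qform V E x"
    using continuous_attains_sup[OF cK ne c2] by blast
  have "qform V E y \<le> qform V E x" if y: "sqn V y = 1" for y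
  proof -
    define z where "z = (\<lambda>v. if v \<in> V then y v else 0)"
    have q: "qform V E z = qform V E y"
      unfolding bform_def adj_sum_if[OF G] by (intro sum.cong) (auto simp: z_def intro!: sum.cong)
    have s: "sqn V z = 1" unfolding y[symmetric] sqn_def by (simp add: z_def)
    have "\<bar>z v\<bar> \<le> 1" if "v \<in> V" for v
    proof -
      have "(z v)\<^sup>2 \<le> sqn V z" unfolding sqn_def using f that by (intro member_le_sum) auto
      then show ?thesis using s by (simp add: abs_square_le_1)
    qed
    then have "z \<in> K" using s by (auto simp: K_def B_def abs_le_iff z_def)
    from mx[OF this] show ?thesis by (simp add: q)
  qed
  then show ?thesis using x by (auto simp: K_def)
qed

lemma sqn_nonneg: "0 \<le> sqn V x"
  by (simp add: sqn_def sum_nonneg)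

lemma sqn_eq_0_iff: "finite V \<Longrightarrow> sqn V x = 0 \<longleftrightarrow> (\<forall>v\<in>V. x v = 0)"
  by (simp add: sqn_def sum_nonneg_eq_0_iff)

lemma lam_eq_maximum:
  assumes "sqn V x = 1" and "\<And>y. sqn V y = 1 \<Longrightarrow> qform V E y \<le> qform V E x"
  shows "lam V E = qform V E x"
  unfolding lam_def using assms by (intro cSup_eq_maximum) auto

lemma qform_le_lam:
  assumes G: "simple_graph V E"
  shows "qform V E x \<le> lam V E * sqn V x"
proof (cases "sqn V x = 0")
  case True
  then have "qform V E x = 0"
    unfolding bform_def using simple_graphD(1)[OF G] by (simp add: sqn_eq_0_iff)
  then show ?thesis using True by simp
next
  case False
  then have pos: "sqn V x > 0" using sqn_nonneg[of V x] by simp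
  then have "V \<noteq> {}" by (auto simp: sqn_def)
  then obtain z where z: "sqn V z = 1" "\<And>y. sqn V y = 1 \<Longrightarrow> qform V E y \<le> qform V E z"
    using ex_maximiser[OF G] by blast
  define c where "c = 1 / sqrt (sqn V x)"
  have c: "c\<^sup>2 = 1 / sqn V x" using pos by (simp add: c_def power_divide)
  have "qform V E (\<lambda>v. c * x v) \<le> qform V E z"
    using pos by (intro z(2)) (simp add: sqn_scale c)
  also have "\<dots> = lam V E" using lam_eq_maximum[OF z] by simp
  finally show ?thesis using pos by (simp add: qform_scale c field_simps)
qed

text \<open>Replacing the entries of a maximiser by their absolute values does not decrease the
  form. Strict positivity would need connectedness and is obtained for extremal graphs only at the
  very end.\<close>

theorem perron:
  assumes G: "simple_graph V E" and V: "V \<noteq> {}"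
  obtains x where "\<And>u. 0 \<le> x u" and "sqn V x = 1"
    and "\<And>u. u \<in> V \<Longrightarrow> adj_sum E x u = lam V E * x u"
proof -
  obtain z where z: "sqn V z = 1" "\<And>y. sqn V y = 1 \<Longrightarrow> qform V E y \<le> qform V E z"
    using ex_maximiser[OF G V] by blast
  note l = lam_eq_maximum[OF z]
  define x where "x = (\<lambda>u. \<bar>z u\<bar>)"
  have s: "sqn V x = 1" using z(1) by (simp add: x_def sqn_def)
  have "qform V E z \<le> qform V E x"
    unfolding bform_def adj_sum_def sum_distrib_left x_def
    by (intro sum_mono) (simp add: abs_mult[symmetric])
  then have "qform V E x = lam V E * sqn V x"
    using z(2)[OF s] l s by simp
  from eigen_of_maximiser[OF G qform_le_lam[OF G] this]
  have "\<And>u. u \<in> V \<Longrightarrow> adj_sum E x u = lam V E * x u" .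
  then show thesis using that[of x] s by (auto simp: x_def)
qed

lemma lam_lt_of_qform:
  assumes "simple_graph V E" and "qform V E x > l * sqn V x"
  shows "l < lam V E"
proof (rule ccontr)
  assume "\<not> l < lam V E"
  then have "lam V E * sqn V x \<le> l * sqn V x" by (intro mult_right_mono) (auto simp: sqn_nonneg)
  then show False using assms(2) qform_le_lam[OF assms(1), of x] by linarith
qed

lemma lam_ge_of_qform:
  assumes "simple_graph V E" and "qform V E x \<ge> l * sqn V x" and "sqn V x > 0"
  shows "l \<le> lam V E"
  using assms(2,3) qform_le_lam[OF assms(1), of x] by (meson dual_order.trans mult_right_le_imp_le)

text \<open>The normalisation with largest entry 1, under which weights of vertex sets are bounded
  by cardinalities.\<close>

lemma perron_max:
  assumes G: "simple_graph V E" and V: "V \<noteq> {}"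
  obtains x v0 where "\<And>u. 0 \<le> x u" and "\<And>u. u \<in> V \<Longrightarrow> x u \<le> 1" and "v0 \<in> V" and "x v0 = 1"
    and "\<And>u. u \<in> V \<Longrightarrow> adj_sum E x u = lam V E * x u"
proof -
  obtain z where z: "\<And>u. 0 \<le> z u" "sqn V z = 1"
    "\<And>u. u \<in> V \<Longrightarrow> adj_sum E z u = lam V E * z u" by (rule perron[OF G V]) blast
  note f = simple_graphD(1)[OF G]
  define M where "M = Max (z ` V)"
  have "M \<in> z ` V" using f V by (simp add: M_def)
  then obtain v0 where v0: "v0 \<in> V" "z v0 = M" by blast
  have le: "z u \<le> M" if "u \<in> V" for u using f that by (simp add: M_def)
  have "M \<noteq> 0"
  proof
    assume "M = 0"
    then have "\<forall>u\<in>V. z u = 0" using le z(1) by (simp add: order_antisym)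
    then show False using z(2) f by (simp add: sqn_def)
  qed
  moreover have "M \<ge> 0" using z(1) v0 by metis
  ultimately have M: "M > 0" by simp
  define x where "x = (\<lambda>u. (1 / M) * z u)"
  show thesis
  proof (rule that[of x v0])
    show "adj_sum E x u = lam V E * x u" if "u \<in> V" for u
      unfolding x_def adj_sum_scale using z(3)[OF that] by simp
    show "0 \<le> x u" for u using M z(1)[of u] by (simp add: x_def)
    show "x u \<le> 1" if "u \<in> V" for u unfolding x_def using M le[OF that] by (metis divide_le_eq_1_pos mult_1 times_divide_eq_left)
    show "v0 \<in> V" by (rule v0(1))
    show "x v0 = 1" unfolding x_def v0(2) using M by simp
  qed
qed

lemma lam_le_card:
  assumes G: "simple_graph V E" and V: "V \<noteq> {}"
  shows "lam V E \<le> real (card V)"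
proof -
  obtain x v0 where "\<And>u. 0 \<le> x u" and x: "\<And>u. u \<in> V \<Longrightarrow> x u \<le> 1" "v0 \<in> V" "x v0 = 1"
    "\<And>u. u \<in> V \<Longrightarrow> adj_sum E x u = lam V E * x u" by (rule perron_max[OF G V]) blast
  have "lam V E = adj_sum E x v0" using x by simp
  also have "\<dots> \<le> (\<Sum>v\<in>nbrs E v0. 1)"
    unfolding adj_sum_def using simple_graphD(6)[OF G] x(1) by (intro sum_mono) auto
  also have "\<dots> = real (card (nbrs E v0))" by simp
  also have "\<dots> \<le> real (card V)"
    using card_mono[OF simple_graphD(1)[OF G] simple_graphD(6)[OF G]] by simp
  finally show ?thesis .
qed

lemma lam_ge_min_degree:
  assumes G: "simple_graph V E" and V: "V \<noteq> {}" and d: "\<And>u. u \<in> V \<Longrightarrow> d \<le> real (card (nbrs E u))"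
  shows "d \<le> lam V E"
proof (rule lam_ge_of_qform[OF G, of _ "\<lambda>_. 1"])
  have "d * sqn V (\<lambda>_. 1) = (\<Sum>u\<in>V. d)" by (simp add: sqn_def)
  also have "\<dots> \<le> qform V E (\<lambda>_. 1)"
    unfolding bform_def adj_sum_def using d by (intro sum_mono) simp
  finally show "d * sqn V (\<lambda>_. 1) \<le> qform V E (\<lambda>_. 1)" .
  show "0 < sqn V (\<lambda>_. 1 :: real)" using V simple_graphD(1)[OF G] by (simp add: sqn_def card_gt_0_iff)
qed

lemma sum_le_sqrt_card:
  fixes x :: "'a \<Rightarrow> real"
  shows "(sum x A)\<^sup>2 \<le> real (card A) * (\<Sum>a\<in>A. (x a)\<^sup>2)"
  using Cauchy_Schwarz_ineq_sum[of "\<lambda>_. 1" x A] by simp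

section \<open>Deleting vertices with the smallest eigenvector entry\<close>

definition induced :: "('a \<Rightarrow> 'a \<Rightarrow> bool) \<Rightarrow> 'a set \<Rightarrow> 'a \<Rightarrow> 'a \<Rightarrow> bool" where
  "induced E U u v \<longleftrightarrow> E u v \<and> u \<in> U \<and> v \<in> U"

lemma simple_graph_induced:
  assumes "simple_graph V E" and "U \<subseteq> V"
  shows "simple_graph U (induced E U)"
  using assms unfolding simple_graph_def induced_def by (auto intro: finite_subset)

lemma induced_induced: "U' \<subseteq> U \<Longrightarrow> induced (induced E U) U' = induced E U'"
  by (auto simp: induced_def fun_eq_iff)

lemma induced_self: "simple_graph V E \<Longrightarrow> induced E V = E"
  by (auto simp: induced_def fun_eq_iff simple_graph_def)

lemma nbrs_induced: "nbrs (induced E U) u = (if u \<in> U then nbrs E u \<inter> U else {})"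
  by (auto simp: nbrs_def induced_def)

lemma qform_induced:
  assumes G: "simple_graph V E" and U: "U \<subseteq> V"
  shows "qform U (induced E U) x = qform V E (\<lambda>u. if u \<in> U then x u else 0)"
proof -
  have a: "adj_sum (induced E U) x u = adj_sum E (\<lambda>u. if u \<in> U then x u else 0) u" if "u \<in> U" for u
  proof -
    have "finite (nbrs E u)" using simple_graphD(7)[OF G] .
    then have "sum x (nbrs E u \<inter> U) = (\<Sum>v\<in>nbrs E u. if v \<in> U then x v else 0)"
      by (rule sum.inter_restrict)
    then show ?thesis using that by (simp add: adj_sum_def nbrs_induced)
  qed
  show ?thesis
    unfolding bform_def using simple_graphD(1)[OF G] U
    by (intro sum.mono_neutral_cong_left) (auto simp: a)
qed

text \<open>Cauchy-Schwarz over the neighbourhood of \<open>u\<close>. Every vertex outside this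
  neighbourhood carries at least \<open>(x v)^2\<close> of the unit norm, which reduces what is left
  for the neighbourhood.\<close>

lemma min_entry_bound:
  assumes G: "simple_graph V E" and x0: "\<And>u. 0 \<le> x u" and s: "sqn V x = 1"
    and eig: "\<And>u. u \<in> V \<Longrightarrow> adj_sum E x u = lam V E * x u"
    and v: "v \<in> V" and mn: "\<And>u. u \<in> V \<Longrightarrow> x v \<le> x u" and u: "u \<in> V"
    and d: "d = real (card (nbrs E u))"
  shows "(x v)\<^sup>2 * ((lam V E)\<^sup>2 + d * (real (card V) - d)) \<le> d"
proof -
  note f = simple_graphD(1)[OF G] and N = simple_graphD(6)[OF G, of u]
  have sq: "(x v)\<^sup>2 \<le> (x w)\<^sup>2" if "w \<in> V" for w using mn[OF that] x0 by (intro power_mono) auto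
  have "(\<Sum>a\<in>nbrs E u. (x a)\<^sup>2) = 1 - (\<Sum>a\<in>V - nbrs E u. (x a)\<^sup>2)"
    using sum.subset_diff[OF N f, of "\<lambda>a. (x a)\<^sup>2"] s by (simp add: sqn_def)
  moreover have "(\<Sum>a\<in>V - nbrs E u. (x a)\<^sup>2) \<ge> (\<Sum>a\<in>V - nbrs E u. (x v)\<^sup>2)"
    using sq by (intro sum_mono) auto
  moreover have "(\<Sum>a\<in>V - nbrs E u. (x v)\<^sup>2) = (real (card V) - d) * (x v)\<^sup>2"
    using card_Diff_subset[OF finite_subset[OF N f] N] card_mono[OF f N] by (simp add: d of_nat_diff)
  ultimately have N2: "(\<Sum>a\<in>nbrs E u. (x a)\<^sup>2) \<le> 1 - (real (card V) - d) * (x v)\<^sup>2" by linarith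
  have "(lam V E)\<^sup>2 * (x v)\<^sup>2 \<le> (lam V E)\<^sup>2 * (x u)\<^sup>2"
    using sq[OF u] by (intro mult_left_mono) auto
  also have "\<dots> = (sum x (nbrs E u))\<^sup>2"
    using eig[OF u] by (simp add: adj_sum_def power_mult_distrib)
  also have "\<dots> \<le> d * (\<Sum>a\<in>nbrs E u. (x a)\<^sup>2)" unfolding d by (rule sum_le_sqrt_card)
  also have "\<dots> \<le> d * (1 - (real (card V) - d) * (x v)\<^sup>2)"
    using N2 by (intro mult_left_mono) (auto simp: d)
  finally show ?thesis by (simp add: algebra_simps)
qed

text \<open>
  The vertex to delete is one with the smallest eigenvector entry; a vertex of small degree forces this entry
  to be small, so that the deletion increases \<open>\<lambda> / n\<close>.
\<close>

lemma deletion_step: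
  fixes \<epsilon> \<theta> :: real
  assumes G: "simple_graph V E" and n: "card V \<ge> 2" and eps: "0 < \<epsilon>" "\<epsilon> \<le> \<theta>" "\<theta> \<le> 1"
    and lam: "\<theta> * real (card V) \<le> lam V E"
    and u: "u \<in> V" "real (card (nbrs E u)) < (\<theta> - \<epsilon>) * real (card V)"
    and c: "c = \<epsilon> * \<theta> / 2"
  obtains v where "v \<in> V"
    and "lam V E * (real (card V) - 2 + 2 * c)
           \<le> lam (V - {v}) (induced E (V - {v})) * (real (card V) - 1 + c)"
proof -
  note f = simple_graphD(1)[OF G]
  have V: "V \<noteq> {}" using u(1) by blast
  obtain x where x0: "\<And>u. 0 \<le> x u" and s: "sqn V x = 1"
    and eig: "\<And>u. u \<in> V \<Longrightarrow> adj_sum E x u = lam V E * x u" by (rule perron[OF G V]) blast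
  define v where "v = arg_min_on x V"
  have v: "v \<in> V" unfolding v_def using arg_min_if_finite(1)[OF f V] by blast
  have mn: "x v \<le> x w" if "w \<in> V" for w unfolding v_def using arg_min_least[OF f V that] .
  define n where "n = real (card V)"
  define d where "d = real (card (nbrs E u))"
  define m where "m = (x v)\<^sup>2"
  define l where "l = lam V E"
  have mb: "m * (l\<^sup>2 + d * (n - d)) \<le> d"
    unfolding m_def n_def l_def using min_entry_bound[OF G x0 s eig v mn u(1) d_def] by simp
  have n2: "n \<ge> 2" using n by (simp add: n_def)
  have d0: "0 \<le> d" "d < (\<theta> - \<epsilon>) * n" using u(2) by (auto simp: d_def n_def)
  have ln: "l \<le> n" "\<theta> * n \<le> l" using lam_le_card[OF G V] lam by (auto simp: l_def n_def)
  have "0 < \<theta> * n" using eps n2 by simp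
  then have l0: "l > 0" using ln(2) by linarith
  have c01: "0 < c" "c \<le> 1/2" using eps by (auto simp: c intro: mult_le_one)
  have "(\<theta> - \<epsilon>) * n \<le> 1 * n" using eps n2 by (intro mult_right_mono) auto
  then have dn: "d \<le> n" using d0(2) by linarith
  have lsq: "l\<^sup>2 \<le> n\<^sup>2" using ln l0 by (intro power_mono) auto
  have "d * n \<le> n * n" using dn n2 by (intro mult_right_mono) auto
  then have T2: "l\<^sup>2 + d * (n - d) \<le> 2 * n\<^sup>2"
    using lsq zero_le_square[of d] unfolding right_diff_distrib power2_eq_square by linarith
  have "d\<^sup>2 \<le> ((\<theta> - \<epsilon>) * n)\<^sup>2" using d0 by (intro power_mono) auto
  moreover have "(\<theta> * n)\<^sup>2 \<le> l\<^sup>2" using ln eps n2 by (intro power_mono) auto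
  ultimately have "l\<^sup>2 - d\<^sup>2 \<ge> (\<theta>\<^sup>2 - (\<theta> - \<epsilon>)\<^sup>2) * n\<^sup>2"
    by (simp only: power_mult_distrib left_diff_distrib[of _ _ "n\<^sup>2"])
  moreover have "\<theta>\<^sup>2 - (\<theta> - \<epsilon>)\<^sup>2 = 2 * (\<theta> * \<epsilon>) - \<epsilon> * \<epsilon>" by (simp add: power2_eq_square algebra_simps)
  moreover have "\<epsilon> * \<epsilon> \<le> \<theta> * \<epsilon>" using eps by (intro mult_right_mono) auto
  ultimately have ld: "l\<^sup>2 - d\<^sup>2 \<ge> (2 * c) * n\<^sup>2"
    using mult_right_mono[of "2 * c" "\<theta>\<^sup>2 - (\<theta> - \<epsilon>)\<^sup>2" "n\<^sup>2"] by (simp add: c mult_ac)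
  have Tpos: "l\<^sup>2 + d * (n - d) > 0" using l0 d0 dn by (intro add_pos_nonneg) auto
  have "n * d \<le> (1 - c) * (l\<^sup>2 + d * (n - d))"
    using ld mult_left_mono[OF T2, of c] c01 by (simp add: algebra_simps power2_eq_square)
  moreover have "(n * m) * (l\<^sup>2 + d * (n - d)) \<le> n * d" using mult_left_mono[OF mb, of n] n2 by (simp add: mult_ac)
  ultimately have "(n * m) * (l\<^sup>2 + d * (n - d)) \<le> (1 - c) * (l\<^sup>2 + d * (n - d))" by linarith
  \<comment> \<open>A constant vector would give \<open>n * m = 1\<close>; the vertex of small
    degree pushes the smallest squared entry below this by the fixed factor
    \<open>1 - c\<close>.\<close>
  then have nm: "n * m \<le> 1 - c" using Tpos by (rule mult_right_le_imp_le)
  have m0: "0 \<le> m" by (simp add: m_def)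
  have "1 * m \<le> n * m" using n2 m0 by (intro mult_right_mono) auto
  then have m1: "m < 1" using nm c01 by linarith
  let ?U = "V - {v}"
  let ?l = "lam ?U (induced E ?U)"
  \<comment> \<open>The old eigenvector without its entry at \<open>v\<close> is the test vector:
    the form loses \<open>2 * m * l\<close>, the squared norm only \<open>m\<close>.\<close>
  have "(\<lambda>u. if u \<in> ?U then x u else 0) = (\<lambda>u. if u \<in> V then (x(v := 0)) u else 0)" by auto
  then have "qform ?U (induced E ?U) x = qform V (induced E V) (x(v := 0))"
    by (simp add: qform_induced[OF G])
  also have "\<dots> = qform V E x - 2 * x v * adj_sum E x v"
    using v by (simp add: induced_self[OF G] qform_update[OF G])
  also have "qform V E x = l * sqn V x"
    unfolding bform_def sqn_def sum_distrib_left l_def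
    by (intro sum.cong) (auto simp: eig power2_eq_square)
  also have "adj_sum E x v = l * x v" using eig[OF v] by (simp add: l_def)
  finally have q: "qform ?U (induced E ?U) x = l * (1 - 2 * m)"
    by (simp add: s m_def power2_eq_square algebra_simps)
  have "sqn V x = m + sqn ?U x" unfolding m_def sqn_def using f v by (rule sum.remove)
  then have sU: "sqn ?U x = 1 - m" using s by simp
  have "l * (1 - 2 * m) \<le> ?l * (1 - m)"
    using qform_le_lam[OF simple_graph_induced[OF G, of ?U], of x] unfolding q sU by auto
  then have "l * (1 - 2 * m) * (n - 1 + c) \<le> ?l * (1 - m) * (n - 1 + c)"
    using n2 c01 by (intro mult_right_mono) auto
  moreover have "(1 - m) * (n - 2 + 2 * c) \<le> (1 - 2 * m) * (n - 1 + c)"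
    using nm by (simp add: algebra_simps)
  then have "l * ((1 - m) * (n - 2 + 2 * c)) \<le> l * ((1 - 2 * m) * (n - 1 + c))"
    using l0 by (intro mult_left_mono) auto
  ultimately have "(1 - m) * (l * (n - 2 + 2 * c)) \<le> (1 - m) * (?l * (n - 1 + c))"
    by (simp add: mult_ac)
  then have "l * (n - 2 + 2 * c) \<le> ?l * (n - 1 + c)" using m1 by simp
  then show thesis using that[OF v] by (simp add: l_def n_def)
qed

text \<open>By \<open>deletion_step\<close> a deletion lowers \<lambda> at most by the factor
  \<open>(n - 2 + 2 * c) / (n - 1 + c)\<close>, about \<open>1 - (1 - c) / n\<close>, whereas
  \<open>n\<close> drops by \<open>1 - 1 / n\<close>. The surplus of order \<open>c / n\<close> pays
  for the factor \<open>n powr (c/4)\<close>; the exponent \<open>c/4\<close> in place of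
  \<open>c\<close> leaves room for crude estimates.\<close>

lemma deletion_ratio:
  fixes n c :: real
  assumes "n \<ge> 2" "0 < c" "c \<le> 1/2" "2 \<le> c * n"
  shows "n powr (c/4) * (n - 1) * (n - 1 + c) \<le> (n - 1) powr (c/4) * n * (n - 2 + 2 * c)"
proof -
  define y where "y = 1 / (n - 1)"
  have y: "0 < y" "y \<le> 1" using assms by (auto simp: y_def)
  have "n / (n - 1) = 1 + y" using assms by (simp add: y_def field_simps)
  then have "(n / (n - 1)) powr (c/4) = exp (c/4 * ln (1 + y))" using y by (simp add: powr_def)
  also have "\<dots> \<le> exp (c/4 * y)" using ln_add_one_self_le_self[of y] y assms by simp
  also have "\<dots> \<le> 1 + 2 * (c/4 * y)"
  proof -
    have "c * y \<le> 1/2 * 1" using y assms by (intro mult_mono) auto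
    then have "norm (c/4 * y) \<le> 1/2" using y assms by (simp add: abs_mult)
    from exp_bound_lemma[OF this] show ?thesis using y assms by (simp add: abs_mult)
  qed
  finally have A: "(n / (n - 1)) powr (c/4) \<le> 1 + c / 2 * y" by simp
  have "(1 + c / 2 * y) * ((n - 1) * (n - 1 + c)) = (n - 1 + c / 2) * (n - 1 + c)"
    using assms by (simp add: y_def field_simps)
  also have "\<dots> \<le> n * (n - 2 + 2 * c)"
  proof -
    have "c * c \<le> c * (1/2)" using assms by (intro mult_left_mono) auto
    moreover have "n * (n - 2 + 2 * c) - (n - 1 + c/2) * (n - 1 + c) = (c * n) / 2 - 1 + 3/2 * c - c * c / 2"
      by (simp add: field_simps)
    ultimately show ?thesis using assms by linarith
  qed
  finally have B: "(1 + c / 2 * y) * ((n - 1) * (n - 1 + c)) \<le> n * (n - 2 + 2 * c)" .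
  have "n powr (c/4) = (n - 1) powr (c/4) * (n / (n - 1)) powr (c/4)"
    using assms by (subst powr_mult[symmetric]) auto
  then have "n powr (c/4) * (n - 1) * (n - 1 + c) =
      (n - 1) powr (c/4) * ((n / (n - 1)) powr (c/4) * ((n - 1) * (n - 1 + c)))" by simp
  also have "\<dots> \<le> (n - 1) powr (c/4) * ((1 + c / 2 * y) * ((n - 1) * (n - 1 + c)))"
    using A assms by (intro mult_left_mono mult_right_mono) auto
  also have "\<dots> \<le> (n - 1) powr (c/4) * (n * (n - 2 + 2 * c))"
    using B by (intro mult_left_mono) auto
  finally show ?thesis by (simp add: mult_ac)
qed

text \<open>The potential \<open>\<lambda> / n * n powr (c/4)\<close> does not decrease under
  deletions. As \<open>\<lambda> \<le> n\<close>, the final set must be large whenever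
  \<open>n\<close> is. The alternative \<open>c * real (card U) < 2\<close> is the range in which
  \<open>deletion_ratio\<close> fails; large \<open>n\<close> excludes it in each
  application.\<close>

lemma deletion_process:
  fixes \<epsilon> \<theta> :: real
  assumes G: "simple_graph V E" and V: "V \<noteq> {}" and eps: "0 < \<epsilon>" "\<epsilon> \<le> \<theta>" "\<theta> \<le> 1"
    and lam: "\<theta> * real (card V) \<le> lam V E" and c: "c = \<epsilon> * \<theta> / 2"
  shows "\<exists>U\<subseteq>V. U \<noteq> {} \<and>
     ((\<forall>u\<in>U. (\<theta> - \<epsilon>) * real (card U) \<le> real (card (nbrs (induced E U) u))) \<or> c * real (card U) < 2) \<and>
     lam V E / real (card V) * real (card V) powr (c/4)
       \<le> lam U (induced E U) / real (card U) * real (card U) powr (c/4)"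
  using G V lam
proof (induction "card V" arbitrary: V E rule: less_induct)
  case (less V E)
  note f = simple_graphD(1)[OF less.prems(1)]
  show ?case
  proof (cases "(\<forall>u\<in>V. (\<theta> - \<epsilon>) * real (card V) \<le> real (card (nbrs E u))) \<or> c * real (card V) < 2")
    case True
    then show ?thesis using less.prems induced_self[OF less.prems(1)] by (intro exI[of _ V]) auto
  next
    case False
    then obtain u where u: "u \<in> V" "real (card (nbrs E u)) < (\<theta> - \<epsilon>) * real (card V)"
      and big: "2 \<le> c * real (card V)" by force
    define n where "n = real (card V)"
    have c01: "0 < c" "c \<le> 1/2" using eps by (auto simp: c intro: mult_le_one)
    have "2 \<le> c * n" using big by (simp add: n_def)
    moreover have "c * n \<le> 1/2 * n" using c01 by (intro mult_right_mono) (auto simp: n_def)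
    ultimately have n4: "n \<ge> 4" by linarith
    then have "card V \<ge> 2" by (simp add: n_def)
    then obtain v where v: "v \<in> V" and st: "lam V E * (n - 2 + 2 * c)
           \<le> lam (V - {v}) (induced E (V - {v})) * (n - 1 + c)"
      using deletion_step[OF less.prems(1) _ eps less.prems(3) u c] unfolding n_def by blast
    let ?U = "V - {v}"
    let ?l = "lam ?U (induced E ?U)"
    have cU: "card ?U = card V - 1" using v f by simp
    have nU: "real (card ?U) = n - 1" using cU n4 by (simp add: n_def of_nat_diff)
    have U0: "?U \<noteq> {}" using nU n4 by force
    have GU: "simple_graph ?U (induced E ?U)" by (rule simple_graph_induced[OF less.prems(1)]) auto
    have "0 < \<theta> * n" using eps n4 by simp
    then have pos: "lam V E > 0" using less.prems(3) by (simp add: n_def)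
    have rat: "n powr (c/4) * (n - 1) * (n - 1 + c) \<le> (n - 1) powr (c/4) * n * (n - 2 + 2 * c)"
      using n4 c01 \<open>2 \<le> c * n\<close> by (intro deletion_ratio) auto
    have "lam V E * (n powr (c/4) * (n - 1)) * (n - 1 + c) \<le> lam V E * ((n - 1) powr (c/4) * n * (n - 2 + 2 * c))"
      using mult_left_mono[OF rat, of "lam V E"] pos by (simp add: mult_ac)
    also have "\<dots> = (n - 1) powr (c/4) * n * (lam V E * (n - 2 + 2 * c))" by (simp add: mult_ac)
    also have "\<dots> \<le> (n - 1) powr (c/4) * n * (?l * (n - 1 + c))"
      using st n4 by (intro mult_left_mono) auto
    finally have "(lam V E * (n powr (c/4) * (n - 1))) * (n - 1 + c) \<le> ((n - 1) powr (c/4) * n * ?l) * (n - 1 + c)"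
      by (simp add: mult_ac)
    then have "lam V E * (n powr (c/4) * (n - 1)) \<le> (n - 1) powr (c/4) * n * ?l"
      by (rule mult_right_le_imp_le) (use n4 c01 in simp)
    then have pot: "lam V E / n * n powr (c/4) \<le> ?l / (n - 1) * (n - 1) powr (c/4)"
      using n4 by (simp add: field_simps)
    \<comment> \<open>The power of \<open>n\<close> shrinks while the potential does not, so
      \<open>\<lambda> / n\<close> itself does not fall and the hypothesis with \<theta> is
      inherited by the smaller graph.\<close>
    have "(n - 1) powr (c/4) \<le> n powr (c/4)" using n4 c01 by (intro powr_mono2) auto
    moreover have ll: "?l \<ge> 0"
    proof -
      have "0 < lam V E * (n - 2 + 2 * c)" using pos n4 c01 by simp
      then have "0 < ?l * (n - 1 + c)" using st by linarith
      then show ?thesis using n4 c01 by (simp add: zero_less_mult_iff)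
    qed
    ultimately have "?l / (n - 1) * (n - 1) powr (c/4) \<le> ?l / (n - 1) * n powr (c/4)"
      using n4 by (intro mult_left_mono) auto
    with pot have "lam V E / n * n powr (c/4) \<le> ?l / (n - 1) * n powr (c/4)" by linarith
    then have "lam V E / n \<le> ?l / (n - 1)" by (rule mult_right_le_imp_le) (use n4 in simp)
    moreover have "\<theta> \<le> lam V E / n" using less.prems(3) n4 by (simp add: n_def field_simps)
    ultimately have "\<theta> \<le> ?l / (n - 1)" by linarith
    then have lU: "\<theta> * real (card ?U) \<le> ?l" using n4 by (simp add: nU field_simps)
    have "card ?U < card V" using cU n4 by (simp add: n_def)
    from less.hyps[OF this GU U0 lU] obtain U where U: "U \<subseteq> ?U" "U \<noteq> {}"
      "(\<forall>u\<in>U. (\<theta> - \<epsilon>) * real (card U) \<le> real (card (nbrs (induced (induced E ?U) U) u))) \<or> c * real (card U) < 2"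
      "?l / real (card ?U) * real (card ?U) powr (c/4)
        \<le> lam U (induced (induced E ?U) U) / real (card U) * real (card U) powr (c/4)" by blast
    have id: "induced (induced E ?U) U = induced E U" using U(1) by (rule induced_induced)
    have "lam V E / real (card V) * real (card V) powr (c/4)
       \<le> lam U (induced E U) / real (card U) * real (card U) powr (c/4)"
      using pot U(4) unfolding id nU n_def[symmetric] by linarith
    then show ?thesis using U(1-3) unfolding id by (intro exI[of _ U]) auto
  qed
qed

subsection \<open>Complete multipartite subgraphs\<close>

text \<open>Pigeonhole over the \<open>2 ^ card S\<close> possible values of
  \<open>f\<close>.\<close>

lemma popular_type:
  assumes "finite X" and "finite S" and "\<And>x. x \<in> X \<Longrightarrow> f x \<subseteq> S"
  obtains T where "T \<subseteq> S" and "card X \<le> 2 ^ card S * card {x \<in> X. f x = T}"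
proof -
  define g where "g T = card {x \<in> X. f x = T}" for T
  have fP: "finite (Pow S)" using assms(2) by simp
  have ne: "g ` Pow S \<noteq> {}" by blast
  have "Max (g ` Pow S) \<in> g ` Pow S" using fP ne by (intro Max_in) auto
  then obtain T where T: "T \<in> Pow S" "g T = Max (g ` Pow S)" by (metis imageE)
  have le: "g T' \<le> g T" if "T' \<in> Pow S" for T' unfolding T(2) using fP that by (intro Max_ge) auto
  have "card X = (\<Sum>x\<in>X. 1)" by simp
  also have "\<dots> = (\<Sum>T'\<in>Pow S. \<Sum>x\<in>{x \<in> X. f x = T'}. 1)"
    using assms fP by (intro sum.group[symmetric]) auto
  also have "\<dots> = (\<Sum>T'\<in>Pow S. g T')" by (simp add: g_def)
  also have "\<dots> \<le> of_nat (card (Pow S)) * g T" by (rule sum_bounded_above) (rule le)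
  also have "\<dots> = 2 ^ card S * g T" using assms(2) by (simp add: card_Pow)
  finally show thesis using that T(1) by (auto simp: g_def)
qed

lemma sum_card_nbrs_swap:
  assumes G: "simple_graph V E" and A: "A \<subseteq> V" and U: "U \<subseteq> V"
  shows "(\<Sum>u\<in>A. card (nbrs E u \<inter> U)) = (\<Sum>v\<in>U. card (nbrs E v \<inter> A))"
proof -
  note f = simple_graphD(1)[OF G]
  have fA: "finite A" "finite U" using A U f finite_subset by auto
  have c: "card (nbrs E u \<inter> B) = (\<Sum>v\<in>B. if E u v then 1 else 0)" if "finite B" for u B
    using that by (simp add: nbrs_def sum.If_cases Int_def conj_commute)
  have "(\<Sum>u\<in>A. card (nbrs E u \<inter> U)) = (\<Sum>u\<in>A. \<Sum>v\<in>U. if E u v then 1 else 0)"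
    using fA by (simp add: c)
  also have "\<dots> = (\<Sum>v\<in>U. \<Sum>u\<in>A. if E u v then 1 else 0)" by (rule sum.swap)
  also have "\<dots> = (\<Sum>v\<in>U. \<Sum>u\<in>A. if E v u then 1 else 0)"
    using simple_graphD(5)[OF G] by (intro sum.cong) auto
  finally show ?thesis using fA by (simp add: c)
qed

definition matching :: "('a \<Rightarrow> 'a \<Rightarrow> bool) \<Rightarrow> 'a set \<Rightarrow> nat set \<Rightarrow> (nat \<Rightarrow> 'a) \<Rightarrow> (nat \<Rightarrow> 'a) \<Rightarrow> bool" where
  "matching E Q J a b \<longleftrightarrow> inj_on a J \<and> inj_on b J \<and> a ` J \<subseteq> Q \<and> b ` J \<subseteq> Q \<and> a ` J \<inter> b ` J = {} \<and>
     (\<forall>j\<in>J. E (a j) (b j))"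

text \<open>The endpoints of a matching that cannot be extended meet every edge.\<close>

lemma matching_or_cover:
  assumes G: "simple_graph V E" and Q: "Q \<subseteq> V"
  shows "(\<exists>a b. matching E Q {..<t} a b) \<or>
    (\<exists>Z\<subseteq>Q. card Z \<le> 2 * t \<and> (\<forall>u\<in>Q - Z. \<forall>v\<in>Q - Z. \<not> E u v))"
proof (induction t)
  case 0
  show ?case by (intro disjI1) (auto simp: matching_def)
next
  case (Suc t)
  then show ?case
  proof
    assume "\<exists>Z\<subseteq>Q. card Z \<le> 2 * t \<and> (\<forall>u\<in>Q - Z. \<forall>v\<in>Q - Z. \<not> E u v)"
    then show ?thesis by (meson le_SucI mult_le_mono2 order_trans le_add2 lessI less_imp_le)
  next
    assume "\<exists>a b. matching E Q {..<t} a b"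
    then obtain a b where m: "matching E Q {..<t} a b" by blast
    define Z where "Z = a ` {..<t} \<union> b ` {..<t}"
    have Z: "Z \<subseteq> Q" using m by (auto simp: Z_def matching_def)
    have cZ: "card Z \<le> 2 * t"
    proof -
      have "card Z \<le> card (a ` {..<t}) + card (b ` {..<t})" unfolding Z_def by (rule card_Un_le)
      also have "\<dots> \<le> t + t" by (intro add_mono order_trans[OF card_image_le]) auto
      finally show ?thesis by simp
    qed
    show ?thesis
    proof (cases "\<forall>u\<in>Q - Z. \<forall>v\<in>Q - Z. \<not> E u v")
      case True
      then show ?thesis using Z cZ by (intro disjI2 exI[of _ Z]) auto
    next
      case False
      then obtain u v where uv: "u \<in> Q - Z" "v \<in> Q - Z" "E u v" by blast
      then have ne: "u \<noteq> v" using simple_graphD(4)[OF G] by blast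
      have "matching E Q {..<Suc t} (a(t := u)) (b(t := v))"
        using m uv ne unfolding matching_def Z_def lessThan_Suc
        by (auto simp: inj_on_def image_iff)
      then show ?thesis by blast
    qed
  qed
qed

definition complete_parts :: "'a set \<Rightarrow> ('a \<Rightarrow> 'a \<Rightarrow> bool) \<Rightarrow> nat \<Rightarrow> nat \<Rightarrow> (nat \<Rightarrow> 'a set) \<Rightarrow> bool" where
  "complete_parts V E h M B \<longleftrightarrow> (\<forall>i<h. B i \<subseteq> V \<and> card (B i) = M) \<and>
     (\<forall>i<h. \<forall>j<h. i \<noteq> j \<longrightarrow> (\<forall>u\<in>B i. \<forall>v\<in>B j. E u v))"

lemma complete_parts_Suc:
  assumes G: "simple_graph V E" and B: "complete_parts V E h M B" and T: "T \<subseteq> V" "card T = M"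
    and c: "\<And>i u v. i < h \<Longrightarrow> u \<in> T \<Longrightarrow> v \<in> B i \<Longrightarrow> E u v"
  shows "complete_parts V E (Suc h) M (B(h := T))"
  unfolding complete_parts_def
proof (intro conjI allI impI ballI)
  fix i assume i: "i < Suc h"
  show "(B(h := T)) i \<subseteq> V" "card ((B(h := T)) i) = M"
    using i B T by (auto simp: complete_parts_def less_Suc_eq)
  fix j u v assume j: "j < Suc h" "i \<noteq> j" and u: "u \<in> (B(h := T)) i" and v: "v \<in> (B(h := T)) j"
  show "E u v"
  proof (cases "i = h")
    case True
    then show ?thesis using c[of j u v] i j u v by auto
  next
    case ih: False
    show ?thesis
    proof (cases "j = h")
      case True
      then show ?thesis using c[of i v u] i j u v ih simple_graphD(5)[OF G] by auto
    next
      case False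
      then show ?thesis using ih i j u v B by (auto simp: complete_parts_def less_Suc_eq)
    qed
  qed
qed

lemma complete_parts_subset:
  assumes "complete_parts V E h M B" and "\<And>i. i < h \<Longrightarrow> B' i \<subseteq> B i" and "\<And>i. i < h \<Longrightarrow> card (B' i) = N"
  shows "complete_parts V E h N B'"
  using assms unfolding complete_parts_def by (meson order_trans subsetD)

text \<open>The vertices of \<open>X\<close> are grouped by their trace on the union of the parts.
  One trace is shared by \<open>N'\<close> of them, and it meets every part in at least
  \<open>N\<close> vertices; \<open>1 \<le> N'\<close> makes it the trace of an actual vertex of
  \<open>X\<close>.\<close>

lemma popular_neighbourhood:
  assumes G: "simple_graph V E" and B: "complete_parts V E h M B" and X: "X \<subseteq> V"
    and N: "\<And>v i. v \<in> X \<Longrightarrow> i < h \<Longrightarrow> N \<le> card (nbrs E v \<inter> B i)"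
    and big: "N' * 2 ^ (h * M) \<le> card X" and N': "1 \<le> N'"
  obtains B' T where "\<And>i. i < h \<Longrightarrow> B' i \<subseteq> B i" and "\<And>i. i < h \<Longrightarrow> card (B' i) = N"
    and "T \<subseteq> X" and "card T = N'" and "\<And>i u v. i < h \<Longrightarrow> u \<in> T \<Longrightarrow> v \<in> B' i \<Longrightarrow> E u v"
proof -
  note f = simple_graphD(1)[OF G]
  have fX: "finite X" using X f by (rule finite_subset)
  define S where "S = (\<Union>i<h. B i)"
  have SV: "S \<subseteq> V" using B by (auto simp: S_def complete_parts_def)
  have fS: "finite S" using SV f by (rule finite_subset)
  have "card S \<le> (\<Sum>i<h. card (B i))" unfolding S_def by (rule card_UN_le) simp
  also have "\<dots> = h * M" using B by (simp add: complete_parts_def)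
  finally have cS: "card S \<le> h * M" .
  obtain T0 where T0: "T0 \<subseteq> S" "card X \<le> 2 ^ card S * card {x \<in> X. nbrs E x \<inter> S = T0}"
    by (rule popular_type[OF fX fS, of "\<lambda>x. nbrs E x \<inter> S"]) auto
  have "N' * 2 ^ (h * M) \<le> 2 ^ (h * M) * card {x \<in> X. nbrs E x \<inter> S = T0}"
    using big T0(2) cS by (meson mult_le_mono1 order_trans one_le_numeral power_increasing)
  then have "N' \<le> card {x \<in> X. nbrs E x \<inter> S = T0}" by (simp add: mult.commute)
  then obtain T where T: "T \<subseteq> {x \<in> X. nbrs E x \<inter> S = T0}" "card T = N'"
    by (meson obtain_subset_with_card_n)
  then have "T \<noteq> {}" using N' by auto
  then obtain x where x: "x \<in> X" "nbrs E x \<inter> S = T0" using T(1) by blast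
  have "\<exists>A. A \<subseteq> T0 \<inter> B i \<and> card A = N" if i: "i < h" for i
  proof -
    have "nbrs E x \<inter> B i \<subseteq> T0 \<inter> B i" using x(2) i by (auto simp: S_def)
    moreover have "finite (T0 \<inter> B i)" using T0(1) fS finite_subset by auto
    ultimately have "N \<le> card (T0 \<inter> B i)" using N[OF x(1) i] card_mono order_trans by metis
    then show ?thesis by (meson obtain_subset_with_card_n)
  qed
  then obtain B' where B': "\<And>i. i < h \<Longrightarrow> B' i \<subseteq> T0 \<inter> B i \<and> card (B' i) = N" by metis
  show thesis
  proof (rule that[of B' T])
    show "E u v" if "i < h" "u \<in> T" "v \<in> B' i" for i u v
      using B'[OF that(1)] T(1) that by (auto simp: nbrs_def)
  qed (use B' T in auto)
qed

text \<open>Double counting of the edges between \<open>V\<close> and the parts. A vertex outside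
  \<open>X\<close> misses almost all of one part, which is the fraction \<open>1/h \<ge> 1/r\<close>
  of their union; the degree condition does not let nearly all vertices do so.\<close>

lemma min_degree_complete_parts_step:
  assumes G: "simple_graph V E" and h: "1 \<le> h" "h \<le> r" and eps: "0 < \<epsilon>"
    and B: "complete_parts V E h M B" and M: "2 * real N \<le> \<epsilon> * real M" "1 \<le> M"
    and deg: "\<And>u. u \<in> V \<Longrightarrow> (1 - 1 / real r + \<epsilon>) * real (card V) \<le> real (card (nbrs E u))"
    and X: "X = {v \<in> V. \<forall>i<h. N \<le> card (nbrs E v \<inter> B i)}"
  shows "\<epsilon> / 2 * real (card V) \<le> real (card X)"
proof -
  note f = simple_graphD(1)[OF G]
  define n where "n = real (card V)"
  define D where "D v = (\<Sum>i<h. card (nbrs E v \<inter> B i))" for v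
  have BV: "B i \<subseteq> V" "card (B i) = M" if "i < h" for i using B that by (auto simp: complete_parts_def)
  have fB: "finite (B i)" if "i < h" for i using BV(1)[OF that] f by (rule finite_subset)
  have XV: "X \<subseteq> V" by (auto simp: X)
  have le: "card (nbrs E v \<inter> B i) \<le> M" if "i < h" for v i
    using card_mono[OF fB[OF that], of "nbrs E v \<inter> B i"] BV(2)[OF that] by auto
  have D1: "D v \<le> h * M" for v
    using sum_bounded_above[of "{..<h}" "\<lambda>i. card (nbrs E v \<inter> B i)" M] le by (auto simp: D_def)
  have D2: "D v \<le> (h - 1) * M + N" if v: "v \<in> V - X" for v
  proof -
    obtain i where i: "i < h" "card (nbrs E v \<inter> B i) < N" using v by (auto simp: X not_le)
    have "D v = card (nbrs E v \<inter> B i) + (\<Sum>j\<in>{..<h} - {i}. card (nbrs E v \<inter> B j))"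
      unfolding D_def using i by (intro sum.remove) auto
    moreover have "(\<Sum>j\<in>{..<h} - {i}. card (nbrs E v \<inter> B j)) \<le> of_nat (card ({..<h} - {i})) * M"
      using le by (intro sum_bounded_above) auto
    moreover have "card ({..<h} - {i}) = h - 1" using i by simp
    ultimately show ?thesis using i by simp
  qed
  have "(\<Sum>v\<in>V. D v) = (\<Sum>i<h. \<Sum>v\<in>V. card (nbrs E v \<inter> B i))"
    unfolding D_def by (rule sum.swap)
  also have "\<dots> = (\<Sum>i<h. \<Sum>u\<in>B i. card (nbrs E u))"
  proof (rule sum.cong[OF refl])
    fix i assume "i \<in> {..<h}"
    then have i: "i < h" by simp
    have "(\<Sum>v\<in>V. card (nbrs E v \<inter> B i)) = (\<Sum>u\<in>B i. card (nbrs E u \<inter> V))"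
      by (rule sum_card_nbrs_swap[OF G order_refl BV(1)[OF i]])
    also have "\<dots> = (\<Sum>u\<in>B i. card (nbrs E u))" using simple_graphD(6)[OF G] by (simp add: Int_absorb2)
    finally show "(\<Sum>v\<in>V. card (nbrs E v \<inter> B i)) = (\<Sum>u\<in>B i. card (nbrs E u))" .
  qed
  finally have eq0: "(\<Sum>v\<in>V. D v) = (\<Sum>i<h. \<Sum>u\<in>B i. card (nbrs E u))" .
  have eq: "(\<Sum>v\<in>V. real (D v)) = (\<Sum>i<h. \<Sum>u\<in>B i. real (card (nbrs E u)))"
    using arg_cong[OF eq0, of real] by simp
  have "real h * (real M * ((1 - 1 / real r + \<epsilon>) * n)) = (\<Sum>i<h. \<Sum>u\<in>B i. (1 - 1 / real r + \<epsilon>) * n)"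
    by (simp add: BV)
  also have "\<dots> \<le> (\<Sum>i<h. \<Sum>u\<in>B i. real (card (nbrs E u)))"
    unfolding n_def using deg BV by (intro sum_mono) auto
  also have "\<dots> = (\<Sum>v\<in>V. real (D v))" by (rule eq[symmetric])
  also have "\<dots> = (\<Sum>v\<in>V - X. real (D v)) + (\<Sum>v\<in>X. real (D v))"
    using f XV by (rule sum.subset_diff[rotated])
  also have "\<dots> \<le> (\<Sum>v\<in>V - X. real ((h - 1) * M + N)) + (\<Sum>v\<in>X. real (h * M))"
    using D1 D2 by (intro add_mono sum_mono) (simp_all only: of_nat_le_iff)
  also have "\<dots> = real (card (V - X)) * ((real h - 1) * real M + real N) + real (card X) * (real h * real M)"
    using h by (simp add: of_nat_diff)
  also have "\<dots> \<le> n * ((real h - 1) * real M + real N) + real (card X) * (real h * real M)"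
    unfolding n_def using h f card_mono[OF f, of "V - X"] by (intro add_right_mono mult_right_mono) auto
  finally have main: "real h * (real M * ((1 - 1 / real r + \<epsilon>) * n))
      \<le> n * ((real h - 1) * real M + real N) + real (card X) * (real h * real M)" .
  have r: "real h / real r \<le> 1" using h by simp
  have "n * (real M * (1 - real h / real r)) \<ge> 0" using r by (simp add: n_def)
  moreover have "real h * (real M * ((1 - 1 / real r + \<epsilon>) * n)) - n * ((real h - 1) * real M + real N)
      = n * (real M * (1 - real h / real r)) + n * (real h * (\<epsilon> * real M) - real N)"
    by (simp add: algebra_simps)
  ultimately have "n * (real h * (\<epsilon> * real M) - real N) \<le> real (card X) * (real h * real M)"
    using main by linarith
  moreover have "n * (real h * (\<epsilon> * real M) / 2) \<le> n * (real h * (\<epsilon> * real M) - real N)"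
  proof (intro mult_left_mono)
    have "1 * (\<epsilon> * real M) \<le> real h * (\<epsilon> * real M)" using h eps by (intro mult_right_mono) auto
    then show "real h * (\<epsilon> * real M) / 2 \<le> real h * (\<epsilon> * real M) - real N" using M by linarith
  qed (simp add: n_def)
  moreover have "(\<epsilon> / 2 * n) * (real h * real M) = n * (real h * (\<epsilon> * real M) / 2)" by simp
  ultimately have "(\<epsilon> / 2 * n) * (real h * real M) \<le> real (card X) * (real h * real M)"
    by linarith
  then show ?thesis unfolding n_def[symmetric] by (rule mult_right_le_imp_le) (use h M in simp)
qed

text \<open>Induction on the number of parts with the part size quantified inside: to gain a part,
  much larger old parts are taken and thinned to the common neighbourhood of the new one.\<close>

theorem erdos_stone_min_degree:
  fixes \<epsilon> :: real
  assumes r: "1 \<le> r" and eps: "0 < \<epsilon>"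
  shows "\<exists>n0. \<forall>V::'a set. \<forall>E. simple_graph V E \<longrightarrow> n0 \<le> card V \<longrightarrow>
    (\<forall>u\<in>V. (1 - 1 / real r + \<epsilon>) * real (card V) \<le> real (card (nbrs E u))) \<longrightarrow>
    (\<exists>B. complete_parts V E (Suc r) N B)"
proof -
  have "\<forall>N. \<exists>n0. \<forall>V::'a set. \<forall>E. simple_graph V E \<longrightarrow> n0 \<le> card V \<longrightarrow>
    (\<forall>u\<in>V. (1 - 1 / real r + \<epsilon>) * real (card V) \<le> real (card (nbrs E u))) \<longrightarrow>
    (\<exists>B. complete_parts V E (Suc h) N B)" if "h \<le> r" for h
    using that
  proof (induction h)
    case 0
    show ?case
    proof
      fix N
      have "\<exists>B. complete_parts V E (Suc 0) N B" if c: "N \<le> card V" for V :: "'a set" and E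
      proof -
        obtain T where "T \<subseteq> V" "card T = N" using c by (meson obtain_subset_with_card_n)
        then have "complete_parts V E (Suc 0) N (\<lambda>_. T)" by (simp add: complete_parts_def)
        then show ?thesis by blast
      qed
      then show "\<exists>n0. \<forall>V::'a set. \<forall>E. simple_graph V E \<longrightarrow> n0 \<le> card V \<longrightarrow>
        (\<forall>u\<in>V. (1 - 1 / real r + \<epsilon>) * real (card V) \<le> real (card (nbrs E u))) \<longrightarrow>
        (\<exists>B. complete_parts V E (Suc 0) N B)" by blast
    qed
  next
    case (Suc h)
    show ?case
    proof
      fix N0
      \<comment> \<open>The successor covers \<open>N0 = 0\<close>, since
        \<open>popular_neighbourhood\<close> demands at least one new vertex.\<close>
      define N where "N = Suc N0"
      define M where "M = nat \<lceil>2 * real N / \<epsilon>\<rceil> + 1"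
      have "2 * real N / \<epsilon> \<le> real M" unfolding M_def by linarith
      then have M: "2 * real N \<le> \<epsilon> * real M" "1 \<le> M" using eps by (auto simp: M_def field_simps)
      obtain n1 where n1: "\<And>(V::'a set) E. simple_graph V E \<Longrightarrow> n1 \<le> card V \<Longrightarrow>
        (\<forall>u\<in>V. (1 - 1 / real r + \<epsilon>) * real (card V) \<le> real (card (nbrs E u))) \<Longrightarrow>
        (\<exists>B. complete_parts V E (Suc h) M B)" using Suc by (metis Suc_leD)
      define n0 where "n0 = max n1 (nat \<lceil>2 * real (N * 2 ^ (Suc h * M)) / \<epsilon>\<rceil>)"
      have "\<exists>B. complete_parts V E (Suc (Suc h)) N0 B"
        if G: "simple_graph V E" and n: "n0 \<le> card V"
          and deg: "\<forall>u\<in>V. (1 - 1 / real r + \<epsilon>) * real (card V) \<le> real (card (nbrs E u))"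
        for V :: "'a set" and E
      proof -
        have "n1 \<le> card V" using n by (simp add: n0_def)
        then obtain B where B: "complete_parts V E (Suc h) M B" using n1[OF G] deg by blast
        define X where "X = {v \<in> V. \<forall>i<Suc h. N \<le> card (nbrs E v \<inter> B i)}"
        have "\<epsilon> / 2 * real (card V) \<le> real (card X)"
          using min_degree_complete_parts_step[OF G _ Suc.prems eps B M _ X_def] deg by simp
        moreover have "2 * real (N * 2 ^ (Suc h * M)) / \<epsilon> \<le> real (card V)"
          using n unfolding n0_def by linarith
        then have "real (N * 2 ^ (Suc h * M)) \<le> \<epsilon> / 2 * real (card V)" using eps by (simp add: field_simps)
        ultimately have "real (N * 2 ^ (Suc h * M)) \<le> real (card X)" by linarith
        then have big: "N * 2 ^ (Suc h * M) \<le> card X" by (simp only: of_nat_le_iff)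
        obtain B' T where B': "\<And>i. i < Suc h \<Longrightarrow> B' i \<subseteq> B i" "\<And>i. i < Suc h \<Longrightarrow> card (B' i) = N"
          and T: "T \<subseteq> X" "card T = N" "\<And>i u v. i < Suc h \<Longrightarrow> u \<in> T \<Longrightarrow> v \<in> B' i \<Longrightarrow> E u v"
          by (rule popular_neighbourhood[OF G B _ _ big, of N]) (auto simp: X_def N_def)
        have c': "complete_parts V E (Suc h) N B'" using complete_parts_subset[OF B B'] .
        have TV: "T \<subseteq> V" using T(1) by (auto simp: X_def)
        have c: "complete_parts V E (Suc (Suc h)) N (B'(Suc h := T))"
          by (rule complete_parts_Suc[OF G c' TV T(2,3)])
        have "\<exists>A. A \<subseteq> (B'(Suc h := T)) i \<and> card A = N0" if "i < Suc (Suc h)" for i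
        proof -
          have "N0 \<le> card ((B'(Suc h := T)) i)" using c that by (simp add: complete_parts_def N_def)
          then show ?thesis by (meson obtain_subset_with_card_n)
        qed
        then obtain B'' where "\<And>i. i < Suc (Suc h) \<Longrightarrow> B'' i \<subseteq> (B'(Suc h := T)) i \<and> card (B'' i) = N0"
          by metis
        then have "complete_parts V E (Suc (Suc h)) N0 B''"
          using complete_parts_subset[OF c, of B'' N0] by blast
        then show ?thesis by blast
      qed
      then show "\<exists>n0. \<forall>V::'a set. \<forall>E. simple_graph V E \<longrightarrow> n0 \<le> card V \<longrightarrow>
        (\<forall>u\<in>V. (1 - 1 / real r + \<epsilon>) * real (card V) \<le> real (card (nbrs E u))) \<longrightarrow>
        (\<exists>B. complete_parts V E (Suc (Suc h)) N0 B)" by blast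
    qed
  qed
  from this[OF order_refl] show ?thesis by blast
qed

text \<open>Fewer than \<open>h * N\<close> vertices precede each part, and together they exclude at
  most \<open>h * N * m\<close> candidates.\<close>

lemma greedy_complete_parts:
  assumes G: "simple_graph V E" and U: "\<And>i. i < h \<Longrightarrow> U i \<subseteq> V"
    and miss: "\<And>i j v. i < h \<Longrightarrow> j < h \<Longrightarrow> i \<noteq> j \<Longrightarrow> v \<in> U i \<Longrightarrow> real (card (U j - nbrs E v)) \<le> m"
    and big: "\<And>i. i < h \<Longrightarrow> real N + real h * real N * m \<le> real (card (U i))" and m: "0 \<le> m"
  obtains B where "complete_parts V E h N B" and "\<And>i. i < h \<Longrightarrow> B i \<subseteq> U i"
proof -
  note f = simple_graphD(1)[OF G]
  have "\<exists>B. complete_parts V E k N B \<and> (\<forall>i<k. B i \<subseteq> U i)" if "k \<le> h" for k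
    using that
  proof (induction k)
    case 0
    show ?case by (auto simp: complete_parts_def)
  next
    case (Suc k)
    then obtain B where B: "complete_parts V E k N B" "\<And>i. i < k \<Longrightarrow> B i \<subseteq> U i" by auto
    define R where "R = (\<Union>i<k. \<Union>v\<in>B i. U k - nbrs E v)"
    have fB: "finite (B i)" if "i < k" for i
      using that B(1) f unfolding complete_parts_def by (meson finite_subset)
    have fU: "finite (U k)" using U[of k] Suc.prems f finite_subset by auto
    have "real (card R) \<le> (\<Sum>i<k. \<Sum>v\<in>B i. real (card (U k - nbrs E v)))"
    proof -
      have "card R \<le> (\<Sum>i<k. card (\<Union>v\<in>B i. U k - nbrs E v))" unfolding R_def by (rule card_UN_le) simp
      also have "\<dots> \<le> (\<Sum>i<k. \<Sum>v\<in>B i. card (U k - nbrs E v))"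
        using fB by (intro sum_mono card_UN_le) auto
      finally show ?thesis by (simp flip: of_nat_sum)
    qed
    also have "\<dots> \<le> (\<Sum>i<k. \<Sum>v\<in>B i. m)"
    proof (intro sum_mono)
      fix i v assume "i \<in> {..<k}" "v \<in> B i"
      then show "real (card (U k - nbrs E v)) \<le> m" using miss[of i k v] B(2)[of i] Suc.prems by auto
    qed
    also have "\<dots> = real k * (real N * m)" using B(1) by (simp add: complete_parts_def)
    also have "\<dots> \<le> real h * (real N * m)" using Suc.prems m by (intro mult_right_mono) auto
    finally have R: "real (card R) \<le> real h * real N * m" by simp
    have RU: "R \<subseteq> U k" by (auto simp: R_def)
    have "card (U k - R) = card (U k) - card R" "card R \<le> card (U k)"
      using card_Diff_subset[OF finite_subset[OF RU fU] RU] card_mono[OF fU RU] by auto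
    then have "real N \<le> real (card (U k - R))"
      using R big[of k] Suc.prems by (simp add: of_nat_diff)
    then have "N \<le> card (U k - R)" by simp
    then obtain T where T: "T \<subseteq> U k - R" "card T = N" by (meson obtain_subset_with_card_n)
    have TV: "T \<subseteq> V" using T(1) U[of k] Suc.prems by auto
    have "complete_parts V E (Suc k) N (B(k := T))"
    proof (rule complete_parts_Suc[OF G B(1) TV T(2)])
      fix i u v assume "i < k" "u \<in> T" "v \<in> B i"
      then have "E v u" using T(1) by (auto simp: R_def nbrs_def)
      then show "E u v" by (rule simple_graphD(5)[OF G])
    qed
    moreover have "\<forall>i<Suc k. (B(k := T)) i \<subseteq> U i" using B(2) T(1) by (auto simp: less_Suc_eq)
    ultimately show ?case by blast
  qed
  from this[OF order_refl] show thesis using that by blast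
qed

text \<open>Double counting gives linearly many vertices of \<open>Y\<close> adjacent to a
  proportion \<open>\<delta> / 2\<close> of \<open>A\<close>, and pigeonhole makes many of their
  traces on \<open>A\<close> coincide. The factor \<open>2 ^ card A\<close> is affordable because
  \<open>A\<close> has bounded size in the application.\<close>

lemma popular_common_cell:
  assumes G: "simple_graph V E" and A: "A \<subseteq> V" and Y: "Y \<subseteq> V"
    and d: "\<And>w. w \<in> A \<Longrightarrow> \<delta> * real n \<le> real (card (nbrs E w \<inter> Y))" and n: "card Y \<le> n" "0 < n" and d0: "0 < \<delta>"
    and A0: "A \<noteq> {}"
  obtains T U where "T \<subseteq> A" and "U \<subseteq> Y" and "\<delta> / 2 * real (card A) \<le> real (card T)"
    and "\<delta> / 2 * real n \<le> 2 ^ card A * real (card U)" and "\<forall>w\<in>T. \<forall>u\<in>U. E w u"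
proof -
  note f = simple_graphD(1)[OF G]
  have fA: "finite A" "finite Y" using A Y f finite_subset by auto
  define X where "X = {v \<in> Y. \<delta> / 2 * real (card A) \<le> real (card (nbrs E v \<inter> A))}"
  have XY: "X \<subseteq> Y" by (auto simp: X_def)
  have fX: "finite X" using XY fA(2) by (rule finite_subset)
  have "real (card A) * (\<delta> * real n) = (\<Sum>w\<in>A. \<delta> * real n)" by simp
  also have "\<dots> \<le> (\<Sum>w\<in>A. real (card (nbrs E w \<inter> Y)))" using d by (rule sum_mono)
  also have "\<dots> = (\<Sum>v\<in>Y. real (card (nbrs E v \<inter> A)))"
    using sum_card_nbrs_swap[OF G A Y] by (metis of_nat_sum)
  also have "\<dots> = (\<Sum>v\<in>Y - X. real (card (nbrs E v \<inter> A))) + (\<Sum>v\<in>X. real (card (nbrs E v \<inter> A)))"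
    using fA(2) XY by (rule sum.subset_diff[rotated])
  also have "\<dots> \<le> (\<Sum>v\<in>Y - X. \<delta> / 2 * real (card A)) + (\<Sum>v\<in>X. real (card A))"
    using fA by (intro add_mono sum_mono) (auto simp: X_def intro: card_mono)
  also have "\<dots> = real (card (Y - X)) * (\<delta> / 2 * real (card A)) + real (card X) * real (card A)" by simp
  also have "\<dots> \<le> real n * (\<delta> / 2 * real (card A)) + real (card X) * real (card A)"
    using d0 card_mono[OF fA(2), of "Y - X"] n by (intro add_right_mono mult_right_mono) auto
  finally have "(\<delta> / 2 * real n) * real (card A) \<le> real (card X) * real (card A)" by (simp add: algebra_simps)
  then have X: "\<delta> / 2 * real n \<le> real (card X)"
    by (rule mult_right_le_imp_le) (use A0 fA in \<open>simp add: card_gt_0_iff\<close>)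
  obtain T where T: "T \<subseteq> A" "card X \<le> 2 ^ card A * card {x \<in> X. nbrs E x \<inter> A = T}"
    by (rule popular_type[OF fX fA(1), of "\<lambda>x. nbrs E x \<inter> A"]) auto
  define U where "U = {x \<in> X. nbrs E x \<inter> A = T}"
  have "0 < \<delta> / 2 * real n" using d0 n by simp
  then have "card X > 0" using X by linarith
  moreover have "card X \<le> 2 ^ card A * card U" using T(2) by (simp only: U_def)
  ultimately have "card U \<noteq> 0" by (cases "card U = 0") auto
  then have "U \<noteq> {}" by auto
  then obtain x where x: "x \<in> X" "nbrs E x \<inter> A = T" by (auto simp: U_def)
  show thesis
  proof (rule that[of T U])
    show "\<delta> / 2 * real (card A) \<le> real (card T)" using x by (auto simp: X_def)
    have "real (card X) \<le> real (2 ^ card A * card U)" using T(2) unfolding U_def by (simp only: of_nat_le_iff)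
    then show "\<delta> / 2 * real n \<le> 2 ^ card A * real (card U)" using X by simp
    show "\<forall>w\<in>T. \<forall>u\<in>U. E w u"
      using simple_graphD(5)[OF G] by (auto simp: U_def nbrs_def)
  qed (use T XY in \<open>auto simp: U_def\<close>)
qed

text \<open>
  The vertices \<open>w\<^sub>j\<close> with \<open>j < c\<close> are the universal ones, the edges \<open>w\<^sub>j b\<^sub>j\<close> with \<open>c \<le> j < t\<close> lie in class \<open>i\<^sub>0\<close>.
  No adjacency between different indices \<open>j\<close> is required, because the corresponding vertices of \<open>C\<^sub>k\<^sup>p\<close> are not adjacent.
\<close>

definition pattern ::
  "nat \<Rightarrow> nat \<Rightarrow> nat \<Rightarrow> 'a set \<Rightarrow> ('a \<Rightarrow> 'a \<Rightarrow> bool) \<Rightarrow> nat \<Rightarrow> nat \<Rightarrow> (nat \<Rightarrow> 'a set) \<Rightarrow> (nat \<Rightarrow> 'a) \<Rightarrow> (nat \<Rightarrow> 'a) \<Rightarrow> bool"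
  where
  "pattern q t N V E c i0 B w b \<longleftrightarrow> complete_parts V E q N B \<and> c \<le> t \<and> i0 < q \<and>
     w ` {..<t} \<subseteq> V \<and> inj_on w {..<t} \<and> b ` {c..<t} \<subseteq> V \<and> inj_on b {c..<t} \<and> w ` {..<t} \<inter> b ` {c..<t} = {} \<and>
     (\<forall>j\<in>{c..<t}. E (w j) (b j)) \<and>
     (\<forall>j<c. \<forall>i<q. \<forall>v\<in>B i. E (w j) v) \<and>
     (\<forall>j\<in>{c..<t}. \<forall>i<q. i \<noteq> i0 \<longrightarrow> (\<forall>v\<in>B i. E (w j) v \<and> E (b j) v))"

definition pattern_free :: "nat \<Rightarrow> nat \<Rightarrow> nat \<Rightarrow> 'a set \<Rightarrow> ('a \<Rightarrow> 'a \<Rightarrow> bool) \<Rightarrow> bool" where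
  "pattern_free q t N V E \<longleftrightarrow> (\<forall>c i0 B w b. \<not> pattern q t N V E c i0 B w b)"

text \<open>The instance \<open>c = t\<close>: the index set of the added edges is empty.\<close>

lemma pattern_free_universal:
  assumes pf: "pattern_free q t N V E" and q: "1 \<le> q" and B: "complete_parts V E q N B"
    and T: "T \<subseteq> V" "finite T" "t \<le> card T" and adj: "\<And>i u v. i < q \<Longrightarrow> u \<in> T \<Longrightarrow> v \<in> B i \<Longrightarrow> E u v"
  shows False
proof -
  obtain T' where T': "T' \<subseteq> T" "card T' = t" using T(3) by (meson obtain_subset_with_card_n)
  then have "finite T'" using T(2) finite_subset by blast
  then obtain w where w: "bij_betw w {..<t} T'" using T'(2) by (metis ex_bij_betw_nat_finite lessThan_atLeast0)
  have "pattern q t N V E t 0 B w w"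
    unfolding pattern_def using B q w T'(1) T(1) adj by (auto simp: bij_betw_def)
  then show False using pf by (auto simp: pattern_free_def)
qed

text \<open>The instance \<open>c = 0\<close>: all of the additional structure consists of disjoint
  edges, and no adjacency to class \<open>i0\<close> is asked of their endpoints.\<close>

lemma pattern_free_matching:
  assumes pf: "pattern_free q t N V E" and B: "complete_parts V E q N B" and i0: "i0 < q"
    and Q: "Q \<subseteq> V" and m: "matching E Q {..<t} a b"
    and adj: "\<And>i u v. i < q \<Longrightarrow> i \<noteq> i0 \<Longrightarrow> u \<in> a ` {..<t} \<union> b ` {..<t} \<Longrightarrow> v \<in> B i \<Longrightarrow> E u v"
  shows False
proof -
  have "pattern q t N V E 0 i0 B a b"
    unfolding pattern_def using B i0 Q m adj
    by (auto simp: matching_def atLeast0LessThan)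
  then show False using pf by (auto simp: pattern_free_def)
qed

text \<open>The instance \<open>c = t - 1\<close>. It is what finally forbids edges inside the
  classes once \<open>t - 1\<close> nearly universal vertices have been found.\<close>

lemma pattern_free_edge:
  assumes pf: "pattern_free q t N V E" and t: "1 \<le> t" and B: "complete_parts V E q N B" and i0: "i0 < q"
    and C: "C \<subseteq> V" "finite C" "card C = t - 1" and ab: "a \<in> V" "b \<in> V" "E a b" "a \<noteq> b" "a \<notin> C" "b \<notin> C"
    and adjC: "\<And>i u v. i < q \<Longrightarrow> u \<in> C \<Longrightarrow> v \<in> B i \<Longrightarrow> E u v"
    and adj: "\<And>i v. i < q \<Longrightarrow> i \<noteq> i0 \<Longrightarrow> v \<in> B i \<Longrightarrow> E a v \<and> E b v"
  shows False
proof -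
  obtain w where w: "bij_betw w {..<t - 1} C" using C by (metis ex_bij_betw_nat_finite lessThan_atLeast0)
  define w' where "w' = w(t - 1 := a)"
  have im: "w' ` {..<t} = insert a C"
  proof -
    have "{..<t} = insert (t - 1) {..<t - 1}" using t by auto
    then show ?thesis using w by (auto simp: w'_def bij_betw_def)
  qed
  have "card (w' ` {..<t}) = card {..<t}" using im C ab(5) t by simp
  then have inj: "inj_on w' {..<t}" by (simp add: eq_card_imp_inj_on)
  have s: "{t - 1..<t} = {t - 1}" using t by auto
  have wC: "w' j \<in> C" if "j < t - 1" for j using that w by (auto simp: w'_def bij_betw_def)
  have "pattern q t N V E (t - 1) i0 B w' (\<lambda>_. b)"
    unfolding pattern_def s im using B i0 C ab inj adj adjC wC by (auto simp: w'_def)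
  then show False using pf by (auto simp: pattern_free_def)
qed

lemma pattern_free_induced:
  assumes "pattern_free q t N V E" and "U \<subseteq> V"
  shows "pattern_free q t N U (induced E U)"
proof -
  have "pattern q t N V E c i0 B w b" if p: "pattern q t N U (induced E U) c i0 B w b" for c i0 B w b
    using p assms(2) unfolding pattern_def complete_parts_def induced_def by auto
  then show ?thesis using assms(1) unfolding pattern_free_def by blast
qed

subsection \<open>Stability under a minimum degree condition\<close>

definition stable_set :: "('a \<Rightarrow> 'a \<Rightarrow> bool) \<Rightarrow> 'a set \<Rightarrow> bool" where
  "stable_set E P \<longleftrightarrow> (\<forall>u\<in>P. \<forall>v\<in>P. \<not> E u v)"

lemma stable_set_card_le:
  assumes G: "simple_graph V E" and P: "P \<subseteq> V" "stable_set E P" and d0: "d \<le> real (card V)"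
    and deg: "\<And>u. u \<in> V \<Longrightarrow> d \<le> real (card (nbrs E u))"
  shows "real (card P) \<le> real (card V) - d"
proof (cases "P = {}")
  case True
  then show ?thesis using d0 by simp
next
  case False
  then obtain v where v: "v \<in> P" by blast
  note f = simple_graphD(1)[OF G]
  have "nbrs E v \<inter> P = {}" using P v by (auto simp: stable_set_def nbrs_def)
  then have "nbrs E v \<subseteq> V - P" using simple_graphD(6)[OF G, of v] by blast
  then have "card (nbrs E v) \<le> card (V - P)" using f by (intro card_mono) auto
  also have "\<dots> = card V - card P" using P(1) f finite_subset by (intro card_Diff_subset) auto
  finally have "card (nbrs E v) \<le> card V - card P" .
  moreover have "card P \<le> card V" using f P(1) by (rule card_mono)
  ultimately have "real (card (nbrs E v)) \<le> real (card V) - real (card P)" by linarith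
  then show ?thesis using deg[of v] v P(1) by auto
qed

text \<open>A vertex that spends at most \<open>a\<close> of its degree inside \<open>P\<close> has
  to spend the rest outside, where little room remains for nonneighbours.\<close>

lemma nonneighbours_outside_part:
  assumes G: "simple_graph V E" and P: "P \<subseteq> V" and v: "v \<in> V"
    and N: "real (card (nbrs E v \<inter> P)) \<le> a" and deg: "d \<le> real (card (nbrs E v))"
  shows "real (card (V - P - nbrs E v)) \<le> real (card V) - real (card P) + a - d"
proof -
  note f = simple_graphD(1)[OF G] and NV = simple_graphD(6)[OF G, of v]
  have fP: "finite P" "finite (nbrs E v)" using P NV f finite_subset by auto
  have "card V = card P + card (V - P)" using card_Int_Diff[OF f, of P] P by (simp add: Int_absorb1)
  moreover have "card (V - P) = card ((V - P) \<inter> nbrs E v) + card (V - P - nbrs E v)"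
    by (rule card_Int_Diff) (use f in simp)
  moreover have "card (nbrs E v) = card (nbrs E v \<inter> P) + card ((V - P) \<inter> nbrs E v)"
  proof -
    have "(V - P) \<inter> nbrs E v = nbrs E v - P" using NV by auto
    then show ?thesis using card_Int_Diff[OF fP(2), of P] by simp
  qed
  ultimately show ?thesis using N deg by linarith
qed

text \<open>The classes do not have to cover \<open>V\<close>; the uncovered vertices form the
  exceptional set.\<close>

definition sep_parts :: "'a set \<Rightarrow> ('a \<Rightarrow> 'a \<Rightarrow> bool) \<Rightarrow> nat \<Rightarrow> (nat \<Rightarrow> 'a set) \<Rightarrow> bool" where
  "sep_parts V E q P \<longleftrightarrow> (\<forall>i<q. P i \<subseteq> V \<and> stable_set E (P i)) \<and> (\<forall>i<q. \<forall>j<q. i \<noteq> j \<longrightarrow> P i \<inter> P j = {})"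

lemma sep_partsD:
  assumes "sep_parts V E q P"
  shows "i < q \<Longrightarrow> P i \<subseteq> V" and "i < q \<Longrightarrow> stable_set E (P i)" and "i < q \<Longrightarrow> j < q \<Longrightarrow> i \<noteq> j \<Longrightarrow> P i \<inter> P j = {}"
  using assms by (auto simp: sep_parts_def)

lemma card_sep_parts:
  assumes "simple_graph V E" and "sep_parts V E q P"
  shows "card (\<Union>i<q. P i) = (\<Sum>i<q. card (P i))"
    and "card V = card (V - (\<Union>i<q. P i)) + (\<Sum>i<q. card (P i))"
proof -
  note f = simple_graphD(1)[OF assms(1)]
  have sub: "(\<Union>i<q. P i) \<subseteq> V" using sep_partsD(1)[OF assms(2)] by auto
  show 1: "card (\<Union>i<q. P i) = (\<Sum>i<q. card (P i))"
    using sep_partsD[OF assms(2)] f by (intro card_UN_disjoint) (auto intro: finite_subset)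
  show "card V = card (V - (\<Union>i<q. P i)) + (\<Sum>i<q. card (P i))"
    using card_Diff_subset[OF finite_subset[OF sub f] sub] card_mono[OF f sub] 1 by simp
qed

text \<open>All neighbours of a member of an independent class lie outside it, which bounds every
  class from above; the lower bound is what the other \<open>q - 1\<close> classes and the
  exceptional set leave over.\<close>

lemma sep_parts_card_bounds:
  assumes G: "simple_graph V E" and P: "sep_parts V E q P" and q: "1 \<le> q" and eps: "0 \<le> \<epsilon>"
    and deg: "\<And>u. u \<in> V \<Longrightarrow> (1 - 1 / real q - \<epsilon>) * real (card V) \<le> real (card (nbrs E u))"
    and W: "real (card (V - (\<Union>i<q. P i))) \<le> W" and i: "i < q"
  shows "real (card (P i)) \<le> (1 / real q + \<epsilon>) * real (card V)"
    and "(1 / real q - real q * \<epsilon>) * real (card V) - W \<le> real (card (P i))"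
proof -
  define n where "n = real (card V)"
  have n0: "0 \<le> n" by (simp add: n_def)
  have up: "real (card (P i)) \<le> (1 / real q + \<epsilon>) * n" if i: "i < q" for i
  proof -
    have "0 \<le> 1 / real q" by simp
    then have "(1 - 1 / real q - \<epsilon>) * n \<le> 1 * n" using eps n0 by (intro mult_right_mono) linarith+
    then have "real (card (P i)) \<le> real (card V) - (1 - 1 / real q - \<epsilon>) * n"
      using stable_set_card_le[OF G sep_partsD(1,2)[OF P i], of "(1 - 1 / real q - \<epsilon>) * n"] i P deg
      by (simp add: n_def)
    also have "\<dots> = (1 / real q + \<epsilon>) * n" by (simp add: n_def algebra_simps)
    finally show ?thesis .
  qed
  show "real (card (P i)) \<le> (1 / real q + \<epsilon>) * real (card V)" using up[OF i] by (simp add: n_def)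
  have "n = real (card (V - (\<Union>i<q. P i))) + (\<Sum>j<q. real (card (P j)))"
    unfolding n_def using card_sep_parts(2)[OF G P] by (metis of_nat_add of_nat_sum)
  also have "(\<Sum>j<q. real (card (P j))) = real (card (P i)) + (\<Sum>j\<in>{..<q} - {i}. real (card (P j)))"
    using i by (intro sum.remove) auto
  also have "(\<Sum>j\<in>{..<q} - {i}. real (card (P j))) \<le> (\<Sum>j\<in>{..<q} - {i}. (1 / real q + \<epsilon>) * n)"
    using up by (intro sum_mono) auto
  also have "\<dots> = (real q - 1) * ((1 / real q + \<epsilon>) * n)" using i by (simp add: of_nat_diff)
  finally have "n \<le> W + real (card (P i)) + (real q - 1) * ((1 / real q + \<epsilon>) * n)" using W by linarith
  moreover have "(real q - 1) * ((1 / real q + \<epsilon>) * n) = n - n / real q + real q * \<epsilon> * n - \<epsilon> * n"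
    using q by (simp add: field_simps)
  moreover have "0 \<le> \<epsilon> * n" using eps n0 by simp
  ultimately have "n / real q - real q * \<epsilon> * n - W \<le> real (card (P i))" by linarith
  then show "(1 / real q - real q * \<epsilon>) * real (card V) - W \<le> real (card (P i))"
    by (simp add: n_def algebra_simps)
qed

text \<open>Candidates for the classes are found by looking only at the trace on one complete
  multipartite subgraph of bounded size, which takes the place of a maximum cut.\<close>

definition trace_class ::
  "'a set \<Rightarrow> ('a \<Rightarrow> 'a \<Rightarrow> bool) \<Rightarrow> nat \<Rightarrow> (nat \<Rightarrow> 'a set) \<Rightarrow> nat \<Rightarrow> real \<Rightarrow> nat \<Rightarrow> 'a set" where
  "trace_class V E q B N \<mu> i = {v \<in> V. card (nbrs E v \<inter> B i) < N \<and>
     (\<forall>j<q. j \<noteq> i \<longrightarrow> \<mu> \<le> real (card (nbrs E v \<inter> B j)))}"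

text \<open>Double counting against \<open>B\<close>: a vertex outside \<open>X\<close> has at most
  \<open>(q - 1) * M + N\<close> neighbours in \<open>B\<close>, and an unclassified one has
  \<open>\<eta> * M\<close> fewer. The minimum degree leaves room for only few such
  deficits.\<close>

lemma trace_class_leftover:
  assumes G: "simple_graph V E" and q: "1 \<le> q" and B: "complete_parts V E q M B" and M: "1 \<le> M"
    and eta: "0 < \<eta>" and eps: "0 \<le> \<epsilon>"
    and deg: "\<And>u. u \<in> V \<Longrightarrow> (1 - 1 / real q - \<epsilon>) * real (card V) \<le> real (card (nbrs E u))"
    and X: "X = {v \<in> V. \<forall>i<q. N \<le> card (nbrs E v \<inter> B i)}"
    and L: "L = V - X - (\<Union>i<q. trace_class V E q B N ((1 - \<eta>) * real M) i)"
  shows "\<eta> * real (card L) \<le> real q * \<epsilon> * real (card V) + real N / real M * real (card V) + real (card X)"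
proof -
  note f = simple_graphD(1)[OF G]
  define n where "n = real (card V)"
  define D where "D v = (\<Sum>i<q. card (nbrs E v \<inter> B i))" for v
  have BV: "B i \<subseteq> V" "card (B i) = M" if "i < q" for i using B that by (auto simp: complete_parts_def)
  have fB: "finite (B i)" if "i < q" for i using BV(1)[OF that] f by (rule finite_subset)
  have XV: "X \<subseteq> V" "L \<subseteq> V" "X \<inter> L = {}" by (auto simp: X L)
  have le: "card (nbrs E v \<inter> B i) \<le> M" if "i < q" for v i
    using card_mono[OF fB[OF that], of "nbrs E v \<inter> B i"] BV(2)[OF that] by auto
  define a where "a = (real q - 1) * real M + real N"
  have D1: "real (D v) \<le> a + real M" for v
  proof -
    have "D v \<le> q * M"
      using sum_bounded_above[of "{..<q}" "\<lambda>i. card (nbrs E v \<inter> B i)" M] le by (auto simp: D_def)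
    then have "real (D v) \<le> real q * real M" by (simp flip: of_nat_mult)
    then show ?thesis by (simp add: a_def algebra_simps)
  qed
  have rem: "real (D v) = real (card (nbrs E v \<inter> B i)) + (\<Sum>j\<in>{..<q} - {i}. real (card (nbrs E v \<inter> B j)))"
    if "i < q" for v i
  proof -
    have "D v = card (nbrs E v \<inter> B i) + (\<Sum>j\<in>{..<q} - {i}. card (nbrs E v \<inter> B j))"
      unfolding D_def using that by (intro sum.remove) auto
    then show ?thesis by simp
  qed
  have D2: "real (D v) \<le> a" if v: "v \<in> V - X" for v
  proof -
    obtain i where i: "i < q" "card (nbrs E v \<inter> B i) < N" using v by (auto simp: X not_le)
    have "(\<Sum>j\<in>{..<q} - {i}. real (card (nbrs E v \<inter> B j))) \<le> real (card ({..<q} - {i})) * real M"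
      using le by (intro sum_bounded_above) auto
    then show ?thesis using rem[OF i(1), of v] i by (simp add: a_def of_nat_diff)
  qed
  have D3: "real (D v) \<le> a - \<eta> * real M" if v: "v \<in> L" for v
  proof -
    obtain i where i: "i < q" "card (nbrs E v \<inter> B i) < N" using v by (auto simp: X L not_le)
    then obtain j where j: "j < q" "j \<noteq> i" "real (card (nbrs E v \<inter> B j)) < (1 - \<eta>) * real M"
      using v by (fastforce simp: L trace_class_def not_le)
    have "(\<Sum>j\<in>{..<q} - {i}. real (card (nbrs E v \<inter> B j))) = real (card (nbrs E v \<inter> B j)) +
        (\<Sum>j\<in>{..<q} - {i} - {j}. real (card (nbrs E v \<inter> B j)))"
      using j by (intro sum.remove) auto
    moreover have "(\<Sum>j\<in>{..<q} - {i} - {j}. real (card (nbrs E v \<inter> B j))) \<le> real (card ({..<q} - {i} - {j})) * real M"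
      using le by (intro sum_bounded_above) auto
    moreover have "real (card ({..<q} - {i} - {j})) = real q - 2"
      using i j by (simp add: card_Diff_singleton of_nat_diff)
    ultimately show ?thesis using rem[OF i(1), of v] i j by (simp add: a_def algebra_simps)
  qed
  have "(\<Sum>v\<in>V. D v) = (\<Sum>i<q. \<Sum>v\<in>V. card (nbrs E v \<inter> B i))"
    unfolding D_def by (rule sum.swap)
  also have "\<dots> = (\<Sum>i<q. \<Sum>u\<in>B i. card (nbrs E u))"
  proof (rule sum.cong[OF refl])
    fix i assume "i \<in> {..<q}"
    then have i: "i < q" by simp
    have "(\<Sum>v\<in>V. card (nbrs E v \<inter> B i)) = (\<Sum>u\<in>B i. card (nbrs E u \<inter> V))"
      by (rule sum_card_nbrs_swap[OF G order_refl BV(1)[OF i]])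
    also have "\<dots> = (\<Sum>u\<in>B i. card (nbrs E u))" using simple_graphD(6)[OF G] by (simp add: Int_absorb2)
    finally show "(\<Sum>v\<in>V. card (nbrs E v \<inter> B i)) = (\<Sum>u\<in>B i. card (nbrs E u))" .
  qed
  finally have eq0: "(\<Sum>v\<in>V. D v) = (\<Sum>i<q. \<Sum>u\<in>B i. card (nbrs E u))" .
  have eq: "(\<Sum>v\<in>V. real (D v)) = (\<Sum>i<q. \<Sum>u\<in>B i. real (card (nbrs E u)))"
    using arg_cong[OF eq0, of real] by simp
  have "real q * (real M * ((1 - 1 / real q - \<epsilon>) * n)) = (\<Sum>i<q. \<Sum>u\<in>B i. (1 - 1 / real q - \<epsilon>) * n)"
    by (simp add: BV)
  also have "\<dots> \<le> (\<Sum>i<q. \<Sum>u\<in>B i. real (card (nbrs E u)))"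
    unfolding n_def using deg BV by (intro sum_mono) auto
  also have "\<dots> = (\<Sum>v\<in>V. real (D v))" by (rule eq[symmetric])
  also have "\<dots> \<le> (\<Sum>v\<in>V. a + (if v \<in> X then real M else 0) - (if v \<in> L then \<eta> * real M else 0))"
    using D1 D2 D3 XV by (intro sum_mono) auto
  also have "\<dots> = n * a + real (card X) * real M - real (card L) * (\<eta> * real M)"
    using f XV by (simp add: sum.distrib sum_subtractf n_def sum.If_cases Int_absorb1)
  finally have "real q * (real M * ((1 - 1 / real q - \<epsilon>) * n)) \<le> n * a + real (card X) * real M - real (card L) * (\<eta> * real M)" .
  moreover have "real q * (real M * ((1 - 1 / real q - \<epsilon>) * n)) = n * ((real q - 1) * real M) - real q * \<epsilon> * n * real M"
    using q by (simp add: field_simps)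
  moreover have "n * a = n * ((real q - 1) * real M) + n * real N" by (simp add: a_def algebra_simps)
  ultimately have "real (card L) * (\<eta> * real M) \<le> real q * \<epsilon> * n * real M + n * real N + real (card X) * real M"
    by linarith
  also have "\<dots> = (real q * \<epsilon> * n + real N / real M * n + real (card X)) * real M"
    using M by (simp add: field_simps)
  finally have "(\<eta> * real (card L)) * real M \<le> (real q * \<epsilon> * n + real N / real M * n + real (card X)) * real M"
    by (simp add: mult_ac)
  then show ?thesis unfolding n_def by (rule mult_right_le_imp_le) (use M in simp)
qed

lemma common_neighbours_card:
  assumes fP: "finite P" and fS: "finite S" and S: "card S \<le> s"
    and m: "\<And>v. v \<in> S \<Longrightarrow> real (card (P - nbrs E v)) \<le> m" and m0: "0 \<le> m"
  shows "real (card P) - real s * m \<le> real (card {u \<in> P. \<forall>v\<in>S. E v u})"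
proof -
  let ?R = "\<Union>v\<in>S. P - nbrs E v"
  have "real (card ?R) \<le> (\<Sum>v\<in>S. real (card (P - nbrs E v)))"
    using card_UN_le[OF fS, of "\<lambda>v. P - nbrs E v"] by (simp flip: of_nat_sum)
  also have "\<dots> \<le> real (card S) * m" using m by (intro sum_bounded_above)
  also have "\<dots> \<le> real s * m" using S m0 by (intro mult_right_mono) auto
  finally have R: "real (card ?R) \<le> real s * m" .
  have "card P \<le> card {u \<in> P. \<forall>v\<in>S. E v u} + card ?R"
  proof -
    have "P \<subseteq> {u \<in> P. \<forall>v\<in>S. E v u} \<union> ?R" by (auto simp: nbrs_def)
    then have "card P \<le> card ({u \<in> P. \<forall>v\<in>S. E v u} \<union> ?R)" using fP fS by (intro card_mono) auto
    also have "\<dots> \<le> card {u \<in> P. \<forall>v\<in>S. E v u} + card ?R" by (rule card_Un_le)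
    finally show ?thesis .
  qed
  then show ?thesis using R by linarith
qed

lemma card_matching_verts: "card (a ` {..<t} \<union> b ` {..<t}) \<le> 2 * (t :: nat)"
proof -
  have "card (a ` {..<t} \<union> b ` {..<t}) \<le> card (a ` {..<t}) + card (b ` {..<t})" by (rule card_Un_le)
  also have "\<dots> \<le> t + t" by (intro add_mono order_trans[OF card_image_le]) auto
  finally show ?thesis by simp
qed

text \<open>The matching has at most \<open>2 * t\<close> endpoints, each missing at most
  \<open>M / (4 * t)\<close> vertices of a part other than \<open>i\<close>; half of every such part
  survives as common neighbourhood. This fixes the constant \<open>1 / (4 * t)\<close>.\<close>

lemma trace_class_no_matching:
  assumes G: "simple_graph V E" and pf: "pattern_free q t N V E"
    and B: "complete_parts V E q M B" and t: "1 \<le> t" and M: "2 * N \<le> M" and i: "i < q"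
    and m: "matching E (trace_class V E q B N ((1 - 1 / (4 * real t)) * real M) i) {..<t} a b"
  shows False
proof -
  note f = simple_graphD(1)[OF G]
  let ?\<mu> = "(1 - 1 / (4 * real t)) * real M"
  let ?Q = "trace_class V E q B N ?\<mu> i"
  let ?S = "a ` {..<t} \<union> b ` {..<t}"
  have BV: "B j \<subseteq> V" "card (B j) = M" "finite (B j)" if "j < q" for j
    using B that f by (auto simp: complete_parts_def intro: finite_subset)
  have SQ: "?S \<subseteq> ?Q" using m by (auto simp: matching_def)
  have "\<exists>A. A \<subseteq> B j \<and> card A = N \<and> (j \<noteq> i \<longrightarrow> (\<forall>u\<in>?S. \<forall>v\<in>A. E u v))" if j: "j < q" for j
  proof (cases "j = i")
    case True
    have "N \<le> card (B j)" using BV[OF j] M by simp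
    then show ?thesis using True by (meson obtain_subset_with_card_n)
  next
    case False
    have "real (card (B j - nbrs E u)) \<le> real M / (4 * real t)" if "u \<in> ?S" for u
    proof -
      have "?\<mu> \<le> real (card (nbrs E u \<inter> B j))" using SQ that False j by (auto simp: trace_class_def)
      moreover have "card (B j - nbrs E u) + card (nbrs E u \<inter> B j) = M"
        using BV[OF j] by (metis Int_commute card_Int_Diff add.commute)
      ultimately show ?thesis using t by (simp add: algebra_simps flip: of_nat_add)
    qed
    then have "real (card (B j)) - real (2 * t) * (real M / (4 * real t)) \<le> real (card {u \<in> B j. \<forall>v\<in>?S. E v u})"
      using BV[OF j] by (intro common_neighbours_card card_matching_verts) auto
    then have "real M / 2 \<le> real (card {u \<in> B j. \<forall>v\<in>?S. E v u})" using t BV[OF j] by simp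
    then have "N \<le> card {u \<in> B j. \<forall>v\<in>?S. E v u}" using M by linarith
    then obtain A where "A \<subseteq> {u \<in> B j. \<forall>v\<in>?S. E v u}" "card A = N" by (meson obtain_subset_with_card_n)
    then show ?thesis by (intro exI[of _ A]) auto
  qed
  then obtain B' where B': "\<And>j. j < q \<Longrightarrow> B' j \<subseteq> B j \<and> card (B' j) = N \<and> (j \<noteq> i \<longrightarrow> (\<forall>u\<in>?S. \<forall>v\<in>B' j. E u v))"
    by metis
  have c: "complete_parts V E q N B'" using complete_parts_subset[OF B, of B' N] B' by blast
  have QV: "?Q \<subseteq> V" by (auto simp: trace_class_def)
  show False by (rule pattern_free_matching[OF pf c i QV m]) (use B' in blast)
qed

text \<open>Since \<open>1 / (q - 1) - 1 / q\<close> exceeds \<open>1 / q^2\<close>, the degree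
  condition is above the threshold for \<open>q - 1\<close> by at least
  \<open>1 / (2 * q^2)\<close>.\<close>

lemma min_degree_q_parts:
  fixes q N :: nat
  assumes q: "2 \<le> q"
  shows "\<exists>n0. \<forall>V::'a set. \<forall>E. simple_graph V E \<longrightarrow> n0 \<le> card V \<longrightarrow>
    (\<forall>u\<in>V. (1 - 1 / real q - 1 / (2 * real q ^ 2)) * real (card V) \<le> real (card (nbrs E u))) \<longrightarrow>
    (\<exists>B. complete_parts V E q N B)"
proof -
  have "1 / (real q - 1) - 1 / real q = 1 / (real q * (real q - 1))" using q by (simp add: field_simps)
  moreover have "1 / (real q ^ 2) \<le> 1 / (real q * (real q - 1))"
    using q by (intro divide_left_mono) (auto simp: power2_eq_square intro!: mult_left_mono)
  moreover have "1 / (real q ^ 2) = 2 * (1 / (2 * real q ^ 2))" by simp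
  ultimately have "1 - 1 / (real q - 1) + 1 / (2 * real q ^ 2) \<le> 1 - 1 / real q - 1 / (2 * real q ^ 2)"
    by linarith
  moreover have "real (q - 1) = real q - 1" using q by simp
  ultimately have *: "1 - 1 / real (q - 1) + 1 / (2 * real q ^ 2) \<le> 1 - 1 / real q - 1 / (2 * real q ^ 2)"
    by simp
  have r1: "1 \<le> q - 1" and e0: "0 < 1 / (2 * real q ^ 2)" using q by auto
  obtain n0 where n0: "\<And>(V::'a set) E. simple_graph V E \<Longrightarrow> n0 \<le> card V \<Longrightarrow>
    (\<forall>u\<in>V. (1 - 1 / real (q - 1) + 1 / (2 * real q ^ 2)) * real (card V) \<le> real (card (nbrs E u))) \<Longrightarrow>
    (\<exists>B. complete_parts V E (Suc (q - 1)) N B)"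
    using erdos_stone_min_degree[OF r1 e0, where N = N] by blast
  have "\<exists>B. complete_parts V E q N B" if "simple_graph V E" "n0 \<le> card V"
      "\<forall>u\<in>V. (1 - 1 / real q - 1 / (2 * real q ^ 2)) * real (card V) \<le> real (card (nbrs E u))" for V :: "'a set" and E
  proof -
    have "\<forall>u\<in>V. (1 - 1 / real (q - 1) + 1 / (2 * real q ^ 2)) * real (card V) \<le> real (card (nbrs E u))"
      using that(3) mult_right_mono[OF *, of "real (card V)"] by fastforce
    from n0[OF that(1,2) this] show ?thesis using q by simp
  qed
  then show ?thesis by blast
qed

text \<open>A coarse stability result: the uncovered vertices are only bounded by a small proportion
  of \<open>n\<close>. The classes serve as a frame in \<open>near_turan_structure\<close>, where
  the exceptional set becomes bounded.\<close>

lemma stability_parts: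
  fixes \<delta> :: real
  assumes q: "2 \<le> q" and t: "1 \<le> t" and N: "1 \<le> N" and \<delta>: "0 < \<delta>"
  shows "\<exists>\<epsilon>>0. \<exists>n0. \<forall>V::'a set. \<forall>E. simple_graph V E \<longrightarrow> pattern_free q t N V E \<longrightarrow> n0 \<le> card V \<longrightarrow>
    (\<forall>u\<in>V. (1 - 1 / real q - \<epsilon>) * real (card V) \<le> real (card (nbrs E u))) \<longrightarrow>
    (\<exists>P. sep_parts V E q P \<and> (\<forall>i<q. (1 / real q - \<delta>) * real (card V) \<le> real (card (P i))))"
proof -
  \<comment> \<open>The ratio \<open>N / M\<close> is at most \<open>\<delta> / (32 * t)\<close>, so
    the few neighbours allowed in the own part contribute at most \<open>\<delta> * n / 8\<close> to
    the leftover.\<close>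
  define M where "M = 2 * N + nat \<lceil>32 * real t * real N / \<delta>\<rceil>"
  have "32 * real t * real N / \<delta> \<le> real M" unfolding M_def by linarith
  then have M1: "32 * real t * real N \<le> real M * \<delta>" using \<delta> by (simp add: divide_le_eq)
  have M: "2 * N \<le> M" "1 \<le> M" using N by (auto simp: M_def)
  \<comment> \<open>The first bound provides \<open>q\<close> complete parts, the second keeps the
    degree deficit below \<open>\<delta> / 8\<close> in the leftover estimate.\<close>
  define \<epsilon> where "\<epsilon> = min (1 / (2 * real q ^ 2)) (\<delta> / (32 * real q * real t))"
  have eps: "0 < \<epsilon>" using q t \<delta> by (simp add: \<epsilon>_def)
  have eps1: "\<epsilon> \<le> 1 / (2 * real q ^ 2)" and "\<epsilon> \<le> \<delta> / (32 * real q * real t)" by (auto simp: \<epsilon>_def)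
  then have eps2: "32 * (real t * (real q * \<epsilon>)) \<le> \<delta>" using q t by (simp add: field_simps)
  \<comment> \<open>The size at which \<open>popular_neighbourhood\<close> produces \<open>t\<close>
    universal vertices.\<close>
  define Y where "Y = t * 2 ^ (q * M)"
  define n1 where "n1 = nat \<lceil>8 * (real Y + 4 * real t * real Y + 2 * real q * real t) / \<delta>\<rceil>"
  obtain n0 where n0: "\<And>(V::'a set) E. simple_graph V E \<Longrightarrow> n0 \<le> card V \<Longrightarrow>
    (\<forall>u\<in>V. (1 - 1 / real q - 1 / (2 * real q ^ 2)) * real (card V) \<le> real (card (nbrs E u))) \<Longrightarrow>
    (\<exists>B. complete_parts V E q M B)"
    using min_degree_q_parts[OF q, where N = M] by blast
  have "\<exists>P. sep_parts V E q P \<and> (\<forall>i<q. (1 / real q - \<delta>) * real (card V) \<le> real (card (P i)))"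
    if G: "simple_graph V E" and pf: "pattern_free q t N V E" and big: "max n0 n1 \<le> card V"
      and deg: "\<forall>u\<in>V. (1 - 1 / real q - \<epsilon>) * real (card V) \<le> real (card (nbrs E u))"
    for V :: "'a set" and E
  proof -
    note f = simple_graphD(1)[OF G]
    define n where "n = real (card V)"
    have n0': "0 \<le> n" by (simp add: n_def)
    have "(1 - 1 / real q - 1 / (2 * real q ^ 2)) * real (card V) \<le> (1 - 1 / real q - \<epsilon>) * real (card V)"
      using eps1 by (intro mult_right_mono) auto
    then have "\<forall>u\<in>V. (1 - 1 / real q - 1 / (2 * real q ^ 2)) * real (card V) \<le> real (card (nbrs E u))"
      using deg by (meson order_trans)
    then obtain B where B: "complete_parts V E q M B" using n0[OF G] big by auto
    define X where "X = {v \<in> V. \<forall>i<q. N \<le> card (nbrs E v \<inter> B i)}"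
    have cX: "card X < Y"
    proof (rule ccontr)
      assume "\<not> card X < Y"
      then have bg: "t * 2 ^ (q * M) \<le> card X" by (simp add: Y_def)
      obtain B' T where B': "\<And>i. i < q \<Longrightarrow> B' i \<subseteq> B i" "\<And>i. i < q \<Longrightarrow> card (B' i) = N"
        and T: "T \<subseteq> X" "card T = t" "\<And>i u v. i < q \<Longrightarrow> u \<in> T \<Longrightarrow> v \<in> B' i \<Longrightarrow> E u v"
        by (rule popular_neighbourhood[OF G B _ _ bg t, of N]) (auto simp: X_def)
      have c': "complete_parts V E q N B'" using complete_parts_subset[OF B B'] .
      have TV: "T \<subseteq> V" using T(1) by (auto simp: X_def)
      show False
        using pattern_free_universal[OF pf _ c' TV finite_subset[OF TV f] _ T(3)] q T(2) by auto
    qed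
    define \<eta> where "\<eta> = 1 / (4 * real t)"
    define Q where "Q = trace_class V E q B N ((1 - \<eta>) * real M)"
    define L where "L = V - X - (\<Union>i<q. Q i)"
    have eta: "0 < \<eta>" using t by (simp add: \<eta>_def)
    have Qdef: "L = V - X - (\<Union>i<q. trace_class V E q B N ((1 - \<eta>) * real M) i)" by (simp add: L_def Q_def)
    have "\<eta> * real (card L) \<le> real q * \<epsilon> * real (card V) + real N / real M * real (card V) + real (card X)"
      by (rule trace_class_leftover[OF G _ B M(2) eta _ _ X_def Qdef]) (use q eps deg in auto)
    then have "4 * real t * (\<eta> * real (card L)) \<le>
        4 * real t * (real q * \<epsilon> * n + real N / real M * n + real (card X))"
      unfolding n_def using t by (intro mult_left_mono) auto
    moreover have "4 * real t * (\<eta> * real (card L)) = real (card L)" using t by (simp add: \<eta>_def)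
    ultimately have L1: "real (card L) \<le> 4 * real t * (real q * \<epsilon> * n + real N / real M * n + real (card X))"
      by simp
    have L2: "4 * real t * (real q * \<epsilon> * n) \<le> \<delta> / 8 * n"
      using mult_right_mono[OF eps2 n0'] by (simp add: algebra_simps)
    have "real N / real M * (32 * real t) \<le> \<delta>" using M1 M by (simp add: field_simps)
    from mult_right_mono[OF this n0'] have L3: "4 * real t * (real N / real M * n) \<le> \<delta> / 8 * n"
      by (simp add: algebra_simps)
    have L4: "4 * real t * real (card X) \<le> 4 * real t * real Y" using cX by (intro mult_left_mono) auto
    have L: "real (card L) \<le> \<delta> * n / 4 + 4 * real t * real Y"
      using L1 L2 L3 L4 unfolding distrib_left by linarith
    have QV: "Q i \<subseteq> V" for i by (auto simp: Q_def trace_class_def)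
    have "\<exists>Z\<subseteq>Q i. card Z \<le> 2 * t \<and> (\<forall>u\<in>Q i - Z. \<forall>v\<in>Q i - Z. \<not> E u v)" if i: "i < q" for i
      using matching_or_cover[OF G QV[of i], of t] trace_class_no_matching[OF G pf B t M(1) i]
      unfolding Q_def \<eta>_def by blast
    then obtain Z where Z: "\<And>i. i < q \<Longrightarrow> Z i \<subseteq> Q i \<and> card (Z i) \<le> 2 * t \<and> stable_set E (Q i - Z i)"
      unfolding stable_set_def by metis
    define P where "P i = Q i - Z i" for i
    have Qdisj: "Q i \<inter> Q j = {}" if "i < q" "j < q" "i \<noteq> j" for i j
    proof -
      have "real N \<le> (1 - \<eta>) * real M"
      proof -
        have "\<eta> \<le> 1 / 2" using t by (simp add: \<eta>_def)
        then have "1 / 2 * real M \<le> (1 - \<eta>) * real M" by (intro mult_right_mono) auto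
        then show ?thesis using M(1) by linarith
      qed
      then show ?thesis using that by (fastforce simp: Q_def trace_class_def)
    qed
    have P: "sep_parts V E q P"
      unfolding sep_parts_def P_def using Z QV Qdisj by blast
    have "V - (\<Union>i<q. P i) \<subseteq> X \<union> L \<union> (\<Union>i<q. Z i)"
      unfolding P_def L_def by blast
    moreover have fin: "finite X" "finite L" "finite (\<Union>i<q. Z i)"
    proof -
      have "Z i \<subseteq> V" if "i < q" for i using Z[OF that] QV by blast
      then show "finite (\<Union>i<q. Z i)" using f by (auto intro: finite_subset)
    qed (use f in \<open>auto simp: X_def L_def\<close>)
    ultimately have "card (V - (\<Union>i<q. P i)) \<le> card (X \<union> L \<union> (\<Union>i<q. Z i))" by (intro card_mono) auto
    also have "\<dots> \<le> card X + card L + card (\<Union>i<q. Z i)"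
      by (meson add_le_mono1 card_Un_le order_trans)
    also have "card (\<Union>i<q. Z i) \<le> (\<Sum>i<q. card (Z i))" by (rule card_UN_le) simp
    also have "\<dots> \<le> of_nat (card {..<q}) * (2 * t)" using Z by (intro sum_bounded_above) auto
    finally have "card (V - (\<Union>i<q. P i)) \<le> card X + card L + 2 * q * t" by simp
    then have "real (card (V - (\<Union>i<q. P i))) \<le> real (card X + card L + 2 * q * t)" by (simp only: of_nat_le_iff)
    then have W: "real (card (V - (\<Union>i<q. P i))) \<le> real Y + 4 * real t * real Y + 2 * real q * real t + \<delta> * n / 4"
      using L cX unfolding of_nat_add of_nat_mult by simp
    have "(1 / real q - \<delta>) * n \<le> real (card (P i))" if i: "i < q" for i
    proof -
      have "(1 / real q - real q * \<epsilon>) * real (card V) -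
          (real Y + 4 * real t * real Y + 2 * real q * real t + \<delta> * n / 4) \<le> real (card (P i))"
        by (rule sep_parts_card_bounds(2)[OF G P _ _ _ W i]) (use q eps deg in auto)
      moreover have "8 * (real Y + 4 * real t * real Y + 2 * real q * real t) \<le> \<delta> * n"
      proof -
        have "n1 \<le> card V" using big by simp
        then have "8 * (real Y + 4 * real t * real Y + 2 * real q * real t) / \<delta> \<le> n"
          unfolding n1_def n_def by linarith
        then show ?thesis using \<delta> by (simp add: divide_le_eq mult.commute)
      qed
      moreover have "real q * \<epsilon> * n \<le> \<delta> * n / 2"
      proof -
        have "1 * (real q * \<epsilon>) \<le> real t * (real q * \<epsilon>)" using t eps by (intro mult_right_mono) auto
        then have "real q * \<epsilon> \<le> \<delta> / 2" using eps2 \<delta> by linarith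
        from mult_right_mono[OF this n0'] show ?thesis by simp
      qed
      moreover have "0 \<le> \<delta> * n" using \<delta> n0' by simp
      moreover have "a - d \<le> p" if "a - e - (K + d / 4) \<le> p" "8 * K \<le> d" "e \<le> d / 2" "0 \<le> d" for a d e K p :: real
        using that by linarith
      ultimately show ?thesis unfolding left_diff_distrib n_def[symmetric] by blast
    qed
    then show ?thesis using P unfolding n_def by blast
  qed
  then show ?thesis using eps by blast
qed

text \<open>\<open>popular_common_cell\<close> is iterated over the \<open>h\<close> sets; each
  round keeps a proportion \<open>\<delta> / 2\<close> of the current \<open>T\<close>, whence the
  power \<open>h\<close>.\<close>

lemma popular_common_cells:
  assumes G: "simple_graph V E" and A: "A \<subseteq> V" "A \<noteq> {}" and P: "\<And>i. i < h \<Longrightarrow> P i \<subseteq> V"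
    and d: "\<And>w i. w \<in> A \<Longrightarrow> i < h \<Longrightarrow> \<delta> * real (card V) \<le> real (card (nbrs E w \<inter> P i))" and d0: "0 < \<delta>"
  obtains T U where "T \<subseteq> A" and "(\<delta> / 2) ^ h * real (card A) \<le> real (card T)"
    and "\<And>i. i < h \<Longrightarrow> U i \<subseteq> P i" and "\<And>i. i < h \<Longrightarrow> \<delta> / 2 * real (card V) \<le> 2 ^ card A * real (card (U i))"
    and "\<And>i w u. i < h \<Longrightarrow> w \<in> T \<Longrightarrow> u \<in> U i \<Longrightarrow> E w u"
proof -
  note f = simple_graphD(1)[OF G]
  have fA: "finite A" using A(1) f by (rule finite_subset)
  have n: "0 < card V" using A f by (auto simp: card_gt_0_iff)
  have "\<exists>T U. T \<subseteq> A \<and> T \<noteq> {} \<and> (\<delta> / 2) ^ k * real (card A) \<le> real (card T) \<and>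
     (\<forall>i<k. U i \<subseteq> P i \<and> \<delta> / 2 * real (card V) \<le> 2 ^ card A * real (card (U i)) \<and> (\<forall>w\<in>T. \<forall>u\<in>U i. E w u))"
    if "k \<le> h" for k
    using that
  proof (induction k)
    case 0
    show ?case using A by (intro exI[of _ A]) auto
  next
    case (Suc k)
    then obtain T U where T: "T \<subseteq> A" "T \<noteq> {}" "(\<delta> / 2) ^ k * real (card A) \<le> real (card T)"
      and U: "\<forall>i<k. U i \<subseteq> P i \<and> \<delta> / 2 * real (card V) \<le> 2 ^ card A * real (card (U i)) \<and> (\<forall>w\<in>T. \<forall>u\<in>U i. E w u)"
      by auto
    have TV: "T \<subseteq> V" using T A by blast
    have k: "k < h" using Suc.prems by simp
    have dT: "\<And>w. w \<in> T \<Longrightarrow> \<delta> * real (card V) \<le> real (card (nbrs E w \<inter> P k))" using d T(1) k by blast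
    obtain T' U' where T': "T' \<subseteq> T" and U': "U' \<subseteq> P k" and T'2: "\<delta> / 2 * real (card T) \<le> real (card T')"
      and U'2: "\<delta> / 2 * real (card V) \<le> 2 ^ card T * real (card U')" and adj: "\<forall>w\<in>T'. \<forall>u\<in>U'. E w u"
      by (rule popular_common_cell[OF G TV P[OF k] dT card_mono[OF f P[OF k]] n d0 T(2)]) blast
    have cT: "0 < real (card T)" using T(2) finite_subset[OF T(1) fA] by (simp add: card_gt_0_iff)
    then have "0 < \<delta> / 2 * real (card T)" using d0 by simp
    then have "T' \<noteq> {}" using T'2 by auto
    moreover have "(\<delta> / 2) ^ Suc k * real (card A) \<le> real (card T')"
    proof -
      have "\<delta> / 2 * ((\<delta> / 2) ^ k * real (card A)) \<le> \<delta> / 2 * real (card T)"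
        using T(3) d0 by (intro mult_left_mono) auto
      also have "\<delta> / 2 * ((\<delta> / 2) ^ k * real (card A)) = (\<delta> / 2) ^ Suc k * real (card A)" by simp
      finally show ?thesis using T'2 by linarith
    qed
    moreover have "\<delta> / 2 * real (card V) \<le> 2 ^ card A * real (card U')"
    proof -
      have "(2::real) ^ card T \<le> 2 ^ card A" using card_mono[OF fA T(1)] by (intro power_increasing) auto
      then have "2 ^ card T * real (card U') \<le> 2 ^ card A * real (card U')" by (intro mult_right_mono) auto
      then show ?thesis using U'2 by linarith
    qed
    ultimately show ?case
      using T' T(1) U U' adj by (intro exI[of _ T'] exI[of _ "U(k := U')"]) (auto simp: less_Suc_eq)
  qed
  from this[OF order_refl] obtain T U where "T \<subseteq> A" "(\<delta> / 2) ^ h * real (card A) \<le> real (card T)"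
     "\<forall>i<h. U i \<subseteq> P i \<and> \<delta> / 2 * real (card V) \<le> 2 ^ card A * real (card (U i)) \<and> (\<forall>w\<in>T. \<forall>u\<in>U i. E w u)"
    by blast
  then show thesis using that[of T U] by blast
qed

text \<open>The absolute bound \<open>K\<close> on the exceptional set and the relative error
  \<delta> are separate arguments, because \<open>K\<close> has to stay fixed while \<delta> is made
  small against it. Nonneighbours are counted only among the classified vertices.\<close>

definition near_turan ::
  "'a set \<Rightarrow> ('a \<Rightarrow> 'a \<Rightarrow> bool) \<Rightarrow> nat \<Rightarrow> (nat \<Rightarrow> 'a set) \<Rightarrow> real \<Rightarrow> real \<Rightarrow> bool" where
  "near_turan V E q R K \<delta> \<longleftrightarrow> sep_parts V E q R \<and> real (card (V - (\<Union>i<q. R i))) \<le> K \<and>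
     (\<forall>i<q. \<bar>real (card (R i)) - real (card V) / real q\<bar> \<le> \<delta> * real (card V)) \<and>
     (\<forall>i<q. \<forall>v\<in>R i. real (card ((\<Union>j<q. R j) - R i - nbrs E v)) \<le> \<delta> * real (card V))"

text \<open>Among \<open>K\<close> vertices rich in every class, \<open>t\<close> would have common
  neighbourhoods of linear size in all classes at once, and large complete parts can be chosen
  greedily inside these.\<close>

lemma few_rich_vertices:
  fixes \<delta>1 :: real
  assumes G: "simple_graph V E" and pf: "pattern_free q t N V E" and q: "1 \<le> q" and t: "1 \<le> t"
    and P: "sep_parts V E q P" and d1: "0 < \<delta>1" and m: "0 \<le> m"
    and miss: "\<And>i j v. i < q \<Longrightarrow> j < q \<Longrightarrow> i \<noteq> j \<Longrightarrow> v \<in> P i \<Longrightarrow> real (card (P j - nbrs E v)) \<le> m"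
    and K: "real t \<le> (\<delta>1 / 2) ^ q * real K" and K0: "0 < K"
    and big: "2 ^ K * (real N + real q * real N * m) \<le> \<delta>1 / 2 * real (card V)"
  shows "card {v \<in> V. \<forall>i<q. \<delta>1 * real (card V) \<le> real (card (nbrs E v \<inter> P i))} < K"
proof (rule ccontr)
  note f = simple_graphD(1)[OF G]
  assume "\<not> ?thesis"
  then have "K \<le> card {v \<in> V. \<forall>i<q. \<delta>1 * real (card V) \<le> real (card (nbrs E v \<inter> P i))}" by simp
  then obtain A where A: "A \<subseteq> {v \<in> V. \<forall>i<q. \<delta>1 * real (card V) \<le> real (card (nbrs E v \<inter> P i))}" "card A = K"
    by (meson obtain_subset_with_card_n)
  have AV: "A \<subseteq> V" "A \<noteq> {}" using A K0 by auto
  have PV: "\<And>i. i < q \<Longrightarrow> P i \<subseteq> V" using sep_partsD(1)[OF P] .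
  have dA: "\<And>w i. w \<in> A \<Longrightarrow> i < q \<Longrightarrow> \<delta>1 * real (card V) \<le> real (card (nbrs E w \<inter> P i))"
    using A by auto
  obtain T U where T: "T \<subseteq> A" "(\<delta>1 / 2) ^ q * real (card A) \<le> real (card T)"
    and U: "\<And>i. i < q \<Longrightarrow> U i \<subseteq> P i" "\<And>i. i < q \<Longrightarrow> \<delta>1 / 2 * real (card V) \<le> 2 ^ card A * real (card (U i))"
    and adj: "\<And>i w u. i < q \<Longrightarrow> w \<in> T \<Longrightarrow> u \<in> U i \<Longrightarrow> E w u"
    by (rule popular_common_cells[OF G AV PV dA d1]) auto
  have fP: "finite (P i)" if "i < q" for i using PV[OF that] f by (rule finite_subset)
  obtain B where B: "complete_parts V E q N B" "\<And>i. i < q \<Longrightarrow> B i \<subseteq> U i"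
  proof (rule greedy_complete_parts[OF G, of q U m N])
    show "U i \<subseteq> V" if "i < q" for i using U(1) PV that by blast
    show "real (card (U j - nbrs E v)) \<le> m" if "i < q" "j < q" "i \<noteq> j" "v \<in> U i" for i j v
    proof -
      have "card (U j - nbrs E v) \<le> card (P j - nbrs E v)"
        using U(1)[of j] that fP[of j] by (intro card_mono) auto
      then show ?thesis using miss[of i j v] that U(1)[of i] by force
    qed
    show "real N + real q * real N * m \<le> real (card (U i))" if "i < q" for i
    proof -
      have "2 ^ K * (real N + real q * real N * m) \<le> 2 ^ K * real (card (U i))"
        using order_trans[OF big U(2)[OF that]] unfolding A(2) .
      then show ?thesis by (rule mult_left_le_imp_le) simp
    qed
  qed (use m in auto)
  have TV: "T \<subseteq> V" using T(1) AV by blast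
  have "real t \<le> real (card T)" using T(2) K A(2) by simp
  then have tT: "t \<le> card T" by simp
  show False
    using pattern_free_universal[OF pf q B(1) TV finite_subset[OF TV f] tT] adj B(2) by blast
qed

text \<open>The endpoints of the matching keep a large common neighbourhood in every class except
  \<open>i\<close>, where the pattern with \<open>c = 0\<close> asks for none.\<close>

lemma poor_class_no_matching:
  assumes G: "simple_graph V E" and pf: "pattern_free q t N V E"
    and P: "sep_parts V E q P" and m: "0 \<le> m" "0 \<le> m'"
    and miss: "\<And>i j v. i < q \<Longrightarrow> j < q \<Longrightarrow> i \<noteq> j \<Longrightarrow> v \<in> P i \<Longrightarrow> real (card (P j - nbrs E v)) \<le> m"
    and Q: "Q \<subseteq> V" "i < q" and missQ: "\<And>j v. j < q \<Longrightarrow> j \<noteq> i \<Longrightarrow> v \<in> Q \<Longrightarrow> real (card (P j - nbrs E v)) \<le> m'"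
    and big: "\<And>j. j < q \<Longrightarrow> real N + real q * real N * m + real (2 * t) * m' \<le> real (card (P j))"
    and M: "matching E Q {..<t} a b"
  shows False
proof -
  note f = simple_graphD(1)[OF G]
  let ?S = "a ` {..<t} \<union> b ` {..<t}"
  have SQ: "?S \<subseteq> Q" using M by (auto simp: matching_def)
  have PV: "P i \<subseteq> V" if "i < q" for i using sep_partsD(1)[OF P that] .
  have fP: "finite (P i)" if "i < q" for i using PV[OF that] f by (rule finite_subset)
  define U where "U j = (if j = i then P i else {u \<in> P j. \<forall>v\<in>?S. E v u})" for j
  have UP: "U j \<subseteq> P j" for j by (auto simp: U_def)
  obtain B where B: "complete_parts V E q N B" "\<And>i. i < q \<Longrightarrow> B i \<subseteq> U i"
  proof (rule greedy_complete_parts[OF G, of q U m N])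
    show "U i \<subseteq> V" if "i < q" for i using UP PV[OF that] by blast
    show "real (card (U j - nbrs E v)) \<le> m" if "i < q" "j < q" "i \<noteq> j" "v \<in> U i" for i j v
    proof -
      have "card (U j - nbrs E v) \<le> card (P j - nbrs E v)"
        using UP[of j] that fP[of j] by (intro card_mono) auto
      then show ?thesis using miss[of i j v] that UP[of i] by force
    qed
    show "real N + real q * real N * m \<le> real (card (U j))" if j: "j < q" for j
    proof (cases "j = i")
      case True
      have "0 \<le> real (2 * t) * m'" using m by simp
      then have "real N + real q * real N * m \<le> real (card (P j))" using big[OF j] by linarith
      then show ?thesis using True by (simp add: U_def)
    next
      case False
      have "real (card (P j)) - real (2 * t) * m' \<le> real (card {u \<in> P j. \<forall>v\<in>?S. E v u})"
        using fP[OF j] missQ[OF j False] SQ m by (intro common_neighbours_card card_matching_verts) auto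
      then show ?thesis using big[OF j] False by (simp add: U_def)
    qed
  qed (use m in auto)
  show False
  proof (rule pattern_free_matching[OF pf B(1) Q(2,1) M])
    fix j u v assume "j < q" "j \<noteq> i" "u \<in> ?S" "v \<in> B j"
    then show "E u v" using B(2)[of j] by (auto simp: U_def)
  qed
qed

text \<open>\<open>K\<close> is quantified before \<delta>. Exceptional vertices are of two kinds:
  those rich in every class, and the at most \<open>2 * t\<close> vertices per class that cover its
  inner edges. Neither count depends on \<delta>, because the auxiliary classes \<open>P\<close> are
  taken with a fixed precision \<open>\<delta>2\<close>.\<close>

theorem near_turan_structure:
  fixes q t N :: nat
  assumes q: "2 \<le> q" and t: "1 \<le> t" and N: "1 \<le> N"
  shows "\<exists>K::nat. \<forall>\<delta>>0. \<exists>\<epsilon>>0. \<exists>n0. \<forall>V::'a set. \<forall>E. simple_graph V E \<longrightarrow> pattern_free q t N V E \<longrightarrow>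
    n0 \<le> card V \<longrightarrow> (\<forall>u\<in>V. (1 - 1 / real q - \<epsilon>) * real (card V) \<le> real (card (nbrs E u))) \<longrightarrow>
    (\<exists>R. near_turan V E q R (real K) \<delta>)"
proof -
  \<comment> \<open>Chosen so that \<open>2 * t\<close> endpoints missing
    \<open>2 * \<delta>1 * n\<close> vertices each use up \<open>n / (4 * q)\<close>, a quarter of a
    class.\<close>
  define \<delta>1 where "\<delta>1 = 1 / (16 * real q * real t)"
  have d1: "0 < \<delta>1" using q t by (simp add: \<delta>1_def)
  define K1 where "K1 = nat \<lceil>real t / (\<delta>1 / 2) ^ q\<rceil> + 1"
  have "real t / (\<delta>1 / 2) ^ q \<le> real K1" unfolding K1_def by linarith
  then have K1: "real t \<le> (\<delta>1 / 2) ^ q * real K1" "0 < K1" using d1 by (auto simp: divide_le_eq mult.commute K1_def)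
  \<comment> \<open>Sets of \<open>c * n\<close> vertices suffice for the greedy choice of parts;
    \<open>c * n\<close> is at most half a class and also at most the size that
    \<open>2 ^ K1\<close> trace types leave.\<close>
  define c where "c = min (1 / (2 * real q)) (\<delta>1 / 2 / 2 ^ K1)"
  have c0: "0 < c" using q d1 by (simp add: c_def)
  have c1: "c \<le> 1 / (2 * real q)" and "c \<le> \<delta>1 / 2 / 2 ^ K1" by (auto simp: c_def)
  then have c2: "2 ^ K1 * c \<le> \<delta>1 / 2" by (simp add: pos_le_divide_eq mult.commute)
  define \<delta>2 where "\<delta>2 = min (min (\<delta>1 / 2) (1 / (4 * real q))) (c / (4 * real q * real N))"
  have d2: "0 < \<delta>2" using q d1 c0 N by (simp add: \<delta>2_def)
  have d2a: "\<delta>2 \<le> \<delta>1 / 2" and d2b: "\<delta>2 \<le> 1 / (4 * real q)" and "\<delta>2 \<le> c / (4 * real q * real N)" by (auto simp: \<delta>2_def)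
  then have d2c: "real q * real N * (2 * \<delta>2) \<le> c / 2" using q N by (simp add: field_simps)
  obtain \<epsilon>A nA where eA: "0 < \<epsilon>A" and nA: "\<And>(V::'a set) E. simple_graph V E \<Longrightarrow> pattern_free q t N V E \<Longrightarrow> nA \<le> card V \<Longrightarrow>
    (\<forall>u\<in>V. (1 - 1 / real q - \<epsilon>A) * real (card V) \<le> real (card (nbrs E u))) \<Longrightarrow>
    (\<exists>P. sep_parts V E q P \<and> (\<forall>i<q. (1 / real q - \<delta>2) * real (card V) \<le> real (card (P i))))"
    using stability_parts[OF q t N d2] by blast
  define K where "K = K1 + 2 * q * t"
  have "\<exists>\<epsilon>>0. \<exists>n0. \<forall>V::'a set. \<forall>E. simple_graph V E \<longrightarrow> pattern_free q t N V E \<longrightarrow>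
    n0 \<le> card V \<longrightarrow> (\<forall>u\<in>V. (1 - 1 / real q - \<epsilon>) * real (card V) \<le> real (card (nbrs E u))) \<longrightarrow>
    (\<exists>R. near_turan V E q R (real K) \<delta>)" if \<delta>: "0 < \<delta>" for \<delta> :: real
  proof -
    define \<epsilon> where "\<epsilon> = min (min \<epsilon>A \<delta>2) (\<delta> / (4 * real q))"
    have eps: "0 < \<epsilon>" using eA d2 \<delta> q by (simp add: \<epsilon>_def)
    have eps1: "\<epsilon> \<le> \<epsilon>A" "\<epsilon> \<le> \<delta>2" and "\<epsilon> \<le> \<delta> / (4 * real q)" by (auto simp: \<epsilon>_def)
    then have eps2: "real q * \<epsilon> \<le> \<delta> / 4" using q by (simp add: field_simps)
    have "1 * \<epsilon> \<le> real q * \<epsilon>" using q eps by (intro mult_right_mono) auto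
    then have eps3: "\<epsilon> \<le> \<delta> / 4" using eps2 by simp
    define n0 where "n0 = max nA (max (nat \<lceil>2 * real N / c\<rceil>) (nat \<lceil>2 * real K / \<delta>\<rceil>))"
    have "\<exists>R. near_turan V E q R (real K) \<delta>"
      if G: "simple_graph V E" and pf: "pattern_free q t N V E" and big: "n0 \<le> card V"
        and deg: "\<forall>u\<in>V. (1 - 1 / real q - \<epsilon>) * real (card V) \<le> real (card (nbrs E u))"
      for V :: "'a set" and E
    proof -
      note f = simple_graphD(1)[OF G]
      define n where "n = real (card V)"
      have n0': "0 \<le> n" by (simp add: n_def)
      have "2 * real N / c \<le> n" "2 * real K / \<delta> \<le> n" using big unfolding n0_def n_def by linarith+
      then have nN: "2 * real N \<le> c * n" and nK: "2 * real K \<le> \<delta> * n"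
        using c0 \<delta> by (simp_all add: divide_le_eq mult.commute)
      have "\<forall>u\<in>V. (1 - 1 / real q - \<epsilon>A) * real (card V) \<le> real (card (nbrs E u))"
      proof
        fix u assume "u \<in> V"
        have "(1 - 1 / real q - \<epsilon>A) * real (card V) \<le> (1 - 1 / real q - \<epsilon>) * real (card V)"
          using eps1 by (intro mult_right_mono) auto
        then show "(1 - 1 / real q - \<epsilon>A) * real (card V) \<le> real (card (nbrs E u))"
          using deg \<open>u \<in> V\<close> by (meson order_trans)
      qed
      then obtain P where P: "sep_parts V E q P" and cP: "\<And>i. i < q \<Longrightarrow> (1 / real q - \<delta>2) * n \<le> real (card (P i))"
        using nA[OF G pf] big unfolding n_def n0_def by (metis max.boundedE)
      have PV: "P i \<subseteq> V" if "i < q" for i using sep_partsD(1)[OF P that] .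
      have missgen: "real (card (P j - nbrs E v)) \<le> (\<delta>2 + \<epsilon>) * n + a"
        if "i < q" "j < q" "i \<noteq> j" "v \<in> V" "real (card (nbrs E v \<inter> P i)) \<le> a" for i j v a
      proof -
        have "P j - nbrs E v \<subseteq> V - P i - nbrs E v" using PV[of j] sep_partsD(3)[OF P, of i j] that by auto
        then have "card (P j - nbrs E v) \<le> card (V - P i - nbrs E v)" using f by (intro card_mono) auto
        moreover have "real (card (V - P i - nbrs E v)) \<le> real (card V) - real (card (P i)) + a - (1 - 1 / real q - \<epsilon>) * n"
          using nonneighbours_outside_part[OF G PV[OF that(1)] that(4,5)] deg that(4) by (simp add: n_def)
        ultimately have "real (card (P j - nbrs E v)) \<le> n - (1 / real q - \<delta>2) * n + a - (1 - 1 / real q - \<epsilon>) * n"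
          using cP[OF that(1)] by (simp add: n_def)
        also have "\<dots> = (\<delta>2 + \<epsilon>) * n + a" by (simp add: algebra_simps)
        finally show ?thesis .
      qed
      have e2: "(\<delta>2 + \<epsilon>) * n \<le> 2 * \<delta>2 * n" using eps1 n0' by (intro mult_right_mono) auto
      have miss: "real (card (P j - nbrs E v)) \<le> 2 * \<delta>2 * n"
        if "i < q" "j < q" "i \<noteq> j" "v \<in> P i" for i j v
      proof -
        have "nbrs E v \<inter> P i = {}" using sep_partsD(2)[OF P that(1)] that(4) by (auto simp: nbrs_def stable_set_def)
        then show ?thesis using missgen[OF that(1-3), of v 0] PV[OF that(1)] that(4) e2 by auto
      qed
      define W1 where "W1 = {v \<in> V. \<forall>i<q. \<delta>1 * real (card V) \<le> real (card (nbrs E v \<inter> P i))}"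
      have cell: "real N + real q * real N * (2 * \<delta>2 * n) \<le> c * n"
        using mult_right_mono[OF d2c n0'] nN by (simp add: algebra_simps)
      have cW1: "card W1 < K1"
        unfolding W1_def
      proof (rule few_rich_vertices[OF G pf _ t P d1 _ miss K1])
        have "2 ^ K1 * (real N + real q * real N * (2 * \<delta>2 * n)) \<le> 2 ^ K1 * (c * n)"
          using cell by (intro mult_left_mono) auto
        also have "\<dots> \<le> \<delta>1 / 2 * n" using mult_right_mono[OF c2 n0'] by (simp add: mult_ac)
        finally show "2 ^ K1 * (real N + real q * real N * (2 * \<delta>2 * n)) \<le> \<delta>1 / 2 * real (card V)"
          by (simp add: n_def)
      qed (use q d2 n0' in auto)
      have "\<exists>i<q. real (card (nbrs E v \<inter> P i)) \<le> \<delta>1 * n" if "v \<in> V - W1" for v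
        using that by (auto simp: W1_def n_def not_le intro: less_imp_le)
      then obtain cl where cl: "\<And>v. v \<in> V - W1 \<Longrightarrow> cl v < q \<and> real (card (nbrs E v \<inter> P (cl v))) \<le> \<delta>1 * n"
        by metis
      \<comment> \<open>Every vertex outside \<open>W1\<close>, also one left over by
        \<open>P\<close>, is sorted anew by a class in which it has few neighbours.\<close>
      define Q where "Q i = {v \<in> V - W1. cl v = i}" for i
      have QV: "Q i \<subseteq> V" for i by (auto simp: Q_def)
      have missQ: "real (card (P j - nbrs E v)) \<le> 2 * \<delta>1 * n" if "i < q" "j < q" "j \<noteq> i" "v \<in> Q i" for i j v
      proof -
        have "real (card (P j - nbrs E v)) \<le> (\<delta>2 + \<epsilon>) * n + \<delta>1 * n"
          using missgen[OF that(1,2), of v "\<delta>1 * n"] that cl[of v] by (auto simp: Q_def)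
        also have "\<dots> = (\<delta>2 + \<epsilon> + \<delta>1) * n" by (simp add: algebra_simps)
        also have "\<dots> \<le> 2 * \<delta>1 * n" using eps1 d2a n0' by (intro mult_right_mono) auto
        finally show ?thesis .
      qed
      have bigP: "real N + real q * real N * (2 * \<delta>2 * n) + real (2 * t) * (2 * \<delta>1 * n) \<le> real (card (P j))" if "j < q" for j
      proof -
        have "real (2 * t) * (2 * \<delta>1) = 1 / (4 * real q)" using q t by (simp add: \<delta>1_def)
        then have "c + real (2 * t) * (2 * \<delta>1) \<le> 1 / real q - \<delta>2" using c1 d2b by simp
        then have "(c + real (2 * t) * (2 * \<delta>1)) * n \<le> (1 / real q - \<delta>2) * n" using n0' by (rule mult_right_mono)
        then show ?thesis using cP[OF that] cell by (simp add: algebra_simps)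
      qed
      have noM: "\<not> matching E (Q i) {..<t} a b" if i: "i < q" for i a b
        using poor_class_no_matching[OF G pf P _ _ miss QV i missQ[OF i] bigP] d2 d1 n0' by fastforce
      have "\<exists>Z\<subseteq>Q i. card Z \<le> 2 * t \<and> (\<forall>u\<in>Q i - Z. \<forall>v\<in>Q i - Z. \<not> E u v)" if i: "i < q" for i
        using matching_or_cover[OF G QV[of i], of t] noM[OF i] by blast
      then obtain Z where Z: "\<And>i. i < q \<Longrightarrow> Z i \<subseteq> Q i \<and> card (Z i) \<le> 2 * t \<and> stable_set E (Q i - Z i)"
        unfolding stable_set_def by metis
      define R where "R i = Q i - Z i" for i
      have R: "sep_parts V E q R"
        unfolding sep_parts_def R_def using Z QV by (auto simp: Q_def)
      have RV: "R i \<subseteq> V" if "i < q" for i using sep_partsD(1)[OF R that] .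
      have cW: "real (card (V - (\<Union>i<q. R i))) \<le> real K"
      proof -
        have "V - (\<Union>i<q. R i) \<subseteq> W1 \<union> (\<Union>i<q. Z i)" using cl by (auto simp: R_def Q_def)
        moreover have "finite W1" "finite (\<Union>i<q. Z i)"
        proof -
          have "Z i \<subseteq> V" if "i < q" for i using Z[OF that] QV by blast
          then show "finite (\<Union>i<q. Z i)" using f by (auto intro: finite_subset)
        qed (use f in \<open>auto simp: W1_def\<close>)
        ultimately have "card (V - (\<Union>i<q. R i)) \<le> card (W1 \<union> (\<Union>i<q. Z i))" by (intro card_mono) auto
        also have "\<dots> \<le> card W1 + card (\<Union>i<q. Z i)" by (rule card_Un_le)
        also have "card (\<Union>i<q. Z i) \<le> (\<Sum>i<q. card (Z i))" by (rule card_UN_le) simp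
        also have "\<dots> \<le> of_nat (card {..<q}) * (2 * t)" using Z by (intro sum_bounded_above) auto
        finally have "card (V - (\<Union>i<q. R i)) \<le> K" using cW1 by (simp add: K_def mult_ac)
        then show ?thesis by simp
      qed
      have up: "real (card (R i)) \<le> (1 / real q + \<epsilon>) * n" and
           lo: "(1 / real q - real q * \<epsilon>) * n - real K \<le> real (card (R i))" if i: "i < q" for i
        unfolding n_def using sep_parts_card_bounds[OF G R _ _ _ cW i, of \<epsilon>] q eps deg by auto
      have "\<bar>real (card (R i)) - real (card V) / real q\<bar> \<le> \<delta> * real (card V)" if i: "i < q" for i
      proof -
        note mult_right_mono[OF eps2 n0'] mult_right_mono[OF eps3 n0']
        moreover have "0 \<le> \<delta> * n" using \<delta> n0' by simp
        moreover have "1 / real q * n = n / real q" by simp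
        ultimately show ?thesis
          using up[OF i] lo[OF i] nK unfolding n_def[symmetric] abs_le_iff left_diff_distrib distrib_right by (intro conjI) linarith+
      qed
      moreover have "real (card ((\<Union>j<q. R j) - R i - nbrs E v)) \<le> \<delta> * real (card V)" if i: "i < q" and v: "v \<in> R i" for i v
      proof -
        have "(\<Union>j<q. R j) - R i - nbrs E v \<subseteq> V - R i - nbrs E v" using RV by auto
        then have "card ((\<Union>j<q. R j) - R i - nbrs E v) \<le> card (V - R i - nbrs E v)" using f by (intro card_mono) auto
        moreover have "nbrs E v \<inter> R i = {}" using sep_partsD(2)[OF R i] v by (auto simp: nbrs_def stable_set_def)
        moreover have "v \<in> V" using RV[OF i] v by blast
        ultimately have "real (card ((\<Union>j<q. R j) - R i - nbrs E v)) \<le> n - real (card (R i)) - (1 - 1 / real q - \<epsilon>) * n"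
          using nonneighbours_outside_part[OF G RV[OF i], of v 0 "(1 - 1 / real q - \<epsilon>) * n"] deg by (auto simp: n_def)
        also have "\<dots> \<le> n - ((1 / real q - real q * \<epsilon>) * n - real K) - (1 - 1 / real q - \<epsilon>) * n"
          using lo[OF i] by linarith
        also have "\<dots> = real q * \<epsilon> * n + \<epsilon> * n + real K" by (simp add: algebra_simps)
        also have "\<dots> \<le> \<delta> * n"
        proof -
          note mult_right_mono[OF eps2 n0'] mult_right_mono[OF eps3 n0']
          then show ?thesis using nK by linarith
        qed
        finally show ?thesis by (simp add: n_def)
      qed
      ultimately have "near_turan V E q R (real K) \<delta>" unfolding near_turan_def using R cW by blast
      then show ?thesis by blast
    qed
    then show ?thesis using eps by blast
  qed
  then show ?thesis by blast
qed

subsection \<open>Extremal graphs for a critical pattern\<close>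

text \<open>Labels below \<open>q\<close> will name the classes, and a label from \<open>q\<close>
  on that occurs only once makes its vertex universal. So a clique joined to a complete
  \<open>q\<close>-partite graph is again of this form, and one \<lambda> calculation covers
  both.\<close>

definition multipartite :: "'a set \<Rightarrow> ('a \<Rightarrow> 'b) \<Rightarrow> 'a \<Rightarrow> 'a \<Rightarrow> bool" where
  "multipartite V g u v \<longleftrightarrow> u \<in> V \<and> v \<in> V \<and> g u \<noteq> g v"

lemma simple_graph_multipartite: "finite V \<Longrightarrow> simple_graph V (multipartite V g)"
  by (auto simp: simple_graph_def multipartite_def)

definition embeds :: "nat \<Rightarrow> (nat \<Rightarrow> nat \<Rightarrow> bool) \<Rightarrow> 'a set \<Rightarrow> ('a \<Rightarrow> 'a \<Rightarrow> bool) \<Rightarrow> bool" where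
  "embeds k A V E \<longleftrightarrow> (\<exists>\<phi>. inj_on \<phi> {..<k} \<and> \<phi> ` {..<k} \<subseteq> V \<and> (\<forall>i<k. \<forall>j<k. A i j \<longrightarrow> E (\<phi> i) (\<phi> j)))"

text \<open>The two assumptions work in opposite directions: \<open>pattern_embeds\<close> converts
  freeness into restrictions on the extremal graph, and \<open>not_colourable\<close> certifies that
  multipartite competitors are free.\<close>

locale critical_graph =
  fixes k q t N :: nat and A :: "nat \<Rightarrow> nat \<Rightarrow> bool"
  assumes q: "2 \<le> q" and t: "1 \<le> t" and N: "1 \<le> N"
    and pattern_embeds: "\<And>(V::nat set) E c i0 B w b. simple_graph V E \<Longrightarrow> pattern q t N V E c i0 B w b \<Longrightarrow> embeds k A V E"
    and not_colourable: "\<And>I col. I \<subseteq> {..<k} \<Longrightarrow> card I \<le> t - 1 \<Longrightarrow> (\<And>i. i \<in> {..<k} - I \<Longrightarrow> col i < q) \<Longrightarrow>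
       \<exists>i\<in>{..<k} - I. \<exists>j\<in>{..<k} - I. A i j \<and> (col i :: nat) = col j"
begin

definition extremal :: "nat set \<Rightarrow> (nat \<Rightarrow> nat \<Rightarrow> bool) \<Rightarrow> bool" where
  "extremal V E \<longleftrightarrow> simple_graph V E \<and> \<not> embeds k A V E \<and>
     (\<forall>E'. simple_graph V E' \<longrightarrow> \<not> embeds k A V E' \<longrightarrow> lam V E' \<le> lam V E)"

lemma extremalD:
  assumes "extremal V E"
  shows "simple_graph V E" and "\<not> embeds k A V E"
    and "simple_graph V E' \<Longrightarrow> \<not> embeds k A V E' \<Longrightarrow> lam V E' \<le> lam V E"
  using assms by (auto simp: extremal_def)

lemma extremal_pattern_free: "extremal V E \<Longrightarrow> pattern_free q t N V E"
  using extremalD(1,2) pattern_embeds unfolding pattern_free_def by blast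

text \<open>The labels along a copy of the forbidden graph would be a proper
  \<open>q\<close>-colouring after deletion of the at most \<open>t - 1\<close> vertices with labels
  from \<open>q\<close> on.\<close>

lemma multipartite_free:
  assumes f: "finite V" and C: "card {v \<in> V. q \<le> g v} \<le> t - 1"
  shows "\<not> embeds k A V (multipartite V g)"
proof
  assume "embeds k A V (multipartite V g)"
  then obtain \<phi> where inj: "inj_on \<phi> {..<k}" and im: "\<phi> ` {..<k} \<subseteq> V"
    and adj: "\<And>i j. i < k \<Longrightarrow> j < k \<Longrightarrow> A i j \<Longrightarrow> multipartite V g (\<phi> i) (\<phi> j)"
    by (auto simp: embeds_def)
  define I where "I = {i \<in> {..<k}. q \<le> g (\<phi> i)}"
  have I: "I \<subseteq> {..<k}" by (auto simp: I_def)
  have "card I = card (\<phi> ` I)" using inj_on_subset[OF inj I] by (simp add: card_image)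
  also have "\<dots> \<le> card {v \<in> V. q \<le> g v}" using f im by (intro card_mono) (auto simp: I_def)
  finally have cI: "card I \<le> t - 1" using C by simp
  have lt: "g (\<phi> i) < q" if "i \<in> {..<k} - I" for i using that by (auto simp: I_def)
  have "\<exists>i\<in>{..<k} - I. \<exists>j\<in>{..<k} - I. A i j \<and> g (\<phi> i) = g (\<phi> j)"
    by (rule not_colourable[OF I cI]) (rule lt)
  then obtain i j where ij: "i \<in> {..<k} - I" "j \<in> {..<k} - I" "A i j" "g (\<phi> i) = g (\<phi> j)"
    by (elim bexE conjE)
  then show False using adj[of i j] by (simp add: multipartite_def)
qed

text \<open>The competitor is the balanced complete \<open>q\<close>-partite graph without universal
  vertices; the summand 1 absorbs the rounding of the class sizes.\<close>

lemma extremal_lower_bound: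
  assumes ex: "extremal V E" and V: "V \<noteq> {}"
  shows "(1 - 1 / real q) * real (card V) - 1 \<le> lam V E"
proof -
  have f: "finite V" using extremalD(1)[OF ex] by (rule simple_graphD(1))
  obtain h where h: "bij_betw h V {..<card V}" using f by (metis ex_bij_betw_finite_nat lessThan_atLeast0)
  define g where "g v = h v mod q" for v
  have gq: "g v < q" for v using q by (simp add: g_def)
  have s: "simple_graph V (multipartite V g)" using f by (rule simple_graph_multipartite)
  have "{v \<in> V. q \<le> g v} = {}" using gq by (auto simp: not_le)
  then have c0: "card {v \<in> V. q \<le> g v} \<le> t - 1" by (metis card.empty le0)
  have nf: "\<not> embeds k A V (multipartite V g)" by (rule multipartite_free[OF f c0])
  have "(1 - 1 / real q) * real (card V) - 1 \<le> lam V (multipartite V g)"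
  proof (rule lam_ge_min_degree[OF s V])
    fix u assume u: "u \<in> V"
    have nb: "nbrs (multipartite V g) u = V - {v \<in> V. g v = g u}" using u by (auto simp: nbrs_def multipartite_def)
    have im: "h ` {v \<in> V. g v = g u} \<subseteq> {a. a < card V \<and> a mod q = g u}" using h by (auto simp: g_def bij_betw_def)
    have inj: "inj_on h {v \<in> V. g v = g u}" using h by (auto simp: bij_betw_def inj_on_def)
    have "card {v \<in> V. g v = g u} \<le> card {a. a < card V \<and> a mod q = g u}"
      by (rule card_inj_on_le[OF inj im]) simp
    also have "\<dots> \<le> card V div q + 1" unfolding turan_parts_balanced[OF gq] by simp
    finally have "card {v \<in> V. g v = g u} \<le> card V div q + 1" .
    moreover have "real (card V div q) \<le> real (card V) / real q"
    proof -
      have "real (card V div q * q) \<le> real (card V)" by (simp only: of_nat_le_iff div_times_less_eq_dividend)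
      then show ?thesis using q by (simp add: pos_le_divide_eq)
    qed
    ultimately have c: "real (card {v \<in> V. g v = g u}) \<le> real (card V) / real q + 1" by linarith
    have "card {v \<in> V. g v = g u} \<le> card V" using f by (intro card_mono) auto
    moreover have "card (V - {v \<in> V. g v = g u}) = card V - card {v \<in> V. g v = g u}"
      using f by (intro card_Diff_subset) auto
    ultimately have "real (card (nbrs (multipartite V g) u)) = real (card V) - real (card {v \<in> V. g v = g u})"
      unfolding nb by (simp add: of_nat_diff)
    then show "(1 - 1 / real q) * real (card V) - 1 \<le> real (card (nbrs (multipartite V g) u))"
      using c by (simp add: left_diff_distrib)
  qed
  also have "\<dots> \<le> lam V E" by (rule extremalD(3)[OF ex s nf])
  finally show ?thesis .
qed

text \<open>Turns the potential inequality of \<open>deletion_process\<close> into the statement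
  that the final set grows beyond every bound with \<open>n\<close>.\<close>

lemma powr_large:
  fixes \<theta> c M :: real
  assumes "0 < \<theta>" "0 < c" "0 \<le> M"
  shows "\<exists>n0::nat. \<forall>n\<ge>n0. \<forall>m. 0 \<le> m \<longrightarrow> \<theta> * real n powr c \<le> m powr c \<longrightarrow> M < m"
proof -
  define n0 where "n0 = nat \<lceil>M * (1 / \<theta>) powr (1 / c)\<rceil> + 1"
  have "M < m" if n: "n0 \<le> n" and m: "0 \<le> m" "\<theta> * real n powr c \<le> m powr c" for n :: nat and m
  proof (rule ccontr)
    assume "\<not> M < m"
    then have "m powr c \<le> M powr c" using m assms by (intro powr_mono2) auto
    moreover have "M * (1 / \<theta>) powr (1 / c) < real n" using n unfolding n0_def by linarith
    then have "(M * (1 / \<theta>) powr (1 / c)) powr c < real n powr c" using assms by (intro powr_less_mono2) auto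
    moreover have "(M * (1 / \<theta>) powr (1 / c)) powr c = M powr c * (1 / \<theta>)"
      using assms by (simp add: powr_mult powr_powr)
    ultimately have "m powr c < \<theta> * real n powr c" using assms by (simp add: field_simps)
    then show False using m(2) by simp
  qed
  then show ?thesis by blast
qed

text \<open>Above the threshold there are \<open>q + 1\<close> complete parts, and \<open>t\<close>
  vertices of the last one are universal to the other \<open>q\<close>.\<close>

lemma min_degree_not_pattern_free:
  assumes "0 < \<epsilon>"
  shows "\<exists>n0. \<forall>V::nat set. \<forall>E. simple_graph V E \<longrightarrow> n0 \<le> card V \<longrightarrow>
    (\<forall>u\<in>V. (1 - 1 / real q + \<epsilon>) * real (card V) \<le> real (card (nbrs E u))) \<longrightarrow> \<not> pattern_free q t N V E"
proof -
  have q1: "1 \<le> q" using q by simp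
  obtain n0 where n0: "\<And>(V::nat set) E. simple_graph V E \<Longrightarrow> n0 \<le> card V \<Longrightarrow>
    (\<forall>u\<in>V. (1 - 1 / real q + \<epsilon>) * real (card V) \<le> real (card (nbrs E u))) \<Longrightarrow>
    (\<exists>B. complete_parts V E (Suc q) (N + t) B)"
    using erdos_stone_min_degree[OF q1 assms, where N = "N + t"] by blast
  have "\<not> pattern_free q t N V E" if G: "simple_graph V E" and big: "n0 \<le> card V" and
    deg: "\<forall>u\<in>V. (1 - 1 / real q + \<epsilon>) * real (card V) \<le> real (card (nbrs E u))" for V :: "nat set" and E
  proof
    assume pf: "pattern_free q t N V E"
    obtain B where B: "complete_parts V E (Suc q) (N + t) B" using n0[OF G big deg] by blast
    have "\<exists>X. X \<subseteq> B i \<and> card X = N" if "i < q" for i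
    proof -
      have "N \<le> card (B i)" using B that by (simp add: complete_parts_def)
      then show ?thesis by (meson obtain_subset_with_card_n)
    qed
    then obtain B' where B': "\<And>i. i < q \<Longrightarrow> B' i \<subseteq> B i \<and> card (B' i) = N" by metis
    have B0: "complete_parts V E q (N + t) B" using B less_SucI unfolding complete_parts_def by blast
    have c: "complete_parts V E q N B'" using complete_parts_subset[OF B0, of B' N] B' by blast
    have T: "B q \<subseteq> V" "t \<le> card (B q)" using B by (auto simp: complete_parts_def)
    have adj: "E u v" if "i < q" "u \<in> B q" "v \<in> B' i" for i u v
      using B B' that unfolding complete_parts_def by (metis lessI less_SucI less_irrefl subsetD)
    show False
      by (rule pattern_free_universal[OF pf q1 c T(1) finite_subset[OF T(1) simple_graphD(1)[OF G]] T(2) adj])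
  qed
  then show ?thesis by blast
qed

text \<open>If \<lambda> is too large, the deletion process ends in a large induced subgraph whose
  minimum degree exceeds the Erdos-Stone threshold, and pattern-freeness is hereditary.\<close>

lemma spectral_erdos_stone:
  fixes \<epsilon> :: real
  assumes eps: "0 < \<epsilon>"
  shows "\<exists>n0. \<forall>V::nat set. \<forall>E. simple_graph V E \<longrightarrow> pattern_free q t N V E \<longrightarrow> n0 \<le> card V \<longrightarrow>
    lam V E \<le> (1 - 1 / real q + \<epsilon>) * real (card V)"
proof -
  define \<theta> where "\<theta> = 1 - 1 / real q + \<epsilon>"
  define c where "c = \<epsilon> / 2 * \<theta> / 2"
  have q1: "1 / real q \<le> 1" using q by simp
  have th: "0 < \<theta>" "\<epsilon> / 2 \<le> \<theta>" using eps q1 by (auto simp: \<theta>_def intro: add_nonneg_pos)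
  have c0: "0 < c" "0 < c / 4" using eps th by (auto simp: c_def)
  have e2: "0 < \<epsilon> / 2" using eps by simp
  obtain n1 where n1: "\<And>(V::nat set) E. simple_graph V E \<Longrightarrow> n1 \<le> card V \<Longrightarrow>
    (\<forall>u\<in>V. (1 - 1 / real q + \<epsilon> / 2) * real (card V) \<le> real (card (nbrs E u))) \<Longrightarrow> \<not> pattern_free q t N V E"
    using min_degree_not_pattern_free[OF e2] by blast
  define M where "M = max (real n1) (2 / c)"
  have "0 \<le> M" by (simp add: M_def)
  from powr_large[OF th(1) c0(2) this] obtain n0 where n0: "\<And>n m. n0 \<le> n \<Longrightarrow> 0 \<le> m \<Longrightarrow>
    \<theta> * real n powr (c / 4) \<le> m powr (c / 4) \<Longrightarrow> M < m" by blast
  have "lam V E \<le> \<theta> * real (card V)"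
    if G: "simple_graph V E" and pf: "pattern_free q t N V E" and big: "max n0 1 \<le> card V" for V :: "nat set" and E
  proof (rule ccontr)
    assume "\<not> ?thesis"
    then have l: "\<theta> * real (card V) \<le> lam V E" by simp
    have V: "V \<noteq> {}" using big by auto
    have n: "0 < real (card V)" using big by simp
    have "\<theta> * real (card V) \<le> 1 * real (card V)" using l lam_le_card[OF G V] by linarith
    then have th1: "\<theta> \<le> 1" using n by (rule mult_right_le_imp_le)
    obtain U where U: "U \<subseteq> V" "U \<noteq> {}"
      and deg: "(\<forall>u\<in>U. (\<theta> - \<epsilon> / 2) * real (card U) \<le> real (card (nbrs (induced E U) u))) \<or> c * real (card U) < 2"
      and pot: "lam V E / real (card V) * real (card V) powr (c/4)
        \<le> lam U (induced E U) / real (card U) * real (card U) powr (c/4)"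
      using deletion_process[OF G V e2 th(2) th1 l c_def] by blast
    have GU: "simple_graph U (induced E U)" using simple_graph_induced[OF G U(1)] .
    have cU: "0 < real (card U)" using U(2) simple_graphD(1)[OF GU] by (simp add: card_gt_0_iff)
    have "\<theta> * real (card V) powr (c/4) \<le> lam V E / real (card V) * real (card V) powr (c/4)"
      using l n by (intro mult_right_mono) (auto simp: pos_le_divide_eq)
    also have "\<dots> \<le> 1 * real (card U) powr (c/4)"
      using pot lam_le_card[OF GU U(2)] cU by (elim order_trans, intro mult_right_mono) auto
    finally have "\<theta> * real (card V) powr (c/4) \<le> real (card U) powr (c/4)" by simp
    then have MU: "M < real (card U)" using n0[of "card V" "real (card U)"] big by simp
    then have "2 < c * real (card U)" using c0 by (simp add: M_def divide_less_eq mult.commute)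
    then have "\<forall>u\<in>U. (1 - 1 / real q + \<epsilon> / 2) * real (card U) \<le> real (card (nbrs (induced E U) u))"
      using deg by (auto simp: \<theta>_def algebra_simps)
    then have "\<not> pattern_free q t N U (induced E U)" using n1[OF GU] MU by (simp add: M_def)
    then show False using pattern_free_induced[OF pf U(1)] by blast
  qed
  then show ?thesis unfolding \<theta>_def by blast
qed

text \<open>By \<open>spectral_erdos_stone\<close>, applied to the final set,
  \<open>\<lambda> / n\<close> can rise only from \<open>b - \<epsilon>\<close> to
  \<open>b + \<epsilon>\<close> during the deletions. The potential charges a power of the ratio of
  the sizes for this, so only a small proportion of the vertices is lost.\<close>

lemma dense_core:
  fixes e :: real
  assumes e: "0 < e" "e \<le> 1 / 2"
  shows "\<exists>\<epsilon>>0. \<exists>n0. \<forall>V::nat set. \<forall>E. simple_graph V E \<longrightarrow> pattern_free q t N V E \<longrightarrow> n0 \<le> card V \<longrightarrow>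
    (1 - 1 / real q - \<epsilon>) * real (card V) \<le> lam V E \<longrightarrow>
    (\<exists>U\<subseteq>V. (1 - e) * real (card V) \<le> real (card U) \<and> m0 \<le> card U \<and>
       (\<forall>u\<in>U. (1 - 1 / real q - e) * real (card U) \<le> real (card (nbrs (induced E U) u))))"
proof -
  define b where "b = 1 - 1 / real q"
  have b: "1 / 2 \<le> b" "b \<le> 1" using q by (auto simp: b_def field_simps)
  define \<theta> where "\<theta> = b - e / 2"
  have th: "0 < \<theta>" "e / 2 \<le> \<theta>" "\<theta> \<le> 1" using e b by (auto simp: \<theta>_def)
  define c where "c = e / 2 * \<theta> / 2"
  have c0: "0 < c" "0 < c / 4" using e th by (auto simp: c_def)
  \<comment> \<open>The price in the potential for losing the proportion \<open>e\<close> of the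
    vertices; \<epsilon> is then taken so small that
    \<open>(b + \<epsilon>) / (b - \<epsilon>)\<close> does not exceed it.\<close>
  define \<rho> where "\<rho> = (1 / (1 - e)) powr (c / 4)"
  have rho: "1 < \<rho>" unfolding \<rho>_def using powr_less_mono2[of "c / 4" 1 "1 / (1 - e)"] e c0 by simp
  define \<epsilon> where "\<epsilon> = min (e / 2) (b * (\<rho> - 1) / (\<rho> + 1))"
  have eps: "0 < \<epsilon>" using e b rho by (simp add: \<epsilon>_def)
  have eps1: "\<epsilon> \<le> e / 2" unfolding \<epsilon>_def by (rule min.cobounded1)
  have "\<epsilon> \<le> b * (\<rho> - 1) / (\<rho> + 1)" unfolding \<epsilon>_def by (rule min.cobounded2)
  then have eps2: "b + \<epsilon> \<le> \<rho> * (b - \<epsilon>)" using rho by (simp add: pos_le_divide_eq algebra_simps)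
  obtain n1 where n1: "\<And>(V::nat set) E. simple_graph V E \<Longrightarrow> pattern_free q t N V E \<Longrightarrow> n1 \<le> card V \<Longrightarrow>
    lam V E \<le> (b + \<epsilon>) * real (card V)"
    using spectral_erdos_stone[OF eps] unfolding b_def by blast
  define M where "M = max (real (max n1 m0)) (2 / c)"
  have "0 \<le> M" by (simp add: M_def)
  from powr_large[OF th(1) c0(2) this] obtain n0 where n0: "\<And>n m. n0 \<le> n \<Longrightarrow> 0 \<le> m \<Longrightarrow>
    \<theta> * real n powr (c / 4) \<le> m powr (c / 4) \<Longrightarrow> M < m" by blast
  have "\<exists>U\<subseteq>V. (1 - e) * real (card V) \<le> real (card U) \<and> m0 \<le> card U \<and>
       (\<forall>u\<in>U. (b - e) * real (card U) \<le> real (card (nbrs (induced E U) u)))"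
    if G: "simple_graph V E" and pf: "pattern_free q t N V E" and big: "max n0 1 \<le> card V"
      and lam: "(b - \<epsilon>) * real (card V) \<le> lam V E" for V :: "nat set" and E
  proof -
    have V: "V \<noteq> {}" using big by auto
    have n: "0 < real (card V)" using big by simp
    have "\<theta> * real (card V) \<le> (b - \<epsilon>) * real (card V)"
      using eps1 by (intro mult_right_mono) (auto simp: \<theta>_def)
    then have l: "\<theta> * real (card V) \<le> lam V E" using lam by linarith
    have e2: "0 < e / 2" using e by simp
    obtain U where U: "U \<subseteq> V" "U \<noteq> {}"
      and deg: "(\<forall>u\<in>U. (\<theta> - e / 2) * real (card U) \<le> real (card (nbrs (induced E U) u))) \<or> c * real (card U) < 2"
      and pot: "lam V E / real (card V) * real (card V) powr (c/4)
        \<le> lam U (induced E U) / real (card U) * real (card U) powr (c/4)"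
      using deletion_process[OF G V e2 th(2,3) l c_def] by blast
    have GU: "simple_graph U (induced E U)" using simple_graph_induced[OF G U(1)] .
    have cU: "0 < real (card U)" using U(2) simple_graphD(1)[OF GU] by (simp add: card_gt_0_iff)
    have "\<theta> * real (card V) powr (c/4) \<le> lam V E / real (card V) * real (card V) powr (c/4)"
      using l n by (intro mult_right_mono) (auto simp: pos_le_divide_eq)
    also have "\<dots> \<le> 1 * real (card U) powr (c/4)"
      using pot lam_le_card[OF GU U(2)] cU by (elim order_trans, intro mult_right_mono) auto
    finally have "\<theta> * real (card V) powr (c/4) \<le> real (card U) powr (c/4)" by simp
    then have MU: "M < real (card U)" using n0[of "card V" "real (card U)"] big by simp
    then have "2 < c * real (card U)" using c0 by (simp add: M_def divide_less_eq mult.commute)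
    then have degU: "\<forall>u\<in>U. (b - e) * real (card U) \<le> real (card (nbrs (induced E U) u))"
      using deg by (auto simp: \<theta>_def algebra_simps)
    have "lam U (induced E U) \<le> (b + \<epsilon>) * real (card U)"
      using n1[OF GU pattern_free_induced[OF pf U(1)]] MU by (simp add: M_def)
    then have lU: "lam U (induced E U) / real (card U) \<le> b + \<epsilon>" using cU by (simp add: pos_divide_le_eq)
    have bpos: "0 < b - \<epsilon>" using th eps1 by (simp add: \<theta>_def)
    have "(b - \<epsilon>) * real (card V) powr (c/4) \<le> lam V E / real (card V) * real (card V) powr (c/4)"
      using lam n by (intro mult_right_mono) (auto simp: pos_le_divide_eq)
    also have "\<dots> \<le> (b + \<epsilon>) * real (card U) powr (c/4)"
      using pot lU by (elim order_trans, intro mult_right_mono) auto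
    also have "\<dots> \<le> (\<rho> * (b - \<epsilon>)) * real (card U) powr (c/4)"
      using eps2 by (intro mult_right_mono) auto
    finally have "(b - \<epsilon>) * real (card V) powr (c/4) \<le> (b - \<epsilon>) * (\<rho> * real (card U) powr (c/4))"
      by (simp add: mult_ac)
    then have "real (card V) powr (c/4) \<le> \<rho> * real (card U) powr (c/4)" using bpos by (rule mult_left_le_imp_le)
    also have "\<dots> = (1 / (1 - e) * real (card U)) powr (c/4)"
      unfolding \<rho>_def using e by (subst powr_mult) auto
    finally have pw: "real (card V) powr (c/4) \<le> (1 / (1 - e) * real (card U)) powr (c/4)" .
    have "real (card V) \<le> 1 / (1 - e) * real (card U)"
    proof (rule ccontr)
      assume "\<not> ?thesis"
      then have "(1 / (1 - e) * real (card U)) powr (c/4) < real (card V) powr (c/4)"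
        using c0 e by (intro powr_less_mono2) auto
      then show False using pw by simp
    qed
    then have "(1 - e) * real (card V) \<le> real (card U)" using e by (simp add: pos_le_divide_eq mult.commute)
    moreover have "m0 \<le> card U" using MU by (simp add: M_def)
    ultimately show ?thesis using U(1) degU by blast
  qed
  then show ?thesis using eps unfolding b_def by blast
qed

end

subsection \<open>The leading eigenvector of an extremal graph\<close>

lemma near_turanD:
  assumes "near_turan V E q R K \<delta>"
  shows "sep_parts V E q R" and "real (card (V - (\<Union>i<q. R i))) \<le> K"
    and "i < q \<Longrightarrow> \<bar>real (card (R i)) - real (card V) / real q\<bar> \<le> \<delta> * real (card V)"
    and "i < q \<Longrightarrow> v \<in> R i \<Longrightarrow> real (card ((\<Union>j<q. R j) - R i - nbrs E v)) \<le> \<delta> * real (card V)"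
  using assms by (auto simp: near_turan_def)

lemma near_turan_miss:
  assumes G: "simple_graph V E" and nt: "near_turan V E q R K \<delta>"
    and ij: "i < q" "j < q" "i \<noteq> j" and v: "v \<in> R i"
  shows "real (card (R j - nbrs E v)) \<le> \<delta> * real (card V)"
proof -
  have "R j - nbrs E v \<subseteq> (\<Union>j<q. R j) - R i - nbrs E v"
    using sep_partsD(3)[OF near_turanD(1)[OF nt] ij] ij by blast
  moreover have "finite (\<Union>j<q. R j)"
    using simple_graphD(1)[OF G] sep_partsD(1)[OF near_turanD(1)[OF nt]] by (auto intro: finite_subset)
  ultimately have "card (R j - nbrs E v) \<le> card ((\<Union>j<q. R j) - R i - nbrs E v)" by (intro card_mono) auto
  then show ?thesis using near_turanD(4)[OF nt ij(1) v] by linarith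
qed

lemma sum_sep_parts:
  assumes G: "simple_graph V E" and P: "sep_parts V E q P"
  shows "sum x (\<Union>i<q. P i) = (\<Sum>i<q. sum x (P i))"
proof (rule sum.UNION_disjoint)
  show "\<forall>i\<in>{..<q}. finite (P i)"
    using sep_partsD(1)[OF P] simple_graphD(1)[OF G] by (auto intro: finite_subset)
qed (use sep_partsD(3)[OF P] in auto)

lemma sum_sep_parts_minus:
  assumes G: "simple_graph V E" and P: "sep_parts V E q P" and i: "i < q"
  shows "sum x ((\<Union>i<q. P i) - P i) = (\<Sum>i<q. sum x (P i)) - (sum x (P i) :: real)"
proof -
  have "finite (\<Union>j<q. P j)"
    using simple_graphD(1)[OF G] sep_partsD(1)[OF P] by (auto intro: finite_subset)
  then have "sum x (\<Union>i<q. P i) = sum x ((\<Union>i<q. P i) - P i) + sum x (P i)"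
    using i by (intro sum.subset_diff) auto
  then show ?thesis using sum_sep_parts[OF G P, of x] by simp
qed

lemma sum_unit_bounds:
  fixes x :: "'a \<Rightarrow> real"
  assumes "finite X" and "\<And>u. 0 \<le> x u" and "\<And>u. u \<in> X \<Longrightarrow> x u \<le> 1"
  shows "0 \<le> sum x X" and "sum x X \<le> real (card X)"
  using assms sum_bounded_above[of X x 1] by (auto intro: sum_nonneg)

text \<open>Everything is divided by \<open>n\<close>: \<open>s\<close> is the weight of a class,
  \<open>c\<close> its size and \<open>T\<close> the total weight. The eigenvector equation summed
  over the class reads \<open>l * s = c * (T - s)\<close> approximately, and \<open>l + c\<close> is
  close to 1.\<close>

lemma concentration_arith:
  fixes l T s c \<delta> q :: real
  assumes q: "2 \<le> q" and l: "\<bar>l - (1 - 1 / q)\<bar> \<le> \<delta>" and c: "\<bar>c - 1 / q\<bar> \<le> \<delta>" "0 \<le> c" "c \<le> 1"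
    and s: "0 \<le> s" "s \<le> 1" and T: "0 \<le> T" "T \<le> 1" and d: "0 \<le> \<delta>"
    and eq: "\<bar>l * s - c * (T - s)\<bar> \<le> c * \<delta>"
  shows "\<bar>s - T / q\<bar> \<le> 4 * \<delta>"
proof -
  have a1: "\<bar>(l + c - 1) * s\<bar> \<le> 2 * \<delta> * 1"
    unfolding abs_mult using l c s d by (intro mult_mono) auto
  have a2: "\<bar>(c - 1 / q) * T\<bar> \<le> \<delta> * 1" unfolding abs_mult using c T d by (intro mult_mono) auto
  have a3: "c * \<delta> \<le> 1 * \<delta>" using c d by (intro mult_right_mono) auto
  have "s - T / q = (l * s - c * (T - s)) - (l + c - 1) * s + (c - 1 / q) * T" by (simp add: algebra_simps)
  then show ?thesis using a1 a2 a3 eq by linarith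
qed

text \<open>The equation of a single vertex, \<open>l * x = T - s\<close> approximately, with
  \<open>s\<close> known from the previous estimate. The accumulated error
  \<open>6 * \<delta>\<close> is doubled on division by
  \<open>1 - 1 / q \<ge> 1 / 2\<close>.\<close>

lemma concentration_arith2:
  fixes l T s x \<delta> q :: real
  assumes q: "2 \<le> q" and l: "\<bar>l - (1 - 1 / q)\<bar> \<le> \<delta>" and x: "0 \<le> x" "x \<le> 1" and d: "0 \<le> \<delta>"
    and s: "\<bar>s - T / q\<bar> \<le> 4 * \<delta>" and eq: "\<bar>l * x - (T - s)\<bar> \<le> \<delta>"
  shows "\<bar>x - T\<bar> \<le> 12 * \<delta>"
proof -
  have a1: "\<bar>(l - (1 - 1 / q)) * x\<bar> \<le> \<delta> * 1" unfolding abs_mult using l x d by (intro mult_mono) auto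
  have "(1 - 1 / q) * (x - T) = (l * x - (T - s)) - (l - (1 - 1 / q)) * x - (s - T / q)" using q by (simp add: field_simps)
  then have "\<bar>(1 - 1 / q) * (x - T)\<bar> \<le> 6 * \<delta>" using a1 s eq by linarith
  moreover have "1 / 2 * \<bar>x - T\<bar> \<le> \<bar>1 - 1 / q\<bar> * \<bar>x - T\<bar>"
    using q by (intro mult_right_mono) (auto simp: field_simps)
  ultimately show ?thesis by (simp add: abs_mult)
qed

text \<open>Up to an error of \<open>\<delta> * n\<close>, a classified vertex sees exactly the
  weight of the other classes, so its entry is nearly determined by the class weights. That
  \<open>S\<close> is of order \<open>n\<close> comes from the equation at a vertex of entry
  1.\<close>

lemma eigen_concentration:
  fixes x :: "'a \<Rightarrow> real"
  assumes G: "simple_graph V E" and nt: "near_turan V E q R K \<delta>" and K: "K \<le> \<delta> * real (card V)"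
    and q: "2 \<le> q" and V: "V \<noteq> {}" and x0: "\<And>u. 0 \<le> x u" and x1: "\<And>u. u \<in> V \<Longrightarrow> x u \<le> 1"
    and eig: "\<And>u. u \<in> V \<Longrightarrow> adj_sum E x u = l * x u"
    and l: "\<bar>l - (1 - 1 / real q) * real (card V)\<bar> \<le> \<delta> * real (card V)"
    and S: "S = (\<Sum>i<q. sum x (R i))" and d: "0 \<le> \<delta>"
  shows "i < q \<Longrightarrow> \<bar>sum x (R i) - S / real q\<bar> \<le> 4 * \<delta> * real (card V)"
    and "i < q \<Longrightarrow> v \<in> R i \<Longrightarrow> \<bar>x v - S / real (card V)\<bar> \<le> 12 * \<delta>"
    and "v0 \<in> V \<Longrightarrow> x v0 = 1 \<Longrightarrow> (1 - 1 / real q - 2 * \<delta>) * real (card V) \<le> S"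
    and "S \<le> real (card V)" and "0 \<le> S"
proof -
  note f = simple_graphD(1)[OF G]
  define n where "n = real (card V)"
  have n: "0 < n" using V f by (simp add: n_def card_gt_0_iff)
  note P = near_turanD(1)[OF nt]
  have RV: "R i \<subseteq> V" if "i < q" for i using sep_partsD(1)[OF P that] .
  have fR: "finite (R i)" if "i < q" for i using RV[OF that] f by (rule finite_subset)
  let ?U = "\<Union>i<q. R i"
  let ?W = "V - ?U"
  have UV: "?U \<subseteq> V" using RV by auto
  have fU: "finite ?U" using UV f by (rule finite_subset)
  have SU: "S = sum x ?U" unfolding S by (rule sum_sep_parts[OF G P, symmetric])
  have sb: "0 \<le> sum x X" "sum x X \<le> real (card X)" if "X \<subseteq> V" for X
    using sum_unit_bounds[of X x] x0 x1 that f finite_subset by blast+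
  show "0 \<le> S" unfolding SU by (rule sb(1)[OF UV])
  show "S \<le> real (card V)"
    unfolding SU using sb(2)[OF UV] card_mono[OF f UV] by linarith
  have W: "real (card ?W) \<le> \<delta> * n" using near_turanD(2)[OF nt] K by (simp add: n_def)
  have row: "\<bar>l * x v - (S - sum x (R i))\<bar> \<le> \<delta> * n" if i: "i < q" and v: "v \<in> R i" for i v
  proof -
    let ?Y = "?U - R i"
    have vV: "v \<in> V" using RV[OF i] v by blast
    have "nbrs E v \<inter> R i = {}" using sep_partsD(2)[OF P i] v by (auto simp: nbrs_def stable_set_def)
    then have dec: "nbrs E v = (nbrs E v \<inter> ?Y) \<union> (nbrs E v \<inter> ?W)" using simple_graphD(6)[OF G, of v] by blast
    have "sum x (nbrs E v) = sum x (nbrs E v \<inter> ?Y) + sum x (nbrs E v \<inter> ?W)"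
      by (subst dec, rule sum.union_disjoint) (use f fU in auto)
    moreover have "sum x ?Y = sum x (?Y - nbrs E v) + sum x (nbrs E v \<inter> ?Y)"
      using sum.Int_Diff[of ?Y x "nbrs E v"] fU by (simp add: Int_commute)
    moreover have "0 \<le> sum x (nbrs E v \<inter> ?W)" using sb(1)[of "nbrs E v \<inter> ?W"] by auto
    moreover have "sum x (nbrs E v \<inter> ?W) \<le> \<delta> * n"
    proof -
      have "sum x (nbrs E v \<inter> ?W) \<le> real (card (nbrs E v \<inter> ?W))" using sb(2)[of "nbrs E v \<inter> ?W"] by auto
      moreover have "card (nbrs E v \<inter> ?W) \<le> card ?W" using f by (intro card_mono) auto
      ultimately show ?thesis using W by linarith
    qed
    moreover have "0 \<le> sum x (?Y - nbrs E v)" "sum x (?Y - nbrs E v) \<le> real (card (?Y - nbrs E v))"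
      using sb[of "?Y - nbrs E v"] UV by auto
    moreover have "real (card (?Y - nbrs E v)) \<le> \<delta> * n" using near_turanD(4)[OF nt i v] by (simp add: n_def)
    moreover have "sum x ?Y = S - sum x (R i)" unfolding S by (rule sum_sep_parts_minus[OF G P i])
    moreover have "l * x v = sum x (nbrs E v)" using eig[OF vV] by (simp add: adj_sum_def)
    ultimately show ?thesis by linarith
  qed
  have q2: "2 \<le> real q" using q by simp
  have div: "\<bar>a / n\<bar> \<le> b" if "\<bar>a\<bar> \<le> b * n" for a b :: real
    using that n by (simp add: pos_divide_le_eq)
  have "\<bar>(l - (1 - 1 / real q) * n) / n\<bar> \<le> \<delta>" using l by (intro div) (simp add: n_def)
  then have ln: "\<bar>l / n - (1 - 1 / real q)\<bar> \<le> \<delta>" using n by (simp add: diff_divide_distrib)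
  have part: "\<bar>sum x (R i) / n - S / n / real q\<bar> \<le> 4 * \<delta>" if i: "i < q" for i
  proof (rule concentration_arith[OF q2 ln])
    let ?c = "real (card (R i)) / n"
    have "\<bar>(real (card (R i)) - n / real q) / n\<bar> \<le> \<delta>"
      using near_turanD(3)[OF nt i] by (intro div) (simp add: n_def)
    then show "\<bar>?c - 1 / real q\<bar> \<le> \<delta>" using n by (simp add: diff_divide_distrib)
    have cn: "real (card (R i)) \<le> n" using card_mono[OF f RV[OF i]] by (simp add: n_def)
    then show "0 \<le> ?c" "?c \<le> 1" using n by auto
    show "0 \<le> sum x (R i) / n" "sum x (R i) / n \<le> 1"
      using sb[OF RV[OF i]] cn n by auto
    show "0 \<le> S / n" "S / n \<le> 1" using \<open>0 \<le> S\<close> \<open>S \<le> real (card V)\<close> n by (auto simp: n_def)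
    have "\<bar>l * sum x (R i) - real (card (R i)) * (S - sum x (R i))\<bar> =
        \<bar>\<Sum>v\<in>R i. l * x v - (S - sum x (R i))\<bar>" by (simp add: sum_subtractf sum_distrib_left)
    also have "\<dots> \<le> (\<Sum>v\<in>R i. \<bar>l * x v - (S - sum x (R i))\<bar>)" by (rule sum_abs)
    also have "\<dots> \<le> (\<Sum>v\<in>R i. \<delta> * n)" using row[OF i] by (rule sum_mono)
    also have "\<dots> = (?c * \<delta> * n) * n" using n by simp
    finally have le: "\<bar>(l * sum x (R i) - real (card (R i)) * (S - sum x (R i))) / n / n\<bar> \<le> ?c * \<delta>"
      by (intro div)
    have eq: "(l * sum x (R i) - real (card (R i)) * (S - sum x (R i))) / n / n =
        l / n * (sum x (R i) / n) - ?c * (S / n - sum x (R i) / n)" by (simp add: diff_divide_distrib right_diff_distrib)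
    show "\<bar>l / n * (sum x (R i) / n) - ?c * (S / n - sum x (R i) / n)\<bar> \<le> ?c * \<delta>"
      using le unfolding eq .
  qed (rule d)
  show "\<bar>sum x (R i) - S / real q\<bar> \<le> 4 * \<delta> * real (card V)" if "i < q" for i
  proof -
    have "sum x (R i) - S / real q = (sum x (R i) / n - S / n / real q) * n" using n by (simp add: field_simps)
    then have "\<bar>sum x (R i) - S / real q\<bar> = \<bar>sum x (R i) / n - S / n / real q\<bar> * n" using n by (simp add: abs_mult)
    then show ?thesis using mult_right_mono[OF part[OF that], of n] n by (simp add: n_def)
  qed
  show "\<bar>x v - S / real (card V)\<bar> \<le> 12 * \<delta>" if i: "i < q" and v: "v \<in> R i" for i v
    unfolding n_def[symmetric]
  proof (rule concentration_arith2[OF q2 ln x0 _ d part[OF i]])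
    show "x v \<le> 1" using x1 RV[OF i] v by blast
    have "\<bar>(l * x v - (S - sum x (R i))) / n\<bar> \<le> \<delta>" by (rule div[OF row[OF i v]])
    then show "\<bar>l / n * x v - (S / n - sum x (R i) / n)\<bar> \<le> \<delta>" by (simp add: diff_divide_distrib)
  qed
  show "(1 - 1 / real q - 2 * \<delta>) * real (card V) \<le> S" if v0: "v0 \<in> V" "x v0 = 1"
  proof -
    have "l = sum x (nbrs E v0)" using eig[OF v0(1)] v0(2) by (simp add: adj_sum_def)
    also have "\<dots> \<le> sum x (?U \<union> ?W)"
      using simple_graphD(6)[OF G, of v0] f fU x0 by (intro sum_mono2) auto
    also have "\<dots> = S + sum x ?W" unfolding SU using f fU by (intro sum.union_disjoint) auto
    also have "\<dots> \<le> S + \<delta> * n" using sb(2)[of ?W] W by auto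
    finally have "l \<le> S + \<delta> * n" .
    then show ?thesis using l by (simp add: n_def left_diff_distrib abs_le_iff)
  qed
qed

section \<open>Switching an exceptional vertex, and the minimum degree of extremal graphs\<close>

context critical_graph
begin

lemma switch_free:
  assumes G: "simple_graph V E" and free: "\<not> embeds k A V E" and R: "sep_parts V E q R"
    and miss: "\<And>j v. 0 < j \<Longrightarrow> j < q \<Longrightarrow> v \<in> R j \<Longrightarrow> real (card (R 0 - nbrs E v)) \<le> m" and m: "0 \<le> m"
    and big: "real k * m + real k < real (card (R 0))" and u: "u \<in> V - (\<Union>i<q. R i)"
    and Y: "Y = (\<Union>i<q. R i) - R 0"
    and E': "E' = (\<lambda>a b. if a = u then b \<in> Y else if b = u then a \<in> Y else E a b)"
  shows "simple_graph V E'" and "\<not> embeds k A V E'"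
proof -
  note f = simple_graphD(1)[OF G]
  have RV: "R i \<subseteq> V" if "i < q" for i using sep_partsD(1)[OF R that] .
  have q0: "0 < q" using q by simp
  have uY: "u \<notin> Y" "u \<in> V" "Y \<subseteq> V" using u RV by (auto simp: Y)
  show "simple_graph V E'"
    using uY G unfolding simple_graph_def E' by auto
  show "\<not> embeds k A V E'"
  proof
    assume "embeds k A V E'"
    then obtain \<phi> where inj: "inj_on \<phi> {..<k}" and im: "\<phi> ` {..<k} \<subseteq> V"
      and adj: "\<And>i j. i < k \<Longrightarrow> j < k \<Longrightarrow> A i j \<Longrightarrow> E' (\<phi> i) (\<phi> j)" by (auto simp: embeds_def)
    show False
    proof (cases "u \<in> \<phi> ` {..<k}")
      case False
      have "E (\<phi> i) (\<phi> j)" if "i < k" "j < k" "A i j" for i j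
      proof -
        have "\<phi> i \<noteq> u" "\<phi> j \<noteq> u" using False that by auto
        then show ?thesis using adj[OF that] by (simp add: E')
      qed
      then show False using free inj im unfolding embeds_def by blast
    next
      case True
      then obtain f0 where f0: "f0 < k" "\<phi> f0 = u" by auto
      define D where "D = {j. j < k \<and> j \<noteq> f0 \<and> (A f0 j \<or> A j f0)}"
      have neu: "\<phi> j \<noteq> u" if "j < k" "j \<noteq> f0" for j using inj f0 that by (auto simp: inj_on_def)
      have DY: "\<phi> ` D \<subseteq> Y"
        using adj f0 neu by (auto simp: D_def E' split: if_splits)
      have DR: "\<exists>j. 0 < j \<and> j < q \<and> v \<in> R j" if "v \<in> Y" for v
        using that by (auto simp: Y) (metis neq0_conv)
      have fin: "finite (R 0)" "finite (\<phi> ` D)" using RV[OF q0] f finite_subset by (auto simp: D_def)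
      have cD: "card (\<phi> ` D) \<le> k"
      proof -
        have "card (\<phi> ` D) \<le> card D" by (rule card_image_le) (simp add: D_def)
        also have "\<dots> \<le> card {..<k}" by (rule card_mono) (auto simp: D_def)
        finally show ?thesis by simp
      qed
      \<comment> \<open>The at most \<open>k\<close> vertices of the copy adjacent to
        \<open>u\<close> lie in \<open>Y\<close> and exclude at most \<open>k * m\<close> vertices
        of \<open>R 0\<close>; the additional \<open>k\<close> in \<open>big\<close> leaves a
        substitute that the copy does not use yet.\<close>
      have "real (card (R 0)) - real k * m \<le> real (card {c \<in> R 0. \<forall>v\<in>\<phi> ` D. E v c})"
        by (rule common_neighbours_card[OF fin cD _ m]) (use DY DR miss in blast)
      then have "k < card {c \<in> R 0. \<forall>v\<in>\<phi> ` D. E v c}" using big by linarith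
      moreover have "card (\<phi> ` {..<k}) \<le> k" using card_image_le[of "{..<k}" \<phi>] by simp
      ultimately have "\<not> {c \<in> R 0. \<forall>v\<in>\<phi> ` D. E v c} \<subseteq> \<phi> ` {..<k}"
        using card_mono[of "\<phi> ` {..<k}" "{c \<in> R 0. \<forall>v\<in>\<phi> ` D. E v c}"] by auto
      then obtain c where c: "c \<in> R 0" "\<And>v. v \<in> \<phi> ` D \<Longrightarrow> E v c" "c \<notin> \<phi> ` {..<k}" by blast
      define \<psi> where "\<psi> = \<phi>(f0 := c)"
      have "inj_on \<psi> {..<k}" using inj c(3) by (auto simp: \<psi>_def inj_on_def)
      moreover have "\<psi> ` {..<k} \<subseteq> V" using im c(1) RV[OF q0] by (auto simp: \<psi>_def)
      moreover have "E (\<psi> i) (\<psi> j)" if ij: "i < k" "j < k" "A i j" for i j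
      proof -
        consider "i = f0" "j = f0" | "i = f0" "j \<noteq> f0" | "i \<noteq> f0" "j = f0" | "i \<noteq> f0" "j \<noteq> f0" by blast
        then show ?thesis
        proof cases
          case 1
          then show ?thesis using adj[OF ij] f0 uY by (simp add: E')
        next
          case 2
          then have "j \<in> D" using ij by (simp add: D_def)
          then have "E (\<phi> j) c" using c(2) by blast
          then show ?thesis using 2 simple_graphD(5)[OF G] by (simp add: \<psi>_def)
        next
          case 3
          then have "i \<in> D" using ij by (simp add: D_def)
          then have "E (\<phi> i) c" using c(2) by blast
          then show ?thesis using 3 by (simp add: \<psi>_def)
        next
          case 4
          then show ?thesis using adj[OF ij] neu ij by (simp add: E' \<psi>_def)
        qed
      qed
      ultimately show False using free unfolding embeds_def by blast
    qed
  qed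
qed

text \<open>
  Replacing the neighbourhood of \<open>u\<close> by the classes other than \<open>R\<^sub>0\<close> keeps the graph free, as in any copy
  \<open>u\<close> can be exchanged for an unused vertex of \<open>R\<^sub>0\<close>; so it does not increase the quadratic form.
\<close>

lemma extremal_switch:
  assumes ex: "extremal V E" and R: "sep_parts V E q R"
    and miss: "\<And>j v. 0 < j \<Longrightarrow> j < q \<Longrightarrow> v \<in> R j \<Longrightarrow> real (card (R 0 - nbrs E v)) \<le> m" and m: "0 \<le> m"
    and big: "real k * m + real k < real (card (R 0))" and u: "u \<in> V - (\<Union>i<q. R i)"
    and x0: "\<And>v. 0 \<le> x v" and eig: "\<And>v. v \<in> V \<Longrightarrow> adj_sum E x v = lam V E * x v"
  shows "sum x ((\<Union>i<q. R i) - R 0) \<le> lam V E * x u"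
proof -
  note G = extremalD(1)[OF ex]
  define Y where "Y = (\<Union>i<q. R i) - R 0"
  define E' where "E' = (\<lambda>a b. if a = u then b \<in> Y else if b = u then a \<in> Y else E a b)"
  have G': "simple_graph V E'"
    by (rule switch_free(1)[OF G extremalD(2)[OF ex] R miss m big u Y_def E'_def])
  have free': "\<not> embeds k A V E'"
    by (rule switch_free(2)[OF G extremalD(2)[OF ex] R miss m big u Y_def E'_def])
  have uV: "u \<in> V" "u \<notin> Y" using u by (auto simp: Y_def)
  have le: "lam V E' \<le> lam V E" by (rule extremalD(3)[OF ex G' free'])
  have aY: "adj_sum E' x u = sum x Y" by (simp add: adj_sum_def nbrs_def E'_def)
  have q0: "qform V E' (x(u := 0)) = qform V E (x(u := 0))"
  proof -
    have "(x(u := 0)) w * adj_sum E' (x(u := 0)) w = (x(u := 0)) w * adj_sum E (x(u := 0)) w" for w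
    proof (cases "w = u")
      case False
      have "adj_sum E' (x(u := 0)) w = (\<Sum>v\<in>V. if E' w v then (x(u := 0)) v else 0)"
        by (rule adj_sum_if[OF G'])
      also have "\<dots> = (\<Sum>v\<in>V. if E w v then (x(u := 0)) v else 0)"
        using False by (intro sum.cong) (auto simp: E'_def)
      also have "\<dots> = adj_sum E (x(u := 0)) w" by (rule adj_sum_if[OF G, symmetric])
      finally have "adj_sum E' (x(u := 0)) w = adj_sum E (x(u := 0)) w" .
      then show ?thesis by simp
    qed simp
    then show ?thesis unfolding bform_def by (intro sum.cong refl)
  qed
  have qE: "qform V E x = lam V E * sqn V x"
    unfolding bform_def sqn_def sum_distrib_left by (intro sum.cong) (auto simp: eig power2_eq_square)
  have q1: "qform V E' x = lam V E * sqn V x + 2 * x u * (sum x Y - lam V E * x u)"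
    using q0 qform_update[OF G uV(1), of x 0] qform_update[OF G' uV(1), of x 0] aY qE eig[OF uV(1)]
    by (simp add: algebra_simps)
  have bound: "qform V E' y \<le> lam V E * sqn V y" for y
  proof -
    have "qform V E' y \<le> lam V E' * sqn V y" by (rule qform_le_lam[OF G'])
    also have "\<dots> \<le> lam V E * sqn V y" using le by (intro mult_right_mono) (simp_all add: sqn_nonneg)
    finally show ?thesis .
  qed
  \<comment> \<open>When \<open>x u = 0\<close> the two forms agree at \<open>x\<close> and
    comparing them says nothing. But then \<open>x\<close> attains the bound in the switched graph
    as well, so it satisfies the eigenvector equation of that graph at \<open>u\<close>.\<close>
  show ?thesis
  proof (cases "x u = 0")
    case True
    then have "qform V E' x = lam V E * sqn V x" using q1 by simp
    from eigen_of_maximiser[OF G' bound this uV(1)] show ?thesis using aY by (simp add: Y_def)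
  next
    case False
    then have pos: "0 < x u" using x0[of u] by simp
    have "2 * x u * (sum x Y - lam V E * x u) \<le> 0" using bound[of x] q1 by simp
    then have "sum x Y - lam V E * x u \<le> 0" using pos by (simp add: mult_le_0_iff)
    then show ?thesis by (simp add: Y_def)
  qed
qed

text \<open>Returns from the dense core to the whole graph: the deleted vertices join the
  exceptional set, which is then only bounded by \<open>\<delta> * n\<close>.\<close>

lemma near_turan_extend:
  assumes G: "simple_graph V E" and UV: "U \<subseteq> V" and nt: "near_turan U (induced E U) q R K (\<delta> / 4)"
    and big: "(1 - \<delta> / 4) * real (card V) \<le> real (card U)" and K: "K \<le> \<delta> / 4 * real (card V)" and d: "0 \<le> \<delta>"
  shows "near_turan V E q R (\<delta> * real (card V)) \<delta>"
proof -
  note f = simple_graphD(1)[OF G]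
  have fU: "finite U" using UV f by (rule finite_subset)
  note P = near_turanD(1)[OF nt]
  have RU: "R i \<subseteq> U" if "i < q" for i using sep_partsD(1)[OF P that] .
  define n where "n = real (card V)"
  define n' where "n' = real (card U)"
  have n: "n' \<le> n" "0 \<le> n'" "(1 - \<delta> / 4) * n \<le> n'" "K \<le> \<delta> / 4 * n"
    using card_mono[OF f UV] big K by (auto simp: n_def n'_def)
  have dn: "\<delta> * n' \<le> \<delta> * n" "0 \<le> \<delta> * n" using n d by (auto intro: mult_left_mono)
  have "sep_parts V E q R"
    unfolding sep_parts_def
  proof (intro conjI allI impI)
    fix i assume i: "i < q"
    show "R i \<subseteq> V" using RU[OF i] UV by blast
    show "stable_set E (R i)"
      using sep_partsD(2)[OF P i] RU[OF i] by (auto simp: stable_set_def induced_def)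
  qed (rule sep_partsD(3)[OF P])
  moreover have "real (card (V - (\<Union>i<q. R i))) \<le> \<delta> * n"
  proof -
    have "V - (\<Union>i<q. R i) \<subseteq> (V - U) \<union> (U - (\<Union>i<q. R i))" by blast
    then have "card (V - (\<Union>i<q. R i)) \<le> card ((V - U) \<union> (U - (\<Union>i<q. R i)))" using f fU by (intro card_mono) auto
    also have "\<dots> \<le> card (V - U) + card (U - (\<Union>i<q. R i))" by (rule card_Un_le)
    finally have "real (card (V - (\<Union>i<q. R i))) \<le> real (card (V - U)) + K" using near_turanD(2)[OF nt] by linarith
    moreover have "real (card (V - U)) = n - n'"
      using card_Diff_subset[OF fU UV] card_mono[OF f UV] by (simp add: n_def n'_def of_nat_diff)
    ultimately show ?thesis using n dn by (simp add: left_diff_distrib)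
  qed
  moreover have "\<bar>real (card (R i)) - n / real q\<bar> \<le> \<delta> * n" if i: "i < q" for i
  proof -
    have "\<bar>real (card (R i)) - n' / real q\<bar> \<le> \<delta> / 4 * n'" using near_turanD(3)[OF nt i] by (simp add: n'_def)
    moreover have "(n - n') / real q \<le> (n - n') / 1" using n i by (intro divide_left_mono) auto
    moreover have "0 \<le> (n - n') / real q" using n by simp
    moreover have "\<delta> / 4 * n' = \<delta> * n' / 4" "\<delta> / 4 * n = \<delta> * n / 4" by auto
    ultimately show ?thesis
      using n dn unfolding left_diff_distrib diff_divide_distrib abs_le_iff by (intro conjI) linarith+
  qed
  moreover have "real (card ((\<Union>j<q. R j) - R i - nbrs E v)) \<le> \<delta> * n" if i: "i < q" and v: "v \<in> R i" for i v
  proof -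
    have vU: "v \<in> U" using RU[OF i] v by blast
    have "(\<Union>j<q. R j) - R i - nbrs E v = (\<Union>j<q. R j) - R i - nbrs (induced E U) v"
      using RU vU by (auto simp: nbrs_induced)
    then have "real (card ((\<Union>j<q. R j) - R i - nbrs E v)) \<le> \<delta> / 4 * n'"
      using near_turanD(4)[OF nt i v] by (simp add: n'_def)
    then show ?thesis using dn by linarith
  qed
  ultimately show ?thesis unfolding near_turan_def n_def by blast
qed

text \<open>A first pass with an exceptional set of linear size. It is good enough to control the
  eigenvector, and the eigenvector in turn gives the minimum degree that removes this
  defect.\<close>

lemma extremal_near_turan:
  fixes \<delta> :: real
  assumes d: "0 < \<delta>"
  shows "\<exists>n0. \<forall>V E. extremal V E \<longrightarrow> n0 \<le> card V \<longrightarrow>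
    (\<exists>R. near_turan V E q R (\<delta> * real (card V)) \<delta>) \<and>
    \<bar>lam V E - (1 - 1 / real q) * real (card V)\<bar> \<le> \<delta> * real (card V)"
proof -
  have d4: "0 < \<delta> / 4" using d by simp
  obtain K \<epsilon>S nS where eS: "0 < \<epsilon>S" and nS: "\<And>(V::nat set) E. simple_graph V E \<Longrightarrow> pattern_free q t N V E \<Longrightarrow>
    nS \<le> card V \<Longrightarrow> (\<forall>u\<in>V. (1 - 1 / real q - \<epsilon>S) * real (card V) \<le> real (card (nbrs E u))) \<Longrightarrow>
    (\<exists>R. near_turan V E q R (real K) (\<delta> / 4))"
    using near_turan_structure[OF q t N, where 'a = nat] d4 by metis
  define e where "e = min (min (\<delta> / 4) \<epsilon>S) (1 / 2)"
  have e: "0 < e" "e \<le> 1 / 2" "e \<le> \<delta> / 4" "e \<le> \<epsilon>S" using d eS unfolding e_def by linarith+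
  obtain \<epsilon>C nC where eC: "0 < \<epsilon>C" and nC: "\<And>(V::nat set) E. simple_graph V E \<Longrightarrow> pattern_free q t N V E \<Longrightarrow> nC \<le> card V \<Longrightarrow>
    (1 - 1 / real q - \<epsilon>C) * real (card V) \<le> lam V E \<Longrightarrow>
    (\<exists>U\<subseteq>V. (1 - e) * real (card V) \<le> real (card U) \<and> nS \<le> card U \<and>
       (\<forall>u\<in>U. (1 - 1 / real q - e) * real (card U) \<le> real (card (nbrs (induced E U) u))))"
    using dense_core[OF e(1,2), of nS] by metis
  obtain nE where nE: "\<And>(V::nat set) E. simple_graph V E \<Longrightarrow> pattern_free q t N V E \<Longrightarrow> nE \<le> card V \<Longrightarrow>
    lam V E \<le> (1 - 1 / real q + \<delta>) * real (card V)" using spectral_erdos_stone[OF d] by metis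
  define n0 where "n0 = nS + nC + nE + 1 + nat \<lceil>1 / \<epsilon>C\<rceil> + nat \<lceil>1 / \<delta>\<rceil> + nat \<lceil>4 * real K / \<delta>\<rceil>"
  have "(\<exists>R. near_turan V E q R (\<delta> * real (card V)) \<delta>) \<and>
    \<bar>lam V E - (1 - 1 / real q) * real (card V)\<bar> \<le> \<delta> * real (card V)"
    if ex: "extremal V E" and big: "n0 \<le> card V" for V E
  proof -
    note G = extremalD(1)[OF ex] and pf = extremal_pattern_free[OF ex]
    have V: "V \<noteq> {}" using big by (auto simp: n0_def)
    have "1 / \<epsilon>C \<le> real (card V)" "1 / \<delta> \<le> real (card V)" "4 * real K / \<delta> \<le> real (card V)"
      using big unfolding n0_def by linarith+
    then have b1: "1 \<le> \<epsilon>C * real (card V)" "1 \<le> \<delta> * real (card V)" "4 * real K \<le> \<delta> * real (card V)"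
      using eC d by (auto simp: divide_le_eq mult.commute)
    have lo: "(1 - 1 / real q) * real (card V) - 1 \<le> lam V E" by (rule extremal_lower_bound[OF ex V])
    have up: "lam V E \<le> (1 - 1 / real q + \<delta>) * real (card V)" using nE[OF G pf] big by (simp add: n0_def)
    have "(1 - 1 / real q - \<epsilon>C) * real (card V) \<le> lam V E" using lo b1(1) by (simp add: left_diff_distrib)
    then obtain U where U: "U \<subseteq> V" "(1 - e) * real (card V) \<le> real (card U)" "nS \<le> card U"
       "\<forall>u\<in>U. (1 - 1 / real q - e) * real (card U) \<le> real (card (nbrs (induced E U) u))"
      using nC[OF G pf] big unfolding n0_def by auto
    have "\<forall>u\<in>U. (1 - 1 / real q - \<epsilon>S) * real (card U) \<le> real (card (nbrs (induced E U) u))"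
    proof
      fix u assume "u \<in> U"
      have "(1 - 1 / real q - \<epsilon>S) * real (card U) \<le> (1 - 1 / real q - e) * real (card U)"
        using e by (intro mult_right_mono) auto
      then show "(1 - 1 / real q - \<epsilon>S) * real (card U) \<le> real (card (nbrs (induced E U) u))"
        using U(4) \<open>u \<in> U\<close> by (meson order_trans)
    qed
    then obtain R where R: "near_turan U (induced E U) q R (real K) (\<delta> / 4)"
      using nS[OF simple_graph_induced[OF G U(1)] pattern_free_induced[OF pf U(1)] U(3)] by blast
    have "(1 - \<delta> / 4) * real (card V) \<le> (1 - e) * real (card V)" using e by (intro mult_right_mono) auto
    then have bU: "(1 - \<delta> / 4) * real (card V) \<le> real (card U)" using U(2) by linarith
    have "near_turan V E q R (\<delta> * real (card V)) \<delta>"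
      by (rule near_turan_extend[OF G U(1) R bU]) (use b1 d in auto)
    moreover have "\<bar>lam V E - (1 - 1 / real q) * real (card V)\<bar> \<le> \<delta> * real (card V)"
      using lo up b1(2) by (simp add: abs_le_iff algebra_simps)
    ultimately show ?thesis by blast
  qed
  then show ?thesis by blast
qed

end

lemma near_turan_mono:
  assumes nt: "near_turan V E q R K \<delta>" and K: "K \<le> K'" and d: "\<delta> \<le> \<delta>'"
  shows "near_turan V E q R K' \<delta>'"
proof -
  have le: "\<delta> * real (card V) \<le> \<delta>' * real (card V)" using d by (rule mult_right_mono) simp
  show ?thesis
    unfolding near_turan_def
  proof (intro conjI allI impI ballI)
    show "sep_parts V E q R" by (rule near_turanD(1)[OF nt])
    show "real (card (V - (\<Union>i<q. R i))) \<le> K'" using near_turanD(2)[OF nt] K by linarith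
    fix i assume i: "i < q"
    show "\<bar>real (card (R i)) - real (card V) / real q\<bar> \<le> \<delta>' * real (card V)"
      using near_turanD(3)[OF nt i] le by linarith
    fix v assume v: "v \<in> R i"
    show "real (card ((\<Union>j<q. R j) - R i - nbrs E v)) \<le> \<delta>' * real (card V)"
      using near_turanD(4)[OF nt i v] le by linarith
  qed
qed

context critical_graph
begin

lemma one_minus_inverse_q: "1 / 2 \<le> 1 - 1 / real q" "1 - 1 / real q \<le> 1"
  using q by (auto simp: field_simps)

text \<open>By switching, an exceptional vertex sees at least the weight of \<open>q - 1\<close>
  classes, and each class has weight about \<open>S / q\<close>.\<close>

lemma outside_weight:
  assumes ex: "extremal V E" and nt: "near_turan V E q R K \<delta>" and K: "K \<le> \<delta> * real (card V)" and V: "V \<noteq> {}"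
    and x0: "\<And>u. 0 \<le> x u" and x1: "\<And>u. u \<in> V \<Longrightarrow> x u \<le> 1"
    and eig: "\<And>u. u \<in> V \<Longrightarrow> adj_sum E x u = lam V E * x u"
    and l: "\<bar>lam V E - (1 - 1 / real q) * real (card V)\<bar> \<le> \<delta> * real (card V)"
    and S: "S = (\<Sum>i<q. sum x (R i))" and d: "0 \<le> \<delta>"
    and big: "real k * (\<delta> * real (card V)) + real k < real (card (R 0))"
    and u: "u \<in> V - (\<Union>i<q. R i)"
  shows "(1 - 1 / real q) * S - 4 * \<delta> * real (card V) \<le> lam V E * x u"
proof -
  note G = extremalD(1)[OF ex] and P = near_turanD(1)[OF nt]
  have q0: "0 < q" using q by simp
  have "sum x ((\<Union>i<q. R i) - R 0) \<le> lam V E * x u"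
  proof (rule extremal_switch[OF ex P _ _ big u x0 eig])
    show "real (card (R 0 - nbrs E v)) \<le> \<delta> * real (card V)" if "0 < j" "j < q" "v \<in> R j" for j v
      using near_turan_miss[OF G nt that(2) q0 _ that(3)] that(1) by simp
  qed (use d in auto)
  moreover have "sum x ((\<Union>i<q. R i) - R 0) = S - sum x (R 0)"
    unfolding S by (rule sum_sep_parts_minus[OF G P q0])
  moreover have "\<bar>sum x (R 0) - S / real q\<bar> \<le> 4 * \<delta> * real (card V)"
    by (rule eigen_concentration(1)[OF G nt K q V x0 x1 eig l S d q0])
  ultimately show ?thesis by (simp add: left_diff_distrib abs_le_iff)
qed

text \<open>For a classified vertex the degree can be read off the structure. An exceptional vertex
  sees a large weight, and the entries that make it up are at most \<open>s + 12 * \<delta>\<close>,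
  so it has many neighbours.\<close>

lemma near_turan_min_degree:
  assumes ex: "extremal V E" and nt: "near_turan V E q R (\<delta> * real (card V)) \<delta>" and V: "V \<noteq> {}"
    and l: "\<bar>lam V E - (1 - 1 / real q) * real (card V)\<bar> \<le> \<delta> * real (card V)"
    and d: "0 \<le> \<delta>" "\<delta> \<le> 1 / 8"
    and big: "real k * (\<delta> * real (card V)) + real k < real (card (R 0))" and u: "u \<in> V"
  shows "(1 - 1 / real q - 68 * \<delta>) * real (card V) \<le> real (card (nbrs E u))"
proof -
  note G = extremalD(1)[OF ex] and P = near_turanD(1)[OF nt]
  note f = simple_graphD(1)[OF G] and Nu = simple_graphD(6)[OF G, of u]
  let ?U = "\<Union>i<q. R i"
  define n where "n = real (card V)"
  have n: "0 < n" using V f by (simp add: n_def card_gt_0_iff)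
  have RV: "R i \<subseteq> V" if "i < q" for i using sep_partsD(1)[OF P that] .
  have UV: "?U \<subseteq> V" using RV by auto
  have fU: "finite ?U" using UV f by (rule finite_subset)
  have W: "real (card (V - ?U)) \<le> \<delta> * n" using near_turanD(2)[OF nt] by (simp add: n_def)
  have dn: "0 \<le> \<delta> * n" using d n by simp
  show ?thesis
  proof (cases "u \<in> ?U")
    case True
    then obtain i where i: "i < q" "u \<in> R i" by blast
    have fR: "finite (R i)" using RV[OF i(1)] f by (rule finite_subset)
    have "V \<subseteq> (V - ?U) \<union> R i \<union> (?U - R i - nbrs E u) \<union> nbrs E u" by blast
    then have "card V \<le> card ((V - ?U) \<union> R i \<union> (?U - R i - nbrs E u) \<union> nbrs E u)"
      using f fR fU simple_graphD(7)[OF G] by (intro card_mono) auto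
    also have "\<dots> \<le> card (V - ?U) + card (R i) + card (?U - R i - nbrs E u) + card (nbrs E u)"
      by (meson card_Un_le add_le_mono1 order_trans)
    finally have "n \<le> real (card (V - ?U)) + real (card (R i)) + real (card (?U - R i - nbrs E u)) + real (card (nbrs E u))"
      unfolding n_def by (simp flip: of_nat_add)
    moreover have "real (card (R i)) \<le> n / real q + \<delta> * n"
      using near_turanD(3)[OF nt i(1)] by (simp add: n_def abs_le_iff)
    moreover have "real (card (?U - R i - nbrs E u)) \<le> \<delta> * n" using near_turanD(4)[OF nt i] by (simp add: n_def)
    ultimately have "n - n / real q - 3 * (\<delta> * n) \<le> real (card (nbrs E u))" using W by linarith
    moreover have "(1 - 1 / real q - 68 * \<delta>) * n = n - n / real q - 68 * (\<delta> * n)" by (simp add: algebra_simps)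
    ultimately have "(1 - 1 / real q - 68 * \<delta>) * n \<le> real (card (nbrs E u))" using dn by linarith
    then show ?thesis by (simp add: n_def)
  next
    case False
    then have uW: "u \<in> V - ?U" using u by blast
    obtain x v0 where x0: "\<And>u. 0 \<le> x u" and x1: "\<And>u. u \<in> V \<Longrightarrow> x u \<le> 1" and v0: "v0 \<in> V" "x v0 = 1"
      and eig: "\<And>u. u \<in> V \<Longrightarrow> adj_sum E x u = lam V E * x u" by (rule perron_max[OF G V]) blast
    define S where "S = (\<Sum>i<q. sum x (R i))"
    define s where "s = S / n"
    have Sn: "S = s * n" using n by (simp add: s_def)
    have "(1 - 1 / real q - 2 * \<delta>) * n \<le> s * n"
      using eigen_concentration(3)[OF G nt order_refl q V x0 x1 eig l S_def d(1) v0] by (simp add: n_def Sn)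
    then have "1 - 1 / real q - 2 * \<delta> \<le> s" using n by simp
    then have s: "1 / 4 \<le> s" using one_minus_inverse_q d by linarith
    have up: "x v \<le> s + 12 * \<delta>" if "v \<in> ?U" for v
    proof -
      obtain i where i: "i < q" "v \<in> R i" using \<open>v \<in> ?U\<close> by blast
      have "\<bar>x v - S / real (card V)\<bar> \<le> 12 * \<delta>"
        by (rule eigen_concentration(2)[OF G nt order_refl q V x0 x1 eig l S_def d(1) i])
      then show ?thesis by (simp add: s_def n_def abs_le_iff)
    qed
    have s12: "0 < s + 12 * \<delta>" using s d by linarith
    have "(1 - 1 / real q) * S - 4 * \<delta> * n \<le> lam V E * x u"
      unfolding n_def by (rule outside_weight[OF ex nt order_refl V x0 x1 eig l S_def d(1) big uW])
    also have "\<dots> = sum x (nbrs E u)" using eig[OF u] by (simp add: adj_sum_def)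
    also have "\<dots> = sum x (nbrs E u \<inter> ?U) + sum x (nbrs E u - ?U)"
      using simple_graphD(7)[OF G] by (rule sum.Int_Diff)
    also have "sum x (nbrs E u - ?U) \<le> \<delta> * n"
    proof -
      have "sum x (nbrs E u - ?U) \<le> real (card (nbrs E u - ?U))"
        using sum_unit_bounds(2)[of "nbrs E u - ?U" x] x0 x1 Nu simple_graphD(7)[OF G] by blast
      moreover have "card (nbrs E u - ?U) \<le> card (V - ?U)" using Nu f by (intro card_mono) auto
      ultimately show ?thesis using W by linarith
    qed
    also have "sum x (nbrs E u \<inter> ?U) \<le> real (card (nbrs E u \<inter> ?U)) * (s + 12 * \<delta>)"
      using up by (intro sum_bounded_above) auto
    also have "\<dots> \<le> real (card (nbrs E u)) * (s + 12 * \<delta>)"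
      using s12 simple_graphD(7)[OF G, of u] by (intro mult_right_mono) (auto intro: card_mono)
    finally have main: "(1 - 1 / real q) * S - 5 * (\<delta> * n) \<le> real (card (nbrs E u)) * (s + 12 * \<delta>)" by simp
    define b where "b = 1 - 1 / real q"
    \<comment> \<open>From \<open>s \<ge> 1/4\<close> and \<open>b \<le> 1\<close>, the linear error
      is at most \<open>12 * \<delta> - 17 * \<delta>\<close>; this is the origin of
      \<open>68 = 4 * (12 + 5)\<close>.\<close>
    have "(b - 68 * \<delta>) * (s + 12 * \<delta>) \<le> b * s - 5 * \<delta>"
    proof -
      have "b * \<delta> \<le> 1 * \<delta>" using one_minus_inverse_q d by (intro mult_right_mono) (auto simp: b_def)
      moreover have "1 / 4 * \<delta> \<le> s * \<delta>" using s d by (intro mult_right_mono) auto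
      moreover have "0 \<le> \<delta> * \<delta>" by simp
      moreover have "(b - 68 * \<delta>) * (s + 12 * \<delta>) = b * s + 12 * (b * \<delta>) - 68 * (s * \<delta>) - 816 * (\<delta> * \<delta>)"
        by (simp add: algebra_simps)
      ultimately show ?thesis by linarith
    qed
    then have "(b - 68 * \<delta>) * (s + 12 * \<delta>) * n \<le> (b * s - 5 * \<delta>) * n" using n by (intro mult_right_mono) auto
    also have "\<dots> = b * S - 5 * (\<delta> * n)" by (simp add: Sn algebra_simps)
    also have "\<dots> \<le> real (card (nbrs E u)) * (s + 12 * \<delta>)" using main by (simp add: b_def)
    finally have "((b - 68 * \<delta>) * n) * (s + 12 * \<delta>) \<le> real (card (nbrs E u)) * (s + 12 * \<delta>)" by (simp add: mult_ac)
    then have "(b - 68 * \<delta>) * n \<le> real (card (nbrs E u))" using s12 by (rule mult_right_le_imp_le)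
    then show ?thesis by (simp add: n_def b_def)
  qed
qed

text \<open>With this bound for all of \<open>V\<close> no vertex has to be deleted any more, and
  \<open>near_turan_structure\<close> applies to the extremal graph itself.\<close>

lemma extremal_min_degree:
  fixes \<epsilon> :: real
  assumes eps: "0 < \<epsilon>"
  shows "\<exists>n0. \<forall>V E. extremal V E \<longrightarrow> n0 \<le> card V \<longrightarrow>
    (\<forall>u\<in>V. (1 - 1 / real q - \<epsilon>) * real (card V) \<le> real (card (nbrs E u)))"
proof -
  \<comment> \<open>The term \<open>\<epsilon> / 68\<close> pays for the loss in
    \<open>near_turan_min_degree\<close>; the last term keeps \<open>R 0\<close> as large as
    \<open>switch_free\<close> requires.\<close>
  define \<delta> where "\<delta> = min (\<epsilon> / 68) (min (1 / 8) (1 / (4 * real q * (real k + 1))))"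
  have qk: "0 < 4 * real q * (real k + 1)" using q by simp
  have d: "0 < \<delta>" "\<delta> \<le> 1 / 8" "\<delta> \<le> \<epsilon> / 68" using eps qk by (auto simp: \<delta>_def)
  then have d68: "68 * \<delta> \<le> \<epsilon>" by simp
  have "\<delta> \<le> 1 / (4 * real q * (real k + 1))" by (auto simp: \<delta>_def)
  then have dk: "\<delta> * (4 * real q * (real k + 1)) \<le> 1" using qk by (simp add: pos_le_divide_eq)
  obtain n1 where n1: "\<And>V E. extremal V E \<Longrightarrow> n1 \<le> card V \<Longrightarrow>
    (\<exists>R. near_turan V E q R (\<delta> * real (card V)) \<delta>) \<and>
    \<bar>lam V E - (1 - 1 / real q) * real (card V)\<bar> \<le> \<delta> * real (card V)"
    using extremal_near_turan[OF d(1)] by blast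
  have "\<forall>u\<in>V. (1 - 1 / real q - \<epsilon>) * real (card V) \<le> real (card (nbrs E u))"
    if ex: "extremal V E" and big: "n1 + 2 * q * k + 1 \<le> card V" for V E
  proof
    fix u assume u: "u \<in> V"
    have V: "V \<noteq> {}" using u by blast
    define n where "n = real (card V)"
    obtain R where R: "near_turan V E q R (\<delta> * real (card V)) \<delta>"
      and l: "\<bar>lam V E - (1 - 1 / real q) * real (card V)\<bar> \<le> \<delta> * real (card V)"
      using n1[OF ex] big by auto
    have q0: "0 < q" using q by simp
    have nbig: "2 * real q * real k < n"
    proof -
      have "2 * q * k < card V" using big by simp
      then have "real (2 * q * k) < n" unfolding n_def by (simp only: of_nat_less_iff)
      then show ?thesis by simp
    qed
    have "n / real q - \<delta> * n \<le> real (card (R 0))"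
      using near_turanD(3)[OF R q0] by (simp add: n_def abs_le_iff)
    moreover have "real k * (\<delta> * n) + real k < n / real q - \<delta> * n"
    proof -
      have n: "0 \<le> n" by (simp add: n_def)
      have "\<delta> * (4 * real q * (real k + 1)) * n \<le> 1 * n" using dk n by (rule mult_right_mono)
      then have "4 * (real q * ((real k + 1) * (\<delta> * n))) \<le> n" by (simp add: mult_ac)
      then have "real q * ((real k + 1) * (\<delta> * n) + real k) < n" using nbig n by (simp add: distrib_left) 
      then have "(real k + 1) * (\<delta> * n) + real k < n / real q" using q0 by (simp add: pos_less_divide_eq mult.commute)
      then show ?thesis by (simp add: algebra_simps)
    qed
    ultimately have "real k * (\<delta> * real (card V)) + real k < real (card (R 0))" by (simp add: n_def)
    from near_turan_min_degree[OF ex R V l _ d(2) this u] d(1)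
    have "(1 - 1 / real q - 68 * \<delta>) * real (card V) \<le> real (card (nbrs E u))" by simp
    moreover have "(1 - 1 / real q - \<epsilon>) * real (card V) \<le> (1 - 1 / real q - 68 * \<delta>) * real (card V)"
      using d68 by (intro mult_right_mono) auto
    ultimately show "(1 - 1 / real q - \<epsilon>) * real (card V) \<le> real (card (nbrs E u))" by linarith
  qed
  then show ?thesis by blast
qed

text \<open>Serves to enlarge the exceptional set on purpose, so that it has room for
  \<open>t - 1\<close> vertices.\<close>

lemma near_turan_shrink:
  assumes G: "simple_graph V E" and nt: "near_turan V E q R K \<delta>" and X: "X \<subseteq> R 0" and q0: "0 < q"
    and c: "real (card X) \<le> c" "c \<le> \<delta> * real (card V)" and d: "0 \<le> \<delta>"
  shows "near_turan V E q (R(0 := R 0 - X)) (K + c) (2 * \<delta>)"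
proof -
  note f = simple_graphD(1)[OF G] and P = near_turanD(1)[OF nt]
  have RV: "R i \<subseteq> V" if "i < q" for i using sep_partsD(1)[OF P that] .
  let ?R = "R(0 := R 0 - X)"
  have fX: "finite X" using X RV[OF q0] f by (meson finite_subset)
  have dn: "0 \<le> \<delta> * real (card V)" using d by simp
  have sub: "?R i \<subseteq> R i" for i by simp
  have "sep_parts V E q ?R"
    unfolding sep_parts_def
  proof (intro conjI allI impI)
    fix i assume i: "i < q"
    show "?R i \<subseteq> V" using RV[OF i] sub[of i] by blast
    show "stable_set E (?R i)" using sep_partsD(2)[OF P i] sub[of i] unfolding stable_set_def by blast
    fix j assume j: "j < q" "i \<noteq> j"
    show "?R i \<inter> ?R j = {}" using sep_partsD(3)[OF P i j] sub[of i] sub[of j] by blast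
  qed
  moreover have "real (card (V - (\<Union>i<q. ?R i))) \<le> K + c"
  proof -
    have "V - (\<Union>i<q. ?R i) \<subseteq> (V - (\<Union>i<q. R i)) \<union> X" by (auto split: if_splits)
    then have "card (V - (\<Union>i<q. ?R i)) \<le> card ((V - (\<Union>i<q. R i)) \<union> X)" using f fX by (intro card_mono) auto
    also have "\<dots> \<le> card (V - (\<Union>i<q. R i)) + card X" by (rule card_Un_le)
    finally show ?thesis using near_turanD(2)[OF nt] c by linarith
  qed
  moreover have "\<bar>real (card (?R i)) - real (card V) / real q\<bar> \<le> 2 * \<delta> * real (card V)" if i: "i < q" for i
  proof -
    have "\<bar>real (card (?R i)) - real (card (R i))\<bar> \<le> c"
    proof (cases "i = 0")
      case True
      have "card (R 0 - X) = card (R 0) - card X" "card X \<le> card (R 0)"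
        using card_Diff_subset[OF fX X] card_mono[OF finite_subset[OF RV[OF q0] f] X] by auto
      then show ?thesis using True c by (simp add: of_nat_diff)
    next
      case False
      then show ?thesis using c by simp
    qed
    then show ?thesis using near_turanD(3)[OF nt i] c by linarith
  qed
  moreover have "real (card ((\<Union>j<q. ?R j) - ?R i - nbrs E v)) \<le> 2 * \<delta> * real (card V)" if i: "i < q" and v: "v \<in> ?R i" for i v
  proof -
    have "(\<Union>j<q. ?R j) - ?R i - nbrs E v \<subseteq> (\<Union>j<q. R j) - R i - nbrs E v"
    proof
      fix y assume y: "y \<in> (\<Union>j<q. ?R j) - ?R i - nbrs E v"
      then obtain j where j: "j < q" "y \<in> ?R j" by blast
      then have ji: "j \<noteq> i" using y by blast
      have "y \<in> R j" using j(2) sub[of j] by blast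
      moreover have "R i \<inter> R j = {}" using sep_partsD(3)[OF P i j(1)] ji by auto
      ultimately show "y \<in> (\<Union>j<q. R j) - R i - nbrs E v" using y j(1) by blast
    qed
    moreover have "finite (\<Union>j<q. R j)" using RV f by (auto intro: finite_subset)
    ultimately have "card ((\<Union>j<q. ?R j) - ?R i - nbrs E v) \<le> card ((\<Union>j<q. R j) - R i - nbrs E v)"
      by (intro card_mono) auto
    moreover have "v \<in> R i" using v sub[of i] by blast
    ultimately show ?thesis using near_turanD(4)[OF nt i] dn by fastforce
  qed
  ultimately show ?thesis unfolding near_turan_def by blast
qed

text \<open>The second pass. The minimum degree brings the exceptional set down to a constant
  independent of \<delta>; afterwards \<open>t - 1\<close> vertices of \<open>R 0\<close> are moved
  into it, because the multipartite competitor takes its universal vertices from there.\<close>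

theorem extremal_structure:
  "\<exists>K::nat. \<forall>\<delta>>0. \<exists>n0. \<forall>V E. extremal V E \<longrightarrow> n0 \<le> card V \<longrightarrow>
    (\<exists>R. near_turan V E q R (real K) \<delta> \<and> t - 1 \<le> card (V - (\<Union>i<q. R i))) \<and>
    \<bar>lam V E - (1 - 1 / real q) * real (card V)\<bar> \<le> \<delta> * real (card V) \<and>
    (\<forall>u\<in>V. (1 - 1 / real q - \<delta>) * real (card V) \<le> real (card (nbrs E u)))"
proof -
  have "\<exists>K::nat. \<forall>\<delta>>0. \<exists>\<epsilon>>0. \<exists>n0. \<forall>V::nat set. \<forall>E. simple_graph V E \<longrightarrow> pattern_free q t N V E \<longrightarrow>
    n0 \<le> card V \<longrightarrow> (\<forall>u\<in>V. (1 - 1 / real q - \<epsilon>) * real (card V) \<le> real (card (nbrs E u))) \<longrightarrow>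
    (\<exists>R. near_turan V E q R (real K) \<delta>)"
    by (rule near_turan_structure[OF q t N])
  then obtain K :: nat where K: "\<forall>\<delta>>0. \<exists>\<epsilon>>0. \<exists>n0. \<forall>V::nat set. \<forall>E. simple_graph V E \<longrightarrow> pattern_free q t N V E \<longrightarrow>
    n0 \<le> card V \<longrightarrow> (\<forall>u\<in>V. (1 - 1 / real q - \<epsilon>) * real (card V) \<le> real (card (nbrs E u))) \<longrightarrow>
    (\<exists>R. near_turan V E q R (real K) \<delta>)" ..
  have "\<exists>n0. \<forall>V E. extremal V E \<longrightarrow> n0 \<le> card V \<longrightarrow>
    (\<exists>R. near_turan V E q R (real (K + t)) \<delta> \<and> t - 1 \<le> card (V - (\<Union>i<q. R i))) \<and>
    \<bar>lam V E - (1 - 1 / real q) * real (card V)\<bar> \<le> \<delta> * real (card V) \<and>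
    (\<forall>u\<in>V. (1 - 1 / real q - \<delta>) * real (card V) \<le> real (card (nbrs E u)))" if d: "0 < \<delta>" for \<delta> :: real
  proof -
    \<comment> \<open>Half of \<delta>, as \<open>near_turan_shrink\<close> doubles the error; the
      bound \<open>1 / (2 * q)\<close> leaves enough vertices in \<open>R 0\<close> to remove
      \<open>t - 1\<close>.\<close>
    define \<delta>' where "\<delta>' = min (\<delta> / 2) (1 / (2 * real q))"
    have d': "0 < \<delta>'" using d q by (simp add: \<delta>'_def)
    have d'1: "2 * \<delta>' \<le> \<delta>" "\<delta>' \<le> 1 / (2 * real q)" unfolding \<delta>'_def by linarith+
    obtain \<epsilon> nS where eps: "0 < \<epsilon>" and nS: "\<And>(V::nat set) E. simple_graph V E \<Longrightarrow> pattern_free q t N V E \<Longrightarrow>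
      nS \<le> card V \<Longrightarrow> (\<forall>u\<in>V. (1 - 1 / real q - \<epsilon>) * real (card V) \<le> real (card (nbrs E u))) \<Longrightarrow>
      (\<exists>R. near_turan V E q R (real K) \<delta>')"
      using K d' by metis
    obtain n1 where n1: "\<And>V E. extremal V E \<Longrightarrow> n1 \<le> card V \<Longrightarrow>
      (\<forall>u\<in>V. (1 - 1 / real q - \<epsilon>) * real (card V) \<le> real (card (nbrs E u)))"
      using extremal_min_degree[OF eps] by blast
    obtain n2 where n2: "\<And>V E. extremal V E \<Longrightarrow> n2 \<le> card V \<Longrightarrow>
      (\<forall>u\<in>V. (1 - 1 / real q - \<delta>) * real (card V) \<le> real (card (nbrs E u)))"
      using extremal_min_degree[OF d] by blast
    obtain n3 where n3: "\<And>V E. extremal V E \<Longrightarrow> n3 \<le> card V \<Longrightarrow>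
      \<bar>lam V E - (1 - 1 / real q) * real (card V)\<bar> \<le> \<delta> * real (card V)"
      using extremal_near_turan[OF d] by blast
    define n0 where "n0 = nS + n1 + n2 + n3 + nat \<lceil>real t / \<delta>'\<rceil>"
    have "\<exists>R. near_turan V E q R (real (K + t)) \<delta> \<and> t - 1 \<le> card (V - (\<Union>i<q. R i))"
      if ex: "extremal V E" and big: "n0 \<le> card V" for V E
    proof -
      note G = extremalD(1)[OF ex]
      note f = simple_graphD(1)[OF G]
      obtain R where R: "near_turan V E q R (real K) \<delta>'"
        using nS[OF G extremal_pattern_free[OF ex]] n1[OF ex] big unfolding n0_def by auto
      have q0: "0 < q" using q by simp
      have "real t / \<delta>' \<le> real (card V)" using big unfolding n0_def by linarith
      then have tn: "real t \<le> \<delta>' * real (card V)" using d' by (simp add: divide_le_eq mult.commute)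
      have "real (card V) / real q - \<delta>' * real (card V) \<le> real (card (R 0))"
        using near_turanD(3)[OF R q0] by (simp add: abs_le_iff)
      moreover have "2 * \<delta>' * real (card V) \<le> real (card V) / real q"
        using mult_right_mono[OF d'1(2), of "real (card V)"] q0 by (simp add: field_simps)
      ultimately have "real t \<le> real (card (R 0))" using tn by linarith
      then have "t - 1 \<le> card (R 0)" by simp
      then obtain X where X: "X \<subseteq> R 0" "card X = t - 1" by (meson obtain_subset_with_card_n)
      let ?R = "R(0 := R 0 - X)"
      have nt: "near_turan V E q ?R (real K + real t) (2 * \<delta>')"
        using near_turan_shrink[OF G R X(1) q0 _ tn] X(2) d' by simp
      have "near_turan V E q ?R (real (K + t)) \<delta>"
        by (rule near_turan_mono[OF nt]) (use d'1 in auto)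
      moreover have "t - 1 \<le> card (V - (\<Union>i<q. ?R i))"
      proof -
        have "X \<inter> R i = {}" if "i < q" "i \<noteq> 0" for i
          using sep_partsD(3)[OF near_turanD(1)[OF R] that(1) q0 that(2)] X(1) by blast
        then have "X \<subseteq> V - (\<Union>i<q. ?R i)"
          using X(1) sep_partsD(1)[OF near_turanD(1)[OF R] q0] by auto
        then have "card X \<le> card (V - (\<Union>i<q. ?R i))" using f by (intro card_mono) auto
        then show ?thesis using X(2) by simp
      qed
      ultimately show ?thesis by blast
    qed
    moreover have "n2 \<le> n0" "n3 \<le> n0" by (auto simp: n0_def)
    ultimately show ?thesis using n2 n3 by (intro exI[of _ n0]) (meson order_trans)
  qed
  then show ?thesis by blast
qed

end

subsection \<open>Universal vertices\<close>

text \<open>Put \<open>z = e - b * s\<close>. Up to \<epsilon>, \<open>z\<close> lies between 0 and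
  \<open>c\<close>, so each \<open>z * (c - z)\<close> is nearly nonnegative, whereas
  \<open>sum1\<close> and \<open>sum2\<close> bound their total by \<open>4 * \<epsilon>\<close>.
  Hence every \<open>z\<close> is close to 0 or to \<open>c\<close>, and a sum of squares near
  \<open>h * c^2\<close> takes \<open>h\<close> values near \<open>c\<close>.\<close>

lemma top_values_arith:
  fixes e :: "'a \<Rightarrow> real" and s b c \<epsilon> \<gamma> :: real
  assumes W: "finite W" and bc: "s = b * s + c" "0 < c" "0 \<le> b" "b \<le> 1" "0 \<le> s" "s \<le> 1"
    and up: "\<And>w. w \<in> W \<Longrightarrow> e w \<le> s" and lo: "\<And>w. w \<in> W \<Longrightarrow> b * s - \<epsilon> \<le> e w"
    and sum1: "sum e W \<le> real (card W) * (b * s) + real h * c + \<epsilon>"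
    and sum2: "real h * s\<^sup>2 + (real (card W) - real h) * (b * s)\<^sup>2 - \<epsilon> \<le> (\<Sum>w\<in>W. (e w)\<^sup>2)"
    and eps: "0 \<le> \<epsilon>" "\<epsilon> \<le> 1" and gam: "0 < \<gamma>" "\<gamma> \<le> 1"
    and small: "3 * \<epsilon> + real (card W) * ((4 + 2 * real (card W)) * \<epsilon> / \<gamma>)\<^sup>2 < c\<^sup>2"
  shows "h \<le> card {w \<in> W. s - \<gamma> \<le> e w}"
proof (rule ccontr)
  assume "\<not> ?thesis"
  then have lt: "card {w \<in> W. s - \<gamma> \<le> e w} + 1 \<le> h" by simp
  define C where "C = {w \<in> W. s - \<gamma> \<le> e w}"
  define K where "K = real (card W)"
  define z where "z w = e w - b * s" for w
  have bs: "0 \<le> b * s" "b * s \<le> 1" using bc by (auto intro: mult_le_one)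
  have c1: "c \<le> 1" using bc bs by linarith
  have zc: "z w \<le> c" "- \<epsilon> \<le> z w" if "w \<in> W" for w using up[OF that] lo[OF that] bc(1) by (auto simp: z_def)
  have sz: "sum z W \<le> real h * c + \<epsilon>" using sum1 by (simp add: z_def sum_subtractf)
  have "(\<Sum>w\<in>W. (z w)\<^sup>2) = (\<Sum>w\<in>W. (e w)\<^sup>2 - 2 * (b * s) * z w - (b * s)\<^sup>2)"
    by (intro sum.cong) (auto simp: z_def power2_eq_square algebra_simps)
  also have "\<dots> = (\<Sum>w\<in>W. (e w)\<^sup>2) - 2 * (b * s) * sum z W - K * (b * s)\<^sup>2"
    by (simp add: sum_subtractf sum_distrib_left K_def)
  finally have z2: "(\<Sum>w\<in>W. (z w)\<^sup>2) = (\<Sum>w\<in>W. (e w)\<^sup>2) - 2 * (b * s) * sum z W - K * (b * s)\<^sup>2" .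
  have "2 * (b * s) * sum z W \<le> 2 * (b * s) * (real h * c + \<epsilon>)" using sz bs by (intro mult_left_mono) auto
  also have "\<dots> \<le> 2 * (b * s) * (real h * c) + 2 * \<epsilon>"
    using mult_right_mono[OF bs(2), of \<epsilon>] eps by (simp add: distrib_left)
  finally have t1: "2 * (b * s) * sum z W \<le> 2 * (b * s) * (real h * c) + 2 * \<epsilon>" .
  have "s\<^sup>2 = (b * s + c)\<^sup>2" using bc(1) by simp
  then have s2: "s\<^sup>2 = (b * s)\<^sup>2 + 2 * (b * s) * c + c\<^sup>2" by (simp add: power2_sum)
  have "real h * s\<^sup>2 = real h * (b * s)\<^sup>2 + 2 * (b * s) * (real h * c) + real h * c\<^sup>2"
    unfolding s2 by (simp add: algebra_simps)
  moreover have "(K - real h) * (b * s)\<^sup>2 = K * (b * s)\<^sup>2 - real h * (b * s)\<^sup>2" by (simp add: left_diff_distrib)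
  ultimately have z2lo: "real h * c\<^sup>2 - 3 * \<epsilon> \<le> (\<Sum>w\<in>W. (z w)\<^sup>2)"
    using z2 t1 sum2 unfolding K_def[symmetric] by linarith
  have zq: "- 2 * \<epsilon> \<le> z w * (c - z w)" if w: "w \<in> W" for w
  proof (cases "0 \<le> z w")
    case True
    then have "0 \<le> z w * (c - z w)" using zc[OF w] by simp
    then show ?thesis using eps by linarith
  next
    case False
    have "(- z w) * (c - z w) \<le> \<epsilon> * 2" using False zc[OF w] c1 eps by (intro mult_mono) auto
    then show ?thesis by simp
  qed
  have "(\<Sum>w\<in>W. z w * (c - z w)) = c * sum z W - (\<Sum>w\<in>W. (z w)\<^sup>2)"
    by (simp add: right_diff_distrib sum_subtractf sum_distrib_left power2_eq_square mult.commute)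
  also have "\<dots> \<le> c * (real h * c + \<epsilon>) - (real h * c\<^sup>2 - 3 * \<epsilon>)"
    using sz z2lo bc by (intro diff_mono mult_left_mono) auto
  also have "\<dots> = c * \<epsilon> + 3 * \<epsilon>" by (simp add: power2_eq_square algebra_simps)
  also have "\<dots> \<le> 4 * \<epsilon>" using mult_right_mono[OF c1 eps(1)] by simp
  finally have tot: "(\<Sum>w\<in>W. z w * (c - z w)) \<le> 4 * \<epsilon>" .
  define \<kappa> where "\<kappa> = (4 + 2 * K) * \<epsilon>"
  have each: "z w * (c - z w) \<le> \<kappa>" if w: "w \<in> W" for w
  proof -
    have "(\<Sum>w\<in>W. z w * (c - z w)) = z w * (c - z w) + (\<Sum>w\<in>W - {w}. z w * (c - z w))"
      using W w by (rule sum.remove)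
    moreover have "real (card (W - {w})) * (- 2 * \<epsilon>) \<le> (\<Sum>w\<in>W - {w}. z w * (c - z w))"
      using zq by (intro sum_bounded_below) auto
    moreover have "K * (- 2 * \<epsilon>) \<le> real (card (W - {w})) * (- 2 * \<epsilon>)"
      unfolding K_def using W eps by (intro mult_right_mono_neg) (auto intro: card_mono)
    ultimately show ?thesis using tot by (simp add: \<kappa>_def algebra_simps)
  qed
  have K0: "0 \<le> K" by (simp add: K_def)
  have kap: "\<epsilon> \<le> \<kappa> / \<gamma>"
  proof -
    have "\<epsilon> * \<gamma> \<le> \<epsilon> * 1" using gam eps by (intro mult_left_mono) auto
    also have "\<dots> \<le> \<kappa>" using eps K0 by (simp add: \<kappa>_def distrib_right)
    finally show ?thesis using gam by (simp add: pos_le_divide_eq)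
  qed
  have out: "(z w)\<^sup>2 \<le> (\<kappa> / \<gamma>)\<^sup>2" if w: "w \<in> W - C" for w
  proof -
    have "e w < s - \<gamma>" using w by (auto simp: C_def)
    then have gz: "\<gamma> \<le> c - z w" using bc(1) by (simp add: z_def)
    have "z w \<le> \<kappa> / \<gamma>"
    proof (cases "0 \<le> z w")
      case True
      have "z w * \<gamma> \<le> z w * (c - z w)" using gz True by (rule mult_left_mono)
      then have "z w * \<gamma> \<le> \<kappa>" using each[of w] w by simp
      then show ?thesis using gam by (simp add: pos_le_divide_eq)
    next
      case False
      then show ?thesis using kap eps by linarith
    qed
    moreover have "- (\<kappa> / \<gamma>) \<le> z w" using zc(2)[of w] w kap by simp
    ultimately have "\<bar>z w\<bar> \<le> \<kappa> / \<gamma>" by (simp add: abs_le_iff)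
    then have "\<bar>z w\<bar>\<^sup>2 \<le> (\<kappa> / \<gamma>)\<^sup>2" by (intro power_mono) auto
    then show ?thesis by simp
  qed
  have inn: "(z w)\<^sup>2 \<le> c\<^sup>2" if w: "w \<in> C" for w
  proof -
    have wW: "w \<in> W" using w by (simp add: C_def)
    show ?thesis
    proof (cases "0 \<le> z w")
      case True
      then show ?thesis using zc(1)[OF wW] by (intro power_mono)
    next
      case False
      have "\<epsilon>\<^sup>2 \<le> 1 * \<epsilon>" unfolding power2_eq_square using eps by (intro mult_right_mono) auto
      moreover have "0 \<le> K * ((4 + 2 * K) * \<epsilon> / \<gamma>)\<^sup>2" using K0 by simp
      ultimately have "\<epsilon>\<^sup>2 \<le> c\<^sup>2" using small eps unfolding K_def[symmetric] by linarith
      moreover have "(- z w)\<^sup>2 \<le> \<epsilon>\<^sup>2" using False zc(2)[OF wW] by (intro power_mono) auto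
      ultimately show ?thesis by simp
    qed
  qed
  have CW: "C \<subseteq> W" by (auto simp: C_def)
  have "(\<Sum>w\<in>W. (z w)\<^sup>2) = (\<Sum>w\<in>W - C. (z w)\<^sup>2) + (\<Sum>w\<in>C. (z w)\<^sup>2)"
    using W CW by (rule sum.subset_diff[rotated])
  also have "\<dots> \<le> real (card (W - C)) * (\<kappa> / \<gamma>)\<^sup>2 + real (card C) * c\<^sup>2"
    using out inn by (intro add_mono sum_bounded_above) auto
  also have "\<dots> \<le> K * (\<kappa> / \<gamma>)\<^sup>2 + (real h - 1) * c\<^sup>2"
    unfolding K_def using lt W by (intro add_mono mult_right_mono) (auto simp: C_def intro: card_mono)
  finally have "c\<^sup>2 \<le> 3 * \<epsilon> + K * (\<kappa> / \<gamma>)\<^sup>2" using z2lo by (simp add: left_diff_distrib)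
  then show False using small by (simp add: \<kappa>_def K_def)
qed

section \<open>Upper and lower bounds for the weights seen from the exceptional set\<close>

context critical_graph
begin

text \<open>Each class is split into cells by the trace on \<open>W\<close>, and \<open>T i\<close>
  is a largest trace among the cells of at least \<open>m\<close> vertices. If \<open>t\<close>
  vertices of \<open>W\<close> lay in every \<open>T i\<close>, complete parts chosen inside those
  cells would form a pattern. So all but \<open>t - 1\<close> vertices of \<open>W\<close> are
  absent from some \<open>T i\<close>, which bounds the sum of the \<open>card (T i)\<close>; the
  cells below \<open>m\<close> account for the last term.\<close>

lemma popular_weight_bound:
  fixes x :: "nat \<Rightarrow> real"
  assumes G: "simple_graph V E" and pf: "pattern_free q t N V E" and nt: "near_turan V E q R K \<delta>"
    and W: "W = V - (\<Union>i<q. R i)"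
    and x0: "\<And>u. 0 \<le> x u" and x1: "\<And>u. u \<in> V \<Longrightarrow> x u \<le> 1" and d: "0 \<le> \<delta>"
    and \<sigma>: "\<And>i. i < q \<Longrightarrow> sum x (R i) \<le> \<sigma>" "0 \<le> \<sigma>"
    and m: "real N + real q * real N * (\<delta> * real (card V)) \<le> real m" "0 < m"
    and big: "\<And>i. i < q \<Longrightarrow> 2 ^ card W * m \<le> card (R i)"
  shows "(\<Sum>w\<in>W. sum x (nbrs E w - W)) \<le>
    \<sigma> * (real (card W) * (real q - 1) + (real t - 1)) + real q * (real (card W) * (2 ^ card W * real m))"
proof -
  note f = simple_graphD(1)[OF G] and P = near_turanD(1)[OF nt]
  have RV: "R i \<subseteq> V" if "i < q" for i using sep_partsD(1)[OF P that] .
  have fR: "finite (R i)" if "i < q" for i using RV[OF that] f by (rule finite_subset)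
  have fW: "finite W" "W \<subseteq> V" using f by (auto simp: W)
  define cell where "cell i T = {v \<in> R i. nbrs E v \<inter> W = T}" for i T
  have "\<exists>T\<subseteq>W. m \<le> card (cell i T) \<and> (\<forall>T'\<subseteq>W. m \<le> card (cell i T') \<longrightarrow> card T' \<le> card T)" if i: "i < q" for i
  proof -
    define \<T> where "\<T> = {T. T \<subseteq> W \<and> m \<le> card (cell i T)}"
    have fin: "finite \<T>" using fW by (simp add: \<T>_def)
    obtain T where T: "T \<subseteq> W" "card (R i) \<le> 2 ^ card W * card {v \<in> R i. nbrs E v \<inter> W = T}"
      by (rule popular_type[OF fR[OF i] fW(1), of "\<lambda>v. nbrs E v \<inter> W"]) auto
    then have "2 ^ card W * m \<le> 2 ^ card W * card (cell i T)" using big[OF i] unfolding cell_def by linarith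
    then have "T \<in> \<T>" using T(1) by (simp add: \<T>_def)
    then have ne: "card ` \<T> \<noteq> {}" "finite (card ` \<T>)" using fin by auto
    obtain T0 where T0: "T0 \<in> \<T>" "card T0 = Max (card ` \<T>)" using Max_in[OF ne(2,1)] by (metis imageE)
    have "card T' \<le> card T0" if "T' \<in> \<T>" for T' unfolding T0(2) using ne(2) that by (intro Max_ge) auto
    then show ?thesis using T0(1) by (auto simp: \<T>_def)
  qed
  then obtain T where T: "\<And>i. i < q \<Longrightarrow> T i \<subseteq> W \<and> m \<le> card (cell i (T i)) \<and>
      (\<forall>T'\<subseteq>W. m \<le> card (cell i T') \<longrightarrow> card T' \<le> card (T i))" by metis
  define F where "F = {w \<in> W. \<forall>i<q. w \<in> T i}"
  have cF: "card F \<le> t - 1"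
  proof (rule ccontr)
    assume "\<not> ?thesis"
    then have tF: "t \<le> card F" using t by simp
    obtain B where B: "complete_parts V E q N B" "\<And>i. i < q \<Longrightarrow> B i \<subseteq> cell i (T i)"
    proof (rule greedy_complete_parts[OF G, of q "\<lambda>i. cell i (T i)" "\<delta> * real (card V)" N])
      show "cell i (T i) \<subseteq> V" if "i < q" for i using RV[OF that] by (auto simp: cell_def)
      show "real (card (cell j (T j) - nbrs E v)) \<le> \<delta> * real (card V)"
        if "i < q" "j < q" "i \<noteq> j" "v \<in> cell i (T i)" for i j v
      proof -
        have "card (cell j (T j) - nbrs E v) \<le> card (R j - nbrs E v)"
          using fR[OF that(2)] by (intro card_mono) (auto simp: cell_def)
        moreover have "real (card (R j - nbrs E v)) \<le> \<delta> * real (card V)"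
          using near_turan_miss[OF G nt that(1-3)] that(4) by (auto simp: cell_def)
        ultimately show ?thesis by linarith
      qed
      show "real N + real q * real N * (\<delta> * real (card V)) \<le> real (card (cell i (T i)))" if "i < q" for i
        using m T[OF that] by linarith
    qed (use d in auto)
    have FV: "F \<subseteq> V" "finite F" using fW by (auto simp: F_def)
    show False
    proof (rule pattern_free_universal[OF pf _ B(1) FV tF])
      fix i u v assume i: "i < q" and "u \<in> F" "v \<in> B i"
      then have "u \<in> nbrs E v \<inter> W" using B(2)[OF i] by (auto simp: F_def cell_def)
      then show "E u v" using simple_graphD(5)[OF G] by (auto simp: nbrs_def)
    qed (use q in simp)
  qed
  have row: "sum x (nbrs E w - W) = (\<Sum>i<q. \<Sum>v\<in>R i. if E w v then x v else 0)" for w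
  proof -
    have "nbrs E w - W = {v \<in> (\<Union>i<q. R i). E w v}"
      using simple_graphD(6)[OF G, of w] RV by (auto simp: W nbrs_def)
    moreover have "sum x {v \<in> (\<Union>i<q. R i). E w v} = (\<Sum>v\<in>(\<Union>i<q. R i). if E w v then x v else 0)"
      by (rule sum.inter_filter) (use fR in auto)
    ultimately have "sum x (nbrs E w - W) = (\<Sum>v\<in>(\<Union>i<q. R i). if E w v then x v else 0)" by (simp only:)
    also have "\<dots> = (\<Sum>i<q. \<Sum>v\<in>R i. if E w v then x v else 0)" by (rule sum_sep_parts[OF G P])
    finally show ?thesis .
  qed
  have part: "(\<Sum>w\<in>W. \<Sum>v\<in>R i. if E w v then x v else 0) \<le> \<sigma> * real (card (T i)) + real (card W) * (2 ^ card W * real m)"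
    if i: "i < q" for i
  proof -
    have "(\<Sum>w\<in>W. \<Sum>v\<in>R i. if E w v then x v else 0) = (\<Sum>v\<in>R i. \<Sum>w\<in>W. if E w v then x v else 0)"
      by (rule sum.swap)
    also have "\<dots> = (\<Sum>v\<in>R i. x v * real (card (nbrs E v \<inter> W)))"
    proof (rule sum.cong[OF refl])
      fix v assume "v \<in> R i"
      have "{w \<in> W. E w v} = nbrs E v \<inter> W" using simple_graphD(5)[OF G] by (auto simp: nbrs_def)
      then show "(\<Sum>w\<in>W. if E w v then x v else 0) = x v * real (card (nbrs E v \<inter> W))"
        using fW by (simp add: sum.inter_filter[symmetric])
    qed
    also have "\<dots> = (\<Sum>T'\<in>Pow W. \<Sum>v\<in>{v \<in> R i. nbrs E v \<inter> W = T'}. x v * real (card (nbrs E v \<inter> W)))"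
      using fR[OF i] fW by (intro sum.group[symmetric]) auto
    also have "\<dots> = (\<Sum>T'\<in>Pow W. sum x (cell i T') * real (card T'))"
      by (intro sum.cong refl) (simp add: cell_def sum_distrib_right)
    also have "\<dots> \<le> (\<Sum>T'\<in>Pow W. sum x (cell i T') * real (card (T i)) + real m * real (card W))"
    proof (intro sum_mono)
      fix T' assume "T' \<in> Pow W"
      then have T': "T' \<subseteq> W" by simp
      have cell: "0 \<le> sum x (cell i T')" "sum x (cell i T') \<le> real (card (cell i T'))"
        using sum_unit_bounds[of "cell i T'" x] fR[OF i] x0 x1 RV[OF i] by (auto simp: cell_def)
      show "sum x (cell i T') * real (card T') \<le> sum x (cell i T') * real (card (T i)) + real m * real (card W)"
      proof (cases "m \<le> card (cell i T')")
        case True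
        then have "card T' \<le> card (T i)" using T[OF i] T' by blast
        then have "sum x (cell i T') * real (card T') \<le> sum x (cell i T') * real (card (T i))"
          using cell by (intro mult_left_mono) auto
        moreover have "0 \<le> real m * real (card W)" by simp
        ultimately show ?thesis by linarith
      next
        case False
        have "sum x (cell i T') * real (card T') \<le> real m * real (card W)"
          using False cell card_mono[OF fW(1) T'] by (intro mult_mono) auto
        moreover have "0 \<le> sum x (cell i T') * real (card (T i))" using cell by simp
        ultimately show ?thesis by linarith
      qed
    qed
    also have "\<dots> = (\<Sum>T'\<in>Pow W. sum x (cell i T')) * real (card (T i)) + real (card W) * (2 ^ card W * real m)"
      using fW by (simp add: sum.distrib sum_distrib_right card_Pow)
    also have "(\<Sum>T'\<in>Pow W. sum x (cell i T')) = sum x (R i)"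
      unfolding cell_def using fR[OF i] fW by (intro sum.group) auto
    also have "sum x (R i) * real (card (T i)) \<le> \<sigma> * real (card (T i))" using \<sigma>(1)[OF i] by (intro mult_right_mono) auto
    finally show ?thesis by simp
  qed
  have cT: "(\<Sum>i<q. real (card (T i))) \<le> real (card W) * (real q - 1) + (real t - 1)"
  proof -
    have "card (T i) = (\<Sum>w\<in>W. if w \<in> T i then 1 else 0)" if "i < q" for i
      using T[OF that] fW by (simp add: sum.If_cases Int_absorb1)
    then have "(\<Sum>i<q. card (T i)) = (\<Sum>i<q. \<Sum>w\<in>W. if w \<in> T i then 1 else 0)" by simp
    also have "\<dots> = (\<Sum>w\<in>W. \<Sum>i<q. if w \<in> T i then 1 else 0)" by (rule sum.swap)
    also have "\<dots> \<le> (\<Sum>w\<in>W. (q - 1) + (if w \<in> F then 1 else 0))"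
    proof (rule sum_mono)
      fix w assume w: "w \<in> W"
      have e: "(\<Sum>i<q. if w \<in> T i then 1 else 0) = card {i. i < q \<and> w \<in> T i}"
        by (simp add: sum.If_cases Int_def)
      show "(\<Sum>i<q. if w \<in> T i then 1 else 0) \<le> (q - 1) + (if w \<in> F then 1 else 0)"
      proof (cases "w \<in> F")
        case True
        have "card {i. i < q \<and> w \<in> T i} \<le> card {..<q}" by (intro card_mono) auto
        then show ?thesis unfolding e using True q by simp
      next
        case False
        then obtain i where "i < q" "w \<notin> T i" using w by (auto simp: F_def)
        then have "card {i. i < q \<and> w \<in> T i} < card {..<q}" by (intro psubset_card_mono) auto
        then show ?thesis unfolding e using False by simp
      qed
    qed
    also have "\<dots> = card W * (q - 1) + card F"
    proof -
      have "F \<subseteq> W" by (auto simp: F_def)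
      then show ?thesis using fW by (simp add: sum.distrib sum.If_cases Int_absorb1)
    qed
    finally have "(\<Sum>i<q. card (T i)) \<le> card W * (q - 1) + (t - 1)" using cF by linarith
    then have "real (\<Sum>i<q. card (T i)) \<le> real (card W * (q - 1) + (t - 1))" by (simp only: of_nat_le_iff)
    then show ?thesis using q t by (simp add: of_nat_diff)
  qed
  have "(\<Sum>w\<in>W. sum x (nbrs E w - W)) = (\<Sum>w\<in>W. \<Sum>i<q. \<Sum>v\<in>R i. if E w v then x v else 0)" by (simp add: row)
  also have "\<dots> = (\<Sum>i<q. \<Sum>w\<in>W. \<Sum>v\<in>R i. if E w v then x v else 0)" by (rule sum.swap)
  also have "\<dots> \<le> (\<Sum>i<q. \<sigma> * real (card (T i)) + real (card W) * (2 ^ card W * real m))"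
    using part by (intro sum_mono) auto
  also have "\<dots> = \<sigma> * (\<Sum>i<q. real (card (T i))) + real q * (real (card W) * (2 ^ card W * real m))"
    by (simp add: sum.distrib sum_distrib_left)
  also have "\<dots> \<le> \<sigma> * (real (card W) * (real q - 1) + (real t - 1)) + real q * (real (card W) * (2 ^ card W * real m))"
    using cT \<sigma>(2) by (intro add_right_mono mult_left_mono) auto
  finally show ?thesis .
qed

text \<open>
  The test vector in the multipartite graph is the eigenvector of \<open>E\<close> off \<open>W\<close>, corrected on \<open>W\<close> so as to satisfy
  the new eigenvector equation there up to edges inside \<open>W\<close>.
\<close>

lemma comparison_with_multipartite:
  fixes x :: "nat \<Rightarrow> real"
  assumes ex: "extremal V E" and R: "sep_parts V E q R" and W: "W = V - (\<Union>i<q. R i)"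
    and C: "C \<subseteq> W" "card C = t - 1"
    and x0: "\<And>u. 0 \<le> x u" and x1: "\<And>u. u \<in> V \<Longrightarrow> x u \<le> 1"
    and eig: "\<And>u. u \<in> V \<Longrightarrow> adj_sum E x u = lam V E * x u" and pos: "0 < lam V E"
    and S: "S = (\<Sum>i<q. sum x (R i))"
  shows "(real t - 1) * S\<^sup>2 + (real (card W) - (real t - 1)) * (S - sum x (R 0))\<^sup>2
    \<le> (\<Sum>w\<in>W. sum x (nbrs E w - W) * (sum x (nbrs E w - W) + real (card W)))"
proof -
  note G = extremalD(1)[OF ex]
  note f = simple_graphD(1)[OF G]
  define l where "l = lam V E"
  define U where "U = (\<Union>i<q. R i)"
  have q0: "0 < q" using q by simp
  have RV: "R i \<subseteq> V" if "i < q" for i using sep_partsD(1)[OF R that] .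
  have UV: "U \<subseteq> V" using RV by (auto simp: U_def)
  have WU: "W = V - U" "U \<inter> W = {}" "V = U \<union> W" using UV by (auto simp: W U_def)
  have WV: "W \<subseteq> V" and dj: "\<And>v. v \<in> U \<Longrightarrow> v \<notin> W" and cov: "\<And>v. v \<in> V \<Longrightarrow> v \<notin> U \<Longrightarrow> v \<in> W"
    using WU by blast+
  have fin: "finite U" "finite W" using f UV finite_subset unfolding WU(1) by auto
  have finC: "finite C" using C(1) fin(2) by (rule finite_subset)
  have SU: "sum x U = S" unfolding U_def S by (rule sum_sep_parts[OF G R])
  have SU0: "sum x (U - R 0) = S - sum x (R 0)" unfolding U_def S by (rule sum_sep_parts_minus[OF G R q0])
  define cl where "cl v = (SOME i. i < q \<and> v \<in> R i)" for v
  have cl: "cl v = i" if "i < q" "v \<in> R i" for v i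
  proof -
    have "\<exists>i. i < q \<and> v \<in> R i" using that by blast
    then have c: "cl v < q \<and> v \<in> R (cl v)" unfolding cl_def by (rule someI_ex)
    show ?thesis
    proof (rule ccontr)
      assume "cl v \<noteq> i"
      then have "R (cl v) \<inter> R i = {}" using sep_partsD(3)[OF R _ that(1)] c by blast
      then show False using c that(2) by blast
    qed
  qed
  \<comment> \<open>The vertices of \<open>C\<close> receive distinct labels beyond the class labels
    and become universal; the rest of \<open>W\<close> is put into class 0.\<close>
  define g where "g v = (if v \<in> C then q + v else if v \<in> W then 0 else cl v)" for v
  have gU: "g v = i" if "i < q" "v \<in> R i" for v i
  proof -
    have "v \<in> U" using that by (auto simp: U_def)
    then have "v \<notin> W" by (rule dj)
    then show ?thesis using cl[OF that] C(1) by (auto simp: g_def)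
  qed
  define E' where "E' = multipartite V g"
  have G': "simple_graph V E'" unfolding E'_def using f by (rule simple_graph_multipartite)
  have "{v \<in> V. q \<le> g v} = C"
  proof
    show "{v \<in> V. q \<le> g v} \<subseteq> C"
    proof
      fix v assume v: "v \<in> {v \<in> V. q \<le> g v}"
      show "v \<in> C"
      proof (rule ccontr)
        assume nC: "v \<notin> C"
        show False
        proof (cases "v \<in> W")
          case True
          then show False using v nC q by (simp add: g_def)
        next
          case False
          then have "v \<in> U" using v cov by blast
          then obtain i where i: "i < q" "v \<in> R i" by (auto simp: U_def)
          then show False using gU[OF i] v by simp
        qed
      qed
    qed
    show "C \<subseteq> {v \<in> V. q \<le> g v}" using C(1) WV by (auto simp: g_def)
  qed
  then have "card {v \<in> V. q \<le> g v} \<le> t - 1" using C(2) by simp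
  from multipartite_free[OF f this] have le: "lam V E' \<le> l"
    unfolding l_def using extremalD(3)[OF ex G'] by (simp add: E'_def)
  define D where "D w = sum x (nbrs E w - W)" for w
  define D' where "D' w = (if w \<in> C then S else S - sum x (R 0))" for w
  have adjW: "sum x (nbrs E' w \<inter> U) = D' w" if w: "w \<in> W" for w
  proof (cases "w \<in> C")
    case True
    have "g w \<noteq> g u" if u: "u \<in> U" for u
    proof -
      obtain i where i: "i < q" "u \<in> R i" using u by (auto simp: U_def)
      then show ?thesis using gU[OF i] True by (simp add: g_def)
    qed
    then have "nbrs E' w \<inter> U = U" using w WV UV by (auto simp: nbrs_def E'_def multipartite_def)
    then show ?thesis using True SU by (simp add: D'_def)
  next
    case False
    have z: "g u = 0 \<longleftrightarrow> u \<in> R 0" if u: "u \<in> U" for u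
    proof -
      obtain i where i: "i < q" "u \<in> R i" using u by (auto simp: U_def)
      show ?thesis using gU[OF i] gU[OF q0, of u] i by auto
    qed
    have gw: "g w = 0" using False w by (simp add: g_def)
    have "u \<in> nbrs E' w \<longleftrightarrow> u \<notin> R 0" if u: "u \<in> U" for u
      unfolding nbrs_def E'_def multipartite_def mem_Collect_eq gw
      using z[OF u] w WV UV u by (metis subsetD)
    then have "nbrs E' w \<inter> U = U - R 0" by blast
    then show ?thesis using False SU0 by (simp add: D'_def)
  qed
  define xU where "xU v = (if v \<in> U then x v else 0)" for v
  define xW where "xW v = (if v \<in> U then 0 else x v)" for v
  \<comment> \<open>\<open>D' w / l\<close> maximises \<open>2 * y * D' w - l * y^2\<close>, the
    contribution of \<open>w\<close> when edges inside \<open>W\<close> are disregarded.\<close>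
  define yW where "yW v = (if v \<in> W then D' v / l else 0)" for v
  have adjU: "adj_sum H xU w = sum x (nbrs H w \<inter> U)" if "simple_graph V H" for H w
    unfolding adj_sum_def xU_def using simple_graphD(7)[OF that] by (rule sum.inter_restrict[symmetric])
  have splitW: "(\<Sum>v\<in>V. (if v \<in> W then h v else 0)) = sum h W" for h :: "nat \<Rightarrow> real"
    using f WV by (simp add: sum.If_cases Int_absorb1)
  \<comment> \<open>The classes are independent in \<open>E\<close>, so every edge of
    \<open>E\<close> inside \<open>U\<close> is also an edge of \<open>E'\<close>.\<close>
  have "qform V E xU \<le> qform V E' xU"
    unfolding bform_def
  proof (rule sum_mono)
    fix u assume "u \<in> V"
    show "xU u * adj_sum E xU u \<le> xU u * adj_sum E' xU u"
    proof (cases "u \<in> U")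
      case True
      then obtain i where i: "i < q" "u \<in> R i" by (auto simp: U_def)
      have "nbrs E u \<inter> U \<subseteq> nbrs E' u \<inter> U"
      proof
        fix v assume v: "v \<in> nbrs E u \<inter> U"
        then obtain j where j: "j < q" "v \<in> R j" by (auto simp: U_def)
        have "i \<noteq> j" using sep_partsD(2)[OF R i(1)] i j v by (auto simp: stable_set_def nbrs_def)
        then show "v \<in> nbrs E' u \<inter> U"
          using gU[OF i] gU[OF j] v i j UV True by (auto simp: nbrs_def E'_def multipartite_def)
      qed
      then have "sum x (nbrs E u \<inter> U) \<le> sum x (nbrs E' u \<inter> U)"
        using simple_graphD(7)[OF G'] x0 by (intro sum_mono2) auto
      then show ?thesis using x0[of u] True by (simp add: adjU[OF G] adjU[OF G'] xU_def mult_left_mono)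
    qed (simp add: xU_def)
  qed
  moreover have "qform V E xU = l * sqn V xU - (\<Sum>w\<in>W. x w * D w)"
  proof -
    have x: "x = (\<lambda>v. xU v + xW v)" by (auto simp: xU_def xW_def)
    have "bform V E xU x = l * sqn V xU"
      unfolding bform_def sqn_def sum_distrib_left
      by (intro sum.cong) (auto simp: eig l_def xU_def power2_eq_square)
    moreover have "bform V E xU x = qform V E xU + bform V E xU xW"
      by (subst x, rule bform_add_right)
    moreover have "bform V E xU xW = bform V E xW xU" by (rule bform_sym[OF G])
    moreover have "bform V E xW xU = (\<Sum>v\<in>V. if v \<in> W then x v * D v else 0)"
      unfolding bform_def
    proof (rule sum.cong[OF refl])
      fix v assume "v \<in> V"
      have "nbrs E v \<inter> U = nbrs E v - W" using simple_graphD(6)[OF G, of v] dj cov by blast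
      then show "xW v * adj_sum E xU v = (if v \<in> W then x v * D v else 0)"
        using \<open>v \<in> V\<close> dj cov by (auto simp: adjU[OF G] xW_def D_def)
    qed
    ultimately show ?thesis by (simp add: splitW)
  qed
  moreover have "qform V E' (\<lambda>v. xU v + yW v) = qform V E' xU + 2 * bform V E' yW xU + qform V E' yW"
    by (simp add: bform_add_left bform_add_right bform_sym[OF G', of xU yW])
  moreover have "bform V E' yW xU = (\<Sum>w\<in>W. (D' w)\<^sup>2 / l)"
  proof -
    have "bform V E' yW xU = (\<Sum>v\<in>V. if v \<in> W then (D' v)\<^sup>2 / l else 0)"
      unfolding bform_def using adjW
      by (intro sum.cong) (auto simp: yW_def adjU[OF G'] power2_eq_square)
    then show ?thesis by (simp add: splitW)
  qed
  moreover have "0 \<le> qform V E' yW"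
  proof -
    have D'0: "0 \<le> D' w" for w
    proof -
      have "sum x (R 0) \<le> S" unfolding S using q0 x0 by (intro member_le_sum) (auto intro: sum_nonneg)
      moreover have "0 \<le> sum x (R 0)" using x0 by (intro sum_nonneg) auto
      ultimately show ?thesis by (auto simp: D'_def)
    qed
    then have "0 \<le> yW v" for v using pos by (simp add: yW_def l_def)
    then show ?thesis unfolding bform_def adj_sum_def by (intro sum_nonneg mult_nonneg_nonneg) auto
  qed
  moreover have "qform V E' (\<lambda>v. xU v + yW v) \<le> l * sqn V (\<lambda>v. xU v + yW v)"
  proof -
    have "qform V E' (\<lambda>v. xU v + yW v) \<le> lam V E' * sqn V (\<lambda>v. xU v + yW v)" by (rule qform_le_lam[OF G'])
    also have "\<dots> \<le> l * sqn V (\<lambda>v. xU v + yW v)" using le by (intro mult_right_mono) (simp_all add: sqn_nonneg)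
    finally show ?thesis .
  qed
  moreover have "l * sqn V (\<lambda>v. xU v + yW v) = l * sqn V xU + (\<Sum>w\<in>W. (D' w)\<^sup>2 / l)"
  proof -
    have "sqn V (\<lambda>v. xU v + yW v) = sqn V xU + (\<Sum>v\<in>V. if v \<in> W then (D' v / l)\<^sup>2 else 0)"
      unfolding sqn_def sum.distrib[symmetric] using dj
      by (intro sum.cong) (auto simp: xU_def yW_def)
    moreover have "l * (\<Sum>w\<in>W. (D' w / l)\<^sup>2) = (\<Sum>w\<in>W. (D' w)\<^sup>2 / l)"
      unfolding sum_distrib_left using pos by (intro sum.cong) (auto simp: l_def power2_eq_square)
    ultimately show ?thesis by (simp add: splitW distrib_left)
  qed
  \<comment> \<open>The cross term counts \<open>D'^2 / l\<close> twice and the norm takes it back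
    once; the right-hand side is the price of cutting \<open>W\<close> off the old
    eigenvector.\<close>
  ultimately have "(\<Sum>w\<in>W. (D' w)\<^sup>2 / l) \<le> (\<Sum>w\<in>W. x w * D w)" by linarith
  then have "l * (\<Sum>w\<in>W. (D' w)\<^sup>2 / l) \<le> l * (\<Sum>w\<in>W. x w * D w)" using pos by (intro mult_left_mono) (auto simp: l_def)
  moreover have "l * (\<Sum>w\<in>W. (D' w)\<^sup>2 / l) = (\<Sum>w\<in>W. (D' w)\<^sup>2)"
    unfolding sum_distrib_left using pos by (intro sum.cong) (auto simp: l_def)
  moreover have "l * (\<Sum>w\<in>W. x w * D w) = (\<Sum>w\<in>W. D w * (l * x w))"
    unfolding sum_distrib_left by (intro sum.cong) auto
  moreover have "(\<Sum>w\<in>W. D w * (l * x w)) \<le> (\<Sum>w\<in>W. D w * (D w + real (card W)))"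
  proof (rule sum_mono)
    fix w assume w: "w \<in> W"
    have "l * x w = sum x (nbrs E w)" using eig[of w] w WV by (auto simp: l_def adj_sum_def)
    also have "\<dots> = sum x (nbrs E w \<inter> W) + D w"
      unfolding D_def using simple_graphD(7)[OF G] by (rule sum.Int_Diff)
    also have "sum x (nbrs E w \<inter> W) \<le> real (card (nbrs E w \<inter> W))"
      using sum_unit_bounds(2)[of "nbrs E w \<inter> W" x] x0 x1 fin WV by blast
    also have "real (card (nbrs E w \<inter> W)) \<le> real (card W)" using fin by (auto intro: card_mono)
    finally have "l * x w \<le> D w + real (card W)" by simp
    moreover have "0 \<le> D w" unfolding D_def using x0 by (intro sum_nonneg) auto
    ultimately show "D w * (l * x w) \<le> D w * (D w + real (card W))" by (rule mult_left_mono)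
  qed
  moreover have "(\<Sum>w\<in>W. (D' w)\<^sup>2) = (real t - 1) * S\<^sup>2 + (real (card W) - (real t - 1)) * (S - sum x (R 0))\<^sup>2"
  proof -
    have "(\<Sum>w\<in>W. (D' w)\<^sup>2) = (\<Sum>w\<in>W - C. (D' w)\<^sup>2) + (\<Sum>w\<in>C. (D' w)\<^sup>2)"
      using fin(2) C(1) by (rule sum.subset_diff[rotated])
    also have "(\<Sum>w\<in>C. (D' w)\<^sup>2) = real (card C) * S\<^sup>2" by (simp add: D'_def)
    also have "(\<Sum>w\<in>W - C. (D' w)\<^sup>2) = (\<Sum>w\<in>W - C. (S - sum x (R 0))\<^sup>2)" by (intro sum.cong) (auto simp: D'_def)
    also have "\<dots> = real (card (W - C)) * (S - sum x (R 0))\<^sup>2" by simp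
    also have "real (card (W - C)) = real (card W) - real (card C)"
      using card_Diff_subset[OF finC C(1)] card_mono[OF fin(2) C(1)] by (simp add: of_nat_diff)
    finally show ?thesis using C(2) t by (simp add: of_nat_diff)
  qed
  ultimately show ?thesis unfolding D_def by linarith
qed

end

subsection \<open>Complete multipartite graphs\<close>

definition class_size :: "'a set \<Rightarrow> ('a \<Rightarrow> 'b) \<Rightarrow> 'b \<Rightarrow> real" where
  "class_size V g c = real (card {v \<in> V. g v = c})"

lemma multipartite_adj_sum:
  assumes f: "finite V" and v: "v \<in> V"
  shows "adj_sum (multipartite V g) x v = sum x V - sum x {u \<in> V. g u = g v}"
proof -
  have "nbrs (multipartite V g) v = V - {u \<in> V. g u = g v}" using v by (auto simp: nbrs_def multipartite_def)
  then show ?thesis using f by (simp add: adj_sum_def sum_diff)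
qed

text \<open>\<open>\<lambda>\<close> of a complete multipartite graph solves \<open>\<Sum>\<^sub>c n\<^sub>c / (\<lambda> + n\<^sub>c) = 1\<close>, summed here over vertices rather than classes.\<close>

lemma multipartite_lam_equation:
  assumes f: "finite V" and V: "V \<noteq> {}" and pos: "0 < lam V (multipartite V g)"
  shows "(\<Sum>v\<in>V. 1 / (lam V (multipartite V g) + class_size V g (g v))) = 1"
proof -
  define l where "l = lam V (multipartite V g)"
  note G = simple_graph_multipartite[OF f, of g]
  obtain x v0 where x0: "\<And>u. 0 \<le> x u" and "\<And>u. u \<in> V \<Longrightarrow> x u \<le> 1" and v0: "v0 \<in> V" "x v0 = 1"
    and eig: "\<And>u. u \<in> V \<Longrightarrow> adj_sum (multipartite V g) x u = l * x u"
    unfolding l_def by (rule perron_max[OF G V]) blast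
  define M where "M = sum x V"
  have "x v0 \<le> M" unfolding M_def using f v0 x0 by (intro member_le_sum) auto
  then have M: "0 < M" using v0 by simp
  have e: "l * x v = M - sum x {u \<in> V. g u = g v}" if "v \<in> V" for v
    using eig[OF that] multipartite_adj_sum[OF f that, of g x] by (simp add: M_def)
  have const: "x u = x v" if "u \<in> V" "v \<in> V" "g u = g v" for u v
  proof -
    have "l * x u = l * x v" using e[OF that(1)] e[OF that(2)] that(3) by simp
    then show ?thesis using pos by (simp add: l_def)
  qed
  have xv: "x v = M * (1 / (l + class_size V g (g v)))" if v: "v \<in> V" for v
  proof -
    have "sum x {u \<in> V. g u = g v} = (\<Sum>u\<in>{u \<in> V. g u = g v}. x v)" using const v by (intro sum.cong refl) blast
    also have "\<dots> = class_size V g (g v) * x v" unfolding class_size_def by (rule sum_constant)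
    finally have "(l + class_size V g (g v)) * x v = M" using e[OF v] unfolding distrib_right by linarith
    moreover have "l + class_size V g (g v) \<noteq> 0"
      using pos by (simp add: l_def class_size_def add_nonneg_eq_0_iff)
    ultimately show ?thesis by (metis mult.right_neutral nonzero_mult_div_cancel_left times_divide_eq_right)
  qed
  have "M = M * (\<Sum>v\<in>V. 1 / (l + class_size V g (g v)))"
    unfolding sum_distrib_left by (subst M_def) (rule sum.cong[OF refl xv])
  then show ?thesis using M by (simp add: l_def)
qed

text \<open>The test vector with entries \<open>1 / (l + class size)\<close> satisfies the
  eigenvector equation for \<open>l\<close> up to a surplus in each row, namely its own sum minus
  1.\<close>

lemma multipartite_lam_gt:
  assumes f: "finite V" and l: "0 < l" and gt: "1 < (\<Sum>v\<in>V. 1 / (l + class_size V g (g v)))"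
  shows "l < lam V (multipartite V g)"
proof (rule lam_lt_of_qform[OF simple_graph_multipartite[OF f]])
  define y where "y v = 1 / (l + class_size V g (g v))" for v
  have cs: "0 \<le> class_size V g c" for c by (simp add: class_size_def)
  have y0: "0 < y v" for v unfolding y_def using l cs[of "g v"] by (simp add: add_pos_nonneg)
  have gt': "1 < sum y V" using gt by (simp add: y_def)
  have a: "adj_sum (multipartite V g) y v = sum y V - 1 + l * y v" if v: "v \<in> V" for v
  proof -
    have "sum y {u \<in> V. g u = g v} = (\<Sum>u\<in>{u \<in> V. g u = g v}. y v)" by (intro sum.cong) (auto simp: y_def)
    also have "\<dots> = class_size V g (g v) * y v" by (simp add: class_size_def)
    also have "\<dots> = 1 - l * y v"
    proof -
      have "0 < l + class_size V g (g v)" using l cs[of "g v"] by simp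
      then show ?thesis by (simp add: y_def field_simps)
    qed
    finally show ?thesis using multipartite_adj_sum[OF f v, of g y] by simp
  qed
  have "qform V (multipartite V g) y = (\<Sum>v\<in>V. (sum y V - 1) * y v + l * (y v)\<^sup>2)"
    unfolding bform_def by (intro sum.cong) (auto simp: a power2_eq_square algebra_simps)
  also have "\<dots> = (sum y V - 1) * sum y V + l * sqn V y" by (simp add: sum.distrib sum_distrib_left sqn_def)
  also have "\<dots> > l * sqn V y" using gt' by simp
  finally show "l * sqn V y < qform V (multipartite V g) y" .
qed

text \<open>Strict concavity of \<open>z / (l + z)\<close>.\<close>

lemma balance_arith:
  fixes a b l :: real
  assumes "0 < l" "0 \<le> b" "b + 2 \<le> a"
  shows "a / (l + a) + b / (l + b) < (a - 1) / (l + (a - 1)) + (b + 1) / (l + (b + 1))"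
proof -
  have r: "z / (l + z) = 1 - l * (1 / (l + z))" if "0 \<le> z" for z using assms that by (simp add: field_simps)
  have "1 / ((l + (a - 1)) * (l + a)) < 1 / ((l + b) * (l + (b + 1)))"
    using assms by (intro divide_strict_left_mono mult_strict_mono) auto
  moreover have "1 / ((l + b) * (l + (b + 1))) = 1 / (l + b) - 1 / (l + (b + 1))"
    using assms by (simp add: field_simps)
  moreover have "1 / ((l + (a - 1)) * (l + a)) = 1 / (l + (a - 1)) - 1 / (l + a)"
    using assms by (simp add: field_simps)
  ultimately have "1 / (l + (a - 1)) + 1 / (l + (b + 1)) < 1 / (l + a) + 1 / (l + b)" by linarith
  then have "l * (1 / (l + (a - 1)) + 1 / (l + (b + 1))) < l * (1 / (l + a) + 1 / (l + b))"
    using assms(1) by (rule mult_strict_left_mono)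
  then show ?thesis using r[of a] r[of b] r[of "a - 1"] r[of "b + 1"] assms by (simp add: distrib_left)
qed

text \<open>At the old \<lambda> the defining sum equals 1; moving a vertex from the larger class to
  the smaller one lifts it above 1, so the new \<lambda> is strictly larger.\<close>

lemma multipartite_balance_step:
  assumes f: "finite V" and V: "V \<noteq> {}" and pos: "0 < lam V (multipartite V g)"
    and v0: "v0 \<in> V" "g v0 = i" and ij: "i \<noteq> j"
    and gap: "card {v \<in> V. g v = j} + 2 \<le> card {v \<in> V. g v = i}"
  shows "lam V (multipartite V g) < lam V (multipartite V (g(v0 := j)))"
proof (rule multipartite_lam_gt[OF f pos])
  define l where "l = lam V (multipartite V g)"
  define g' where "g' = g(v0 := j)"
  define A where "A = {v \<in> V. g v = i}"
  define B where "B = {v \<in> V. g v = j}"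
  define Z where "Z = V - A - B"
  have A': "{v \<in> V. g' v = i} = A - {v0}" and B': "{v \<in> V. g' v = j} = insert v0 B"
    using v0 ij by (auto simp: A_def B_def g'_def)
  have fin: "finite A" "finite B" "finite Z" using f by (auto simp: A_def B_def Z_def)
  have v0A: "v0 \<in> A" "v0 \<notin> B" using v0 ij by (auto simp: A_def B_def)
  define a where "a = real (card A)"
  define b where "b = real (card B)"
  have ca: "real (card (A - {v0})) = a - 1" using v0A fin gap by (simp add: a_def A_def of_nat_diff)
  have cb: "real (card (insert v0 B)) = b + 1" using v0A fin by (simp add: b_def)
  have split: "sum h V = sum h A' + sum h B' + sum h Z"
    if "A' \<union> B' = A \<union> B" "A' \<inter> B' = {}" for h :: "'a \<Rightarrow> real" and A' B'
  proof -
    have "V = (A' \<union> B') \<union> Z" unfolding that(1) by (auto simp: A_def B_def Z_def)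
    moreover have f': "finite (A' \<union> B')" unfolding that(1) using fin by simp
    moreover have "(A' \<union> B') \<inter> Z = {}" unfolding that(1) by (auto simp: Z_def)
    ultimately have "sum h V = sum h (A' \<union> B') + sum h Z" using fin by (metis sum.union_disjoint)
    then show ?thesis using sum.union_disjoint[of A' B' h] f' that(2) by simp
  qed
  have "(\<Sum>v\<in>V. 1 / (l + class_size V g (g v))) =
      (\<Sum>v\<in>A. 1 / (l + class_size V g (g v))) + (\<Sum>v\<in>B. 1 / (l + class_size V g (g v)))
      + (\<Sum>v\<in>Z. 1 / (l + class_size V g (g v)))"
    by (rule split) (use ij in \<open>auto simp: A_def B_def\<close>)
  moreover have "(\<Sum>v\<in>A. 1 / (l + class_size V g (g v))) = (\<Sum>v\<in>A. 1 / (l + a))"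
    by (intro sum.cong) (auto simp: A_def a_def class_size_def)
  moreover have "(\<Sum>v\<in>B. 1 / (l + class_size V g (g v))) = (\<Sum>v\<in>B. 1 / (l + b))"
    by (intro sum.cong) (auto simp: B_def b_def class_size_def)
  moreover have "(\<Sum>v\<in>V. 1 / (l + class_size V g (g v))) = 1"
    unfolding l_def by (rule multipartite_lam_equation[OF f V pos])
  ultimately have one: "1 = a / (l + a) + b / (l + b) + (\<Sum>v\<in>Z. 1 / (l + class_size V g (g v)))"
    by (simp add: a_def b_def)
  have "(\<Sum>v\<in>V. 1 / (l + class_size V g' (g' v))) =
      (\<Sum>v\<in>A - {v0}. 1 / (l + class_size V g' (g' v))) + (\<Sum>v\<in>insert v0 B. 1 / (l + class_size V g' (g' v)))
      + (\<Sum>v\<in>Z. 1 / (l + class_size V g' (g' v)))"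
    by (rule split) (use v0A ij in \<open>auto simp: A_def B_def\<close>)
  moreover have "(\<Sum>v\<in>A - {v0}. 1 / (l + class_size V g' (g' v))) = (\<Sum>v\<in>A - {v0}. 1 / (l + (a - 1)))"
  proof (intro sum.cong refl)
    fix v assume "v \<in> A - {v0}"
    then have "g' v = i" unfolding A'[symmetric] by simp
    then show "1 / (l + class_size V g' (g' v)) = 1 / (l + (a - 1))" by (simp add: class_size_def A' ca)
  qed
  moreover have "(\<Sum>v\<in>insert v0 B. 1 / (l + class_size V g' (g' v))) = (\<Sum>v\<in>insert v0 B. 1 / (l + (b + 1)))"
  proof (intro sum.cong refl)
    fix v assume "v \<in> insert v0 B"
    then have "g' v = j" unfolding B'[symmetric] by simp
    then show "1 / (l + class_size V g' (g' v)) = 1 / (l + (b + 1))" by (simp add: class_size_def B' cb)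
  qed
  moreover have "(\<Sum>v\<in>Z. 1 / (l + class_size V g' (g' v))) = (\<Sum>v\<in>Z. 1 / (l + class_size V g (g v)))"
  proof (intro sum.cong refl)
    fix v assume v: "v \<in> Z"
    have ne: "v \<noteq> v0" "g v \<noteq> i" "g v \<noteq> j" using v v0A by (auto simp: Z_def A_def B_def)
    have "{u \<in> V. g' u = g v} = {u \<in> V. g u = g v}" using ne v0 by (auto simp: g'_def)
    then show "1 / (l + class_size V g' (g' v)) = 1 / (l + class_size V g (g v))"
      using ne by (simp add: class_size_def g'_def)
  qed
  moreover have "(\<Sum>v\<in>A - {v0}. 1 / (l + (a - 1))) = (a - 1) / (l + (a - 1))" by (simp only: sum_constant ca) simp
  moreover have "(\<Sum>v\<in>insert v0 B. 1 / (l + (b + 1))) = (b + 1) / (l + (b + 1))" by (simp only: sum_constant cb) simp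
  ultimately have two: "(\<Sum>v\<in>V. 1 / (l + class_size V g' (g' v))) =
      (a - 1) / (l + (a - 1)) + (b + 1) / (l + (b + 1)) + (\<Sum>v\<in>Z. 1 / (l + class_size V g (g v)))"
    by (simp only:)
  have "b + 2 \<le> a" using gap by (simp add: a_def b_def A_def B_def flip: of_nat_le_iff)
  then have "a / (l + a) + b / (l + b) < (a - 1) / (l + (a - 1)) + (b + 1) / (l + (b + 1))"
    using pos by (intro balance_arith) (auto simp: l_def b_def)
  then have "1 < (\<Sum>v\<in>V. 1 / (l + class_size V g' (g' v)))" unfolding two using one by linarith
  then show "1 < (\<Sum>v\<in>V. 1 / (lam V (multipartite V g) + class_size V (g(v0 := j)) ((g(v0 := j)) v)))"
    by (simp only: g'_def l_def)
qed

section \<open>The exact structure of extremal graphs\<close>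

context critical_graph
begin

text \<open>As all entries of \<open>x\<close> are positive, a missing edge of the multipartite
  graph would strictly increase the form, although that graph is an admissible competitor.\<close>

lemma extremal_eq_multipartite:
  assumes ex: "extremal V E" and sub: "\<And>u v. E u v \<Longrightarrow> multipartite V g u v"
    and C: "card {v \<in> V. q \<le> g v} \<le> t - 1"
    and eig: "\<And>u. u \<in> V \<Longrightarrow> adj_sum E x u = lam V E * x u" and pos: "\<And>u. u \<in> V \<Longrightarrow> 0 < x u"
  shows "E = multipartite V g"
proof (rule ccontr)
  note G = extremalD(1)[OF ex]
  note f = simple_graphD(1)[OF G]
  let ?M = "multipartite V g"
  note GM = simple_graph_multipartite[OF f, of g]
  assume "E \<noteq> ?M"
  then obtain a b where ab: "?M a b" "\<not> E a b" using sub by blast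
  have le: "lam V ?M \<le> lam V E" by (rule extremalD(3)[OF ex GM multipartite_free[OF f C]])
  have aV: "a \<in> V" "b \<in> V" using ab(1) by (auto simp: multipartite_def)
  have sn: "nbrs E u \<subseteq> nbrs ?M u" for u using sub by (auto simp: nbrs_def)
  have xn: "0 \<le> x v" if "v \<in> nbrs ?M u" for u v using that pos[of v] by (auto simp: nbrs_def multipartite_def)
  have mono: "adj_sum E x u \<le> adj_sum ?M x u" for u
    unfolding adj_sum_def using simple_graphD(7)[OF GM] sn xn by (intro sum_mono2) auto
  have strict: "adj_sum E x a < adj_sum ?M x a"
    unfolding adj_sum_def
  proof (rule sum_strict_mono2[OF simple_graphD(7)[OF GM] sn])
    show "b \<in> nbrs ?M a - nbrs E a" using ab by (simp add: nbrs_def)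
    show "0 < x b" using pos aV by simp
  qed (rule xn)
  have "lam V E * sqn V x = qform V E x"
    unfolding bform_def sqn_def sum_distrib_left by (intro sum.cong) (auto simp: eig power2_eq_square)
  also have "\<dots> < qform V ?M x"
    unfolding bform_def
  proof (rule sum_strict_mono_ex1[OF f])
    show "\<forall>u\<in>V. x u * adj_sum E x u \<le> x u * adj_sum ?M x u"
      using mono pos by (auto intro!: mult_left_mono less_imp_le)
    show "\<exists>u\<in>V. x u * adj_sum E x u < x u * adj_sum ?M x u"
      using strict pos aV by (intro bexI[of _ a]) auto
  qed
  also have "\<dots> \<le> lam V ?M * sqn V x" by (rule qform_le_lam[OF GM])
  also have "\<dots> \<le> lam V E * sqn V x" using le by (intro mult_right_mono) (auto simp: sqn_nonneg)
  finally show False by simp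
qed

text \<open>Moving a vertex between classes below \<open>q\<close> leaves the set of universal
  vertices unchanged, so the modified graph is still free.\<close>

lemma extremal_multipartite_balanced:
  assumes ex: "extremal V (multipartite V g)" and C: "card {v \<in> V. q \<le> g v} \<le> t - 1" and V: "V \<noteq> {}"
    and pos: "0 < lam V (multipartite V g)" and ij: "i < q" "j < q"
  shows "card {v \<in> V. g v = i} \<le> card {v \<in> V. g v = j} + 1"
proof (rule ccontr)
  note f = simple_graphD(1)[OF extremalD(1)[OF ex]]
  assume "\<not> ?thesis"
  then have gap: "card {v \<in> V. g v = j} + 2 \<le> card {v \<in> V. g v = i}" by simp
  then have ne: "i \<noteq> j" by auto
  have "{v \<in> V. g v = i} \<noteq> {}" using gap by (metis add_2_eq_Suc' card.empty not_less_eq_eq zero_le Suc_le_D nat.distinct(1))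
  then obtain v0 where v0: "v0 \<in> V" "g v0 = i" by blast
  have "{v \<in> V. q \<le> (g(v0 := j)) v} = {v \<in> V. q \<le> g v}" using v0 ij by auto
  then have "\<not> embeds k A V (multipartite V (g(v0 := j)))" using multipartite_free[OF f, of "g(v0 := j)"] C by simp
  then have "lam V (multipartite V (g(v0 := j))) \<le> lam V (multipartite V g)"
    by (intro extremalD(3)[OF ex] simple_graph_multipartite[OF f])
  then show False using multipartite_balance_step[OF f V pos v0 ne gap] by simp
qed

text \<open>A vertex of \<open>W - C\<close> that is rich in every class would complete
  \<open>C\<close> to \<open>t\<close> universal vertices, so it is poor in some class and takes the
  label of that class. An edge between equal labels would then give the pattern with
  \<open>t - 1\<close> universal vertices and one edge. The labels \<open>q + v\<close> keep the
  vertices of \<open>C\<close> apart.\<close>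

lemma partite_off_universal:
  assumes ex: "extremal V E" and nt: "near_turan V E q R K \<delta>" and W: "W = V - (\<Union>i<q. R i)" and d: "0 \<le> \<delta>" "0 \<le> \<delta>1"
    and deg: "\<And>u. u \<in> V \<Longrightarrow> (1 - 1 / real q - \<delta>) * real (card V) \<le> real (card (nbrs E u))"
    and C: "C \<subseteq> W" "card C = t - 1"
    and missC: "\<And>c. c \<in> C \<Longrightarrow> real (card ((\<Union>i<q. R i) - nbrs E c)) \<le> mC" and mC: "0 \<le> mC"
    and b1: "real N + real q * real N * (\<delta> * real (card V)) + real (t - 1) * mC \<le> \<delta>1 * real (card V)"
    and b2: "real N + real q * real N * (\<delta> * real (card V)) + real (t - 1) * mC + 2 * ((2 * \<delta> + \<delta>1) * real (card V))
      \<le> (1 / real q - \<delta>) * real (card V)"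
  obtains g where "\<And>u v. E u v \<Longrightarrow> multipartite V g u v" and "{v \<in> V. q \<le> g v} = C" and "inj_on g C"
proof -
  note G = extremalD(1)[OF ex] and pf = extremal_pattern_free[OF ex] and P = near_turanD(1)[OF nt]
  note f = simple_graphD(1)[OF G]
  define n where "n = real (card V)"
  define U where "U = (\<Union>i<q. R i)"
  have n0: "0 \<le> n" by (simp add: n_def)
  have RV: "R i \<subseteq> V" if "i < q" for i using sep_partsD(1)[OF P that] .
  have fR: "finite (R i)" if "i < q" for i using RV[OF that] f by (rule finite_subset)
  have UV: "U \<subseteq> V" using RV by (auto simp: U_def)
  have fU: "finite U" using UV f by (rule finite_subset)
  have CV: "C \<subseteq> V" using C(1) W by blast
  have fC: "finite C" using CV f by (rule finite_subset)
  have cards: "(1 / real q - \<delta>) * n \<le> real (card (R i))" if "i < q" for i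
    using near_turanD(3)[OF nt that] by (simp add: n_def abs_le_iff left_diff_distrib)
  have missCi: "real (card (X - nbrs E c)) \<le> mC" if "c \<in> C" "X \<subseteq> U" for c X
  proof -
    have "card (X - nbrs E c) \<le> card (U - nbrs E c)" using that fU by (intro card_mono) auto
    then show ?thesis using missC[OF that(1)] by (simp add: U_def)
  qed
  have commonC: "real (card X) - real (t - 1) * mC \<le> real (card {u \<in> X. \<forall>c\<in>C. E c u})" if "X \<subseteq> U" for X
    using that fU C(2) by (intro common_neighbours_card[OF _ fC _ missCi mC]) (auto intro: finite_subset)
  have greedy: "\<exists>B. complete_parts V E q N B \<and> (\<forall>i<q. B i \<subseteq> X i)"
    if X: "\<And>i. i < q \<Longrightarrow> X i \<subseteq> R i" and big: "\<And>i. i < q \<Longrightarrow> real N + real q * real N * (\<delta> * n) \<le> real (card (X i))" for X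
  proof -
    obtain B where "complete_parts V E q N B" "\<And>i. i < q \<Longrightarrow> B i \<subseteq> X i"
    proof (rule greedy_complete_parts[OF G, of q X "\<delta> * n" N])
      show "X i \<subseteq> V" if "i < q" for i using X[OF that] RV[OF that] by blast
      show "real (card (X j - nbrs E v)) \<le> \<delta> * n" if "i < q" "j < q" "i \<noteq> j" "v \<in> X i" for i j v
      proof -
        have "card (X j - nbrs E v) \<le> card (R j - nbrs E v)" using X[OF that(2)] fR[OF that(2)] by (intro card_mono) auto
        moreover have "real (card (R j - nbrs E v)) \<le> \<delta> * n"
          using near_turan_miss[OF G nt that(1-3)] X[OF that(1)] that(4) by (auto simp: n_def)
        ultimately show ?thesis by linarith
      qed
    qed (use big d n0 in auto)
    then show ?thesis by blast
  qed
  have "\<exists>i<q. real (card (nbrs E w \<inter> R i)) \<le> \<delta>1 * n" if w: "w \<in> W - C" for w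
  proof (rule ccontr)
    assume "\<not> ?thesis"
    then have rich: "\<delta>1 * n < real (card (nbrs E w \<inter> R i))" if "i < q" for i using that by auto
    define X where "X i = {u \<in> nbrs E w \<inter> R i. \<forall>c\<in>C. E c u}" for i
    have "\<exists>B. complete_parts V E q N B \<and> (\<forall>i<q. B i \<subseteq> X i)"
    proof (rule greedy)
      show "X i \<subseteq> R i" for i by (auto simp: X_def)
      fix i assume i: "i < q"
      have "real (card (nbrs E w \<inter> R i)) - real (t - 1) * mC \<le> real (card (X i))"
        unfolding X_def using i by (intro commonC) (auto simp: U_def)
      then show "real N + real q * real N * (\<delta> * n) \<le> real (card (X i))" using b1 rich[OF i] by (simp add: n_def)
    qed
    then obtain B where B: "complete_parts V E q N B" "\<And>i. i < q \<Longrightarrow> B i \<subseteq> X i" by blast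
    have q1: "1 \<le> q" using q by simp
    have T: "insert w C \<subseteq> V" "finite (insert w C)" using w W CV fC by auto
    have "w \<notin> C" using w by blast
    then have T2: "t \<le> card (insert w C)" using fC C(2) t by simp
    show False
    proof (rule pattern_free_universal[OF pf q1 B(1) T T2])
      fix i u v assume "i < q" "u \<in> insert w C" "v \<in> B i"
      then show "E u v" using B(2)[of i] by (auto simp: X_def nbrs_def)
    qed
  qed
  then obtain cl where cl: "\<And>w. w \<in> W - C \<Longrightarrow> cl w < q \<and> real (card (nbrs E w \<inter> R (cl w))) \<le> \<delta>1 * n" by metis
  have "\<exists>i. i < q \<and> v \<in> R i" if "v \<in> U" for v using that by (auto simp: U_def)
  then obtain ix where ix: "\<And>v. v \<in> U \<Longrightarrow> ix v < q \<and> v \<in> R (ix v)" by metis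
  define g where "g v = (if v \<in> C then q + v else if v \<in> W then cl v else ix v)" for v
  define \<mu> where "\<mu> = (2 * \<delta> + \<delta>1) * n"
  have mu0: "0 \<le> \<mu>" using d n0 by (simp add: \<mu>_def)
  have low: "g v < q \<and> (\<forall>j<q. j \<noteq> g v \<longrightarrow> real (card (R j - nbrs E v)) \<le> \<mu>)" if v: "v \<in> V - C" for v
  proof (cases "v \<in> W")
    case True
    then have gv: "g v = cl v" using v by (simp add: g_def)
    have c: "cl v < q" "real (card (nbrs E v \<inter> R (cl v))) \<le> \<delta>1 * n" using cl[of v] v True by auto
    have "real (card (R j - nbrs E v)) \<le> \<mu>" if j: "j < q" "j \<noteq> cl v" for j
    proof -
      have "R j - nbrs E v \<subseteq> V - R (cl v) - nbrs E v"
        using RV[OF j(1)] sep_partsD(3)[OF P j(1) c(1) j(2)] by blast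
      then have "card (R j - nbrs E v) \<le> card (V - R (cl v) - nbrs E v)" using f by (intro card_mono) auto
      moreover have "real (card (V - R (cl v) - nbrs E v)) \<le> real (card V) - real (card (R (cl v))) + \<delta>1 * n - (1 - 1 / real q - \<delta>) * n"
        using deg[of v] v by (intro nonneighbours_outside_part[OF G RV[OF c(1)] _ c(2)]) (auto simp: n_def)
      ultimately have "real (card (R j - nbrs E v)) \<le> n - (1 / real q - \<delta>) * n + \<delta>1 * n - (1 - 1 / real q - \<delta>) * n"
        using cards[OF c(1)] by (simp add: n_def)
      also have "\<dots> = \<mu>" by (simp add: \<mu>_def algebra_simps)
      finally show ?thesis .
    qed
    then show ?thesis using gv c(1) by simp
  next
    case False
    then have vU: "v \<in> U" using v W by (auto simp: U_def)
    have gv: "g v = ix v" using v False by (simp add: g_def)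
    have i: "ix v < q" "v \<in> R (ix v)" using ix[OF vU] by auto
    have "real (card (R j - nbrs E v)) \<le> \<mu>" if j: "j < q" "j \<noteq> ix v" for j
    proof -
      have "real (card (R j - nbrs E v)) \<le> \<delta> * n"
        using near_turan_miss[OF G nt i(1) j(1) _ i(2)] j(2) by (simp add: n_def)
      moreover have "\<delta> * n \<le> \<mu>" unfolding \<mu>_def using d n0 by (intro mult_right_mono) auto
      ultimately show ?thesis by linarith
    qed
    then show ?thesis using gv i(1) by simp
  qed
  have noedge: "g u \<noteq> g v" if uv: "E u v" for u v
  proof
    assume eq: "g u = g v"
    have V: "u \<in> V" "v \<in> V" "u \<noteq> v" using uv simple_graphD(2-4)[OF G] by blast+
    have nC: "u \<notin> C \<and> v \<notin> C"
    proof -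
      have "u \<notin> C" if "v \<notin> C" using low[of v] V that eq by (auto simp: g_def split: if_splits)
      moreover have "v \<notin> C" if "u \<notin> C" using low[of u] V that eq by (auto simp: g_def split: if_splits)
      moreover have "\<not> (u \<in> C \<and> v \<in> C)" using eq V by (auto simp: g_def)
      ultimately show ?thesis by blast
    qed
    define i0 where "i0 = g u"
    have i0: "i0 < q" using low[of u] V nC by (auto simp: i0_def)
    have mu: "real (card (R j - nbrs E u)) \<le> \<mu>" "real (card (R j - nbrs E v)) \<le> \<mu>" if "j < q" "j \<noteq> i0" for j
      using low[of u] low[of v] V nC that eq by (auto simp: i0_def)
    define Y where "Y i = {z \<in> R i. \<forall>c\<in>C. E c z}" for i
    define X where "X i = (if i = i0 then Y i else {z \<in> Y i. \<forall>w\<in>{u, v}. E w z})" for i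
    have cY: "(1 / real q - \<delta>) * n - real (t - 1) * mC \<le> real (card (Y i))" if i: "i < q" for i
    proof -
      have "real (card (R i)) - real (t - 1) * mC \<le> real (card (Y i))"
        unfolding Y_def using i by (intro commonC) (auto simp: U_def)
      then show ?thesis using cards[OF i] by linarith
    qed
    have "\<exists>B. complete_parts V E q N B \<and> (\<forall>i<q. B i \<subseteq> X i)"
    proof (rule greedy)
      show "X i \<subseteq> R i" for i by (auto simp: X_def Y_def)
      fix i assume i: "i < q"
      have "real (card (Y i)) - real 2 * \<mu> \<le> real (card (X i))"
      proof (cases "i = i0")
        case True
        then show ?thesis using mu0 by (simp add: X_def)
      next
        case False
        have "finite (Y i)" using fR[OF i] by (simp add: Y_def)
        moreover have "real (card (Y i - nbrs E w)) \<le> \<mu>" if "w \<in> {u, v}" for w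
        proof -
          have "card (Y i - nbrs E w) \<le> card (R i - nbrs E w)" using fR[OF i] by (intro card_mono) (auto simp: Y_def)
          then show ?thesis using mu[OF i False] that by auto
        qed
        moreover have "card {u, v} \<le> 2" by (simp add: card_insert_if)
        ultimately have "real (card (Y i)) - real 2 * \<mu> \<le> real (card {z \<in> Y i. \<forall>w\<in>{u, v}. E w z})"
          using mu0 by (intro common_neighbours_card) auto
        then show ?thesis using False by (simp add: X_def)
      qed
      then show "real N + real q * real N * (\<delta> * n) \<le> real (card (X i))"
        using cY[OF i] b2 unfolding \<mu>_def n_def by simp
    qed
    then obtain B where B: "complete_parts V E q N B" "\<And>i. i < q \<Longrightarrow> B i \<subseteq> X i" by blast
    have nC': "u \<notin> C" "v \<notin> C" using nC by auto
    show False
    proof (rule pattern_free_edge[OF pf t B(1) i0 CV fC C(2) V(1,2) uv V(3) nC'])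
      fix i z assume i: "i < q" "z \<in> B i"
      then have zX: "z \<in> X i" using B(2) by blast
      show "E c z" if "c \<in> C" for c using zX that by (auto simp: X_def Y_def split: if_splits)
      show "E u z \<and> E v z" if "i \<noteq> i0" using zX that by (auto simp: X_def)
    qed
  qed
  show thesis
  proof (rule that[of g])
    show "multipartite V g u v" if "E u v" for u v
      using noedge[OF that] simple_graphD(2,3)[OF G that] by (simp add: multipartite_def)
    show "{v \<in> V. q \<le> g v} = C"
    proof
      show "{v \<in> V. q \<le> g v} \<subseteq> C" using low by (force simp: not_le[symmetric])
      show "C \<subseteq> {v \<in> V. q \<le> g v}" using CV by (auto simp: g_def)
    qed
    show "inj_on g C" by (auto simp: inj_on_def g_def)
  qed
qed


text \<open>Feeds \<open>top_values_arith\<close> with the weights divided by \<open>n\<close>, the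
  values \<open>b = 1 - 1 / q\<close> and \<open>c = s / q\<close>, and \<open>h = t - 1\<close>.
  The sum is bounded by \<open>popular_weight_bound\<close>, the squares by
  \<open>comparison_with_multipartite\<close>; \<open>err1\<close>, \<open>err2\<close> and
  \<open>err3\<close> collect the respective errors.\<close>

lemma universal_vertices:
  fixes x :: "nat \<Rightarrow> real"
  assumes ex: "extremal V E" and nt: "near_turan V E q R K \<delta>" and W: "W = V - (\<Union>i<q. R i)"
    and tW: "t - 1 \<le> card W" and V: "V \<noteq> {}"
    and x0: "\<And>u. 0 \<le> x u" and x1: "\<And>u. u \<in> V \<Longrightarrow> x u \<le> 1" and v0: "v0 \<in> V" "x v0 = 1"
    and eig: "\<And>u. u \<in> V \<Longrightarrow> adj_sum E x u = lam V E * x u"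
    and l: "\<bar>lam V E - (1 - 1 / real q) * real (card V)\<bar> \<le> \<delta> * real (card V)"
    and S: "S = (\<Sum>i<q. sum x (R i))" and n: "n = real (card V)"
    and K: "K \<le> \<delta> * n" and d: "0 \<le> \<delta>" "\<delta> \<le> 1 / 96"
    and big: "real k * (\<delta> * n) + real k < real (card (R 0))"
    and m: "real N + real q * real N * (\<delta> * n) \<le> real m" "0 < m"
    and cells: "\<And>i. i < q \<Longrightarrow> 2 ^ card W * m \<le> card (R i)"
    and eps: "0 \<le> \<epsilon>" "\<epsilon> \<le> 1" and gam: "0 < \<gamma>" "\<gamma> \<le> 1"
    and small: "3 * \<epsilon> + real (card W) * ((4 + 2 * real (card W)) * \<epsilon> / \<gamma>)\<^sup>2 < 1 / (16 * real q ^ 2)"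
    and err1: "4 * \<delta> * n * (real (card W) * (real q - 1) + (real t - 1)) + real q * (real (card W) * (2 ^ card W * real m)) \<le> \<epsilon> * n"
    and err2: "8 * \<delta> * real (card W) * n\<^sup>2 + (real (card W))\<^sup>2 * n \<le> \<epsilon> * n\<^sup>2"
    and err3: "4 * \<delta> * n + real (card W) \<le> \<epsilon> * n"
  shows "t - 1 \<le> card {w \<in> W. S - \<gamma> * n \<le> sum x (nbrs E w - W)}"
proof -
  note G = extremalD(1)[OF ex] and P = near_turanD(1)[OF nt]
  note f = simple_graphD(1)[OF G]
  define s where "s = S / n"
  define b where "b = 1 - 1 / real q"
  define D where "D w = sum x (nbrs E w - W)" for w
  have np: "0 < n" using V f by (simp add: n card_gt_0_iff)
  have Sn: "S = s * n" using np by (simp add: s_def)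
  have q0: "0 < q" "0 < real q" using q by auto
  have b: "1 / 2 \<le> b" "b \<le> 1" using one_minus_inverse_q by (auto simp: b_def)
  have RV: "R i \<subseteq> V" if "i < q" for i using sep_partsD(1)[OF P that] .
  have UV: "(\<Union>i<q. R i) \<subseteq> V" using RV by auto
  have fU: "finite (\<Union>i<q. R i)" using UV f by (rule finite_subset)
  have WV: "W \<subseteq> V" "finite W" using f by (auto simp: W)
  have K': "K \<le> \<delta> * real (card V)" using K by (simp add: n)
  have part: "\<bar>sum x (R i) - S / real q\<bar> \<le> 4 * \<delta> * n" if "i < q" for i
    unfolding n by (rule eigen_concentration(1)[OF G nt K' q V x0 x1 eig l S d(1) that])
  have "(1 - 1 / real q - 2 * \<delta>) * real (card V) \<le> S"
    by (rule eigen_concentration(3)[OF G nt K' q V x0 x1 eig l S d(1) v0])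
  then have "(b - 2 * \<delta>) * n \<le> s * n" by (simp add: Sn n b_def)
  then have "b - 2 * \<delta> \<le> s" using np by simp
  then have s: "1 / 4 \<le> s" using b d by linarith
  have "S \<le> real (card V)" by (rule eigen_concentration(4)[OF G nt K' q V x0 x1 eig l S d(1)])
  then have s1: "s \<le> 1" using np by (simp add: s_def n)
  have lpos: "0 < lam V E"
  proof -
    have "(b - \<delta>) * n \<le> lam V E" using l by (simp add: b_def n abs_le_iff left_diff_distrib)
    moreover have "0 < (b - \<delta>) * n" using b d np by simp
    ultimately show ?thesis by linarith
  qed
  have DS: "D w \<le> S" if "w \<in> W" for w
  proof -
    have "nbrs E w - W \<subseteq> (\<Union>i<q. R i)" using simple_graphD(6)[OF G, of w] by (auto simp: W)
    then have "D w \<le> sum x (\<Union>i<q. R i)" unfolding D_def using fU x0 by (intro sum_mono2) auto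
    then show ?thesis unfolding S by (simp add: sum_sep_parts[OF G P])
  qed
  have Dlo: "b * S - (4 * \<delta> * n + real (card W)) \<le> D w" if w: "w \<in> W" for w
  proof -
    have "(1 - 1 / real q) * S - 4 * \<delta> * real (card V) \<le> lam V E * x w"
      by (rule outside_weight[OF ex nt K' V x0 x1 eig l S d(1)]) (use big w in \<open>auto simp: n W\<close>)
    also have "\<dots> = sum x (nbrs E w)" using eig[of w] w WV by (auto simp: adj_sum_def)
    also have "\<dots> = sum x (nbrs E w \<inter> W) + D w"
      unfolding D_def using simple_graphD(7)[OF G] by (rule sum.Int_Diff)
    also have "sum x (nbrs E w \<inter> W) \<le> real (card (nbrs E w \<inter> W))"
      using sum_unit_bounds(2)[of "nbrs E w \<inter> W" x] x0 x1 WV by blast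
    also have "real (card (nbrs E w \<inter> W)) \<le> real (card W)" using WV by (auto intro: card_mono)
    finally show ?thesis by (simp add: b_def n)
  qed
  have h: "real (t - 1) = real t - 1" using t by (simp add: of_nat_diff)
  have bS: "b * S = real q * (S / real q) - S / real q" using q0 by (simp add: b_def left_diff_distrib)
  have "t - 1 \<le> card {w \<in> W. s - \<gamma> \<le> D w / n}"
  proof (rule top_values_arith[where b = b and c = "s / real q" and \<epsilon> = \<epsilon>])
    show "s = b * s + s / real q" by (simp add: b_def left_diff_distrib)
    show "0 < s / real q" using s q0 by simp
    show "D w / n \<le> s" if "w \<in> W" for w using DS[OF that] np by (simp add: Sn pos_divide_le_eq)
    show "b * s - \<epsilon> \<le> D w / n" if "w \<in> W" for w
    proof -
      have "(b * s - \<epsilon>) * n \<le> D w" using Dlo[OF that] err3 by (simp add: Sn left_diff_distrib mult.assoc)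
      then show ?thesis using np by (simp add: pos_le_divide_eq)
    qed
    have sumD: "(\<Sum>w\<in>W. D w) \<le> (S / real q + 4 * \<delta> * n) * (real (card W) * (real q - 1) + (real t - 1))
        + real q * (real (card W) * (2 ^ card W * real m))"
      unfolding D_def
    proof (rule popular_weight_bound[OF G extremal_pattern_free[OF ex] nt W x0 x1 d(1) _ _ _ m(2) cells])
      show "sum x (R i) \<le> S / real q + 4 * \<delta> * n" if "i < q" for i using part[OF that] by (simp add: abs_le_iff)
      show "0 \<le> S / real q + 4 * \<delta> * n" using s np d q0 by (simp add: Sn)
      show "real N + real q * real N * (\<delta> * real (card V)) \<le> real m" using m(1) by (simp add: n)
    qed
    have "(\<Sum>w\<in>W. D w) \<le> (S / real q) * (real (card W) * (real q - 1) + (real t - 1)) + \<epsilon> * n"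
      using sumD err1 unfolding distrib_right[of "S / real q"] by linarith
    also have "\<dots> = (real (card W) * (b * s) + real (t - 1) * (s / real q) + \<epsilon>) * n"
      unfolding h using q0 by (simp add: Sn b_def field_simps)
    finally show "(\<Sum>w\<in>W. D w / n) \<le> real (card W) * (b * s) + real (t - 1) * (s / real q) + \<epsilon>"
      using np by (simp add: sum_divide_distrib[symmetric] pos_divide_le_eq)
    obtain C where C: "C \<subseteq> W" "card C = t - 1" using tW by (meson obtain_subset_with_card_n)
    have cmp: "(real t - 1) * S\<^sup>2 + (real (card W) - (real t - 1)) * (S - sum x (R 0))\<^sup>2
      \<le> (\<Sum>w\<in>W. D w * (D w + real (card W)))"
      unfolding D_def by (rule comparison_with_multipartite[OF ex P W C x0 x1 eig lpos S])
    have "b * S - 4 * \<delta> * n \<le> S - sum x (R 0)" using part[OF q0(1)] by (simp add: b_def left_diff_distrib abs_le_iff)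
    moreover have bSd: "0 \<le> b * S - 4 * \<delta> * n"
    proof -
      have "1 / 2 * (1 / 4) \<le> b * s" using b s by (intro mult_mono) auto
      then have "0 \<le> (b * s - 4 * \<delta>) * n" using d np by (intro mult_nonneg_nonneg) auto
      then show ?thesis by (simp add: Sn left_diff_distrib mult.assoc)
    qed
    ultimately have "(b * S - 4 * \<delta> * n)\<^sup>2 \<le> (S - sum x (R 0))\<^sup>2" by (intro power_mono)
    moreover have "(b * S)\<^sup>2 - 8 * \<delta> * n\<^sup>2 \<le> (b * S - 4 * \<delta> * n)\<^sup>2"
    proof -
      have "b * s \<le> 1 * 1" using b s s1 by (intro mult_mono) auto
      then have "b * S \<le> n" using np by (simp add: Sn mult.assoc[symmetric])
      then have "8 * \<delta> * n * (b * S) \<le> 8 * \<delta> * n * n" using d np by (intro mult_left_mono) auto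
      moreover have "(b * S - 4 * \<delta> * n)\<^sup>2 = (b * S)\<^sup>2 - 8 * \<delta> * n * (b * S) + (4 * \<delta> * n)\<^sup>2"
        by (simp add: power2_eq_square algebra_simps)
      moreover have "8 * \<delta> * n * n = 8 * \<delta> * n\<^sup>2" by (simp add: power2_eq_square)
      moreover have "0 \<le> (4 * \<delta> * n)\<^sup>2" by simp
      ultimately show ?thesis by linarith
    qed
    ultimately have sq: "(b * S)\<^sup>2 - 8 * \<delta> * n\<^sup>2 \<le> (S - sum x (R 0))\<^sup>2" by linarith
    have hW: "0 \<le> real (card W) - (real t - 1)" "real (card W) - (real t - 1) \<le> real (card W)" using tW h t by auto
    have "(real (card W) - (real t - 1)) * (b * S)\<^sup>2 - real (card W) * (8 * \<delta> * n\<^sup>2)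
      \<le> (real (card W) - (real t - 1)) * ((b * S)\<^sup>2 - 8 * \<delta> * n\<^sup>2)"
      using mult_right_mono[OF hW(2), of "8 * \<delta> * n\<^sup>2"] d by (simp add: right_diff_distrib)
    also have "\<dots> \<le> (real (card W) - (real t - 1)) * (S - sum x (R 0))\<^sup>2" using sq hW by (intro mult_left_mono) auto
    finally have a1: "(real (card W) - (real t - 1)) * (b * S)\<^sup>2 - real (card W) * (8 * \<delta> * n\<^sup>2)
      \<le> (real (card W) - (real t - 1)) * (S - sum x (R 0))\<^sup>2" .
    have "(\<Sum>w\<in>W. D w * (D w + real (card W))) \<le> (\<Sum>w\<in>W. (D w)\<^sup>2 + n * real (card W))"
    proof (rule sum_mono)
      fix w assume w: "w \<in> W"
      have "s * n \<le> 1 * n" using s1 np by (intro mult_right_mono) auto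
      then have "D w \<le> n" using DS[OF w] Sn by simp
      then have "D w * real (card W) \<le> n * real (card W)" by (rule mult_right_mono) simp
      then show "D w * (D w + real (card W)) \<le> (D w)\<^sup>2 + n * real (card W)"
        by (simp add: power2_eq_square distrib_left)
    qed
    also have "\<dots> = (\<Sum>w\<in>W. (D w)\<^sup>2) + (real (card W))\<^sup>2 * n"
      by (simp add: sum.distrib power2_eq_square)
    finally have a2: "(\<Sum>w\<in>W. D w * (D w + real (card W))) \<le> (\<Sum>w\<in>W. (D w)\<^sup>2) + (real (card W))\<^sup>2 * n" .
    have a3: "real (card W) * (8 * \<delta> * n\<^sup>2) = 8 * \<delta> * real (card W) * n\<^sup>2" by simp
    have "(real t - 1) * S\<^sup>2 + (real (card W) - (real t - 1)) * (b * S)\<^sup>2 - \<epsilon> * n\<^sup>2 \<le> (\<Sum>w\<in>W. (D w)\<^sup>2)"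
      using cmp a1 a2 err2 unfolding a3 by linarith
    then have "(real (t - 1) * s\<^sup>2 + (real (card W) - real (t - 1)) * (b * s)\<^sup>2 - \<epsilon>) * n\<^sup>2 \<le> (\<Sum>w\<in>W. (D w)\<^sup>2)"
      unfolding h Sn by (simp add: power_mult_distrib algebra_simps)
    then have "real (t - 1) * s\<^sup>2 + (real (card W) - real (t - 1)) * (b * s)\<^sup>2 - \<epsilon> \<le> (\<Sum>w\<in>W. (D w)\<^sup>2) / n\<^sup>2"
      using np by (simp add: pos_le_divide_eq)
    also have "\<dots> = (\<Sum>w\<in>W. (D w / n)\<^sup>2)" by (simp add: sum_divide_distrib power_divide)
    finally show "real (t - 1) * s\<^sup>2 + (real (card W) - real (t - 1)) * (b * s)\<^sup>2 - \<epsilon> \<le> (\<Sum>w\<in>W. (D w / n)\<^sup>2)" .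
    have "(1 / (4 * real q))\<^sup>2 \<le> (s / real q)\<^sup>2" using s q0 by (intro power_mono) (auto simp: field_simps)
    moreover have "(1 / (4 * real q))\<^sup>2 = 1 / (16 * real q ^ 2)" by (simp add: power_divide power_mult_distrib)
    ultimately show "3 * \<epsilon> + real (card W) * ((4 + 2 * real (card W)) * \<epsilon> / \<gamma>)\<^sup>2 < (s / real q)\<^sup>2"
      using small by linarith
  qed (use WV eps gam b s s1 in auto)
  moreover have "s - \<gamma> \<le> D w / n \<longleftrightarrow> S - \<gamma> * n \<le> D w" for w
    using np by (simp add: pos_le_divide_eq Sn left_diff_distrib)
  ultimately show ?thesis by (simp add: D_def)
qed

text \<open>The parameters depend on each other in the order \<open>\<delta>\<^sub>1, \<gamma>, \<epsilon>, \<mu>, \<delta>\<close>, each small against the previous ones and \<open>K\<close>.\<close>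

theorem extremal_multipartite:
  "\<exists>n0. \<forall>V E. extremal V E \<longrightarrow> n0 \<le> card V \<longrightarrow>
    (\<exists>g. E = multipartite V g \<and> card {v \<in> V. q \<le> g v} = t - 1 \<and> inj_on g {v \<in> V. q \<le> g v} \<and>
      (\<forall>i<q. \<forall>j<q. card {v \<in> V. g v = i} \<le> card {v \<in> V. g v = j} + 1))"
proof -
  have q0: "0 < real q" "1 \<le> real q" using q by auto
  have t0: "1 \<le> real t" using t by simp
  have N0: "0 < real N" using N by simp
  obtain K :: nat where K: "\<And>\<delta>. 0 < \<delta> \<Longrightarrow> \<exists>n0. \<forall>V E. extremal V E \<longrightarrow> n0 \<le> card V \<longrightarrow>
    (\<exists>R. near_turan V E q R (real K) \<delta> \<and> t - 1 \<le> card (V - (\<Union>i<q. R i))) \<and>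
    \<bar>lam V E - (1 - 1 / real q) * real (card V)\<bar> \<le> \<delta> * real (card V) \<and>
    (\<forall>u\<in>V. (1 - 1 / real q - \<delta>) * real (card V) \<le> real (card (nbrs E u)))"
    using extremal_structure by blast
  define \<kappa> where "\<kappa> = real K"
  have kap: "0 \<le> \<kappa>" by (simp add: \<kappa>_def)
  define \<delta>1 where "\<delta>1 = 1 / (16 * real q)"
  \<comment> \<open>Entries on the classes are at least \<open>1/8\<close>, so a weight deficit of
    \<open>\<gamma> * n\<close> means at most \<open>8 * \<gamma> * n\<close> missing neighbours.
    For \<open>t - 1\<close> vertices this amounts to at most half of
    \<open>\<delta>1 * n\<close>.\<close>
  define \<gamma> where "\<gamma> = \<delta>1 / (16 * real t)"
  have d1: "0 < \<delta>1" "\<delta>1 \<le> 1" using q0 by (auto simp: \<delta>1_def)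
  have gam: "0 < \<gamma>" using d1 t0 by (simp add: \<gamma>_def)
  have gt: "16 * real t * \<gamma> = \<delta>1" using t0 by (simp add: \<gamma>_def)
  have "1 * \<gamma> \<le> (16 * real t) * \<gamma>" using t0 gam by (intro mult_right_mono) auto
  then have gam1: "\<gamma> \<le> 1" using gt d1 by simp
  \<comment> \<open>Since \<open>\<epsilon>^2 \<le> \<epsilon>\<close>, the left side of the
    condition \<open>small\<close> is at most \<open>\<epsilon> * \<Lambda>\<close>.\<close>
  define \<Lambda> where "\<Lambda> = 3 + \<kappa> * ((4 + 2 * \<kappa>) / \<gamma>)\<^sup>2"
  have Lam: "0 < \<Lambda>" unfolding \<Lambda>_def using kap by (intro add_pos_nonneg) auto
  define \<epsilon> where "\<epsilon> = min 1 (1 / (32 * real q ^ 2 * \<Lambda>))"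
  have eps: "0 < \<epsilon>" "\<epsilon> \<le> 1" using q0 Lam by (auto simp: \<epsilon>_def)
  have "\<epsilon> \<le> 1 / (32 * real q ^ 2 * \<Lambda>)" by (simp add: \<epsilon>_def)
  then have epsL: "\<epsilon> * \<Lambda> \<le> 1 / (32 * real q ^ 2)" using q0 Lam by (simp add: field_simps)
  \<comment> \<open>Cells below about \<open>\<mu> * n\<close> count as small. There are at most
    \<open>2 ^ K\<close> of them in a class, and with this value their total contribution is at most
    \<open>\<epsilon> * n / 4\<close>.\<close>
  define \<mu> where "\<mu> = \<epsilon> / (4 * real q * (\<kappa> + 1) * 2 ^ K)"
  have mu: "0 < \<mu>" using eps q0 kap by (simp add: \<mu>_def)
  have muK: "4 * real q * (\<kappa> + 1) * (2 ^ K * \<mu>) = \<epsilon>" using q0 kap by (simp add: \<mu>_def)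
  \<comment> \<open>The bound \<open>1 / 96\<close> gives \<open>12 * \<delta> \<le> 1/8\<close>,
    which keeps the entries on the classes at \<open>1/8\<close> or above. The third term serves the
    switching, the two with \<open>N\<close> the greedy choices, and the last two the error terms
    \<open>err1\<close>, \<open>err2\<close> and \<open>err3\<close>.\<close>
  define \<delta> where "\<delta> = Min {1 / 96, \<delta>1, 1 / (16 * real q * (real k + 1)), \<delta>1 / (4 * real q * real N), \<mu> / (4 * real q * real N),
     \<epsilon> / (8 * (\<kappa> * real q + real t)), \<epsilon> / (16 * (\<kappa> + 1))}"
  have fin: "finite {1 / 96, \<delta>1, 1 / (16 * real q * (real k + 1)), \<delta>1 / (4 * real q * real N), \<mu> / (4 * real q * real N),
     \<epsilon> / (8 * (\<kappa> * real q + real t)), \<epsilon> / (16 * (\<kappa> + 1))}" by simp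
  have qt: "0 < \<kappa> * real q + real t" using kap q0 t0 by (intro add_nonneg_pos) auto
  have d0: "0 < \<delta>" unfolding \<delta>_def using d1 mu eps q0 N0 kap qt by (subst Min_gr_iff) auto
  have dle: "\<delta> \<le> 1 / 96" "\<delta> \<le> \<delta>1" "\<delta> \<le> 1 / (16 * real q * (real k + 1))" "\<delta> \<le> \<delta>1 / (4 * real q * real N)"
    "\<delta> \<le> \<mu> / (4 * real q * real N)" "\<delta> \<le> \<epsilon> / (8 * (\<kappa> * real q + real t))" "\<delta> \<le> \<epsilon> / (16 * (\<kappa> + 1))"
    unfolding \<delta>_def by (rule Min_le[OF fin], simp)+
  have qk: "0 < 16 * real q * (real k + 1)" "0 < 4 * real q * real N" "0 < 8 * (\<kappa> * real q + real t)" "0 < 16 * (\<kappa> + 1)"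
    using q0 N0 kap qt by auto
  have de: "\<delta> * (16 * real q * (real k + 1)) \<le> 1" "\<delta> * (4 * real q * real N) \<le> \<delta>1" "\<delta> * (4 * real q * real N) \<le> \<mu>"
    "\<delta> * (8 * (\<kappa> * real q + real t)) \<le> \<epsilon>" "\<delta> * (16 * (\<kappa> + 1)) \<le> \<epsilon>"
    using dle(3-7) qk by (simp_all only: pos_le_divide_eq)
  obtain n1 where n1: "\<And>V E. extremal V E \<Longrightarrow> n1 \<le> card V \<Longrightarrow>
    (\<exists>R. near_turan V E q R (real K) \<delta> \<and> t - 1 \<le> card (V - (\<Union>i<q. R i))) \<and>
    \<bar>lam V E - (1 - 1 / real q) * real (card V)\<bar> \<le> \<delta> * real (card V) \<and>
    (\<forall>u\<in>V. (1 - 1 / real q - \<delta>) * real (card V) \<le> real (card (nbrs E u)))"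
    using K[OF d0] by blast
  define n0 where "n0 = n1 + 1 + nat \<lceil>\<kappa> / \<delta>\<rceil> + nat \<lceil>16 * real q * real k\<rceil> + nat \<lceil>(2 * real N + 2) / \<mu>\<rceil>
     + nat \<lceil>4 * real N / \<delta>1\<rceil> + nat \<lceil>2 * \<kappa>\<^sup>2 / \<epsilon>\<rceil> + nat \<lceil>2 * \<kappa> / \<epsilon>\<rceil>"
  have "\<exists>g. E = multipartite V g \<and> card {v \<in> V. q \<le> g v} = t - 1 \<and> inj_on g {v \<in> V. q \<le> g v} \<and>
      (\<forall>i<q. \<forall>j<q. card {v \<in> V. g v = i} \<le> card {v \<in> V. g v = j} + 1)"
    if ex: "extremal V E" and big: "n0 \<le> card V" for V E
  proof -
    note G = extremalD(1)[OF ex]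
    note f = simple_graphD(1)[OF G]
    define n where "n = real (card V)"
    have V: "V \<noteq> {}" using big by (auto simp: n0_def)
    have np: "0 < n" using V f by (simp add: n_def card_gt_0_iff)
    have "\<kappa> / \<delta> \<le> n" "16 * real q * real k < n" "(2 * real N + 2) / \<mu> \<le> n" "4 * real N / \<delta>1 \<le> n"
      "2 * \<kappa>\<^sup>2 / \<epsilon> \<le> n" "2 * \<kappa> / \<epsilon> \<le> n"
      using big unfolding n0_def n_def by linarith+
    then have ng: "\<kappa> \<le> \<delta> * n" "16 * real q * real k < n" "2 * real N + 2 \<le> \<mu> * n" "4 * real N \<le> \<delta>1 * n"
      "2 * \<kappa>\<^sup>2 \<le> \<epsilon> * n" "2 * \<kappa> \<le> \<epsilon> * n"
      using d0 mu d1 eps by (simp_all add: pos_divide_le_eq mult.commute)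
    obtain R where nt: "near_turan V E q R (real K) \<delta>" and tW: "t - 1 \<le> card (V - (\<Union>i<q. R i))"
      and l: "\<bar>lam V E - (1 - 1 / real q) * real (card V)\<bar> \<le> \<delta> * real (card V)"
      and deg: "\<And>u. u \<in> V \<Longrightarrow> (1 - 1 / real q - \<delta>) * real (card V) \<le> real (card (nbrs E u))"
      using n1[OF ex] big unfolding n0_def by auto
    note P = near_turanD(1)[OF nt]
    define U where "U = (\<Union>i<q. R i)"
    define W where "W = V - (\<Union>i<q. R i)"
    have cW: "card W \<le> K" using near_turanD(2)[OF nt] by (simp add: W_def)
    then have cWr: "real (card W) \<le> \<kappa>" by (simp add: \<kappa>_def)
    have tWr: "real t - 1 \<le> \<kappa>" using tW cW t unfolding W_def[symmetric] \<kappa>_def by linarith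
    have RV: "R i \<subseteq> V" if "i < q" for i using sep_partsD(1)[OF P that] .
    have UV: "U \<subseteq> V" using RV by (auto simp: U_def)
    have fU: "finite U" using UV f by (rule finite_subset)
    have q00: "0 < q" using q by simp
    have nq: "0 \<le> \<delta> * n" using d0 np by simp
    have cR: "n / (2 * real q) \<le> real (card (R i))" if "i < q" for i
    proof -
      have "16 * real q * 1 \<le> 16 * real q * (real k + 1)" using q0 by (intro mult_left_mono) auto
      then have "\<delta> * (16 * real q) \<le> \<delta> * (16 * real q * (real k + 1))" using d0 by (intro mult_left_mono) auto
      then have "\<delta> * (16 * real q) \<le> 1" using de(1) by linarith
      then have "\<delta> \<le> 1 / (2 * real q)" using q0 d0 by (simp add: field_simps)
      then have "\<delta> * n \<le> 1 / (2 * real q) * n" using np by (intro mult_right_mono) auto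
      moreover have "n / real q = 2 * (n / (2 * real q))" by simp
      ultimately show ?thesis using near_turanD(3)[OF nt that] by (simp add: n_def abs_le_iff)
    qed
    obtain x v0 where x0: "\<And>u. 0 \<le> x u" and x1: "\<And>u. u \<in> V \<Longrightarrow> x u \<le> 1" and v0: "v0 \<in> V" "x v0 = 1"
      and eig: "\<And>u. u \<in> V \<Longrightarrow> adj_sum E x u = lam V E * x u" by (rule perron_max[OF G V]) blast
    define S where "S = (\<Sum>i<q. sum x (R i))"
    have Kn: "real K \<le> \<delta> * real (card V)" using ng(1) by (simp add: \<kappa>_def n_def)
    have SU: "sum x U = S" unfolding U_def S_def by (rule sum_sep_parts[OF G P])
    have "(1 - 1 / real q - 2 * \<delta>) * real (card V) \<le> S"
      by (rule eigen_concentration(3)[OF G nt Kn q V x0 x1 eig l S_def less_imp_le[OF d0] v0])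
    moreover have "1 / 4 * n \<le> (1 - 1 / real q - 2 * \<delta>) * n"
      using one_minus_inverse_q dle(1) np by (intro mult_right_mono) auto
    ultimately have Slo: "n / 4 \<le> S" unfolding n_def by linarith
    have xU: "1 / 8 \<le> x v" if "v \<in> U" for v
    proof -
      obtain i where i: "i < q" "v \<in> R i" using \<open>v \<in> U\<close> by (auto simp: U_def)
      have "\<bar>x v - S / real (card V)\<bar> \<le> 12 * \<delta>"
        by (rule eigen_concentration(2)[OF G nt Kn q V x0 x1 eig l S_def less_imp_le[OF d0] i])
      moreover have "1 / 4 \<le> S / real (card V)" using Slo np by (simp add: n_def pos_le_divide_eq)
      ultimately show ?thesis using dle(1) by (simp add: abs_le_iff)
    qed
    have sw: "real k * (\<delta> * n) + real k < real (card (R 0))"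
    proof -
      have "\<delta> * (16 * real q * (real k + 1)) * n \<le> 1 * n" using de(1) np by (intro mult_right_mono) auto
      then have "16 * (real q * (real k * (\<delta> * n))) + 16 * (real q * (\<delta> * n)) \<le> n" by (simp add: algebra_simps)
      moreover have "0 \<le> real q * (\<delta> * n)" using q0 nq by simp
      ultimately have "2 * real q * (real k * (\<delta> * n) + real k) < n" using ng(2) np by (simp add: distrib_left)
      then have "real k * (\<delta> * n) + real k < n / (2 * real q)" using q0 by (simp add: pos_less_divide_eq mult.commute)
      then show ?thesis using cR[OF q00] by linarith
    qed
    define m where "m = nat \<lfloor>\<mu> * n\<rfloor>"
    have mun: "0 < \<mu> * n" using mu np by simp
    have m1: "real m \<le> \<mu> * n" and m2: "\<mu> * n - 1 \<le> real m" using mun unfolding m_def by linarith+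
    have mN: "real N + real q * real N * (\<delta> * n) \<le> real m"
    proof -
      have "\<delta> * (4 * real q * real N) * n \<le> \<mu> * n" using de(3) np by (intro mult_right_mono) auto
      then have "4 * (real q * real N * (\<delta> * n)) \<le> \<mu> * n" by (simp add: mult_ac)
      then show ?thesis using ng(3) m2 mun by linarith
    qed
    have m0: "0 < m"
    proof -
      have "0 \<le> real q * real N * (\<delta> * n)" using nq by simp
      then have "0 < real m" using mN N0 by linarith
      then show ?thesis by simp
    qed
    have p2: "(2::real) ^ card W \<le> 2 ^ K" using cW by (intro power_increasing) auto
    have pm: "2 ^ card W * real m \<le> 2 ^ K * \<mu> * n"
    proof -
      have "2 ^ card W * real m \<le> 2 ^ K * (\<mu> * n)" using p2 m1 by (intro mult_mono) auto
      then show ?thesis by simp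
    qed
    have muq: "4 * (real q * ((\<kappa> + 1) * (2 ^ K * \<mu> * n))) = \<epsilon> * n" using muK by (metis mult.assoc)
    have pz: "0 \<le> 2 ^ K * \<mu> * n" using mu np by simp
    have cells: "2 ^ card W * m \<le> card (R i)" if i: "i < q" for i
    proof -
      have "1 * (2 ^ K * \<mu> * n) \<le> (\<kappa> + 1) * (2 ^ K * \<mu> * n)" using kap pz by (intro mult_right_mono) auto
      then have "real q * (2 ^ K * \<mu> * n) \<le> real q * ((\<kappa> + 1) * (2 ^ K * \<mu> * n))" using q0 by (intro mult_left_mono) auto
      moreover have "\<epsilon> * n \<le> 1 * n" using eps np by (intro mult_right_mono) auto
      ultimately have "2 * (real q * (2 ^ K * \<mu> * n)) \<le> n" using muq np by linarith
      then have "2 ^ K * \<mu> * n \<le> n / (2 * real q)" using q0 by (simp add: pos_le_divide_eq mult_ac)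
      then have "2 ^ card W * real m \<le> real (card (R i))" using pm cR[OF i] by linarith
      then have "real (2 ^ card W * m) \<le> real (card (R i))" by simp
      then show ?thesis by (simp only: of_nat_le_iff)
    qed
    have small: "3 * \<epsilon> + real (card W) * ((4 + 2 * real (card W)) * \<epsilon> / \<gamma>)\<^sup>2 < 1 / (16 * real q ^ 2)"
    proof -
      have "real (card W) * ((4 + 2 * real (card W)) * \<epsilon> / \<gamma>)\<^sup>2 \<le> \<kappa> * ((4 + 2 * \<kappa>) * \<epsilon> / \<gamma>)\<^sup>2"
        using cWr kap eps gam by (intro mult_mono power_mono divide_right_mono mult_right_mono) auto
      also have "\<dots> = (\<kappa> * ((4 + 2 * \<kappa>) / \<gamma>)\<^sup>2) * (\<epsilon> * \<epsilon>)" by (simp add: power2_eq_square)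
      also have "\<dots> \<le> (\<kappa> * ((4 + 2 * \<kappa>) / \<gamma>)\<^sup>2) * (1 * \<epsilon>)"
        using eps kap by (intro mult_left_mono mult_right_mono) auto
      finally have "3 * \<epsilon> + real (card W) * ((4 + 2 * real (card W)) * \<epsilon> / \<gamma>)\<^sup>2 \<le> \<epsilon> * \<Lambda>"
        by (simp add: \<Lambda>_def algebra_simps)
      also have "\<dots> \<le> 1 / (32 * real q ^ 2)" by (rule epsL)
      also have "\<dots> < 1 / (16 * real q ^ 2)" using q0 by (intro divide_strict_left_mono) auto
      finally show ?thesis .
    qed
    have err1: "4 * \<delta> * n * (real (card W) * (real q - 1) + (real t - 1)) + real q * (real (card W) * (2 ^ card W * real m)) \<le> \<epsilon> * n"
    proof -
      have "real (card W) * (real q - 1) + (real t - 1) \<le> \<kappa> * real q + real t"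
      proof -
        have "real (card W) * (real q - 1) \<le> \<kappa> * real q" using cWr q0 by (intro mult_mono) auto
        then show ?thesis by linarith
      qed
      then have "4 * \<delta> * n * (real (card W) * (real q - 1) + (real t - 1)) \<le> 4 * \<delta> * n * (\<kappa> * real q + real t)"
        using nq by (intro mult_left_mono) auto
      also have "\<dots> = \<delta> * (8 * (\<kappa> * real q + real t)) * n / 2" by simp
      also have "\<dots> \<le> \<epsilon> * n / 2" using mult_right_mono[OF de(4), of n] np by simp
      finally have a: "4 * \<delta> * n * (real (card W) * (real q - 1) + (real t - 1)) \<le> \<epsilon> * n / 2" .
      have "real (card W) * (2 ^ card W * real m) \<le> (\<kappa> + 1) * (2 ^ K * \<mu> * n)"
        by (rule mult_mono) (use cWr pm kap in auto)
      then have "real q * (real (card W) * (2 ^ card W * real m)) \<le> real q * ((\<kappa> + 1) * (2 ^ K * \<mu> * n))"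
        using q0 by (intro mult_left_mono) auto
      moreover have "0 \<le> \<epsilon> * n" using eps np by simp
      ultimately show ?thesis using a muq by linarith
    qed
    have dk: "16 * (\<delta> * \<kappa>) + 16 * \<delta> \<le> \<epsilon>" using de(5) by (simp add: algebra_simps)
    have err2: "8 * \<delta> * real (card W) * n\<^sup>2 + (real (card W))\<^sup>2 * n \<le> \<epsilon> * n\<^sup>2"
    proof -
      have "\<delta> * real (card W) \<le> \<delta> * \<kappa>" using cWr d0 by (intro mult_left_mono) auto
      then have "8 * \<delta> * real (card W) \<le> \<epsilon> / 2" using dk d0 by linarith
      then have "8 * \<delta> * real (card W) * n\<^sup>2 \<le> \<epsilon> / 2 * n\<^sup>2" by (rule mult_right_mono) simp
      moreover have "(real (card W))\<^sup>2 * n \<le> \<epsilon> / 2 * n\<^sup>2"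
      proof -
        have "(real (card W))\<^sup>2 \<le> \<kappa>\<^sup>2" using cWr by (intro power_mono) auto
        then have "(real (card W))\<^sup>2 \<le> \<epsilon> / 2 * n" using ng(5) by linarith
        then have "(real (card W))\<^sup>2 * n \<le> \<epsilon> / 2 * n * n" using np by (intro mult_right_mono) auto
        then show ?thesis by (simp add: power2_eq_square)
      qed
      ultimately show ?thesis by linarith
    qed
    have err3: "4 * \<delta> * n + real (card W) \<le> \<epsilon> * n"
    proof -
      have "0 \<le> \<delta> * \<kappa>" using d0 kap by simp
      then have "4 * \<delta> \<le> \<epsilon> / 2" using dk d0 by linarith
      then have "4 * \<delta> * n \<le> \<epsilon> / 2 * n" using np by (intro mult_right_mono) auto
      then show ?thesis using cWr ng(6) by linarith
    qed
    define D where "D w = sum x (nbrs E w - W)" for w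
    have tW': "t - 1 \<le> card W" using tW by (simp add: W_def)
    have "t - 1 \<le> card {w \<in> W. S - \<gamma> * n \<le> D w}"
      unfolding D_def
      by (rule universal_vertices[OF ex nt W_def tW' V x0 x1 v0 eig l S_def n_def _ _ dle(1) sw mN m0 cells _ eps(2) gam gam1 small err1 err2 err3])
        (use Kn d0 eps in \<open>auto simp: n_def\<close>)
    then obtain C where C: "C \<subseteq> {w \<in> W. S - \<gamma> * n \<le> D w}" "card C = t - 1" by (meson obtain_subset_with_card_n)
    have CW: "C \<subseteq> W" using C(1) by blast
    have missC: "real (card (U - nbrs E c)) \<le> 8 * \<gamma> * n" if c: "c \<in> C" for c
    proof -
      have "nbrs E c - W = U \<inter> nbrs E c" using simple_graphD(6)[OF G, of c] UV by (auto simp: W_def U_def)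
      then have "S = sum x (U - nbrs E c) + D c"
        using sum.Int_Diff[OF fU, of x "nbrs E c"] by (simp add: D_def SU)
      moreover have "S - \<gamma> * n \<le> D c" using C(1) c by blast
      ultimately have "sum x (U - nbrs E c) \<le> \<gamma> * n" by linarith
      moreover have "real (card (U - nbrs E c)) * (1 / 8) \<le> sum x (U - nbrs E c)"
        using xU by (intro sum_bounded_below) auto
      ultimately show ?thesis by linarith
    qed
    have tg: "real (t - 1) * (8 * \<gamma> * n) \<le> \<delta>1 * n / 2"
    proof -
      have "real (t - 1) * (8 * \<gamma> * n) \<le> real t * (8 * \<gamma> * n)" using gam np by (intro mult_right_mono) auto
      also have "\<dots> = (16 * real t * \<gamma>) * n / 2" by simp
      finally show ?thesis unfolding gt .
    qed
    have qNd: "real q * real N * (\<delta> * n) \<le> \<delta>1 * n / 4"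
    proof -
      have "\<delta> * (4 * real q * real N) * n \<le> \<delta>1 * n" using de(2) np by (intro mult_right_mono) auto
      then show ?thesis by (simp add: mult_ac)
    qed
    obtain g where g: "\<And>u v. E u v \<Longrightarrow> multipartite V g u v" "{v \<in> V. q \<le> g v} = C" "inj_on g C"
    proof (rule partite_off_universal[OF ex nt W_def less_imp_le[OF d0] less_imp_le[OF d1(1)] deg CW C(2)])
      show "real (card ((\<Union>i<q. R i) - nbrs E c)) \<le> 8 * \<gamma> * n" if "c \<in> C" for c
        using missC[OF that] by (simp add: U_def)
      show "0 \<le> 8 * \<gamma> * n" using gam np by simp
      show "real N + real q * real N * (\<delta> * real (card V)) + real (t - 1) * (8 * \<gamma> * n) \<le> \<delta>1 * real (card V)"
        using qNd tg ng(4) unfolding n_def[symmetric] by linarith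
      have "\<delta> * n \<le> \<delta>1 * n" using dle(2) np by (intro mult_right_mono) auto
      moreover have "16 * (\<delta>1 * n) = n / real q" using q0 by (simp add: \<delta>1_def)
      moreover have "0 \<le> \<delta>1 * n" using d1 np by simp
      moreover have "(2 * \<delta> + \<delta>1) * n = 2 * (\<delta> * n) + \<delta>1 * n" "(1 / real q - \<delta>) * n = n / real q - \<delta> * n"
        by (simp_all add: algebra_simps)
      ultimately show "real N + real q * real N * (\<delta> * real (card V)) + real (t - 1) * (8 * \<gamma> * n) + 2 * ((2 * \<delta> + \<delta>1) * real (card V))
        \<le> (1 / real q - \<delta>) * real (card V)"
        using qNd tg ng(4) unfolding n_def[symmetric] by linarith
    qed auto
    have lpos: "0 < lam V E"
    proof -
      have "(1 - 1 / real q) * n - \<delta> * n \<le> lam V E" using l by (simp add: n_def abs_le_iff)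
      moreover have "0 < (1 - 1 / real q - \<delta>) * n" using one_minus_inverse_q dle(1) np by (intro mult_pos_pos) auto
      ultimately show ?thesis by (simp add: left_diff_distrib)
    qed
    \<comment> \<open>Positivity of the whole eigenvector, which
      \<open>extremal_eq_multipartite\<close> requires, comes from concentration on the classes and
      from switching on the exceptional vertices.\<close>
    have xpos: "0 < x u" if u: "u \<in> V" for u
    proof (cases "u \<in> U")
      case True
      then show ?thesis using xU[of u] by simp
    next
      case False
      then have uW: "u \<in> V - (\<Union>i<q. R i)" using u by (simp add: U_def)
      have "(1 - 1 / real q) * S - 4 * \<delta> * real (card V) \<le> lam V E * x u"
        by (rule outside_weight[OF ex nt Kn V x0 x1 eig l S_def less_imp_le[OF d0] sw[unfolded n_def] uW])
      moreover have "1 / 2 * (n / 4) \<le> (1 - 1 / real q) * S" using one_minus_inverse_q Slo np by (intro mult_mono) auto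
      moreover have "4 * \<delta> * n \<le> 4 * (1 / 96) * n" using dle(1) np by (intro mult_right_mono) auto
      ultimately have "0 < lam V E * x u" using np unfolding n_def[symmetric] by linarith
      then show ?thesis using lpos by (simp add: zero_less_mult_iff)
    qed
    have cC: "card {v \<in> V. q \<le> g v} \<le> t - 1" using g(2) C(2) by simp
    have E: "E = multipartite V g" by (rule extremal_eq_multipartite[OF ex g(1) cC eig xpos])
    have "card {v \<in> V. g v = i} \<le> card {v \<in> V. g v = j} + 1" if "i < q" "j < q" for i j
      by (rule extremal_multipartite_balanced[OF _ cC V _ that]) (use ex lpos in \<open>simp_all only: E[symmetric]\<close>)
    then show ?thesis using E g(2,3) C(2) by (intro exI[of _ g]) auto
  qed
  then show ?thesis by blast
qed

end

subsection \<open>Powers of cycles\<close>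

text \<open>Adjacency in \<open>C\<^sub>k\<^sup>p\<close>, with the distance on the cycle expressed by a signed offset.\<close>

definition cyclic_adj :: "nat \<Rightarrow> nat \<Rightarrow> nat \<Rightarrow> nat \<Rightarrow> bool" where
  "cyclic_adj k p i j \<longleftrightarrow> i < k \<and> j < k \<and> i \<noteq> j \<and> (\<exists>d::int. \<bar>d\<bar> \<le> int p \<and> int k dvd int j - int i - d)"

lemma cyclic_adj_sym: "cyclic_adj k p i j \<Longrightarrow> cyclic_adj k p j i"
proof -
  assume a: "cyclic_adj k p i j"
  then obtain d :: int where d: "\<bar>d\<bar> \<le> int p" "int k dvd int j - int i - d" by (auto simp: cyclic_adj_def)
  have "int i - int j - (- d) = - (int j - int i - d)" by simp
  then have "int k dvd int i - int j - (- d)" using d(2) by (metis dvd_minus_iff)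
  moreover have "\<bar>- d\<bar> \<le> int p" using d(1) by simp
  ultimately show "cyclic_adj k p j i" using a unfolding cyclic_adj_def by blast
qed

text \<open>Both ways around the cycle between \<open>i\<close> and \<open>j\<close> are longer than
  \<open>p\<close>.\<close>

lemma not_cyclic_adj:
  assumes "i < j" "p < j - i" "j - i + p < k"
  shows "\<not> cyclic_adj k p i j" and "\<not> cyclic_adj k p j i"
proof -
  show 1: "\<not> cyclic_adj k p i j"
  proof
    assume "cyclic_adj k p i j"
    then obtain d :: int where d: "\<bar>d\<bar> \<le> int p" "int k dvd int j - int i - d" by (auto simp: cyclic_adj_def)
    have "0 < int j - int i - d" "int j - int i - d < int k" using assms d(1) by linarith+
    then show False using d(2) zdvd_not_zless by blast
  qed
  show "\<not> cyclic_adj k p j i" using 1 cyclic_adj_sym by blast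
qed

section \<open>Distances in the cycle as residues modulo k\<close>

lemma in_cycle_arcs:
  assumes "(u, v) \<in> parcs (cycle_graph k)"
  shows "int k dvd int v - int u - 1 \<or> int k dvd int v - int u + 1"
proof -
  have m: "int k dvd int (Suc a mod k) - int a - 1" for a
  proof -
    have "int (Suc a mod k) = int (Suc a) mod int k" by (simp add: zmod_int)
    then have e: "int (Suc a mod k) - int a - 1 = int (Suc a) mod int k - int (Suc a)" by simp
    have "int k dvd int (Suc a) mod int k - int (Suc a)"
      by (metis dvd_minus_mod dvd_minus_iff minus_diff_eq)
    then show ?thesis unfolding e .
  qed
  have "v = Suc u mod k \<or> u = Suc v mod k" using assms by (auto simp: cycle_graph_def)
  then show ?thesis
  proof
    assume "v = Suc u mod k"
    then show ?thesis using m[of u] by simp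
  next
    assume "u = Suc v mod k"
    then have "int k dvd int u - int v - 1" using m[of v] by simp
    moreover have "int v - int u + 1 = - (int u - int v - 1)" by simp
    ultimately show ?thesis by (metis dvd_minus_iff)
  qed
qed

lemma (in wf_digraph) awalk_cost_unit: "awalk_cost (\<lambda>_. 1) p = real (length p)"
  by (induction p) auto

lemma wf_cycle_graph: "wf_digraph (with_proj (cycle_graph k))"
  using pair_graph_cycle_graph[of k] by (simp add: wf_digraph_wp_iff pair_graph_def pair_digraph_def pair_fin_digraph_def)

lemma cycle_walk_offset:
  assumes "pre_digraph.awalk (with_proj (cycle_graph k)) u p v"
  shows "\<exists>d::int. \<bar>d\<bar> \<le> int (length p) \<and> int k dvd int v - int u - d"
  using assms
proof (induction p arbitrary: u)
  case Nil
  then have "u = v" by (simp add: pre_digraph.awalk_def pre_digraph.cas.simps)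
  then show ?case by (intro exI[of _ 0]) auto
next
  case (Cons e p)
  interpret wf_digraph "with_proj (cycle_graph k)" by (rule wf_cycle_graph)
  obtain a w where e: "e = (a, w)" by (cases e)
  have aw: "(u, w) \<in> parcs (cycle_graph k)" "awalk w p v" using Cons.prems by (auto simp: awalk_Cons_iff e)
  obtain d :: int where d: "\<bar>d\<bar> \<le> int (length p)" "int k dvd int v - int w - d" using Cons.IH[OF aw(2)] by blast
  have "\<exists>c::int. \<bar>c\<bar> \<le> 1 \<and> int k dvd int w - int u - c"
  proof (cases "int k dvd int w - int u - 1")
    case True
    then show ?thesis by (intro exI[of _ 1]) auto
  next
    case False
    then have "int k dvd int w - int u - (- 1)" using in_cycle_arcs[OF aw(1)] by simp
    then show ?thesis by (intro exI[of _ "- 1"]) auto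
  qed
  then obtain c :: int where c: "\<bar>c\<bar> \<le> 1" "int k dvd int w - int u - c" by blast
  have "int k dvd (int v - int w - d) + (int w - int u - c)" using d(2) c(2) by (rule dvd_add)
  moreover have "(int v - int w - d) + (int w - int u - c) = int v - int u - (d + c)" by simp
  ultimately have "int k dvd int v - int u - (d + c)" by simp
  moreover have "\<bar>d + c\<bar> \<le> int (length (e # p))" using d(1) c(1) by simp
  ultimately show ?case by blast
qed

lemma cycle_walk_exists:
  assumes k: "2 \<le> k" and u: "u < k"
  shows "\<exists>p. pre_digraph.awalk (with_proj (cycle_graph k)) u p ((u + n) mod k) \<and> length p = n"
  using u
proof (induction n arbitrary: u)
  case 0
  then show ?case by (intro exI[of _ "[]"]) (simp add: pre_digraph.awalk_def pre_digraph.cas.simps cycle_graph_def)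
next
  case (Suc n)
  interpret wf_digraph "with_proj (cycle_graph k)" by (rule wf_cycle_graph)
  define w where "w = Suc u mod k"
  have w: "w < k" using k by (simp add: w_def)
  have "w \<noteq> u"
  proof (cases "Suc u = k")
    case True
    then show ?thesis using k by (simp add: w_def)
  next
    case False
    then show ?thesis using Suc.prems by (simp add: w_def)
  qed
  then have arc: "(u, w) \<in> parcs (cycle_graph k)" using Suc.prems w by (auto simp: cycle_graph_def w_def)
  obtain p where p: "awalk w p ((w + n) mod k)" "length p = n" using Suc.IH[OF w] by blast
  have "(w + n) mod k = (u + Suc n) mod k" by (simp add: w_def mod_simps)
  then have "awalk u ((u, w) # p) ((u + Suc n) mod k)" using p(1) arc by (simp add: awalk_Cons_iff)
  then show ?case using p(2) by (intro exI[of _ "(u, w) # p"]) simp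
qed

lemma cycle_walk_exists_back:
  assumes k: "2 \<le> k" and u: "u < k"
  shows "\<exists>p. pre_digraph.awalk (with_proj (cycle_graph k)) ((u + n) mod k) p u \<and> length p = n"
proof (induction n)
  case 0
  show ?case using u by (intro exI[of _ "[]"]) (simp add: pre_digraph.awalk_def pre_digraph.cas.simps cycle_graph_def)
next
  case (Suc n)
  interpret wf_digraph "with_proj (cycle_graph k)" by (rule wf_cycle_graph)
  obtain p where p: "awalk ((u + n) mod k) p u" "length p = n" using Suc by blast
  define w where "w = (u + n) mod k"
  have w: "w < k" using k by (simp add: w_def)
  have sw: "(u + Suc n) mod k = Suc w mod k" by (simp add: w_def mod_simps)
  have "Suc w mod k \<noteq> w"
  proof (cases "Suc w = k")
    case True
    then show ?thesis using k by simp
  next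
    case False
    then show ?thesis using w by simp
  qed
  then have "(Suc w mod k, w) \<in> parcs (cycle_graph k)" using w k by (auto simp: cycle_graph_def)
  then have "awalk (Suc w mod k) ((Suc w mod k, w) # p) u" using p(1) by (simp add: awalk_Cons_iff w_def)
  then show ?case using p(2) unfolding sw by (intro exI[of _ "(Suc w mod k, w) # p"]) simp
qed

lemma cycle_distance_le_iff:
  assumes k: "2 \<le> k" and u: "u < k" and v: "v < k"
  shows "wf_digraph.\<mu> (with_proj (cycle_graph k)) (\<lambda>_. 1) u v \<le> ereal (real p) \<longleftrightarrow>
    (\<exists>d::int. \<bar>d\<bar> \<le> int p \<and> int k dvd int v - int u - d)"
proof -
  interpret wf_digraph "with_proj (cycle_graph k)" by (rule wf_cycle_graph)
  show ?thesis
  proof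
    assume "\<mu> (\<lambda>_. 1) u v \<le> ereal (real p)"
    \<comment> \<open>The distance is an infimum, which is not yet known to be attained; a walk of
      cost below \<open>p + 1\<close> exists, and its length, being an integer, is at most
      \<open>p\<close>.\<close>
    also have "\<dots> < ereal (real p + 1)" by simp
    finally obtain P where P: "awalk u P v" "ereal (awalk_cost (\<lambda>_. 1) P) < ereal (real p + 1)"
      unfolding \<mu>_def INF_less_iff by blast
    have "length P \<le> p" using P(2) by (simp add: awalk_cost_unit)
    moreover obtain d :: int where "\<bar>d\<bar> \<le> int (length P)" "int k dvd int v - int u - d"
      using cycle_walk_offset[OF P(1)] by blast
    ultimately show "\<exists>d::int. \<bar>d\<bar> \<le> int p \<and> int k dvd int v - int u - d" by (intro exI[of _ d]) auto
  next
    assume "\<exists>d::int. \<bar>d\<bar> \<le> int p \<and> int k dvd int v - int u - d"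
    then obtain d :: int where d: "\<bar>d\<bar> \<le> int p" "int k dvd int v - int u - d" by blast
    have walk: "\<mu> (\<lambda>_. 1) u v \<le> ereal (real p)" if "awalk u P v" "length P \<le> p" for P
    proof -
      have "\<mu> (\<lambda>_. 1) u v \<le> ereal (awalk_cost (\<lambda>_. 1) P)" using that(1) by (rule min_cost_le_walk_cost)
      also have "\<dots> \<le> ereal (real p)" using that(2) by (simp add: awalk_cost_unit)
      finally show ?thesis .
    qed
    have toeq: "a = (b + n) mod k" if "a < k" "int k dvd int a - int b - int n" for a b n :: nat
    proof -
      have "int a mod int k = (int b + int n) mod int k" using that(2) by (simp add: mod_eq_dvd_iff diff_diff_eq)
      then have "a mod k = (b + n) mod k" by (metis of_nat_add of_nat_eq_iff zmod_int)
      then show ?thesis using that(1) by simp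
    qed
    show "\<mu> (\<lambda>_. 1) u v \<le> ereal (real p)"
    proof (cases "0 \<le> d")
      case True
      then have n: "nat d \<le> p" "int (nat d) = d" using d(1) by auto
      have "v = (u + nat d) mod k" using toeq[OF v, of u "nat d"] d(2) n(2) by simp
      then obtain P where "awalk u P v" "length P = nat d" using cycle_walk_exists[OF k u, of "nat d"] by metis
      then show ?thesis using walk n by simp
    next
      case False
      then have n: "nat (- d) \<le> p" "int (nat (- d)) = - d" using d(1) by auto
      have "int u - int v - int (nat (- d)) = - (int v - int u - d)" using n(2) by simp
      then have "int k dvd int u - int v - int (nat (- d))" using d(2) by (metis dvd_minus_iff)
      then have "u = (v + nat (- d)) mod k" using toeq[OF u, of v "nat (- d)"] by simp
      then obtain P where "awalk u P v" "length P = nat (- d)" using cycle_walk_exists_back[OF k v, of "nat (- d)"] by metis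
      then show ?thesis using walk n by simp
    qed
  qed
qed

lemma in_cycle_power_iff:
  assumes "2 \<le> k"
  shows "(u, v) \<in> parcs (graph_power (cycle_graph k) p) \<longleftrightarrow> cyclic_adj k p u v"
proof -
  have "(u, v) \<in> parcs (graph_power (cycle_graph k) p) \<longleftrightarrow> u < k \<and> v < k \<and> u \<noteq> v \<and>
      wf_digraph.\<mu> (with_proj (cycle_graph k)) (\<lambda>_. 1) u v \<le> ereal (real p)"
    by (auto simp: graph_power_def cycle_graph_def)
  then show ?thesis using cycle_distance_le_iff[OF assms, of u v p] by (auto simp: cyclic_adj_def)
qed

text \<open>An independent set of \<open>C\<^sub>k\<^sup>p\<close> has pairwise disjoint windows of \<open>p + 1\<close> consecutive vertices.\<close>

lemma cyclic_independent_card: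
  assumes X: "X \<subseteq> {..<k}" and ind: "\<And>x y. x \<in> X \<Longrightarrow> y \<in> X \<Longrightarrow> \<not> cyclic_adj k p x y" and pk: "p < k"
  shows "card X * (p + 1) \<le> k"
proof -
  let ?f = "\<lambda>(x, i). (x + i) mod k"
  have k: "0 < k" using pk by simp
  have "inj_on ?f (X \<times> {..p})"
  proof (rule inj_onI, clarsimp)
    fix x i y j assume a: "x \<in> X" "i \<le> p" "y \<in> X" "j \<le> p" "(x + i) mod k = (y + j) mod k"
    have "int ((x + i) mod k) = int ((y + j) mod k)" using a(5) by simp
    then have "(int x + int i) mod int k = (int y + int j) mod int k" by (simp add: zmod_int)
    then have "int k dvd (int x + int i) - (int y + int j)" by (simp add: mod_eq_dvd_iff)
    then have dv: "int k dvd - ((int x + int i) - (int y + int j))" by (simp only: dvd_minus_iff)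
    have e: "- ((int x + int i) - (int y + int j)) = int y - int x - (int i - int j)" by simp
    have d: "int k dvd int y - int x - (int i - int j)" using dv unfolding e .
    have "\<bar>int i - int j\<bar> \<le> int p" using a by linarith
    then have xy: "x = y" using ind[OF a(1,3)] a X d unfolding cyclic_adj_def by blast
    have "i = j"
    proof (rule ccontr)
      assume ne: "i \<noteq> j"
      have d': "int k dvd int i - int j" using d xy by (metis diff_self diff_0 dvd_minus_iff)
      have "int i - int j \<noteq> 0" using ne by simp
      from dvd_imp_le_int[OF this d'] have "\<bar>int k\<bar> \<le> \<bar>int i - int j\<bar>" .
      then show False using a pk by linarith
    qed
    then show "x = y \<and> i = j" using xy by simp
  qed
  then have "card (?f ` (X \<times> {..p})) = card (X \<times> {..p})" by (rule card_image)
  moreover have "card (?f ` (X \<times> {..p})) \<le> card {..<k}" by (rule card_mono) (use k in auto)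
  ultimately show ?thesis by (simp add: card_cartesian_product)
qed

text \<open>By \<open>ks\<close>, no \<open>s + 1\<close> disjoint windows of length
  \<open>p + 1\<close> fit into the cycle, so a colour class has at most \<open>s\<close> vertices;
  the rest is counting over \<open>q\<close> colours.\<close>

lemma cycle_power_not_colourable:
  fixes k p s q t :: nat and col :: "nat \<Rightarrow> nat"
  assumes k: "k = s * q + t" and ks: "k < (s + 1) * (p + 1)" and pk: "p < k" and t: "1 \<le> t"
    and I: "I \<subseteq> {..<k}" "card I \<le> t - 1" and col: "\<And>i. i \<in> {..<k} - I \<Longrightarrow> col i < q"
  shows "\<exists>i\<in>{..<k} - I. \<exists>j\<in>{..<k} - I. cyclic_adj k p i j \<and> col i = col j"
proof (rule ccontr)
  assume no: "\<not> ?thesis"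
  let ?Y = "{..<k} - I"
  define X where "X c = {i \<in> ?Y. col i = c}" for c
  have "card (X c) \<le> s" for c
  proof -
    have "card (X c) * (p + 1) \<le> k"
    proof (rule cyclic_independent_card[OF _ _ pk])
      show "\<not> cyclic_adj k p x y" if "x \<in> X c" "y \<in> X c" for x y
      proof -
        have "x \<in> ?Y" "y \<in> ?Y" "col x = col y" using that by (auto simp: X_def)
        then show ?thesis using no by blast
      qed
    qed (auto simp: X_def)
    then have "card (X c) * (p + 1) < (s + 1) * (p + 1)" using ks by linarith
    then have "card (X c) < s + 1" by (simp only: mult_less_cancel2)
    then show ?thesis by simp
  qed
  moreover have "card ?Y = (\<Sum>c<q. card (X c))"
  proof -
    have "?Y = (\<Union>c<q. X c)" using col by (auto simp: X_def)
    then have "card ?Y = card (\<Union>c<q. X c)" by simp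
    also have "\<dots> = (\<Sum>c<q. card (X c))" by (rule card_UN_disjoint) (auto simp: X_def)
    finally show ?thesis .
  qed
  ultimately have "card ?Y \<le> q * s" using sum_bounded_above[of "{..<q}" "\<lambda>c. card (X c)" s] by simp
  moreover have "card ?Y = k - card I" using I finite_subset[OF I(1)] by (simp add: card_Diff_subset)
  ultimately show False using k I(2) t by (simp add: mult.commute)
qed

text \<open>The cycle is cut into \<open>s\<close> blocks, the first \<open>t\<close> of length \<open>q + 1\<close> and the others of length \<open>q\<close>;
  the position inside its block is the colour of a vertex.\<close>

definition block_start :: "nat \<Rightarrow> nat \<Rightarrow> nat \<Rightarrow> nat" where
  "block_start q t j = j * q + min j t"

section \<open>Embedding the power of a cycle into a pattern\<close>

lemma block_start_step: "i < i' \<Longrightarrow> block_start q t i + q \<le> block_start q t i'"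
  by (drule less_imp_Suc_add) (auto simp: block_start_def min_def algebra_simps)

lemma block_decomposition:
  assumes x: "x < s * q + t" and ts: "t \<le> s" and q: "1 \<le> q"
  shows "\<exists>j c. j < s \<and> c \<le> q \<and> (c = q \<longrightarrow> j < t) \<and> x = block_start q t j + c"
proof (cases "x < t * (q + 1)")
  case True
  define j where "j = x div (q + 1)"
  define c where "c = x mod (q + 1)"
  have jt: "j < t" using True by (simp add: j_def less_mult_imp_div_less)
  have "c < q + 1" unfolding c_def by (rule mod_less_divisor) simp
  moreover have "x = j * (q + 1) + c" unfolding j_def c_def by (rule div_mult_mod_eq[symmetric])
  ultimately show ?thesis using jt ts by (intro exI[of _ j] exI[of _ c]) (auto simp: block_start_def)
next
  case False
  define y where "y = x - t * (q + 1)"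
  have xy: "x = t * (q + 1) + y" using False by (simp add: y_def)
  have "s * q = t * q + (s - t) * q" using ts by (metis add_mult_distrib le_add_diff_inverse)
  then have "y < (s - t) * q" using x xy by simp
  then have jd: "y div q < s - t" by (rule less_mult_imp_div_less)
  have "y mod q < q" using q by simp
  moreover have "y = y div q * q + y mod q" by simp
  ultimately show ?thesis using jd ts xy
    by (intro exI[of _ "t + y div q"] exI[of _ "y mod q"]) (auto simp: block_start_def algebra_simps)
qed

text \<open>Equal positions in different blocks are at least \<open>q > p\<close> apart in both
  directions, since every block has length at least \<open>q\<close>.\<close>

lemma block_nonadjacent:
  assumes ks: "k = s * q + t" and ts: "t < s" and pq: "p < q" and j: "j < j'" "j' < s"
  shows "\<not> cyclic_adj k p (block_start q t j + c) (block_start q t j' + c)"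
proof (rule not_cyclic_adj(1))
  have a: "block_start q t j + q \<le> block_start q t j'" by (rule block_start_step[OF j(1)])
  have "block_start q t s = k" using ts ks by (simp add: block_start_def)
  then have b: "block_start q t j' + q \<le> k" using block_start_step[OF j(2), of q t] by simp
  show "block_start q t j + c < block_start q t j' + c" using a pq by simp
  show "p < block_start q t j' + c - (block_start q t j + c)" using a pq by simp
  show "block_start q t j' + c - (block_start q t j + c) + p < k" using a b pq by simp
qed

text \<open>The extra position \<open>q\<close> of a long block is within reach of position 0 only
  in the next block. By \<open>t < s\<close> that block exists without going around the
  cycle.\<close>

lemma block_last_first:
  assumes ks: "k = s * q + t" and ts: "t < s" and pq: "p < q" and j: "j < t" "j' < s"
    and adj: "cyclic_adj k p (block_start q t j + q) (block_start q t j')"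
  shows "j' = Suc j"
proof (rule ccontr)
  assume ne: "j' \<noteq> Suc j"
  have sj: "block_start q t (Suc j) = block_start q t j + q + 1" using j by (simp add: block_start_def)
  have ss: "block_start q t s = k" using ts ks by (simp add: block_start_def)
  show False
  proof (cases "Suc j < j'")
    case True
    have "block_start q t (Suc j) + q \<le> block_start q t j'" by (rule block_start_step[OF True])
    moreover have "block_start q t j' + q \<le> k" using block_start_step[OF j(2), of q t] ss by simp
    ultimately have "\<not> cyclic_adj k p (block_start q t j + q) (block_start q t j')"
      using sj pq by (intro not_cyclic_adj(1)) auto
    then show False using adj by blast
  next
    case False
    then have jj: "j' \<le> j" using ne by simp
    have a: "block_start q t j' \<le> block_start q t j"
    proof (cases "j' = j")
      case False
      then have "j' < j" using jj by simp
      from block_start_step[OF this, of q t] show ?thesis by simp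
    qed simp
    have "Suc j < s" using j ts by simp
    then have "block_start q t (Suc j) + q \<le> k" using block_start_step[of "Suc j" s q t] ss by simp
    then have "\<not> cyclic_adj k p (block_start q t j + q) (block_start q t j')"
      using sj pq a by (intro not_cyclic_adj(2)) auto
    then show False using adj by blast
  qed
qed

text \<open>Positions below \<open>q\<close> serve as classes, and the last vertex of the long block
  \<open>j\<close> is mapped to \<open>w j\<close>. If \<open>j < c\<close>, this image is adjacent
  to all parts. Otherwise the first vertex of block \<open>j + 1\<close> is mapped to
  \<open>b j\<close>: it is the only vertex of position 0 adjacent to that last vertex, so the
  missing adjacency of \<open>w j\<close> and \<open>b j\<close> to class \<open>i0\<close> is never
  called upon.\<close>

lemma pattern_embeds_cycle_power:
  assumes ks: "k = s * q + t" and ts: "t < s" and pq: "p < q"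
    and G: "simple_graph V E" and pat: "pattern q t (3 * k) V E c i0 B w b"
  shows "embeds k (cyclic_adj k p) V E"
proof -
  note f = simple_graphD(1)[OF G]
  have cp: "complete_parts V E q (3 * k) B" and ct: "c \<le> t" and i0: "i0 < q"
    and w: "w ` {..<t} \<subseteq> V" "inj_on w {..<t}" and b: "b ` {c..<t} \<subseteq> V" "inj_on b {c..<t}"
    and wb: "w ` {..<t} \<inter> b ` {c..<t} = {}" and edge: "\<And>j. j \<in> {c..<t} \<Longrightarrow> E (w j) (b j)"
    and uni: "\<And>j i v. j < c \<Longrightarrow> i < q \<Longrightarrow> v \<in> B i \<Longrightarrow> E (w j) v"
    and oth: "\<And>j i v. j \<in> {c..<t} \<Longrightarrow> i < q \<Longrightarrow> i \<noteq> i0 \<Longrightarrow> v \<in> B i \<Longrightarrow> E (w j) v \<and> E (b j) v"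
    using pat unfolding pattern_def by blast+
  have sym: "E v u" if "E u v" for u v using simple_graphD(5)[OF G that] .
  have q1: "1 \<le> q" using pq by simp
  have "\<exists>j c. j < s \<and> c \<le> q \<and> (c = q \<longrightarrow> j < t) \<and> x = block_start q t j + c" if "x < k" for x
    using block_decomposition[of x s q t] that ks ts q1 by simp
  then obtain blk pos where bp: "\<And>x. x < k \<Longrightarrow> blk x < s \<and> pos x \<le> q \<and> (pos x = q \<longrightarrow> blk x < t) \<and>
      x = block_start q t (blk x) + pos x" by metis
  have C1: "pos x \<noteq> pos y" if a: "cyclic_adj k p x y" for x y
  proof
    assume eq: "pos x = pos y"
    have xy: "x < k" "y < k" "x \<noteq> y" using a by (auto simp: cyclic_adj_def)
    have ne: "blk x \<noteq> blk y" using bp[OF xy(1)] bp[OF xy(2)] eq xy(3) by metis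
    show False
    proof (cases "blk x < blk y")
      case True
      then show False using block_nonadjacent[OF ks ts pq True, of "pos x"] bp[OF xy(1)] bp[OF xy(2)] eq a by metis
    next
      case False
      then have yx: "blk y < blk x" using ne by simp
      show False
        using block_nonadjacent[OF ks ts pq yx, of "pos x"] bp[OF xy(1)] bp[OF xy(2)] eq cyclic_adj_sym[OF a] by metis
    qed
  qed
  have C2: "blk y = Suc (blk x)" if a: "cyclic_adj k p x y" and "pos x = q" "pos y = 0" for x y
  proof -
    have xy: "x < k" "y < k" using a by (auto simp: cyclic_adj_def)
    have "x = block_start q t (blk x) + q" "y = block_start q t (blk y)" "blk x < t" "blk y < s"
      using bp[OF xy(1)] bp[OF xy(2)] that(2,3) by auto
    then show ?thesis using block_last_first[OF ks ts pq, of "blk x" "blk y"] a by metis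
  qed
  define F where "F = w ` {..<t} \<union> b ` {c..<t}"
  have tk: "t \<le> k" using ks by simp
  have cF: "card F \<le> 2 * k"
  proof -
    have "card F \<le> card (w ` {..<t}) + card (b ` {c..<t})" unfolding F_def by (rule card_Un_le)
    also have "\<dots> \<le> t + (t - c)" by (intro add_mono order_trans[OF card_image_le]) auto
    finally show ?thesis using tk by simp
  qed
  \<comment> \<open>The part size \<open>3 * k\<close> leaves \<open>k\<close> vertices after the at
    most \<open>2 * k\<close> vertices of \<open>F\<close> are removed.\<close>
  have "\<exists>\<beta>. inj_on \<beta> {..<k} \<and> \<beta> ` {..<k} \<subseteq> B i - F" if i: "i < q" for i
  proof -
    have "finite F" by (simp add: F_def)
    then have "card (B i) - card F \<le> card (B i - F)" by (rule diff_card_le_card_Diff)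
    moreover have "card (B i) = 3 * k" using cp i by (simp add: complete_parts_def)
    ultimately have "card {..<k} \<le> card (B i - F)" using cF by simp
    moreover have "finite (B i - F)" using cp i f by (auto simp: complete_parts_def intro: finite_subset)
    ultimately show ?thesis using card_le_inj[of "{..<k}" "B i - F"] by blast
  qed
  then obtain \<beta> where \<beta>: "\<And>i. i < q \<Longrightarrow> inj_on (\<beta> i) {..<k} \<and> \<beta> i ` {..<k} \<subseteq> B i - F" by metis
  \<comment> \<open>Position 0 has to land in class \<open>i0\<close>, where the added edges sit, so
    0 and \<open>i0\<close> are exchanged.\<close>
  define \<pi> where "\<pi> i = (if i = 0 then i0 else if i = i0 then 0 else i)" for i
  have pi: "\<pi> i < q" if "i < q" for i using that i0 by (auto simp: \<pi>_def)
  have pi0: "\<pi> i = i0 \<longleftrightarrow> i = 0" for i by (auto simp: \<pi>_def)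
  have piinj: "\<pi> i = \<pi> j \<longleftrightarrow> i = j" for i j by (auto simp: \<pi>_def)
  define isV where "isV x \<longleftrightarrow> pos x = q" for x
  define isS where "isS x \<longleftrightarrow> pos x = 0 \<and> c < blk x \<and> blk x \<le> t" for x
  \<comment> \<open>The end of block \<open>j\<close> and the start of block \<open>j + 1\<close>
    share the index \<open>j\<close> in the pattern, hence \<open>blk x - 1\<close>.\<close>
  define \<phi> where "\<phi> x = (if isV x then w (blk x) else if isS x then b (blk x - 1) else \<beta> (\<pi> (pos x)) x)" for x
  have VS: "\<not> (isV x \<and> isS x)" for x using q1 by (auto simp: isV_def isS_def)
  have phiV: "\<phi> x = w (blk x)" "blk x < t" if "x < k" "isV x" for x
    using that bp[OF that(1)] by (auto simp: \<phi>_def isV_def)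
  have phiS: "\<phi> x = b (blk x - 1)" "blk x - 1 \<in> {c..<t}" "pos x = 0" if "x < k" "isS x" for x
    using that VS[of x] by (auto simp: \<phi>_def isS_def)
  have phiO: "\<phi> x = \<beta> (\<pi> (pos x)) x" "pos x < q" "\<phi> x \<in> B (\<pi> (pos x))" "\<phi> x \<notin> F" if "x < k" "\<not> isV x" "\<not> isS x" for x
  proof -
    show 1: "\<phi> x = \<beta> (\<pi> (pos x)) x" using that by (simp add: \<phi>_def)
    show 2: "pos x < q" using that bp[OF that(1)] by (auto simp: isV_def)
    show "\<phi> x \<in> B (\<pi> (pos x))" "\<phi> x \<notin> F" using \<beta>[OF pi[OF 2]] that(1) unfolding 1 by auto
  qed
  have disj: "i = j" if "v \<in> B i" "v \<in> B j" "i < q" "j < q" for v i j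
    using cp that simple_graphD(4)[OF G, of v] unfolding complete_parts_def by metis
  have inj: "inj_on \<phi> {..<k}"
  proof (rule inj_onI)
    fix x y assume xy: "x \<in> {..<k}" "y \<in> {..<k}" "\<phi> x = \<phi> y"
    then have x: "x < k" and y: "y < k" by auto
    have inF: "\<phi> z \<in> w ` {..<t}" if "z < k" "isV z" for z using phiV[OF that] by auto
    have inF2: "\<phi> z \<in> b ` {c..<t}" if "z < k" "isS z" for z using phiS[OF that] by auto
    have same: "x = y" if "blk x = blk y" "pos x = pos y" using bp[OF x] bp[OF y] that by metis
    consider "isV x" "isV y" | "isS x" "isS y" | "\<not> isV x" "\<not> isS x" "\<not> isV y" "\<not> isS y"
      | "isV x" "isS y" | "isS x" "isV y" | "isV x \<or> isS x" "\<not> isV y" "\<not> isS y" | "\<not> isV x" "\<not> isS x" "isV y \<or> isS y" by blast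
    then show "x = y"
    proof cases
      case 1
      then have "blk x = blk y" using phiV[OF x] phiV[OF y] xy(3) w(2) by (auto simp: inj_on_def)
      then show ?thesis using same 1 by (simp add: isV_def)
    next
      case 2
      then have "blk x - 1 = blk y - 1" using phiS[OF x] phiS[OF y] xy(3) b(2) by (auto simp: inj_on_def)
      moreover have "0 < blk x" "0 < blk y" using 2 by (auto simp: isS_def)
      ultimately have "blk x = blk y" by simp
      then show ?thesis using same 2 by (simp add: isS_def)
    next
      case 3
      have "\<pi> (pos x) = \<pi> (pos y)"
        using disj phiO[OF x 3(1,2)] phiO[OF y 3(3,4)] xy(3) pi by metis
      then have "\<beta> (\<pi> (pos x)) x = \<beta> (\<pi> (pos x)) y" using phiO(1)[OF x 3(1,2)] phiO(1)[OF y 3(3,4)] xy(3) by simp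
      then show ?thesis using \<beta>[OF pi[OF phiO(2)[OF x 3(1,2)]]] xy(1,2) by (auto simp: inj_on_def)
    next
      case 4
      then show ?thesis using inF[OF x] inF2[OF y] xy(3) wb by auto
    next
      case 5
      then show ?thesis using inF[OF y] inF2[OF x] xy(3) wb by auto
    next
      case 6
      then show ?thesis using inF[OF x] inF2[OF x] phiO(4)[OF y 6(2,3)] xy(3) by (auto simp: F_def)
    next
      case 7
      then show ?thesis using inF[OF y] inF2[OF y] phiO(4)[OF x 7(1,2)] xy(3) by (auto simp: F_def)
    qed
  qed
  have im: "\<phi> ` {..<k} \<subseteq> V"
  proof
    fix v assume "v \<in> \<phi> ` {..<k}"
    then obtain x where x: "x < k" "v = \<phi> x" by auto
    show "v \<in> V"
    proof (cases "isV x")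
      case True
      then show ?thesis using phiV[OF x(1) True] w(1) x(2) by auto
    next
      case nV: False
      show ?thesis
      proof (cases "isS x")
        case True
        then show ?thesis using phiS[OF x(1) True] b(1) x(2) by auto
      next
        case False
        have "B (\<pi> (pos x)) \<subseteq> V" using cp pi[OF phiO(2)[OF x(1) nV False]] by (simp add: complete_parts_def)
        then show ?thesis using phiO(3)[OF x(1) nV False] x(2) by blast
      qed
    qed
  qed
  have VSadj: "isS y \<and> blk y - 1 = blk x" if "cyclic_adj k p x y" "isV x" "pos y = 0" "c \<le> blk x" for x y
  proof -
    have "x < k" using that(1) by (auto simp: cyclic_adj_def)
    then have "blk x < t" using phiV(2) that(2) by blast
    moreover have "blk y = Suc (blk x)" using C2[OF that(1)] that(2,3) by (simp add: isV_def)
    ultimately show ?thesis using that(3,4) by (simp add: isS_def)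
  qed
  have Vadj: "E (\<phi> x) (\<phi> y)" if a: "cyclic_adj k p x y" and V: "isV x" for x y
  proof -
    have xy: "x < k" "y < k" using a by (auto simp: cyclic_adj_def)
    have nV: "\<not> isV y" using C1[OF a] V by (simp add: isV_def)
    note px = phiV[OF xy(1) V]
    show ?thesis
    proof (cases "isS y")
      case True
      have by1: "blk y = Suc (blk x)" using C2[OF a] V phiS(3)[OF xy(2) True] by (simp add: isV_def)
      then have "c \<le> blk x" using True by (simp add: isS_def)
      then show ?thesis using edge[of "blk x"] px phiS(1)[OF xy(2) True] by1 by simp
    next
      case False
      note py = phiO[OF xy(2) nV False]
      show ?thesis
      proof (cases "blk x < c")
        case True
        then show ?thesis using uni[OF True pi[OF py(2)] py(3)] px by simp
      next
        case ge: False
        then have "pos y \<noteq> 0" using VSadj[OF a V] False by auto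
        then show ?thesis using oth[OF _ pi[OF py(2)] _ py(3), of "blk x"] ge px pi0 by auto
      qed
    qed
  qed
  have Sadj: "E (\<phi> x) (\<phi> y)" if a: "cyclic_adj k p x y" and S: "isS x" and nV: "\<not> isV y" for x y
  proof -
    have xy: "x < k" "y < k" using a by (auto simp: cyclic_adj_def)
    note px = phiS[OF xy(1) S]
    have nz: "pos y \<noteq> 0" using C1[OF a] px(3) by simp
    then have "\<not> isS y" by (simp add: isS_def)
    note py = phiO[OF xy(2) nV this]
    show ?thesis using oth[OF px(2) pi[OF py(2)] _ py(3)] px(1) nz pi0 by auto
  qed
  have "E (\<phi> x) (\<phi> y)" if a: "cyclic_adj k p x y" for x y
  proof -
    have xy: "x < k" "y < k" using a by (auto simp: cyclic_adj_def)
    note a' = cyclic_adj_sym[OF a]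
    show ?thesis
    proof (cases "isV x \<or> isV y")
      case True
      then show ?thesis using Vadj[OF a] Vadj[OF a'] sym by blast
    next
      case nV: False
      show ?thesis
      proof (cases "isS x \<or> isS y")
        case True
        then show ?thesis using Sadj[OF a] Sadj[OF a'] sym nV by blast
      next
        case False
        note px = phiO[OF xy(1)] and py = phiO[OF xy(2)]
        have "\<pi> (pos x) \<noteq> \<pi> (pos y)" using C1[OF a] piinj by simp
        then show ?thesis using cp px(3) py(3) pi[OF px(2)] pi[OF py(2)] nV False unfolding complete_parts_def by blast
      qed
    qed
  qed
  then show ?thesis using inj im unfolding embeds_def by blast
qed

lemma critical_graph_cycle_power:
  assumes k: "k = s * (p + 1) + r" and r: "r = m * s + t" and rp: "r < p + 1" and kp: "2 * p + 1 \<le> k" and p: "1 \<le> p"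
    and t: "1 \<le> t" "t < s"
  shows "critical_graph k (p + m + 1) t (3 * k) (cyclic_adj k p)"
proof
  have ks: "k = s * (p + m + 1) + t" using k r by (simp add: algebra_simps)
  have pk: "p < k" using kp p by simp
  show "2 \<le> p + m + 1" using p by simp
  show "1 \<le> t" by (rule t)
  show "1 \<le> 3 * k" using pk by simp
  show "embeds k (cyclic_adj k p) V E" if "simple_graph V E" "pattern (p + m + 1) t (3 * k) V E c i0 B w b"
    for V :: "nat set" and E c i0 B w b
    by (rule pattern_embeds_cycle_power[OF ks t(2) _ that]) simp
  have lt: "k < (s + 1) * (p + 1)" using k rp by simp
  show "\<exists>i\<in>{..<k} - I. \<exists>j\<in>{..<k} - I. cyclic_adj k p i j \<and> col i = col j"
    if "I \<subseteq> {..<k}" "card I \<le> t - 1" "\<And>i. i \<in> {..<k} - I \<Longrightarrow> col i < p + m + 1" for I and col :: "nat \<Rightarrow> nat"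
    by (rule cycle_power_not_colourable[OF ks lt pk t(1) that])
qed

subsection \<open>Transfer to digraphs and matrices\<close>

lemma lam_le_of_iso:
  assumes G: "simple_graph V E" and G': "simple_graph V' E'" and V: "V \<noteq> {}"
    and \<phi>: "bij_betw \<phi> V V'" and adj: "\<And>u v. u \<in> V \<Longrightarrow> v \<in> V \<Longrightarrow> E u v \<longleftrightarrow> E' (\<phi> u) (\<phi> v)"
  shows "lam V' E' \<le> lam V E"
proof -
  have inj: "inj_on \<phi> V" and im: "\<phi> ` V = V'" using \<phi> by (auto simp: bij_betw_def)
  have V': "V' \<noteq> {}" using V im by blast
  obtain x where s: "sqn V' x = 1" and eig: "\<And>u. u \<in> V' \<Longrightarrow> adj_sum E' x u = lam V' E' * x u"
    by (rule perron[OF G' V']) blast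
  have a: "adj_sum E (x \<circ> \<phi>) u = lam V' E' * x (\<phi> u)" if u: "u \<in> V" for u
  proof -
    have "nbrs E' (\<phi> u) = \<phi> ` nbrs E u"
    proof
      show "\<phi> ` nbrs E u \<subseteq> nbrs E' (\<phi> u)"
        using adj[OF u] simple_graphD(3)[OF G] by (auto simp: nbrs_def)
      show "nbrs E' (\<phi> u) \<subseteq> \<phi> ` nbrs E u"
      proof
        fix w assume w: "w \<in> nbrs E' (\<phi> u)"
        then obtain v where "v \<in> V" "w = \<phi> v" using simple_graphD(6)[OF G', of "\<phi> u"] im by blast
        then show "w \<in> \<phi> ` nbrs E u" using w adj[OF u] by (auto simp: nbrs_def)
      qed
    qed
    then have "adj_sum E' x (\<phi> u) = adj_sum E (x \<circ> \<phi>) u"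
      unfolding adj_sum_def using inj_on_subset[OF inj simple_graphD(6)[OF G]] by (simp add: sum.reindex)
    then show ?thesis using eig[of "\<phi> u"] im u by auto
  qed
  have "sqn V (x \<circ> \<phi>) = 1" unfolding s[symmetric] sqn_def im[symmetric] by (simp add: sum.reindex[OF inj])
  moreover have "qform V E (x \<circ> \<phi>) = lam V' E' * sqn V (x \<circ> \<phi>)"
    unfolding bform_def sqn_def sum_distrib_left by (intro sum.cong) (auto simp: a power2_eq_square)
  ultimately show ?thesis by (intro lam_ge_of_qform[OF G, of _ "x \<circ> \<phi>"]) auto
qed

lemma lam_iso:
  assumes G: "simple_graph V E" and G': "simple_graph V' E'" and V: "V \<noteq> {}"
    and \<phi>: "bij_betw \<phi> V V'" and adj: "\<And>u v. u \<in> V \<Longrightarrow> v \<in> V \<Longrightarrow> E u v \<longleftrightarrow> E' (\<phi> u) (\<phi> v)"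
  shows "lam V E = lam V' E'"
proof (rule antisym)
  show "lam V' E' \<le> lam V E" by (rule lam_le_of_iso[OF G G' V \<phi> adj])
  have inv: "bij_betw (inv_into V \<phi>) V' V" by (rule bij_betw_inv_into[OF \<phi>])
  have V': "V' \<noteq> {}" using V \<phi> by (auto simp: bij_betw_def)
  show "lam V E \<le> lam V' E'"
  proof (rule lam_le_of_iso[OF G' G V' inv])
    fix u v assume "u \<in> V'" "v \<in> V'"
    then show "E' u v \<longleftrightarrow> E (inv_into V \<phi> u) (inv_into V \<phi> v)"
      using adj[of "inv_into V \<phi> u" "inv_into V \<phi> v"] bij_betwE[OF inv] bij_betw_inv_into_right[OF \<phi>] by simp
  qed
qed

lemma embeds_iso:
  assumes \<phi>: "bij_betw \<phi> V V'" and adj: "\<And>u v. u \<in> V \<Longrightarrow> v \<in> V \<Longrightarrow> E u v \<Longrightarrow> E' (\<phi> u) (\<phi> v)"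
    and e: "embeds k A V E"
  shows "embeds k A V' E'"
proof -
  obtain \<psi> where \<psi>: "inj_on \<psi> {..<k}" "\<psi> ` {..<k} \<subseteq> V" "\<And>i j. i < k \<Longrightarrow> j < k \<Longrightarrow> A i j \<Longrightarrow> E (\<psi> i) (\<psi> j)"
    using e by (auto simp: embeds_def)
  have inj: "inj_on \<phi> V" and im: "\<phi> ` V = V'" using \<phi> by (auto simp: bij_betw_def)
  have "inj_on (\<phi> \<circ> \<psi>) {..<k}" using \<psi>(1) inj_on_subset[OF inj \<psi>(2)] by (rule comp_inj_on)
  moreover have "(\<phi> \<circ> \<psi>) ` {..<k} \<subseteq> V'" using \<psi>(2) im by auto
  moreover have "E' ((\<phi> \<circ> \<psi>) i) ((\<phi> \<circ> \<psi>) j)" if "i < k" "j < k" "A i j" for i j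
    using adj[OF _ _ \<psi>(3)[OF that]] \<psi>(2) that by auto
  ultimately show ?thesis unfolding embeds_def by blast
qed

section \<open>Freeness and isomorphism in terms of vertex maps\<close>

definition arc_rel :: "'a pair_pre_digraph \<Rightarrow> 'a \<Rightarrow> 'a \<Rightarrow> bool" where
  "arc_rel G u v \<longleftrightarrow> (u, v) \<in> parcs G"

lemma pair_graphD:
  assumes "pair_graph G"
  shows "simple_graph (pverts G) (arc_rel G)" and "wf_digraph (with_proj G)"
proof -
  interpret pair_graph G by fact
  show "wf_digraph (with_proj G)" by unfold_locales
  have "sym (parcs G)" using pair_sym_arcs by (simp add: symmetric_def)
  then show "simple_graph (pverts G) (arc_rel G)"
    unfolding simple_graph_def arc_rel_def
    by (auto simp: in_arcsD1 in_arcsD2 dest: symD pair_no_loops)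
qed

text \<open>With \<open>fst\<close> and \<open>snd\<close> as tail and head on both sides, an arc is
  the pair of its ends, so the map on vertices determines the map on arcs.\<close>

lemma iso_arcs_with_proj:
  assumes "pre_digraph.digraph_isomorphism (with_proj G) f" and "iso_tail f = fst" and "iso_head f = snd" and "e \<in> parcs G"
  shows "iso_arcs f e = map_prod (iso_verts f) (iso_verts f) e"
  using assms unfolding pre_digraph.digraph_isomorphism_def by (cases e) (auto simp: prod_eq_iff)

lemma digraph_isomorphism_map_prod:
  assumes "wf_digraph (with_proj G)" and inj: "inj_on \<phi> (pverts G)"
  shows "pre_digraph.digraph_isomorphism (with_proj G)
     \<lparr> iso_verts = \<phi>, iso_arcs = map_prod \<phi> \<phi>, iso_head = snd, iso_tail = fst \<rparr>"
proof -
  interpret wf_digraph "with_proj G" by fact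
  have "parcs G \<subseteq> pverts G \<times> pverts G" using wellformed by force
  then have "inj_on (map_prod \<phi> \<phi>) (parcs G)" using map_prod_inj_on[OF inj inj] inj_on_subset by blast
  then show ?thesis unfolding pre_digraph.digraph_isomorphism_def using assms by auto
qed

lemma digraph_iso_with_proj_iff:
  assumes G: "pair_graph G" and H: "pair_graph H"
  shows "digraph_iso (with_proj G) (with_proj H) \<longleftrightarrow>
    (\<exists>\<phi>. bij_betw \<phi> (pverts G) (pverts H) \<and>
      (\<forall>u\<in>pverts G. \<forall>v\<in>pverts G. arc_rel G u v \<longleftrightarrow> arc_rel H (\<phi> u) (\<phi> v)))"
    (is "?L \<longleftrightarrow> ?R")
proof
  assume ?L
  then obtain f where f: "pre_digraph.digraph_isomorphism (with_proj G) f" and H': "with_proj H = app_iso f (with_proj G)"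
    by (auto simp: digraph_iso_def)
  have eqs: "pverts H = iso_verts f ` pverts G" "parcs H = iso_arcs f ` parcs G" "iso_tail f = fst" "iso_head f = snd"
    using arg_cong[OF H', of verts] arg_cong[OF H', of arcs] arg_cong[OF H', of tail] arg_cong[OF H', of head] by auto
  have inj: "inj_on (iso_verts f) (pverts G)" using f by (simp add: pre_digraph.digraph_isomorphism_def)
  have arcs: "parcs H = map_prod (iso_verts f) (iso_verts f) ` parcs G"
    unfolding eqs(2) using iso_arcs_with_proj[OF f eqs(3,4)] by (intro image_cong) auto
  have "arc_rel G u v \<longleftrightarrow> arc_rel H (iso_verts f u) (iso_verts f v)" if uv: "u \<in> pverts G" "v \<in> pverts G" for u v
  proof
    assume "arc_rel H (iso_verts f u) (iso_verts f v)"
    then obtain a b where ab: "(a, b) \<in> parcs G" "iso_verts f a = iso_verts f u" "iso_verts f b = iso_verts f v"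
      by (auto simp: arc_rel_def arcs)
    have "a \<in> pverts G" "b \<in> pverts G"
      using simple_graphD(2,3)[OF pair_graphD(1)[OF G], of a b] ab(1) by (auto simp: arc_rel_def)
    then have "a = u" "b = v" using ab uv inj by (auto dest: inj_onD)
    then show "arc_rel G u v" using ab(1) by (simp add: arc_rel_def)
  qed (auto simp: arc_rel_def arcs)
  then show ?R using inj eqs(1) by (intro exI[of _ "iso_verts f"]) (auto simp: bij_betw_def)
next
  assume ?R
  then obtain \<phi> where \<phi>: "bij_betw \<phi> (pverts G) (pverts H)"
    and adj: "\<And>u v. u \<in> pverts G \<Longrightarrow> v \<in> pverts G \<Longrightarrow> arc_rel G u v \<longleftrightarrow> arc_rel H (\<phi> u) (\<phi> v)" by blast
  let ?f = "\<lparr> iso_verts = \<phi>, iso_arcs = map_prod \<phi> \<phi>, iso_head = snd, iso_tail = fst \<rparr>"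
  have inj: "inj_on \<phi> (pverts G)" and im: "\<phi> ` pverts G = pverts H" using \<phi> by (auto simp: bij_betw_def)
  have "parcs H = map_prod \<phi> \<phi> ` parcs G"
  proof
    show "map_prod \<phi> \<phi> ` parcs G \<subseteq> parcs H"
    proof
      fix e assume "e \<in> map_prod \<phi> \<phi> ` parcs G"
      then obtain u v where uv: "e = (\<phi> u, \<phi> v)" "arc_rel G u v" by (auto simp: arc_rel_def)
      have "u \<in> pverts G" "v \<in> pverts G" using simple_graphD(2,3)[OF pair_graphD(1)[OF G] uv(2)] .
      then show "e \<in> parcs H" using adj uv by (simp add: arc_rel_def)
    qed
    show "parcs H \<subseteq> map_prod \<phi> \<phi> ` parcs G"
    proof
      fix e assume e: "e \<in> parcs H"
      obtain a b where ab: "e = (a, b)" by (cases e)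
      then have "a \<in> pverts H" "b \<in> pverts H"
        using simple_graphD(2,3)[OF pair_graphD(1)[OF H], of a b] e by (auto simp: arc_rel_def)
      then obtain u v where uv: "u \<in> pverts G" "v \<in> pverts G" "a = \<phi> u" "b = \<phi> v" using im by blast
      then have "(u, v) \<in> parcs G" using adj[OF uv(1,2)] e ab by (simp add: arc_rel_def)
      moreover have "e = map_prod \<phi> \<phi> (u, v)" using ab uv by simp
      ultimately show "e \<in> map_prod \<phi> \<phi> ` parcs G" by (rule rev_image_eqI)
    qed
  qed
  then have "with_proj H = app_iso ?f (with_proj G)" using im by (simp add: app_iso_def with_proj_def)
  then show ?L
    unfolding digraph_iso_def using digraph_isomorphism_map_prod[OF pair_graphD(2)[OF G] inj] by blast
qed

text \<open>A subgraph has to be compatible with the ambient graph, which forces \<open>fst\<close>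
  and \<open>snd\<close> on it and reduces a copy to an injective vertex map. Conversely, the image
  of \<open>F\<close> under such a map is the required subgraph.\<close>

lemma graph_free_iff:
  assumes F: "pair_graph F" "pverts F = {..<k}" and G: "pair_graph G"
  shows "graph_free F G \<longleftrightarrow> \<not> embeds k (arc_rel F) (pverts G) (arc_rel G)"
proof -
  have "embeds k (arc_rel F) (pverts G) (arc_rel G)" if H: "subgraph H (with_proj G)" "digraph_iso (with_proj F) H" for H
  proof -
    obtain f where f: "pre_digraph.digraph_isomorphism (with_proj F) f" and H': "H = app_iso f (with_proj F)"
      using H(2) by (auto simp: digraph_iso_def)
    have sub: "verts H \<subseteq> pverts G" "arcs H \<subseteq> parcs G" "tail H = fst" "head H = snd"
      using H(1) by (auto simp: subgraph_def compatible_def)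
    have th: "iso_tail f = fst" "iso_head f = snd" using sub(3,4) by (simp_all add: H')
    have "arc_rel G (iso_verts f i) (iso_verts f j)" if "arc_rel F i j" for i j
    proof -
      have "iso_arcs f (i, j) \<in> parcs G" using that sub(2) by (auto simp: H' arc_rel_def)
      then show ?thesis using iso_arcs_with_proj[OF f th, of "(i, j)"] that by (simp add: arc_rel_def)
    qed
    moreover have "inj_on (iso_verts f) {..<k}" using f F(2) by (simp add: pre_digraph.digraph_isomorphism_def)
    moreover have "iso_verts f ` {..<k} \<subseteq> pverts G" using sub(1) F(2) by (simp add: H')
    ultimately show ?thesis unfolding embeds_def by blast
  qed
  moreover have "\<exists>H. subgraph H (with_proj G) \<and> digraph_iso (with_proj F) H"
    if e: "embeds k (arc_rel F) (pverts G) (arc_rel G)"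
  proof -
    obtain \<phi> where inj: "inj_on \<phi> {..<k}" and im: "\<phi> ` {..<k} \<subseteq> pverts G"
      and adj: "\<And>i j. i < k \<Longrightarrow> j < k \<Longrightarrow> arc_rel F i j \<Longrightarrow> arc_rel G (\<phi> i) (\<phi> j)"
      using e by (auto simp: embeds_def)
    let ?f = "\<lparr> iso_verts = \<phi>, iso_arcs = map_prod \<phi> \<phi>, iso_head = snd, iso_tail = fst \<rparr>"
    have f: "pre_digraph.digraph_isomorphism (with_proj F) ?f"
      using pair_graphD(2)[OF F(1)] inj F(2) by (intro digraph_isomorphism_map_prod) auto
    interpret wf_digraph "with_proj F" by (rule pair_graphD(2)[OF F(1)])
    let ?H = "app_iso ?f (with_proj F)"
    have "map_prod \<phi> \<phi> ` parcs F \<subseteq> parcs G"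
    proof
      fix e assume "e \<in> map_prod \<phi> \<phi> ` parcs F"
      then obtain u v where uv: "e = (\<phi> u, \<phi> v)" "arc_rel F u v" by (auto simp: arc_rel_def)
      have "u \<in> pverts F" "v \<in> pverts F" using simple_graphD(2,3)[OF pair_graphD(1)[OF F(1)] uv(2)] .
      then show "e \<in> parcs G" using adj[of u v] uv F(2) by (simp add: arc_rel_def)
    qed
    then have "subgraph ?H (with_proj G)"
      using im F(2) pair_graphD(2)[OF G] wf_digraphI_app_iso[OF f] by (simp add: subgraph_def compatible_def)
    moreover have "digraph_iso (with_proj F) ?H" using f by (auto simp: digraph_iso_def)
    ultimately show ?thesis by blast
  qed
  ultimately show ?thesis unfolding graph_free_def by blast
qed

section \<open>The spectral radius of the adjacency matrix\<close>

lemma adjacency_matrix_mult: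
  assumes G: "G \<in> graphs_on n" and v: "v \<in> carrier_vec n" and i: "i < n"
  shows "(adjacency_matrix G *\<^sub>v v) $ i = (\<Sum>j<n. if arc_rel G i j then v $ j else 0)"
proof -
  have n: "card (pverts G) = n" using G by (simp add: graphs_on_def)
  have "(adjacency_matrix G *\<^sub>v v) $ i = (\<Sum>j = 0..<n. (if (i, j) \<in> parcs G then 1 else 0) * v $ j)"
    using v i by (simp add: adjacency_matrix_def n scalar_prod_def)
  also have "\<dots> = (\<Sum>j<n. if arc_rel G i j then v $ j else 0)"
    unfolding atLeast0LessThan by (intro sum.cong) (auto simp: arc_rel_def)
  finally show ?thesis .
qed

text \<open>The moduli of the entries of a complex eigenvector form a test vector for
  \<open>lam\<close>, by the triangle inequality in each row; in the other direction the nonnegative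
  eigenvector of \<open>lam\<close> is a complex eigenvector.\<close>

lemma graph_spectral_radius_eq_lam:
  assumes G: "G \<in> graphs_on n" and n0: "0 < n"
  shows "graph_spectral_radius G = lam {..<n} (arc_rel G)"
proof -
  let ?A = "adjacency_matrix G"
  let ?V = "{..<n}"
  have S: "simple_graph ?V (arc_rel G)" using pair_graphD(1)[of G] G by (auto simp: graphs_on_def)
  have V: "?V \<noteq> {}" using n0 by auto
  have A: "?A \<in> carrier_mat n n" using G by (simp add: adjacency_matrix_def graphs_on_def)
  have lam0: "0 \<le> lam ?V (arc_rel G)" by (rule lam_ge_min_degree[OF S V]) simp
  note sr = spectral_radius_mem_max[OF A n0]
  obtain \<nu> where \<nu>: "eigenvalue ?A \<nu>" "spectral_radius ?A = norm \<nu>" using sr(1) by (auto simp: spectrum_def)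
  then obtain v where v: "v \<in> carrier_vec n" "v \<noteq> 0\<^sub>v n" "?A *\<^sub>v v = \<nu> \<cdot>\<^sub>v v"
    using A by (auto simp: eigenvalue_def eigenvector_def)
  have "norm \<nu> \<le> lam ?V (arc_rel G)"
  proof (rule lam_ge_of_qform[OF S])
    define x where "x i = norm (v $ i)" for i
    have row: "norm \<nu> * x i \<le> adj_sum (arc_rel G) x i" if i: "i \<in> ?V" for i
    proof -
      have "\<nu> * v $ i = (?A *\<^sub>v v) $ i" using v i by simp
      also have "\<dots> = (\<Sum>j<n. if arc_rel G i j then v $ j else 0)" using i by (intro adjacency_matrix_mult[OF G v(1)]) simp
      finally have "norm \<nu> * x i = norm (\<Sum>j<n. if arc_rel G i j then v $ j else 0)" by (simp add: x_def norm_mult[symmetric])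
      also have "\<dots> \<le> (\<Sum>j<n. norm (if arc_rel G i j then v $ j else 0))" by (rule norm_sum)
      also have "\<dots> = (\<Sum>j<n. if arc_rel G i j then x j else 0)" by (intro sum.cong) (auto simp: x_def)
      finally show ?thesis by (simp add: adj_sum_if[OF S])
    qed
    have "norm \<nu> * sqn ?V x = (\<Sum>i<n. x i * (norm \<nu> * x i))"
      unfolding sqn_def sum_distrib_left by (intro sum.cong) (auto simp: power2_eq_square)
    also have "\<dots> \<le> qform ?V (arc_rel G) x"
      unfolding bform_def using row by (intro sum_mono mult_left_mono) (auto simp: x_def)
    finally show "norm \<nu> * sqn ?V x \<le> qform ?V (arc_rel G) x" .
    have "sqn ?V x \<noteq> 0"
    proof
      assume "sqn ?V x = 0"
      then have "\<forall>i<n. v $ i = 0" by (auto simp: sqn_eq_0_iff x_def)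
      then have "v = 0\<^sub>v n" using v(1) by (intro eq_vecI) auto
      then show False using v(2) by simp
    qed
    then show "0 < sqn ?V x" using sqn_nonneg[of ?V x] by simp
  qed
  moreover have "lam ?V (arc_rel G) \<le> spectral_radius ?A"
  proof -
    obtain x where x: "\<And>u. 0 \<le> x u" "sqn ?V x = 1" "\<And>u. u \<in> ?V \<Longrightarrow> adj_sum (arc_rel G) x u = lam ?V (arc_rel G) * x u"
      by (rule perron[OF S V]) blast
    define w where "w = vec n (\<lambda>i. complex_of_real (x i))"
    have w: "w \<in> carrier_vec n" by (simp add: w_def)
    have "?A *\<^sub>v w = complex_of_real (lam ?V (arc_rel G)) \<cdot>\<^sub>v w"
    proof (rule eq_vecI)
      fix i assume "i < dim_vec (complex_of_real (lam ?V (arc_rel G)) \<cdot>\<^sub>v w)"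
      then have i: "i < n" by (simp add: w_def)
      have "(?A *\<^sub>v w) $ i = (\<Sum>j<n. if arc_rel G i j then w $ j else 0)" by (rule adjacency_matrix_mult[OF G w i])
      also have "\<dots> = complex_of_real (\<Sum>j<n. if arc_rel G i j then x j else 0)"
        unfolding of_real_sum by (intro sum.cong) (auto simp: w_def)
      also have "\<dots> = complex_of_real (lam ?V (arc_rel G) * x i)" using x(3)[of i] i by (simp add: adj_sum_if[OF S])
      finally show "(?A *\<^sub>v w) $ i = (complex_of_real (lam ?V (arc_rel G)) \<cdot>\<^sub>v w) $ i" using i by (simp add: w_def)
    qed (use A in \<open>simp add: w_def\<close>)
    moreover have "w \<noteq> 0\<^sub>v n"
    proof
      assume "w = 0\<^sub>v n"
      then have "w $ i = 0" if "i < n" for i using that by simp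
      then have "\<forall>i<n. x i = 0" by (simp add: w_def)
      then have "sqn ?V x = 0" by (simp add: sqn_def)
      then show False using x(2) by simp
    qed
    ultimately have "eigenvalue ?A (complex_of_real (lam ?V (arc_rel G)))"
      using A w unfolding eigenvalue_def eigenvector_def by auto
    then have "norm (complex_of_real (lam ?V (arc_rel G))) \<in> norm ` spectrum ?A"
      by (intro imageI) (simp add: spectrum_def)
    from sr(2)[OF this] show ?thesis using lam0 by simp
  qed
  ultimately show ?thesis unfolding graph_spectral_radius_def using \<nu>(2) by simp
qed

text \<open>All values are \<open>L\<close> or \<open>L + 1\<close> with \<open>L\<close> the
  minimum, and fewer than \<open>q\<close> equal \<open>L + 1\<close>, so \<open>L\<close> and their
  number are quotient and remainder of \<open>n\<close> by \<open>q\<close>. The permutation puts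
  the larger classes first, as in \<open>turan_graph\<close>.\<close>

lemma balanced_sizes:
  fixes a :: "nat \<Rightarrow> nat"
  assumes q: "1 \<le> q" and bal: "\<And>i j. i < q \<Longrightarrow> j < q \<Longrightarrow> a i \<le> a j + 1" and s: "(\<Sum>i<q. a i) = n"
  shows "\<exists>\<sigma>. bij_betw \<sigma> {..<q} {..<q} \<and> (\<forall>i<q. a i = n div q + (if \<sigma> i < n mod q then 1 else 0))"
proof -
  have ne: "a ` {..<q} \<noteq> {}" "finite (a ` {..<q})" using q by (auto simp: lessThan_empty_iff)
  define L where "L = Min (a ` {..<q})"
  obtain i0 where i0: "i0 < q" "a i0 = L" using Min_in[OF ne(2,1)] by (auto simp: L_def)
  have Lle: "L \<le> a i" if "i < q" for i unfolding L_def using ne that by (intro Min_le) auto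
  define Big where "Big = {i. i < q \<and> a i = L + 1}"
  have ai: "a i = L + (if i \<in> Big then 1 else 0)" if "i < q" for i
  proof -
    have "a i \<le> L + 1" using bal[OF that i0(1)] i0(2) by simp
    then show ?thesis using Lle[OF that] that by (auto simp: Big_def)
  qed
  have B: "Big \<subseteq> {..<q} - {i0}" using i0 by (auto simp: Big_def)
  have fB: "finite Big" using B finite_subset by blast
  have "card Big \<le> card ({..<q} - {i0})" using B by (intro card_mono) auto
  then have cB: "card Big < q" using i0 by simp
  have "n = (\<Sum>i<q. L + (if i \<in> Big then 1 else 0))" unfolding s[symmetric] using ai by (intro sum.cong) auto
  also have "\<dots> = q * L + card Big"
  proof -
    have "{..<q} \<inter> Big = Big" using B by auto
    then show ?thesis by (simp add: sum.distrib sum.If_cases)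
  qed
  finally have n: "n = card Big + q * L" by simp
  have dm: "n div q = L" "n mod q = card Big" unfolding n using cB by auto
  obtain \<sigma>1 where \<sigma>1: "bij_betw \<sigma>1 Big {..<card Big}" using fB finite_same_card_bij[of Big "{..<card Big}"] by auto
  have "card ({..<q} - Big) = card {card Big..<q}" using B fB by (subst card_Diff_subset) auto
  then obtain \<sigma>2 where \<sigma>2: "bij_betw \<sigma>2 ({..<q} - Big) {card Big..<q}"
    using finite_same_card_bij[of "{..<q} - Big" "{card Big..<q}"] by auto
  define \<sigma> where "\<sigma> i = (if i \<in> Big then \<sigma>1 i else \<sigma>2 i)" for i
  have b1: "bij_betw \<sigma> Big {..<card Big}" using \<sigma>1 by (subst bij_betw_cong[of _ _ \<sigma>1]) (auto simp: \<sigma>_def)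
  have b2: "bij_betw \<sigma> ({..<q} - Big) {card Big..<q}" using \<sigma>2 by (subst bij_betw_cong[of _ _ \<sigma>2]) (auto simp: \<sigma>_def)
  have "bij_betw \<sigma> (Big \<union> ({..<q} - Big)) ({..<card Big} \<union> {card Big..<q})"
    by (rule bij_betw_combine[OF b1 b2]) auto
  moreover have "Big \<union> ({..<q} - Big) = {..<q}" "{..<card Big} \<union> {card Big..<q} = {..<q}" using B cB by auto
  ultimately have b: "bij_betw \<sigma> {..<q} {..<q}" by simp
  have "a i = n div q + (if \<sigma> i < n mod q then 1 else 0)" if i: "i < q" for i
  proof (cases "i \<in> Big")
    case True
    then show ?thesis using ai[OF i] bij_betwE[OF b1] dm by auto
  next
    case False
    then have "\<sigma> i \<in> {card Big..<q}" using bij_betwE[OF b2] i by blast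
    then show ?thesis using ai[OF i] False dm by simp
  qed
  then show ?thesis using b by blast
qed

text \<open>Vertices with labels from \<open>q\<close> on are alone in their classes, so any
  bijection between them will do; the other classes are matched along \<sigma>.\<close>

lemma multipartite_iso:
  fixes g :: "'a \<Rightarrow> nat" and h :: "'b \<Rightarrow> nat"
  assumes f: "finite V" "finite V'" and inj: "inj_on g {v \<in> V. q \<le> g v}" "inj_on h {v \<in> V'. q \<le> h v}"
    and C: "card {v \<in> V. q \<le> g v} = card {v \<in> V'. q \<le> h v}"
    and \<sigma>: "bij_betw \<sigma> {..<q} {..<q}" and sz: "\<And>i. i < q \<Longrightarrow> card {v \<in> V. g v = i} = card {v \<in> V'. h v = \<sigma> i}"
  shows "\<exists>\<phi>. bij_betw \<phi> V V' \<and> (\<forall>u\<in>V. \<forall>v\<in>V. g u = g v \<longleftrightarrow> h (\<phi> u) = h (\<phi> v))"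
proof -
  obtain \<gamma> where \<gamma>: "bij_betw \<gamma> {v \<in> V. q \<le> g v} {v \<in> V'. q \<le> h v}"
    using finite_same_card_bij[OF _ _ C] f by auto
  have "\<exists>\<beta>. bij_betw \<beta> {v \<in> V. g v = i} {v \<in> V'. h v = \<sigma> i}" if "i < q" for i
    using finite_same_card_bij[OF _ _ sz[OF that]] f by auto
  then obtain \<beta> where \<beta>: "\<And>i. i < q \<Longrightarrow> bij_betw (\<beta> i) {v \<in> V. g v = i} {v \<in> V'. h v = \<sigma> i}" by metis
  define \<phi> where "\<phi> v = (if q \<le> g v then \<gamma> v else \<beta> (g v) v)" for v
  have big: "\<phi> v = \<gamma> v" "\<phi> v \<in> V'" "q \<le> h (\<phi> v)" if "v \<in> V" "q \<le> g v" for v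
    using that bij_betwE[OF \<gamma>] by (auto simp: \<phi>_def)
  have small: "\<phi> v = \<beta> (g v) v" "\<phi> v \<in> V'" "h (\<phi> v) = \<sigma> (g v)" "h (\<phi> v) < q" if "v \<in> V" "g v < q" for v
  proof -
    show 1: "\<phi> v = \<beta> (g v) v" using that by (simp add: \<phi>_def)
    show "\<phi> v \<in> V'" and 2: "h (\<phi> v) = \<sigma> (g v)" using bij_betwE[OF \<beta>[OF that(2)]] that(1) unfolding 1 by auto
    show "h (\<phi> v) < q" unfolding 2 using bij_betwE[OF \<sigma>] that(2) by auto
  qed
  have eq: "g u = g v \<longleftrightarrow> h (\<phi> u) = h (\<phi> v)" if uv: "u \<in> V" "v \<in> V" for u v
  proof -
    consider "q \<le> g u" "q \<le> g v" | "g u < q" "g v < q" | "q \<le> g u" "g v < q" | "g u < q" "q \<le> g v" by linarith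
    then show ?thesis
    proof cases
      case 1
      have "g u = g v \<longleftrightarrow> u = v" using inj(1) uv 1 by (auto dest: inj_onD)
      also have "\<dots> \<longleftrightarrow> \<gamma> u = \<gamma> v" using bij_betw_imp_inj_on[OF \<gamma>] uv 1 by (auto dest: inj_onD)
      also have "\<dots> \<longleftrightarrow> h (\<phi> u) = h (\<phi> v)"
        using inj(2) big[OF uv(1) 1(1)] big[OF uv(2) 1(2)] by (auto dest: inj_onD)
      finally show ?thesis .
    next
      case 2
      then show ?thesis using small(3)[OF uv(1)] small(3)[OF uv(2)] bij_betw_imp_inj_on[OF \<sigma>] by (auto dest: inj_onD)
    next
      case 3
      then show ?thesis using big(3)[OF uv(1)] small(4)[OF uv(2)] by auto
    next
      case 4
      then show ?thesis using big(3)[OF uv(2)] small(4)[OF uv(1)] by auto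
    qed
  qed
  have "inj_on \<phi> V"
  proof (rule inj_onI)
    fix u v assume uv: "u \<in> V" "v \<in> V" "\<phi> u = \<phi> v"
    then have g: "g u = g v" using eq by simp
    show "u = v"
    proof (cases "q \<le> g u")
      case True
      then show ?thesis using inj(1) uv g by (auto dest: inj_onD)
    next
      case False
      then have i: "g u < q" "g v < q" using g by auto
      have "\<beta> (g u) u = \<beta> (g u) v" using small(1)[OF uv(1) i(1)] small(1)[OF uv(2) i(2)] uv(3) g by simp
      then show ?thesis using bij_betw_imp_inj_on[OF \<beta>[OF i(1)]] uv g by (auto dest: inj_onD)
    qed
  qed
  moreover have "\<phi> ` V = V'"
  proof
    show "\<phi> ` V \<subseteq> V'" using big(2) small(2) by (auto simp: not_le[symmetric])
    show "V' \<subseteq> \<phi> ` V"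
    proof
      fix w assume w: "w \<in> V'"
      show "w \<in> \<phi> ` V"
      proof (cases "q \<le> h w")
        case True
        then have "w \<in> \<gamma> ` {v \<in> V. q \<le> g v}" using bij_betw_imp_surj_on[OF \<gamma>] w by simp
        then show ?thesis using big(1) by force
      next
        case False
        then have "h w \<in> \<sigma> ` {..<q}" using bij_betw_imp_surj_on[OF \<sigma>] by simp
        then obtain i where i: "i < q" "h w = \<sigma> i" by auto
        then have "w \<in> \<beta> i ` {v \<in> V. g v = i}" using bij_betw_imp_surj_on[OF \<beta>[OF i(1)]] w by simp
        then show ?thesis using small(1) i(1) by force
      qed
    qed
  qed
  ultimately show ?thesis using eq by (intro exI[of _ \<phi>]) (auto simp: bij_betw_def)
qed

text \<open>Exhibits the join as a single complete multipartite graph: the clique labels start at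
  \<open>q\<close> and never meet a residue modulo \<open>q\<close>.\<close>

definition join_label :: "nat \<Rightarrow> nat + nat \<Rightarrow> nat" where
  "join_label q = case_sum (\<lambda>i. q + i) (\<lambda>u. u mod q)"

lemma arc_rel_join:
  assumes "1 \<le> q"
  shows "arc_rel (graph_join (complete_graph a) (turan_graph n q)) =
    multipartite (pverts (graph_join (complete_graph a) (turan_graph n q))) (join_label q)"
proof -
  have "u mod q < q" for u :: nat using assms by simp
  then have ne: "q + i \<noteq> u mod q" "u mod q \<noteq> q + i" for i u :: nat by (metis not_add_less1)+
  show ?thesis
    by (intro ext) (auto simp: arc_rel_def multipartite_def join_label_def graph_join_def complete_graph_def
        turan_graph_def ne Plus_def split: sum.splits intro: rev_image_eqI)
qed

lemma join_classes:
  fixes a n q :: nat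
  assumes q: "1 \<le> q"
  defines "V \<equiv> pverts (graph_join (complete_graph a) (turan_graph n q))"
  shows "finite V" and "inj_on (join_label q) {v \<in> V. q \<le> join_label q v}"
    and "card {v \<in> V. q \<le> join_label q v} = a"
    and "i < q \<Longrightarrow> card {v \<in> V. join_label q v = i} = n div q + (if i < n mod q then 1 else 0)"
proof -
  have V: "V = Inl ` {..<a} \<union> Inr ` {..<n}"
    by (auto simp: V_def graph_join_def complete_graph_def turan_graph_def Plus_def)
  have lt: "u mod q < q" for u :: nat using q by simp
  show "finite V" by (simp add: V)
  have C: "{v \<in> V. q \<le> join_label q v} = Inl ` {..<a}"
  proof -
    have "\<not> q \<le> u mod q" for u :: nat using lt[of u] by simp
    then show ?thesis by (auto simp: V join_label_def)
  qed
  show "inj_on (join_label q) {v \<in> V. q \<le> join_label q v}" unfolding C by (auto simp: inj_on_def join_label_def)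
  show "card {v \<in> V. q \<le> join_label q v} = a" unfolding C by (simp add: card_image)
  show "card {v \<in> V. join_label q v = i} = n div q + (if i < n mod q then 1 else 0)" if i: "i < q"
  proof -
    have "{v \<in> V. join_label q v = i} = Inr ` {u. u < n \<and> u mod q = i}"
      using i by (auto simp: V join_label_def)
    then show ?thesis using turan_parts_balanced[OF i, of n] by (simp add: card_image)
  qed
qed

lemma balanced_multipartite_iso_join:
  assumes f: "finite V" and q: "1 \<le> q" and C: "card {v \<in> V. q \<le> g v} = a" and inj: "inj_on g {v \<in> V. q \<le> g v}"
    and bal: "\<And>i j. i < q \<Longrightarrow> j < q \<Longrightarrow> card {v \<in> V. g v = i} \<le> card {v \<in> V. g v = j} + 1"
  shows "\<exists>\<phi>. bij_betw \<phi> V (pverts (graph_join (complete_graph a) (turan_graph (card V - a) q))) \<and>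
    (\<forall>u\<in>V. \<forall>v\<in>V. multipartite V g u v \<longleftrightarrow>
       arc_rel (graph_join (complete_graph a) (turan_graph (card V - a) q)) (\<phi> u) (\<phi> v))"
proof -
  let ?H = "graph_join (complete_graph a) (turan_graph (card V - a) q)"
  have "card V = card {v \<in> V. q \<le> g v} + (\<Sum>i<q. card {v \<in> V. g v = i})"
  proof -
    have V: "V = {v \<in> V. q \<le> g v} \<union> (\<Union>i<q. {v \<in> V. g v = i})" by auto
    have "card ({v \<in> V. q \<le> g v} \<union> (\<Union>i<q. {v \<in> V. g v = i})) =
        card {v \<in> V. q \<le> g v} + card (\<Union>i<q. {v \<in> V. g v = i})"
      using f by (intro card_Un_disjoint) auto
    moreover have "card (\<Union>i<q. {v \<in> V. g v = i}) = (\<Sum>i<q. card {v \<in> V. g v = i})"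
      using f by (intro card_UN_disjoint) auto
    ultimately show ?thesis using V by simp
  qed
  then have "(\<Sum>i<q. card {v \<in> V. g v = i}) = card V - a" using C by simp
  from balanced_sizes[OF q bal this] obtain \<sigma> where \<sigma>: "bij_betw \<sigma> {..<q} {..<q}"
    and sz: "\<And>i. i < q \<Longrightarrow> card {v \<in> V. g v = i} = (card V - a) div q + (if \<sigma> i < (card V - a) mod q then 1 else 0)"
    by blast
  have "\<exists>\<phi>. bij_betw \<phi> V (pverts ?H) \<and> (\<forall>u\<in>V. \<forall>v\<in>V. g u = g v \<longleftrightarrow> join_label q (\<phi> u) = join_label q (\<phi> v))"
  proof (rule multipartite_iso[OF f join_classes(1)[OF q] inj join_classes(2)[OF q] _ \<sigma>])
    show "card {v \<in> V. q \<le> g v} = card {v \<in> pverts ?H. q \<le> join_label q v}" by (simp add: C join_classes(3)[OF q])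
    show "card {v \<in> V. g v = i} = card {v \<in> pverts ?H. join_label q v = \<sigma> i}" if "i < q" for i
    proof -
      have "\<sigma> i < q" using bij_betwE[OF \<sigma>] that by auto
      then show ?thesis using sz[OF that] join_classes(4)[OF q, of "\<sigma> i"] by simp
    qed
  qed
  then obtain \<phi> where \<phi>: "bij_betw \<phi> V (pverts ?H)"
    and e: "\<And>u v. u \<in> V \<Longrightarrow> v \<in> V \<Longrightarrow> g u = g v \<longleftrightarrow> join_label q (\<phi> u) = join_label q (\<phi> v)" by blast
  have "multipartite V g u v \<longleftrightarrow> arc_rel ?H (\<phi> u) (\<phi> v)" if "u \<in> V" "v \<in> V" for u v
    unfolding arc_rel_join[OF q] using e[OF that] that bij_betwE[OF \<phi>] by (simp add: multipartite_def)
  then show ?thesis using \<phi> by blast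
qed

theorem theorem1p2:
  fixes k p s r m t :: nat
  assumes "k \<ge> 1" and "p \<ge> 1" and "k \<ge> 2 * p + 1"
    and "k = s * (p + 1) + r" and "s \<ge> 1" and "r < p + 1"
    and "r \<noteq> 0"
    and "r = m * s + t" and "1 \<le> t" and "t \<le> s"
    and "t \<noteq> s"
  shows "\<forall>\<^sub>F n in sequentially.
           SPEX n (graph_power (cycle_graph k) p) =
             {G \<in> graphs_on n. digraph_iso (with_proj G)
                (with_proj (graph_join (complete_graph (t - 1))
                                       (turan_graph (n - (t - 1)) (p + m + 1))))}"
proof -
  have ts: "t < s" using assms(10,11) by simp
  interpret critical_graph k "p + m + 1" t "3 * k" "cyclic_adj k p"
    by (rule critical_graph_cycle_power[OF assms(4,8,6,3,2,9) ts])
  define F where "F = graph_power (cycle_graph k) p"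
  define H where "H n = graph_join (complete_graph (t - 1)) (turan_graph (n - (t - 1)) (p + m + 1))" for n
  have k2: "2 \<le> k" using assms(2,3) by simp
  have arcF: "arc_rel F = cyclic_adj k p" unfolding F_def arc_rel_def using in_cycle_power_iff[OF k2] by (intro ext) simp
  have vF: "pverts F = {..<k}" by (simp add: F_def graph_power_def cycle_graph_def)
  have F: "pair_graph F"
  proof (rule pair_graphI)
    show "finite (pverts F)" by (simp add: vF)
    show "parcs F \<subseteq> pverts F \<times> pverts F" by (auto simp: F_def graph_power_def)
    show "(v, u) \<in> parcs F" if "(u, v) \<in> parcs F" for u v
      using that cyclic_adj_sym[of k p u v] arcF by (simp add: arc_rel_def fun_eq_iff)
    show "(u, u) \<notin> parcs F" for u by (simp add: F_def graph_power_def)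
  qed
  have PH: "pair_graph (H n)" for n
    unfolding H_def by (intro pair_graph_graph_join pair_graph_complete_graph pair_graph_turan_graph)
  obtain n0 where n0: "\<And>V E. extremal V E \<Longrightarrow> n0 \<le> card V \<Longrightarrow>
    (\<exists>g. E = multipartite V g \<and> card {v \<in> V. p + m + 1 \<le> g v} = t - 1 \<and> inj_on g {v \<in> V. p + m + 1 \<le> g v} \<and>
      (\<forall>i<p + m + 1. \<forall>j<p + m + 1. card {v \<in> V. g v = i} \<le> card {v \<in> V. g v = j} + 1))"
    using extremal_multipartite by blast
  have "SPEX n F = {G \<in> graphs_on n. digraph_iso (with_proj G) (with_proj (H n))}" if n: "max n0 1 \<le> n" for n
  proof -
    let ?V = "{..<n}"
    have np: "0 < n" and V: "?V \<noteq> {}" using n by (auto simp: lessThan_empty_iff)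
    have on: "pair_graph G" "pverts G = ?V" if "G \<in> graphs_on n" for G using that by (auto simp: graphs_on_def)
    have sg: "simple_graph ?V (arc_rel G)" if "G \<in> graphs_on n" for G using pair_graphD(1)[OF on(1)[OF that]] on(2)[OF that] by simp
    have free: "graph_free F G \<longleftrightarrow> \<not> embeds k (cyclic_adj k p) ?V (arc_rel G)" if "G \<in> graphs_on n" for G
      using graph_free_iff[OF F vF on(1)[OF that]] on(2)[OF that] by (simp add: arcF)
    have rad: "graph_spectral_radius G = lam ?V (arc_rel G)" if "G \<in> graphs_on n" for G
      by (rule graph_spectral_radius_eq_lam[OF that np])
    define toG where "toG E = \<lparr> pverts = ?V, parcs = {(u, v). E u v} \<rparr>" for E
    have toG: "toG E \<in> graphs_on n" "arc_rel (toG E) = E" if "simple_graph ?V E" for E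
    proof -
      show "arc_rel (toG E) = E" by (intro ext) (simp add: toG_def arc_rel_def)
      have "pair_graph (toG E)" using that unfolding simple_graph_def
        by (intro pair_graphI) (auto simp: toG_def)
      then show "toG E \<in> graphs_on n" by (simp add: graphs_on_def toG_def)
    qed
    define \<F> where "\<F> = {G \<in> graphs_on n. graph_free F G}"
    have finF: "finite \<F>" unfolding \<F>_def using finite_graphs_on by simp
    \<comment> \<open>A single label gives the edgeless graph, which is free; so the maximum in
      \<open>spex\<close> is taken over a nonempty set.\<close>
    have neF: "\<F> \<noteq> {}"
    proof -
      let ?E = "multipartite ?V (\<lambda>_. 0 :: nat)"
      have s: "simple_graph ?V ?E" by (rule simple_graph_multipartite) simp
      have "\<not> embeds k (cyclic_adj k p) ?V ?E" by (rule multipartite_free) auto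
      then have "graph_free F (toG ?E)" using free[OF toG(1)[OF s]] toG(2)[OF s] by simp
      then show ?thesis using toG(1)[OF s] by (auto simp: \<F>_def)
    qed
    have spex: "spex n F = Max (graph_spectral_radius ` \<F>)" by (simp add: spex_def \<F>_def)
    have S: "SPEX n F = {G \<in> \<F>. graph_spectral_radius G = spex n F}" by (auto simp: SPEX_def \<F>_def)
    have ext: "extremal ?V (arc_rel G)" if G: "G \<in> SPEX n F" for G
    proof -
      have G1: "G \<in> graphs_on n" "graph_free F G" "graph_spectral_radius G = spex n F" using G by (auto simp: S \<F>_def)
      have "lam ?V E' \<le> lam ?V (arc_rel G)" if E': "simple_graph ?V E'" "\<not> embeds k (cyclic_adj k p) ?V E'" for E'
      proof -
        have "toG E' \<in> \<F>" using toG[OF E'(1)] free E'(2) by (simp add: \<F>_def)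
        then have "graph_spectral_radius (toG E') \<le> spex n F" unfolding spex using finF by (intro Max_ge) auto
        then show ?thesis using rad[OF toG(1)[OF E'(1)]] toG(2)[OF E'(1)] rad[OF G1(1)] G1(3) by simp
      qed
      then show ?thesis unfolding extremal_def using sg[OF G1(1)] free[OF G1(1)] G1(2) by blast
    qed
    have iso: "digraph_iso (with_proj G) (with_proj (H n))" if G: "G \<in> SPEX n F" for G
    proof -
      have G1: "G \<in> graphs_on n" using G by (simp add: S \<F>_def)
      obtain g where g: "arc_rel G = multipartite ?V g" "card {v \<in> ?V. p + m + 1 \<le> g v} = t - 1"
        "inj_on g {v \<in> ?V. p + m + 1 \<le> g v}"
        "\<forall>i<p + m + 1. \<forall>j<p + m + 1. card {v \<in> ?V. g v = i} \<le> card {v \<in> ?V. g v = j} + 1"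
        using n0[OF ext[OF G]] n by auto
      have "\<exists>\<phi>. bij_betw \<phi> ?V (pverts (graph_join (complete_graph (t - 1)) (turan_graph (card ?V - (t - 1)) (p + m + 1)))) \<and>
        (\<forall>u\<in>?V. \<forall>v\<in>?V. multipartite ?V g u v \<longleftrightarrow>
           arc_rel (graph_join (complete_graph (t - 1)) (turan_graph (card ?V - (t - 1)) (p + m + 1))) (\<phi> u) (\<phi> v))"
        by (rule balanced_multipartite_iso_join) (use g in auto)
      then have "\<exists>\<phi>. bij_betw \<phi> ?V (pverts (H n)) \<and>
        (\<forall>u\<in>?V. \<forall>v\<in>?V. multipartite ?V g u v \<longleftrightarrow> arc_rel (H n) (\<phi> u) (\<phi> v))" by (simp add: H_def)
      then show ?thesis unfolding digraph_iso_with_proj_iff[OF on(1)[OF G1] PH] on(2)[OF G1] g(1) .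
    qed
    \<comment> \<open>The converse inclusion calls for no computation with \<open>H n\<close>: some
      extremal graph \<open>G0\<close> exists and is already known to be isomorphic to
      \<open>H n\<close>, so every graph isomorphic to \<open>H n\<close> inherits freeness and
      spectral radius from \<open>G0\<close>.\<close>
    have "Max (graph_spectral_radius ` \<F>) \<in> graph_spectral_radius ` \<F>" using finF neF by (intro Max_in) auto
    then obtain G0 where G0: "G0 \<in> SPEX n F" by (auto simp: S spex)
    have G01: "G0 \<in> graphs_on n" using G0 by (simp add: S \<F>_def)
    obtain \<phi>0 where \<phi>0: "bij_betw \<phi>0 ?V (pverts (H n))"
      "\<And>u v. u \<in> ?V \<Longrightarrow> v \<in> ?V \<Longrightarrow> arc_rel G0 u v \<longleftrightarrow> arc_rel (H n) (\<phi>0 u) (\<phi>0 v)"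
      using iso[OF G0] unfolding digraph_iso_with_proj_iff[OF on(1)[OF G01] PH] on(2)[OF G01] by blast
    have "G \<in> SPEX n F" if G: "G \<in> graphs_on n" "digraph_iso (with_proj G) (with_proj (H n))" for G
    proof -
      obtain \<phi> where \<phi>: "bij_betw \<phi> ?V (pverts (H n))"
        "\<And>u v. u \<in> ?V \<Longrightarrow> v \<in> ?V \<Longrightarrow> arc_rel G u v \<longleftrightarrow> arc_rel (H n) (\<phi> u) (\<phi> v)"
        using G(2) unfolding digraph_iso_with_proj_iff[OF on(1)[OF G(1)] PH] on(2)[OF G(1)] by blast
      define \<psi> where "\<psi> = inv_into ?V \<phi>0 \<circ> \<phi>"
      have inv: "bij_betw (inv_into ?V \<phi>0) (pverts (H n)) ?V" by (rule bij_betw_inv_into[OF \<phi>0(1)])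
      have \<psi>: "bij_betw \<psi> ?V ?V" unfolding \<psi>_def by (rule bij_betw_trans[OF \<phi>(1) inv])
      have adj: "arc_rel G u v \<longleftrightarrow> arc_rel G0 (\<psi> u) (\<psi> v)" if uv: "u \<in> ?V" "v \<in> ?V" for u v
      proof -
        have "\<phi>0 (\<psi> w) = \<phi> w" if "w \<in> ?V" for w
          unfolding \<psi>_def o_def using bij_betw_inv_into_right[OF \<phi>0(1)] bij_betwE[OF \<phi>(1)] that by blast
        moreover have "\<psi> u \<in> ?V" "\<psi> v \<in> ?V" using bij_betwE[OF \<psi>] uv by blast+
        ultimately show ?thesis using \<phi>(2)[OF uv] \<phi>0(2)[of "\<psi> u" "\<psi> v"] uv by simp
      qed
      have "lam ?V (arc_rel G) = lam ?V (arc_rel G0)" by (rule lam_iso[OF sg[OF G(1)] sg[OF G01] V \<psi> adj])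
      then have "graph_spectral_radius G = spex n F" using rad[OF G(1)] rad[OF G01] G0 by (simp add: S)
      moreover have "\<not> embeds k (cyclic_adj k p) ?V (arc_rel G)"
      proof
        assume "embeds k (cyclic_adj k p) ?V (arc_rel G)"
        then have "embeds k (cyclic_adj k p) ?V (arc_rel G0)" by (rule embeds_iso[OF \<psi>, rotated]) (simp add: adj)
        then show False using free[OF G01] G0 by (simp add: S \<F>_def)
      qed
      ultimately show ?thesis using free[OF G(1)] G(1) by (simp add: S \<F>_def)
    qed
    then show ?thesis using iso by (auto simp: S \<F>_def)
  qed
  then show ?thesis unfolding eventually_sequentially F_def H_def by blast
qed

end
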